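(* Let $\rho\in\mathbb R$ and $m\in\mathbb Z$. Let $(h_0^j,h_\infty^j;\sigma_j)_{j\in\mathbb Z}$ be a sequence of pairs of germs of analytic diffeomorphisms of $(\mathbb C,0)$ fixing $0$, where $h_0^j,h_\infty^j$ are analytic on the disc $|t|<\sigma_j$, such that: (i) (symmetry) $\overline{(h_0^{-j+1})^{-1}(t)}= h_\infty^j(\overline t)$ for $t$ near $0$ and all $j\in\mathbb Z$; (ii) there are $C,K,K_1>0$ with $\sigma_j\ge K_1e^{-Ke^{C\sqrt{|j|}}}$ for all $j\in\mathbb Z$; (iii) (uniform bound) there are constants $d_1,d_2>0$ independent of $j$ such that for $h\in\{h_0^j,h_\infty^j\}$: $|h(t)-t|\le d_1|t|^2$ and $|h'(t)-1|\le d_2|t|$ for $0<|t|\le\sigma_j$, $j\in\mathbb Z$. Then there exists a germ $f$, analytic on a standard quadratic domain $\mathcal R_{C'}$, mapping $\mathbb R_+\cap\mathcal R_{C'}$ into $\mathbb R_+$, of the form $f(z)=z-z^2\boldsymbol\ell^m+\rho z^3\boldsymbol\ell^{2m+1}+o(z^3\boldsymbol\ell^{2m+1})$, and satisfying for some $c>0$ the uniform estimate $|f(z)-z+z^2\boldsymbol\ell^m-\rho z^3\boldsymbol\ell^{2m+1}|\le c|z^3\boldsymbol\ell^{2m+2}|$ for all $z\in\mathcal R_{C'}$, which realizes the given sequence as its sequence of horn maps (up to the equivalence of sequences defined below).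
   Context: $\mathcal R$ denotes the Riemann surface of the logarithm, with logarithmic chart $\zeta=-\log z$. A standard quadratic domain in the $\zeta$-chart is $\widetilde{\mathcal R}_C=\varphi(\{\mathrm{Re}\,\zeta>0\}\setminus\overline K(0,R))$, $\varphi(\zeta)=\zeta+C(\zeta+1)^{1/2}$, $C,R>0$; $\mathcal R_C\subset\mathcal R$ is its preimage under $\zeta=-\log z$. Germs on such domains are classes of functions agreeing on some such domain. $\boldsymbol\ell:=-1/\log z$, and $\mathbb R_+:=\{z\in\mathcal R:\arg z=0\}$. Petals and horn maps: an analytic germ $f$ on a standard quadratic (or linear) domain satisfying $|f(z)-z+z^2\boldsymbol\ell^m-\rho z^3\boldsymbol\ell^{2m+1}|\le c|z^3\boldsymbol\ell^{2m+2}|$ has the following dynamics: the domain is covered by $f$-invariant attracting petals $V_j^+$ centered at direction $\arg z=2j\pi$ and repelling petals $V_j^-$ centered at $\arg z=(2j-1)\pi$, $j\in\mathbb Z$, each of opening $2\pi$ (a petal being a union of sectors with continuously increasing openings up to the given opening and decreasing radii); put $V_0^j:=V_{j-1}^+\cap V_j^-$, $V_\infty^j:=V_j^-\cap V_j^+$. On each petal there is an analytic Fatou coordinate $\Psi_j^\pm$, i.e. $\Psi_j^\pm\circ f-\Psi_j^\pm=1$ on $V_j^\pm$, unique up to an additive constant. The horn maps of $f$ are the germs at $t=0$ $h_0^j(t)=\exp\big(-2\pi i\,\Psi_{j-1}^+\circ(\Psi_j^-)^{-1}(-\tfrac{\log t}{2\pi i})\big)$, $h_\infty^j(t)=\exp\big(2\pi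 i\,\Psi_j^-\circ(\Psi_j^+)^{-1}(\tfrac{\log t}{2\pi i})\big)$, $j\in\mathbb Z$. Two sequences $(h_0^j,h_\infty^j)_j$, $(k_0^j,k_\infty^j)_j$ are equivalent if there exist $(\beta_j)_j,(\gamma_j)_j\subset\mathbb C^*$ with $h_0^j(t)=\beta_{j-1}k_0^j(\gamma_jt)$ and $h_\infty^j(t)=\gamma_jk_\infty^j(\beta_jt)$ for all $j$; $f$ realizes a sequence as its horn maps if its horn maps are equivalent to that sequence. *)

theory Defs
  imports "HOL-Analysis.Analysis"
begin

text \<open>Everything is expressed in the logarithmic chart zeta = - log z of the
Riemann surface of the logarithm.  A point z corresponds to zeta, with
z = exp(-zeta) as a complex number, arg z = - Im zeta, abs z = exp(- Re zeta),
and the monomial ell = -1/log z corresponds to 1/zeta.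
A map f of (parts of) the Riemann surface is represented by its lift F in the
zeta-chart, f(z) = exp(- F zeta).\<close>

definition quad_phi :: "real \<Rightarrow> complex \<Rightarrow> complex" where
  "quad_phi C \<zeta> = \<zeta> + of_real C * csqrt (\<zeta> + 1)"

definition quad_dom :: "real \<Rightarrow> real \<Rightarrow> complex set" where
  "quad_dom C R = quad_phi C ` ({\<zeta>. Re \<zeta> > 0} - cball 0 R)"

text \<open>Sector with bisector arg z = theta, opening alpha and radius r:
  abs(arg z - theta) < alpha/2, 0 < abs z < r, in the zeta-chart.\<close>
definition sector :: "real \<Rightarrow> real \<Rightarrow> real \<Rightarrow> complex set" where
  "sector \<theta> \<alpha> r = {\<zeta>. \<bar>Im \<zeta> + \<theta>\<bar> < \<alpha> / 2 \<and> Re \<zeta> > - ln r}"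

definition is_petal :: "real \<Rightarrow> real \<Rightarrow> complex set \<Rightarrow> bool" where
  "is_petal \<theta> A V \<longleftrightarrow>
     (\<exists>r::real \<Rightarrow> real. (\<forall>\<alpha>\<in>{0<..<A}. r \<alpha> > 0) \<and> continuous_on {0<..<A} r \<and>
        (\<forall>\<alpha> \<beta>. 0 < \<alpha> \<and> \<alpha> \<le> \<beta> \<and> \<beta> < A \<longrightarrow> r \<beta> \<le> r \<alpha>) \<and>
        V = (\<Union>\<alpha>\<in>{0<..<A}. sector \<theta> \<alpha> (r \<alpha>)))"

definition fatou_coord :: "(complex \<Rightarrow> complex) \<Rightarrow> complex set \<Rightarrow> (complex \<Rightarrow> complex) \<Rightarrow> bool" where
  "fatou_coord F V \<Psi> \<longleftrightarrow> \<Psi> holomorphic_on V \<and> inj_on \<Psi> V \<and>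
     (\<forall>\<zeta>\<in>V. F \<zeta> \<in> V \<longrightarrow> \<Psi> (F \<zeta>) = \<Psi> \<zeta> + 1)"

text \<open>The germ h at 0 coincides (on a punctured neighbourhood of 0) with the
  horn map t \<mapsto> exp(-2 pi i Psi_p((Psi_m)^{-1}(-log t/(2 pi i)))),
  the inverse being taken on W = V_p \<inter> V_m.  The branch of log is arbitrary;
  we require that some branch yields a point of W and that every such
  choice gives the value h t.\<close>
definition horn0_is :: "(complex \<Rightarrow> complex) \<Rightarrow> (complex \<Rightarrow> complex) \<Rightarrow> complex set
    \<Rightarrow> (complex \<Rightarrow> complex) \<Rightarrow> bool" where
  "horn0_is \<Psi>p \<Psi>m W h \<longleftrightarrow> (\<exists>\<epsilon>>0. \<forall>t. 0 < cmod t \<and> cmod t < \<epsilon> \<longrightarrow>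
      (\<exists>w \<zeta>. exp (- 2 * pi * \<i> * w) = t \<and> \<zeta> \<in> W \<and> \<Psi>m \<zeta> = w) \<and>
      (\<forall>w \<zeta>. exp (- 2 * pi * \<i> * w) = t \<and> \<zeta> \<in> W \<and> \<Psi>m \<zeta> = w \<longrightarrow>
           h t = exp (- 2 * pi * \<i> * \<Psi>p \<zeta>)))"

text \<open>Same for t \<mapsto> exp(2 pi i Psi_m((Psi_p)^{-1}(log t/(2 pi i)))).\<close>
definition hornI_is :: "(complex \<Rightarrow> complex) \<Rightarrow> (complex \<Rightarrow> complex) \<Rightarrow> complex set
    \<Rightarrow> (complex \<Rightarrow> complex) \<Rightarrow> bool" where
  "hornI_is \<Psi>p \<Psi>m W h \<longleftrightarrow> (\<exists>\<epsilon>>0. \<forall>t. 0 < cmod t \<and> cmod t < \<epsilon> \<longrightarrow>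
      (\<exists>w \<zeta>. exp (2 * pi * \<i> * w) = t \<and> \<zeta> \<in> W \<and> \<Psi>p \<zeta> = w) \<and>
      (\<forall>w \<zeta>. exp (2 * pi * \<i> * w) = t \<and> \<zeta> \<in> W \<and> \<Psi>p \<zeta> = w \<longrightarrow>
           h t = exp (2 * pi * \<i> * \<Psi>m \<zeta>)))"

definition realizes_horn :: "(complex \<Rightarrow> complex) \<Rightarrow> complex set
    \<Rightarrow> (int \<Rightarrow> complex \<Rightarrow> complex) \<Rightarrow> (int \<Rightarrow> complex \<Rightarrow> complex) \<Rightarrow> bool" where
  "realizes_horn F D k0 kI \<longleftrightarrow>
    (\<exists>Vp Vm :: int \<Rightarrow> complex set. \<exists>\<Psi>p \<Psi>m :: int \<Rightarrow> complex \<Rightarrow> complex.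
       (\<forall>j. is_petal (2 * of_int j * pi) (2 * pi) (Vp j) \<and> Vp j \<subseteq> D \<and> F ` Vp j \<subseteq> Vp j) \<and>
       (\<forall>j. is_petal ((2 * of_int j - 1) * pi) (2 * pi) (Vm j) \<and> Vm j \<subseteq> D \<and>
            (\<forall>w\<in>Vm j. \<exists>\<zeta>\<in>Vm j. F \<zeta> = w)) \<and>
       (\<forall>j. fatou_coord F (Vp j) (\<Psi>p j) \<and> fatou_coord F (Vm j) (\<Psi>m j)) \<and>
       (\<exists>\<beta> \<gamma> :: int \<Rightarrow> complex. (\<forall>j. \<beta> j \<noteq> 0 \<and> \<gamma> j \<noteq> 0) \<and>
          (\<forall>j. horn0_is (\<Psi>p (j - 1)) (\<Psi>m j) (Vp (j - 1) \<inter> Vm j)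
                  (\<lambda>t. \<beta> (j - 1) * k0 j (\<gamma> j * t)) \<and>
               hornI_is (\<Psi>p j) (\<Psi>m j) (Vm j \<inter> Vp j)
                  (\<lambda>t. \<gamma> j * kI j (\<beta> j * t)))))"

end

theory Submission
  imports Defs "HOL-Complex_Analysis.Complex_Analysis" "HOL-Real_Asymp.Real_Asymp"
begin

text \<open>Let \<open>p = exp (\<zeta> + m Ln \<zeta>)\<close> and \<open>\<kappa> = m / 2 - \<rho>\<close>. A model Fatou coordinate
\<open>\<Psi>\<close> with derivative \<open>p - 1 - \<kappa> / \<zeta>\<close> yields the prescribed formal class, and \<open>s = log \<Psi>\<close> is asymptotic
to \<open>\<zeta> + m Ln \<zeta>\<close>. In the \<open>s\<close>-plane the strips of width \<open>\<pi>\<close> around \<open>Im s = k \<pi>\<close> correspond alternately to attracting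
(\<open>k = - 2 j\<close>) and repelling (\<open>k = 1 - 2 j\<close>) petals. On strip \<open>k\<close> we look for a Fatou coordinate \<open>\<Phi> k = exp s + R k s\<close>; prescribing
the horn maps means that \<open>\<Phi> (k + 1)\<close> is a near-identity function, of the germ number \<open>k\<close>, of \<open>\<Phi> k\<close> on the overlaps around
\<open>Im s = (k + 1/2) \<pi>\<close>, where the variable of the germ is doubly exponentially small in \<open>Re s\<close>. The lower bound on the radii makes
everything defined for \<open>Re s > A + B sqrt \<bar>k\<bar>\<close>, which is a quadratic domain. The nonlinear gluing problem is
solved by a Newton scheme, whose linear step is an additive Cousin problem solved by Cauchy integrals with a loss
of domain. Since \<open>R (- k)\<close> is taken to be the conjugate of \<open>R k\<close>, the symmetry hypothesis makes the solution real. The map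
\<open>F\<close> is then defined by \<open>\<Phi> k (F \<zeta>) = \<Phi> k \<zeta> + 1\<close>, which does not depend on \<open>k\<close>. Finally \<open>\<Phi> k\<close> extends to the full petal of opening
\<open>2 \<pi>\<close> through the germs and their inverses, and Brouwer's fixed point theorem provides preimages.\<close>


section \<open>The Cousin problem on half-strips\<close>

text \<open>The linearised gluing relation D (k + 1) = (1 + L) D k + e, with L the derivative of the
  germ term, is not additive. Differentiating the approximate relation shows that 1 + L is the
  quotient of the derivatives of \<Phi> (k + 1) and \<Phi> k up to the derivative of the error.
  Dividing D by \<Phi>' therefore leaves an additive problem and a quadratic error, which pays for
  the factors 1/(r - r')^2 lost with the domain. One weight carries three decays: (1/2)^k sums over
  the overlaps, exp(-Re s) makes integrals along half-lines converge, and (1 + |s|)^(-2) survives in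
  the bound of R'. It gives d\<Phi>/d\<zeta> = p - 1 - \<kappa>/\<zeta> + O(|\<zeta>|^(-2))
  uniformly in k, the accuracy that the uniform estimate on f demands. The terms -1 and \<kappa>
  come from \<Psi>(\<zeta> + u) = \<Psi>(\<zeta>) + 1: the prescribed f has the step u = 1/p + (1/2
  - \<rho>/\<zeta>)/p^2 + ..., and comparing terms of order 1/p with \<Psi>'' ~ p (1 + m/\<zeta>)
  gives \<Psi>' = p - 1 - (m/2 - \<rho>)/\<zeta>.\<close>

lemma geometric_series_holomorphic:
  fixes f :: "nat \<Rightarrow> complex \<Rightarrow> complex"
  assumes U: "open U" and hol: "\<And>n. f n holomorphic_on U"
    and b: "\<And>n s. s \<in> U \<Longrightarrow> cmod (f n s) \<le> c * (1/2)^n"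
    and d: "\<And>n s. s \<in> U \<Longrightarrow> cmod (deriv (f n) s) * (1 + cmod s)^2 \<le> c' * (1/2)^n"
  shows "(\<lambda>s. \<Sum>n. f n s) holomorphic_on U"
    and "\<And>s. s \<in> U \<Longrightarrow> summable (\<lambda>n. f n s)"
    and "\<And>s. s \<in> U \<Longrightarrow> cmod (\<Sum>n. f n s) \<le> 2 * c"
    and "\<And>s. s \<in> U \<Longrightarrow> cmod (deriv (\<lambda>s. \<Sum>n. f n s) s) * (1 + cmod s)^2 \<le> 2 * c'"
proof -
  have geo: "(\<lambda>n. k * (1/2)^n) sums (2 * k)" for k :: real
    using sums_mult[OF geometric_sums[of "1/2::real"], of k] by (simp add: mult.commute)
  have "\<exists>g g'. \<forall>x \<in> U. ((\<lambda>n. f n x) sums g x) \<and> ((\<lambda>n. deriv (f n) x) sums g' x) \<and> (g has_field_derivative g' x) (at x)"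
  proof (rule series_and_derivative_comparison_local[OF U])
    fix n x assume "x \<in> U"
    then show "(f n has_field_derivative deriv (f n) x) (at x)"
      using hol U holomorphic_derivI by blast
  next
    fix x assume "x \<in> U"
    show "\<exists>d h. 0 < d \<and> summable h \<and> (\<forall>\<^sub>F n in sequentially. \<forall>y\<in>ball x d \<inter> U. norm (f n y) \<le> h n)"
      by (rule exI[of _ 1], rule exI[of _ "\<lambda>n. c * (1/2)^n"])
         (use b geo in \<open>auto simp: sums_iff intro!: always_eventually\<close>)
  qed
  then obtain g g' where g: "\<And>x. x \<in> U \<Longrightarrow> (\<lambda>n. f n x) sums g x"
      "\<And>x. x \<in> U \<Longrightarrow> (\<lambda>n. deriv (f n) x) sums g' x"
      "\<And>x. x \<in> U \<Longrightarrow> (g has_field_derivative g' x) (at x)" by blast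
  have eq: "(\<Sum>n. f n x) = g x" if "x \<in> U" for x using g(1)[OF that] by (simp add: sums_iff)
  have der: "((\<lambda>s. \<Sum>n. f n s) has_field_derivative g' x) (at x)" if "x \<in> U" for x
    using DERIV_cong_ev[of x x "\<lambda>s. \<Sum>n. f n s" g "g' x" "g' x"] g(3)[OF that]
      eventually_nhds_in_open[OF U that] eq by (simp add: eventually_mono)
  show "(\<lambda>s. \<Sum>n. f n s) holomorphic_on U"
    using der U by (auto simp: holomorphic_on_open)
  show "\<And>s. s \<in> U \<Longrightarrow> summable (\<lambda>n. f n s)" using g(1) by (auto simp: sums_iff)
  have bd: "cmod y \<le> 2 * k" if "h sums y" "\<And>n. cmod (h n) \<le> k * (1/2)^n" for h :: "nat \<Rightarrow> complex" and y k
    using norm_sums_le[OF that(1) geo[of k]] that(2) by auto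
  show "\<And>s. s \<in> U \<Longrightarrow> cmod (\<Sum>n. f n s) \<le> 2 * c"
    using bd g(1) eq b by metis
  show "cmod (deriv (\<lambda>s. \<Sum>n. f n s) s) * (1 + cmod s)^2 \<le> 2 * c'" if "s \<in> U" for s
  proof -
    have p: "(1 + cmod s)^2 > 0" by (smt (verit) norm_ge_zero zero_less_power)
    have "cmod (deriv (f n) s) \<le> (c' / (1 + cmod s)^2) * (1/2)^n" for n
      using d[OF that, of n] p by (simp add: field_simps)
    from bd[OF g(2)[OF that] this] have "cmod (g' s) \<le> 2 * (c' / (1 + cmod s)^2)" .
    then have "cmod (g' s) * (1 + cmod s)^2 \<le> 2 * c'" using p by (simp add: field_simps)
    then show ?thesis using DERIV_imp_deriv[OF der[OF that]] by simp
  qed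
qed

text \<open>Transfers decay of a density at w to decay of its Cauchy integral at s: |s| is at most
  |w| + |w - s|, and as |w - s| is bounded below by \<delta>, this sum is dominated by the product.
  Its square is played against the kernel 1/(w - s)^2.\<close>

lemma norm_plus_one_le:
  assumes "\<delta> \<le> cmod (w - s)" "0 < \<delta>" "\<delta> \<le> 1"
  shows "1 + cmod s \<le> (2 / \<delta>) * ((1 + cmod w) * cmod (w - s))"
proof -
  have "cmod s \<le> cmod w + cmod (w - s)" by (metis norm_minus_commute norm_triangle_sub)
  moreover have "(1 + cmod w) * \<delta> \<le> (1 + cmod w) * cmod (w - s)"
    using assms by (intro mult_left_mono) auto
  then have "1 + cmod w \<le> (1 + cmod w) * cmod (w - s) / \<delta>" using assms by (simp add: field_simps)
  moreover have "cmod (w - s) \<le> (1 + cmod w) * cmod (w - s) / \<delta>"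
  proof -
    have "cmod (w-s) * \<delta> \<le> (1 + cmod w) * cmod (w - s)" using assms
      by (smt (verit) mult.commute mult_left_le_one_le mult_right_mono norm_ge_zero)
    then show ?thesis using assms by (simp add: field_simps)
  qed
  ultimately show ?thesis by simp
qed

text \<open>The derivative has the kernel 1/(w - s)^2, whose two powers convert the factor (1 +
  |w|)^2 of the density into (1 + |s|)^2. The integral itself has only one power, so it is merely
  bounded, while its derivative inherits the full quadratic decay.\<close>

lemma Cauchy_kernel_segment:
  fixes e :: "complex \<Rightarrow> complex"
  defines "K \<equiv> \<lambda>p q s. contour_integral (linepath p q) (\<lambda>w. e w / (w - s))"
  assumes cont: "continuous_on (closed_segment p q) e" and U: "open U"
    and \<delta>: "0 < \<delta>" "\<delta> \<le> 1" and dist: "\<And>s w. s \<in> U \<Longrightarrow> w \<in> closed_segment p q \<Longrightarrow> \<delta> \<le> cmod (w - s)"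
    and e: "\<And>w. w \<in> closed_segment p q \<Longrightarrow> cmod (e w) * (1 + cmod w)^2 \<le> \<eta>"
    and L: "cmod (q - p) \<le> L" and \<eta>: "0 \<le> \<eta>"
  shows "K p q holomorphic_on U"
    and "\<And>s. s \<in> U \<Longrightarrow> cmod (K p q s) \<le> \<eta> * L / \<delta>"
    and "\<And>s. s \<in> U \<Longrightarrow> cmod (deriv (K p q) s) * (1 + cmod s)^2 \<le> 4 * \<eta> * L / \<delta>^2"
proof -
  have int: "(\<lambda>w. e w / (w - s)^k) contour_integrable_on linepath p q" if "s \<in> U" for s k
    using dist[OF that] \<delta> by (intro contour_integrable_continuous_linepath continuous_intros cont) force
  have pi: "s \<in> U \<Longrightarrow> s \<notin> path_image (linepath p q)" for s using dist[of s s] \<delta> by auto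
  have der: "(K p q has_field_derivative contour_integral (linepath p q) (\<lambda>w. e w / (w - s)^2)) (at s)" if s: "s \<in> U" for s
  proof -
    have "((\<lambda>s. K p q s) has_field_derivative (of_nat 1 * contour_integral (linepath p q) (\<lambda>u. e u / (u - s) ^ Suc 1))) (at s)"
    proof (rule Cauchy_next_derivative(2)[where S = U and B = L])
      show "((\<lambda>u. e u / (u - w) ^ 1) has_contour_integral K p q w) (linepath p q)" if "w \<in> U - path_image (linepath p q)" for w
        using int[of w 1] that unfolding K_def by (auto intro: has_contour_integral_integral)
      show "cmod (vector_derivative (linepath p q) (at t)) \<le> L" for t
        using L by simp
    qed (use cont U s pi in auto)
    then show ?thesis by (simp add: power2_eq_square numeral_2_eq_2)
  qed
  show "K p q holomorphic_on U" using der U by (auto simp: holomorphic_on_open)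
  have e': "cmod (e w) \<le> \<eta>" if "w \<in> closed_segment p q" for w
  proof -
    have "1 \<le> (1 + cmod w)^2" by (simp add: one_le_power)
    then have "cmod (e w) * 1 \<le> cmod (e w) * (1 + cmod w)^2" by (intro mult_left_mono) auto
    then show ?thesis using e[OF that] by simp
  qed
  have L0: "0 \<le> L" using L norm_ge_zero order_trans by blast
  show "cmod (K p q s) \<le> \<eta> * L / \<delta>" if s: "s \<in> U" for s
  proof -
    have "cmod (K p q s) \<le> (\<eta> / \<delta>) * cmod (q - p)"
      unfolding K_def
    proof (rule contour_integral_bound_linepath)
      show "cmod (e w / (w - s)) \<le> \<eta> / \<delta>" if "w \<in> closed_segment p q" for w
        using e'[OF that] dist[OF s that] \<delta> \<eta> by (simp add: norm_divide frac_le)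
    qed (use int[OF s, of 1] \<delta> \<eta> in auto)
    also have "\<dots> \<le> (\<eta> / \<delta>) * L" using L \<eta> \<delta> by (intro mult_left_mono) auto
    finally show ?thesis by simp
  qed
  show "cmod (deriv (K p q) s) * (1 + cmod s)^2 \<le> 4 * \<eta> * L / \<delta>^2" if s: "s \<in> U" for s
  proof -
    let ?N = "(1 + cmod s)^2"
    have N: "?N > 0" by (smt (verit) norm_ge_zero zero_less_power)
    have "cmod (contour_integral (linepath p q) (\<lambda>w. e w / (w - s)^2)) \<le> (4 * \<eta> / \<delta>^2 / ?N) * cmod (q - p)"
    proof (rule contour_integral_bound_linepath)
      show "cmod (e w / (w - s)^2) \<le> 4 * \<eta> / \<delta>^2 / ?N" if w: "w \<in> closed_segment p q" for w
      proof -
        have ws: "cmod (w - s) > 0" using dist[OF s w] \<delta> by linarith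
        have "?N \<le> ((2 / \<delta>) * ((1 + cmod w) * cmod (w - s)))^2"
          using norm_plus_one_le[OF dist[OF s w] \<delta>] by (intro power_mono) auto
        then have "cmod (e w) * ?N \<le> cmod (e w) * ((2 / \<delta>) * ((1 + cmod w) * cmod (w - s)))^2"
          by (intro mult_left_mono) auto
        also have "\<dots> = (cmod (e w) * (1 + cmod w)^2) * (4 / \<delta>^2 * cmod (w - s)^2)"
          by (simp add: power_mult_distrib power_divide)
        also have "\<dots> \<le> \<eta> * (4 / \<delta>^2 * cmod (w - s)^2)"
          using e[OF w] by (intro mult_right_mono) auto
        finally have "cmod (e w) * ?N / cmod (w - s)^2 \<le> 4 * \<eta> / \<delta>^2"
          using ws by (subst pos_divide_le_eq) (auto simp: mult_ac)
        then have "cmod (e w) / cmod (w - s)^2 \<le> 4 * \<eta> / \<delta>^2 / ?N"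
          by (subst pos_le_divide_eq[OF N]) (simp add: mult_ac)
        then show ?thesis by (simp add: norm_divide norm_power)
      qed
    qed (use int[OF s, of 2] \<eta> N in auto)
    also have "\<dots> \<le> (4 * \<eta> / \<delta>^2 / ?N) * L" using L \<eta> N by (intro mult_left_mono) auto
    finally have "cmod (deriv (K p q) s) \<le> (4 * \<eta> * L / \<delta>^2) / ?N" using DERIV_imp_deriv[OF der[OF s]] by (simp add: mult_ac)
    then show ?thesis by (subst (asm) pos_le_divide_eq[OF N])
  qed
qed

lemma Re_closed_segment: "w \<in> closed_segment p q \<Longrightarrow> Re p \<le> Re q \<Longrightarrow> Re p \<le> Re w \<and> Re w \<le> Re q"
  and Im_closed_segment: "w \<in> closed_segment p q \<Longrightarrow> Im p \<le> Im q \<Longrightarrow> Im p \<le> Im w \<and> Im w \<le> Im q"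
proof -
  assume "w \<in> closed_segment p q"
  then obtain u where u: "0 \<le> u" "u \<le> 1" "w = (1 - u) *\<^sub>R p + u *\<^sub>R q" by (auto simp: in_segment)
  have "Re w = Re p + u * (Re q - Re p)" "Re w = Re q - (1 - u) * (Re q - Re p)"
       "Im w = Im p + u * (Im q - Im p)" "Im w = Im q - (1 - u) * (Im q - Im p)"
    by (simp_all add: u(3) algebra_simps)
  then show "Re p \<le> Re q \<Longrightarrow> Re p \<le> Re w \<and> Re w \<le> Re q" "Im p \<le> Im q \<Longrightarrow> Im p \<le> Im w \<and> Im w \<le> Im q"
    using u(1,2) mult_left_le_one_le[of "Re q - Re p" u] mult_left_le_one_le[of "Im q - Im p" u]
    by (simp_all add: mult_nonneg_nonneg)
qed

lemma exp_minus_le_half_power: "exp (- real i) \<le> (1/2)^i"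
proof -
  have "exp (-1::real) \<le> 1/2" using exp_ge_add_one_self[of 1] by (simp add: exp_minus field_simps)
  then have "exp (-1::real)^i \<le> (1/2)^i" by (intro power_mono) auto
  then show ?thesis by (simp add: exp_of_nat_mult[symmetric])
qed

text \<open>The half-line to the right of p is cut into unit segments; the density decays like exp(-
  Re w), so the i-th integral is bounded by a multiple of (1/2)^i. The last conclusion recombines
  finitely many segments into one, as the residue computation on rectangles requires.\<close>

lemma half_strip_segments:
  fixes e :: "complex \<Rightarrow> complex"
  defines "f \<equiv> \<lambda>p i s. contour_integral (linepath (p + of_nat i) (p + of_nat (Suc i))) (\<lambda>w. e w / (w - s))"
  assumes cont: "\<And>i. continuous_on (closed_segment (p + of_nat i) (p + of_nat (Suc i))) e"
    and U: "open U" and \<delta>: "0 < \<delta>" "\<delta> \<le> 1"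
    and dist: "\<And>s w. s \<in> U \<Longrightarrow> Im w = Im p \<Longrightarrow> Re p \<le> Re w \<Longrightarrow> \<delta> \<le> cmod (w - s)"
    and e: "\<And>w. Im w = Im p \<Longrightarrow> Re p \<le> Re w \<Longrightarrow> cmod (e w) * (1 + cmod w)^2 \<le> \<eta> * exp (Re p - Re w)"
    and \<eta>: "0 \<le> \<eta>"
  shows "(\<lambda>s. \<Sum>i. f p i s) holomorphic_on U"
    and "\<And>s. s \<in> U \<Longrightarrow> summable (\<lambda>i. f p i s)"
    and "\<And>s. s \<in> U \<Longrightarrow> cmod (\<Sum>i. f p i s) \<le> 2 * \<eta> / \<delta>"
    and "\<And>s. s \<in> U \<Longrightarrow> cmod (deriv (\<lambda>s. \<Sum>i. f p i s) s) * (1 + cmod s)^2 \<le> 8 * \<eta> / \<delta>^2"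
    and "\<And>s n. s \<in> U \<Longrightarrow> (\<Sum>i<n. f p i s) = contour_integral (linepath p (p + of_nat n)) (\<lambda>w. e w / (w - s))"
proof -
  have cs: "Im w = Im p \<and> Re p + real i \<le> Re w \<and> Re w \<le> Re p + real (Suc i)"
    if "w \<in> closed_segment (p + of_nat i) (p + of_nat (Suc i))" for w i
    using Re_closed_segment[OF that] Im_closed_segment[OF that] by auto
  have bnd: "cmod (e w) * (1 + cmod w)^2 \<le> \<eta> * (1/2)^i"
    if "w \<in> closed_segment (p + of_nat i) (p + of_nat (Suc i))" for w i
  proof -
    have "cmod (e w) * (1 + cmod w)^2 \<le> \<eta> * exp (Re p - Re w)" using e[of w] cs[OF that] by auto
    also have "\<dots> \<le> \<eta> * exp (- real i)" using cs[OF that] \<eta> by (intro mult_left_mono) auto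
    also have "\<dots> \<le> \<eta> * (1/2)^i" using exp_minus_le_half_power \<eta> by (intro mult_left_mono) auto
    finally show ?thesis .
  qed
  have dist': "\<delta> \<le> cmod (w - s)" if "s \<in> U" "w \<in> closed_segment (p + of_nat i) (p + of_nat (Suc i))" for s w i
    using dist[OF that(1)] cs[OF that(2)] by auto
  have len: "cmod (p + of_nat (Suc i) - (p + of_nat i)) \<le> 1" for i by simp
  have \<eta>': "0 \<le> \<eta> * (1/2)^i" for i using \<eta> by simp
  have hol: "f p i holomorphic_on U" for i
    unfolding f_def by (rule Cauchy_kernel_segment(1)[OF cont[of i] U \<delta> dist'[where i=i] bnd[where i=i] len \<eta>'[of i]])
  have b1: "cmod (f p i s) \<le> (\<eta> / \<delta>) * (1/2)^i" if "s \<in> U" for i s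
    using Cauchy_kernel_segment(2)[OF cont[of i] U \<delta> dist'[where i=i] bnd[where i=i] len \<eta>'[of i] that] unfolding f_def by simp
  have b2: "cmod (deriv (f p i) s) * (1 + cmod s)^2 \<le> (4 * \<eta> / \<delta>^2) * (1/2)^i" if "s \<in> U" for i s
    using Cauchy_kernel_segment(3)[OF cont[of i] U \<delta> dist'[where i=i] bnd[where i=i] len \<eta>'[of i] that] unfolding f_def by simp
  note G = geometric_series_holomorphic[OF U hol b1 b2]
  show "(\<lambda>s. \<Sum>i. f p i s) holomorphic_on U" by (rule G(1))
  show "\<And>s. s \<in> U \<Longrightarrow> summable (\<lambda>i. f p i s)" by (rule G(2))
  show "\<And>s. s \<in> U \<Longrightarrow> cmod (\<Sum>i. f p i s) \<le> 2 * \<eta> / \<delta>" using G(3) by simp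
  show "\<And>s. s \<in> U \<Longrightarrow> cmod (deriv (\<lambda>s. \<Sum>i. f p i s) s) * (1 + cmod s)^2 \<le> 8 * \<eta> / \<delta>^2"
    using G(4) by simp
  show "(\<Sum>i<n. f p i s) = contour_integral (linepath p (p + of_nat n)) (\<lambda>w. e w / (w - s))" if s: "s \<in> U" for s n
  proof (induction n)
    case (Suc n)
    let ?g = "\<lambda>w. e w / (w - s)"
    have "continuous_on (closed_segment p (p + of_nat m)) ?g" for m
    proof (induction m)
      case (Suc m)
      have sub: "closed_segment p (p + of_nat (Suc m)) = closed_segment p (p + of_nat m) \<union> closed_segment (p + of_nat m) (p + of_nat (Suc m))"
      proof (rule Un_closed_segment[symmetric])
        show "p + of_nat m \<in> closed_segment p (p + of_nat (Suc m))"
          unfolding in_segment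
          by (rule exI[of _ "real m / real (Suc m)"])
             (auto simp: scaleR_conv_of_real field_simps simp del: of_nat_Suc)
      qed
      have "continuous_on (closed_segment (p + of_nat m) (p + of_nat (Suc m))) ?g"
        using dist'[OF s] \<delta> by (intro continuous_intros cont) force
      then show ?case unfolding sub using Suc by (intro continuous_on_closed_Un) auto
    qed simp
    then have "contour_integral (linepath p (p + of_nat (Suc n))) ?g =
       contour_integral (linepath p (p + of_nat n)) ?g + contour_integral (linepath (p + of_nat n) (p + of_nat (Suc n))) ?g"
    proof (rule contour_integral_split_linepath)
      show "p + of_nat n \<in> closed_segment p (p + of_nat (Suc n))"
          unfolding in_segment
          by (rule exI[of _ "real n / real (Suc n)"])
             (auto simp: scaleR_conv_of_real field_simps simp del: of_nat_Suc)
    qed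
    then show ?case using Suc by (simp add: f_def)
  next
    case 0
    show ?case unfolding of_nat_0 add_0_right contour_integral_trivial by simp
  qed
qed


text \<open>Cauchy's formula on a half-strip: the integral over the top edge is holomorphic below
  it, the integral over the bottom and left edges is holomorphic above and to the right of them, and
  their difference is \<open>e\<close>. The function \<open>lo\<close> has no restriction on Re s;
  this matters because the lower half-strips of the chain begin further to the left.\<close>

lemma half_strip_jump:
  fixes e :: "complex \<Rightarrow> complex"
  assumes r: "0 < r'" "r' < r" "r \<le> 1" and \<eta>: "0 \<le> \<eta>"
    and hol: "e holomorphic_on {s. b - r < Re s \<and> \<bar>Im s - c\<bar> < r}"
    and bd: "\<And>s. b - r < Re s \<Longrightarrow> \<bar>Im s - c\<bar> < r \<Longrightarrow> cmod (e s) * (1 + cmod s)^2 \<le> \<eta> * exp (b - Re s)"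
  obtains lo up where
    "lo holomorphic_on {s. Im s < c + r'}"
    "up holomorphic_on {s. c - r' < Im s \<and> b - r' < Re s}"
    "\<And>s. Im s < c + r' \<Longrightarrow> cmod (lo s) \<le> 24 * \<eta> / (r - r')"
    "\<And>s. Im s < c + r' \<Longrightarrow> cmod (deriv lo s) * (1 + cmod s)^2 \<le> 200 * \<eta> / (r - r')^2"
    "\<And>s. c - r' < Im s \<Longrightarrow> b - r' < Re s \<Longrightarrow> cmod (up s) \<le> 24 * \<eta> / (r - r')"
    "\<And>s. c - r' < Im s \<Longrightarrow> b - r' < Re s \<Longrightarrow> cmod (deriv up s) * (1 + cmod s)^2 \<le> 200 * \<eta> / (r - r')^2"
    "\<And>s. \<bar>Im s - c\<bar> < r' \<Longrightarrow> b - r' < Re s \<Longrightarrow> up s - lo s = e s"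
proof -
  \<comment> \<open>The contour runs halfway between the given margin r and the desired margin r',
    at distance \<delta> from both.\<close>
  define \<rho> where "\<rho> = (r + r') / 2"
  define \<delta> where "\<delta> = (r - r') / 2"
  have \<delta>: "0 < \<delta>" "\<delta> \<le> 1" and \<rho>: "r' + \<delta> = \<rho>" "\<rho> + \<delta> = r" "0 < \<rho>" "\<rho> < 1"
    using r by (auto simp: \<rho>_def \<delta>_def field_simps)
  define S where "S = {s. b - r < Re s \<and> \<bar>Im s - c\<bar> < r}"
  define T where "T = Complex (b - \<rho>) (c + \<rho>)"
  define B where "B = Complex (b - \<rho>) (c - \<rho>)"
  define K where "K p q s = contour_integral (linepath p q) (\<lambda>w. e w / (w - s))" for p q s
  define f where "f p i s = K (p + of_nat i) (p + of_nat (Suc i)) s" for p i s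
  define UL where "UL = {s. Im s < c + r'}"
  define UU where "UU = {s. c - r' < Im s \<and> b - r' < Re s}"
  have open_U: "open UL" "open UU"
    unfolding UL_def UU_def
    by (auto intro!: open_Collect_conj open_halfspace_Im_lt open_halfspace_Im_gt open_halfspace_Re_gt)
  \<comment> \<open>Measuring the decay from the left edge Re s = b - \<rho> instead of b costs the
    factor exp \<rho>.\<close>
  have e1: "exp \<rho> \<le> 3" using exp_le \<rho> by (meson exp_le_cancel_iff less_imp_le order_trans)
  have bd3: "cmod (e w) * (1 + cmod w)^2 \<le> 3 * \<eta> * exp (b - \<rho> - Re w)" if "w \<in> S" for w
  proof -
    have "cmod (e w) * (1 + cmod w)^2 \<le> \<eta> * exp (b - Re w)" using bd that by (auto simp: S_def)
    also have "exp (b - Re w) = exp \<rho> * exp (b - \<rho> - Re w)" by (simp add: exp_add[symmetric])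
    also have "\<eta> * (exp \<rho> * exp (b - \<rho> - Re w)) \<le> \<eta> * (3 * exp (b - \<rho> - Re w))"
      using e1 \<eta> by (intro mult_left_mono mult_right_mono) auto
    finally show ?thesis by simp
  qed
  have convS: "convex S"
  proof -
    have "S = {s. Re s > b - r} \<inter> ({s. Im s < c + r} \<inter> {s. Im s > c - r})" unfolding S_def by auto
    then show ?thesis
      by (auto intro!: convex_Int convex_halfspace_Re_gt convex_halfspace_Im_lt convex_halfspace_Im_gt)
  qed
  have openS: "open S"
  proof -
    have "S = {s. Re s > b - r} \<inter> ({s. Im s < c + r} \<inter> {s. Im s > c - r})" unfolding S_def by auto
    then show ?thesis
      by (auto intro!: open_Int open_halfspace_Re_gt open_halfspace_Im_lt open_halfspace_Im_gt)
  qed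
  have contS: "continuous_on S e" using hol S_def holomorphic_on_imp_continuous_on by blast
  have segS: "closed_segment p q \<subseteq> S" if "p \<in> S" "q \<in> S" for p q
    using convS that by (simp add: closed_segment_subset)
  have contseg: "continuous_on (closed_segment p q) e" if "p \<in> S" "q \<in> S" for p q
    using contS segS[OF that] continuous_on_subset by blast
  have TS: "T + of_nat i \<in> S" and BS: "B + of_nat i \<in> S" for i
    using \<rho> r by (auto simp: T_def B_def S_def)
  have TS0: "T \<in> S" and BS0: "B \<in> S" using TS[of 0] BS[of 0] by auto
  have distT: "\<delta> \<le> cmod (w - s)" if "s \<in> UL" "Im w = Im T" for s w
    using abs_Im_le_cmod[of "w - s"] that \<rho> by (auto simp: UL_def T_def)
  have distB: "\<delta> \<le> cmod (w - s)" if "s \<in> UU" "Im w = Im B" for s w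
    using abs_Im_le_cmod[of "w - s"] that \<rho> by (auto simp: UU_def B_def)
  have vert: "Re w = b - \<rho>" "w \<in> S" if "w \<in> closed_segment B T" for w
    using Re_closed_segment[OF that] segS[OF BS0 TS0] that by (auto simp: B_def T_def)
  have distV: "\<delta> \<le> cmod (w - s)" if "s \<in> UU" "w \<in> closed_segment B T" for s w
    using abs_Re_le_cmod[of "w - s"] that vert[OF that(2)] \<rho> by (auto simp: UU_def)
  have bT: "cmod (e w) * (1 + cmod w)^2 \<le> 3 * \<eta> * exp (Re T - Re w)" if "Im w = Im T" "Re T \<le> Re w" for w
    using bd3[of w] that \<rho> r by (auto simp: S_def T_def)
  have bB: "cmod (e w) * (1 + cmod w)^2 \<le> 3 * \<eta> * exp (Re B - Re w)" if "Im w = Im B" "Re B \<le> Re w" for w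
    using bd3[of w] that \<rho> r by (auto simp: S_def B_def)
  have \<eta>3: "0 \<le> 3 * \<eta>" using \<eta> by simp
  have hT: "(\<lambda>s. \<Sum>i. f T i s) holomorphic_on UL"
    "\<And>s. s \<in> UL \<Longrightarrow> summable (\<lambda>i. f T i s)"
    "\<And>s. s \<in> UL \<Longrightarrow> cmod (\<Sum>i. f T i s) \<le> 2 * (3 * \<eta>) / \<delta>"
    "\<And>s. s \<in> UL \<Longrightarrow> cmod (deriv (\<lambda>s. \<Sum>i. f T i s) s) * (1 + cmod s)^2 \<le> 8 * (3 * \<eta>) / \<delta>^2"
    "\<And>s n. s \<in> UL \<Longrightarrow> (\<Sum>i<n. f T i s) = K T (T + of_nat n) s"
    unfolding f_def K_def
    by (rule half_strip_segments[OF contseg[OF TS TS] open_U(1) \<delta> distT bT \<eta>3]; assumption)+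
  have hB: "(\<lambda>s. \<Sum>i. f B i s) holomorphic_on UU"
    "\<And>s. s \<in> UU \<Longrightarrow> summable (\<lambda>i. f B i s)"
    "\<And>s. s \<in> UU \<Longrightarrow> cmod (\<Sum>i. f B i s) \<le> 2 * (3 * \<eta>) / \<delta>"
    "\<And>s. s \<in> UU \<Longrightarrow> cmod (deriv (\<lambda>s. \<Sum>i. f B i s) s) * (1 + cmod s)^2 \<le> 8 * (3 * \<eta>) / \<delta>^2"
    "\<And>s n. s \<in> UU \<Longrightarrow> (\<Sum>i<n. f B i s) = K B (B + of_nat n) s"
    unfolding f_def K_def
    by (rule half_strip_segments[OF contseg[OF BS BS] open_U(2) \<delta> distB bB \<eta>3]; assumption)+
  have bV: "cmod (e w) * (1 + cmod w)^2 \<le> 3 * \<eta>" if "w \<in> closed_segment B T" for w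
    using bd3[OF vert(2)[OF that]] vert(1)[OF that] by simp
  have lenV: "cmod (T - B) \<le> 2"
  proof -
    have "T - B = Complex 0 (2 * \<rho>)" by (simp add: T_def B_def complex_eq_iff)
    then show ?thesis using \<rho> cmod_eq_Im[of "T - B"] by simp
  qed
  have hV: "K B T holomorphic_on UU"
    "\<And>s. s \<in> UU \<Longrightarrow> cmod (K B T s) \<le> 3 * \<eta> * 2 / \<delta>"
    "\<And>s. s \<in> UU \<Longrightarrow> cmod (deriv (K B T) s) * (1 + cmod s)^2 \<le> 4 * (3 * \<eta>) * 2 / \<delta>^2"
    unfolding K_def[abs_def]
    by (rule Cauchy_kernel_segment[OF contseg[OF BS0 TS0] open_U(2) \<delta> distV bV lenV \<eta>3]; assumption)+
  \<comment> \<open>The counterclockwise boundary follows the bottom edge to the right, the top edge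
    to the left and the left edge downwards, which fixes the signs of the three integrals.\<close>
  define lo where "lo = (\<lambda>s. (\<Sum>i. f T i s) / (2 * pi * \<i>))"
  define up where "up = (\<lambda>s. ((\<Sum>i. f B i s) - K B T s) / (2 * pi * \<i>))"
  have pi1: "1 \<le> cmod (2 * pi * \<i>)" using pi_gt3 by (simp add: norm_mult)
  have dv: "cmod (z / (2 * pi * \<i>)) \<le> cmod z" for z
    using frac_le[OF norm_ge_zero order_refl _ pi1, of z] by (simp only: norm_divide div_by_1)
  show ?thesis
  proof (rule that[of lo up])
    show "lo holomorphic_on {s. Im s < c + r'}"
      unfolding lo_def UL_def[symmetric] by (intro holomorphic_intros hT(1)) auto
    show "up holomorphic_on {s. c - r' < Im s \<and> b - r' < Re s}"
      unfolding up_def UU_def[symmetric] by (intro holomorphic_intros hB(1) hV(1)) auto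
    show "cmod (lo s) \<le> 24 * \<eta> / (r - r')" if "Im s < c + r'" for s
    proof -
      have "s \<in> UL" using that by (simp add: UL_def)
      then have "cmod (lo s) \<le> 2 * (3 * \<eta>) / \<delta>"
        unfolding lo_def by (intro order_trans[OF dv hT(3)])
      also have "\<dots> = 12 * \<eta> / (r - r')" by (simp add: \<delta>_def)
      also have "\<dots> \<le> 24 * \<eta> / (r - r')" using \<eta> r by (intro divide_right_mono) auto
      finally show ?thesis .
    qed
    show "cmod (deriv lo s) * (1 + cmod s)^2 \<le> 200 * \<eta> / (r - r')^2" if "Im s < c + r'" for s
    proof -
      have s: "s \<in> UL" using that by (simp add: UL_def)
      have "deriv lo s = deriv (\<lambda>s. \<Sum>i. f T i s) s / (2 * pi * \<i>)"
        unfolding lo_def by (rule deriv_cdivide_right) (use hT(1) s open_U holomorphic_on_imp_differentiable_at in blast)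
      then have "cmod (deriv lo s) * (1 + cmod s)^2 \<le> cmod (deriv (\<lambda>s. \<Sum>i. f T i s) s) * (1 + cmod s)^2"
        by (simp only:) (intro mult_right_mono dv, simp)
      also have "\<dots> \<le> 8 * (3 * \<eta>) / \<delta>^2" by (rule hT(4)[OF s])
      also have "\<dots> = 96 * \<eta> / (r - r')^2" by (simp add: \<delta>_def power_divide)
      also have "\<dots> \<le> 200 * \<eta> / (r - r')^2" using \<eta> by (intro divide_right_mono) auto
      finally show ?thesis .
    qed
    show "cmod (up s) \<le> 24 * \<eta> / (r - r')" if "c - r' < Im s" "b - r' < Re s" for s
    proof -
      have s: "s \<in> UU" using that by (simp add: UU_def)
      have "cmod (up s) \<le> cmod (\<Sum>i. f B i s) + cmod (K B T s)"
        unfolding up_def by (rule order_trans[OF dv norm_triangle_ineq4])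
      also have "\<dots> \<le> 2 * (3 * \<eta>) / \<delta> + 3 * \<eta> * 2 / \<delta>" by (rule add_mono[OF hB(3)[OF s] hV(2)[OF s]])
      also have "\<dots> = 24 * \<eta> / (r - r')" by (simp add: \<delta>_def)
      finally show ?thesis .
    qed
    show "cmod (deriv up s) * (1 + cmod s)^2 \<le> 200 * \<eta> / (r - r')^2" if "c - r' < Im s" "b - r' < Re s" for s
    proof -
      have s: "s \<in> UU" using that by (simp add: UU_def)
      have fd: "(\<lambda>s. \<Sum>i. f B i s) field_differentiable at s" "K B T field_differentiable at s"
        using hB(1) hV(1) s open_U holomorphic_on_imp_differentiable_at by blast+
      have "deriv up s = (deriv (\<lambda>s. \<Sum>i. f B i s) s - deriv (K B T) s) / (2 * pi * \<i>)"
        unfolding up_def using fd by (subst deriv_cdivide_right) (auto intro: field_differentiable_diff)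
      then have "cmod (deriv up s) * (1 + cmod s)^2 \<le> (cmod (deriv (\<lambda>s. \<Sum>i. f B i s) s) + cmod (deriv (K B T) s)) * (1 + cmod s)^2"
        by (simp only:) (intro mult_right_mono order_trans[OF dv norm_triangle_ineq4], simp)
      also have "\<dots> \<le> 8 * (3 * \<eta>) / \<delta>^2 + 4 * (3 * \<eta>) * 2 / \<delta>^2"
        unfolding distrib_right by (rule add_mono[OF hB(4)[OF s] hV(3)[OF s]])
      also have "\<dots> = 192 * \<eta> / (r - r')^2" by (simp add: \<delta>_def power_divide)
      also have "\<dots> \<le> 200 * \<eta> / (r - r')^2" using \<eta> by (intro divide_right_mono) auto
      finally show ?thesis .
    qed
    show "up s - lo s = e s" if s: "\<bar>Im s - c\<bar> < r'" "b - r' < Re s" for s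
    proof -
      have sU: "s \<in> UL" "s \<in> UU" and sS: "s \<in> S" using s r by (auto simp: UL_def UU_def S_def)
      define V where "V = (\<lambda>n::nat. K (B + of_nat n) (T + of_nat n) s)"
      obtain n0 :: nat where n0: "Re s - b + 2 < real n0" using reals_Archimedean2 by blast
      \<comment> \<open>Cauchy's formula on the rectangle with opposite corners B and T + n. The
        right edge contributes \<open>V n\<close>, which tends to 0 because of the exponential decay
        of \<open>e\<close>.\<close>
      have rect: "K B (B + of_nat n) s + V n - K T (T + of_nat n) s - K B T s = 2 * pi * \<i> * e s" if n: "n \<ge> n0" for n
      proof -
        let ?g = "\<lambda>w. e w / (w - s)"
        have n': "Re s - b + 2 < real n" using n n0 by linarith
        have c1: "Complex (Re (T + of_nat n)) (Im B) = B + of_nat n" "Complex (Re B) (Im (T + of_nat n)) = T"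
          by (simp_all add: B_def T_def complex_eq_iff)
        have box: "s \<in> box B (T + of_nat n)"
          using s n' \<rho> r by (auto simp: B_def T_def box_def Basis_complex_def inner_complex_def abs_if split: if_splits)
        have wn: "winding_number (rectpath B (T + of_nat n)) s = 1"
          by (rule winding_number_rectpath[OF box])
        have cb: "cbox B (T + of_nat n) \<subseteq> S"
          using \<rho> r by (auto simp: B_def T_def S_def cbox_def Basis_complex_def inner_complex_def)
        have pim: "path_image (rectpath B (T + of_nat n)) \<subseteq> S - {s}"
          using path_image_rectpath_cbox_minus_box[of B "T + of_nat n"] cb box \<rho> n' s r by (auto simp: B_def T_def)
        have "(?g has_contour_integral (2 * pi * \<i> * winding_number (rectpath B (T + of_nat n)) s * e s)) (rectpath B (T + of_nat n))"
          using sS openS pim hol[folded S_def]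
          by (intro Cauchy_integral_formula_convex_simple[OF convS]) (auto simp: interior_open)
        then have ci: "(?g has_contour_integral (2 * pi * \<i> * e s)) (linepath B (B + of_nat n) +++ linepath (B + of_nat n) (T + of_nat n) +++ linepath (T + of_nat n) T +++ linepath T B)"
          using wn c1 by (simp add: rectpath_def Let_def)
        have ns: "closed_segment B (B + of_nat n) \<union> closed_segment (B + of_nat n) (T + of_nat n) \<union> closed_segment (T + of_nat n) T \<union> closed_segment T B \<subseteq> S - {s}"
          using pim c1 by (auto simp: rectpath_def Let_def path_image_join)
        have int: "?g contour_integrable_on linepath p q" if "closed_segment p q \<subseteq> S - {s}" for p q
          using that contS by (intro contour_integrable_continuous_linepath continuous_intros) (auto intro: continuous_on_subset)
        have ii: "?g contour_integrable_on linepath B (B + of_nat n)" "?g contour_integrable_on linepath (B + of_nat n) (T + of_nat n)"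
           "?g contour_integrable_on linepath (T + of_nat n) T" "?g contour_integrable_on linepath T B"
          using ns by (auto intro!: int)
        have "K B (B + of_nat n) s + (V n + (contour_integral (linepath (T + of_nat n) T) ?g + contour_integral (linepath T B) ?g)) = 2 * pi * \<i> * e s"
          using contour_integral_unique[OF ci] ii by (simp add: contour_integrable_joinI K_def V_def)
        moreover have "contour_integral (linepath (T + of_nat n) T) ?g = - K T (T + of_nat n) s"
          unfolding K_def by (metis contour_integral_reversepath reversepath_linepath valid_path_linepath)
        moreover have "contour_integral (linepath T B) ?g = - K B T s"
          unfolding K_def by (metis contour_integral_reversepath reversepath_linepath valid_path_linepath)
        ultimately show ?thesis by (simp add: algebra_simps)
      qed
      have V0: "V \<longlonglongrightarrow> 0"
      proof (rule Lim_null_comparison)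
        show "\<forall>\<^sub>F n in sequentially. cmod (V n) \<le> 6 * \<eta> * (1/2)^n"
        proof (rule eventually_sequentiallyI[of n0])
          fix n assume n: "n0 \<le> n"
          then have n': "Re s - b + 2 < real n" using n0 by linarith
          have cs: "Re w = b - \<rho> + real n" "w \<in> S" if "w \<in> closed_segment (B + of_nat n) (T + of_nat n)" for w
            using Re_closed_segment[OF that] segS[OF BS TS] that by (auto simp: B_def T_def)
          have "cmod (V n) \<le> (3 * \<eta> * (1/2)^n) * 2 / 1"
            unfolding V_def K_def
          proof (rule Cauchy_kernel_segment(2)[where U = "{s. Re s < b - 2 + real n}"])
            show "continuous_on (closed_segment (B + of_nat n) (T + of_nat n)) e" by (rule contseg[OF BS TS])
            show "cmod (e w) * (1 + cmod w)^2 \<le> 3 * \<eta> * (1/2)^n" if "w \<in> closed_segment (B + of_nat n) (T + of_nat n)" for w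
              using bd3[OF cs(2)[OF that]] cs(1)[OF that] mult_left_mono[OF exp_minus_le_half_power[of n] \<eta>3] by simp
            show "1 \<le> cmod (w - s)" if "s \<in> {s. Re s < b - 2 + real n}" "w \<in> closed_segment (B + of_nat n) (T + of_nat n)" for s w
              using abs_Re_le_cmod[of "w - s"] cs(1)[OF that(2)] that \<rho> by auto
          qed (use n' lenV \<eta> open_halfspace_Re_lt in auto)
          then show "cmod (V n) \<le> 6 * \<eta> * (1/2)^n" by simp
        qed
        show "(\<lambda>n. 6 * \<eta> * (1/2)^n) \<longlonglongrightarrow> 0" by (intro tendsto_mult_right_zero LIMSEQ_power_zero) auto
      qed
      have tB: "(\<lambda>n. K B (B + of_nat n) s) \<longlonglongrightarrow> (\<Sum>i. f B i s)"
        using summable_LIMSEQ[OF hB(2)[OF sU(2)]] by (simp only: hB(5)[OF sU(2)])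
      have tT: "(\<lambda>n. K T (T + of_nat n) s) \<longlonglongrightarrow> (\<Sum>i. f T i s)"
        using summable_LIMSEQ[OF hT(2)[OF sU(1)]] by (simp only: hT(5)[OF sU(1)])
      have lim: "(\<lambda>n. K B (B + of_nat n) s + V n - K T (T + of_nat n) s - K B T s) \<longlonglongrightarrow> (\<Sum>i. f B i s) + 0 - (\<Sum>i. f T i s) - K B T s"
        by (rule tendsto_diff[OF tendsto_diff[OF tendsto_add[OF tB V0] tT] tendsto_const])
      have "\<forall>\<^sub>F n in sequentially. K B (B + of_nat n) s + V n - K T (T + of_nat n) s - K B T s = 2 * pi * \<i> * e s"
        using rect by (auto intro: eventually_sequentiallyI[of n0])
      then have eq: "(\<Sum>i. f B i s) + 0 - (\<Sum>i. f T i s) - K B T s = 2 * pi * \<i> * e s"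
        by (rule LIMSEQ_unique[OF lim tendsto_eventually])
      have "up s - lo s = ((\<Sum>i. f B i s) + 0 - (\<Sum>i. f T i s) - K B T s) / (2 * pi * \<i>)"
        unfolding up_def lo_def by (simp add: diff_divide_distrib)
      then show ?thesis unfolding eq by simp
    qed
  qed
qed

section \<open>The chain of overlapping half-strips and its additive Cousin problem\<close>

definition overlap :: "(nat \<Rightarrow> real) \<Rightarrow> real \<Rightarrow> nat \<Rightarrow> complex set" where
  "overlap b r k = {s. b k - r < Re s \<and> \<bar>Im s - (real k + 1/2) * pi\<bar> < r}"

text \<open>Patch k begins at b (k - 1) and not at b k, since it has to contain its overlap with
  patch k - 1. For k = 0 the truncated subtraction gives b 0.\<close>

definition patch :: "(nat \<Rightarrow> real) \<Rightarrow> real \<Rightarrow> nat \<Rightarrow> complex set" where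
  "patch b r k = {s. b (k - 1) - r < Re s \<and> \<bar>Im s - real k * pi\<bar> < pi/2 + r}"

definition weight :: "(nat \<Rightarrow> real) \<Rightarrow> nat \<Rightarrow> complex \<Rightarrow> real" where
  "weight b k s = (1/2)^k * exp (b k - Re s) / (1 + cmod s)^2"

lemma weight_nonneg [simp]: "0 \<le> weight b k s" by (simp add: weight_def)

lemma open_overlap: "open (overlap b r k)"
proof -
  have "overlap b r k = {s. Re s > b k - r} \<inter> ({s. Im s < (real k + 1/2) * pi + r} \<inter> {s. Im s > (real k + 1/2) * pi - r})"
    unfolding overlap_def by auto
  then show ?thesis by (auto intro!: open_Int open_halfspace_Re_gt open_halfspace_Im_lt open_halfspace_Im_gt)
qed

lemma open_patch: "open (patch b r k)"
proof -
  have "patch b r k = {s. Re s > b (k - 1) - r} \<inter> ({s. Im s < real k * pi + (pi/2 + r)} \<inter> {s. Im s > real k * pi - (pi/2 + r)})"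
    unfolding patch_def by auto
  then show ?thesis by (auto intro!: open_Int open_halfspace_Re_gt open_halfspace_Im_lt open_halfspace_Im_gt)
qed

lemma overlap_subset_patch:
  assumes "mono b" "r \<le> 1"
  shows "overlap b r k \<subseteq> patch b r k" "overlap b r k \<subseteq> patch b r (Suc k)"
proof -
  have "b (k - 1) \<le> b k" using monoD[OF assms(1), of "k - 1" k] by simp
  then show "overlap b r k \<subseteq> patch b r k" "overlap b r k \<subseteq> patch b r (Suc k)"
    using assms pi_gt3 by (auto simp: overlap_def patch_def algebra_simps abs_if split: if_splits)
qed

lemma overlap_mono: "r' \<le> r \<Longrightarrow> overlap b r' k \<subseteq> overlap b r k"
  and patch_mono: "r' \<le> r \<Longrightarrow> patch b r' k \<subseteq> patch b r k"
  by (auto simp: overlap_def patch_def)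

lemma deriv_cnj_cnj:
  assumes "f field_differentiable at (cnj z)"
  shows "deriv (\<lambda>z. cnj (f (cnj z))) z = cnj (deriv f (cnj z))"
  using has_field_derivative_cnj_cnj[of f "deriv f (cnj z)" z] assms
  by (auto simp: o_def DERIV_deriv_iff_field_differentiable intro!: DERIV_imp_deriv)

text \<open>Overlap l contributes \<open>lo l\<close> to all patches up to number l and
  \<open>up l\<close> to all patches above, so that it creates a jump at l only. Adding the
  reflection of \<open>lo l\<close> to every patch changes no jump, and it makes the function on
  patch 0 symmetric, where only the \<open>lo l\<close> and their reflections occur.\<close>

lemma cousin_problem:
  fixes e :: "nat \<Rightarrow> complex \<Rightarrow> complex"
  assumes b: "mono b" and r: "0 < r'" "r' < r" "r \<le> 1" and \<epsilon>: "0 \<le> \<epsilon>"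
    and hol: "\<And>k. e k holomorphic_on overlap b r k"
    and bd: "\<And>k s. s \<in> overlap b r k \<Longrightarrow> cmod (e k s) \<le> \<epsilon> * weight b k s"
  obtains D where "\<And>k. D k holomorphic_on patch b r' k"
    "\<And>k s. s \<in> patch b r' k \<Longrightarrow> cmod (D k s) \<le> 100 * \<epsilon> / (r - r')"
    "\<And>k s. s \<in> patch b r' k \<Longrightarrow> cmod (deriv (D k) s) * (1 + cmod s)^2 \<le> 800 * \<epsilon> / (r - r')^2"
    "\<And>k s. s \<in> overlap b r' k \<Longrightarrow> D (Suc k) s - D k s = e k s"
    "\<And>s. s \<in> patch b r' 0 \<Longrightarrow> D 0 (cnj s) = cnj (D 0 s)"
proof -
  define c where "c l = (real l + 1/2) * pi" for l :: nat
  define \<eta> where "\<eta> l = \<epsilon> * (1/2)^l" for l :: nat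
  define Q where "Q l lo up \<longleftrightarrow> lo holomorphic_on {s. Im s < c l + r'} \<and>
    up holomorphic_on {s. c l - r' < Im s \<and> b l - r' < Re s} \<and>
    (\<forall>s. Im s < c l + r' \<longrightarrow> cmod (lo s) \<le> 24 * \<eta> l / (r - r')) \<and>
    (\<forall>s. Im s < c l + r' \<longrightarrow> cmod (deriv lo s) * (1 + cmod s)^2 \<le> 200 * \<eta> l / (r - r')^2) \<and>
    (\<forall>s. c l - r' < Im s \<longrightarrow> b l - r' < Re s \<longrightarrow> cmod (up s) \<le> 24 * \<eta> l / (r - r')) \<and>
    (\<forall>s. c l - r' < Im s \<longrightarrow> b l - r' < Re s \<longrightarrow> cmod (deriv up s) * (1 + cmod s)^2 \<le> 200 * \<eta> l / (r - r')^2) \<and>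
    (\<forall>s. \<bar>Im s - c l\<bar> < r' \<longrightarrow> b l - r' < Re s \<longrightarrow> up s - lo s = e l s)" for l lo up
  have ex: "\<exists>lo up. Q l lo up" for l
  proof -
    have \<eta>0: "0 \<le> \<eta> l" using \<epsilon> by (simp add: \<eta>_def)
    have hol': "e l holomorphic_on {s. b l - r < Re s \<and> \<bar>Im s - c l\<bar> < r}"
      using hol[of l] by (simp add: overlap_def c_def)
    have bd': "cmod (e l s) * (1 + cmod s)^2 \<le> \<eta> l * exp (b l - Re s)" if "b l - r < Re s" "\<bar>Im s - c l\<bar> < r" for s
    proof -
      have p: "(1 + cmod s)^2 > 0" by (smt (verit) norm_ge_zero zero_less_power)
      have "cmod (e l s) \<le> \<eta> l * exp (b l - Re s) / (1 + cmod s)^2"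
        using bd[of s l] that by (simp add: overlap_def c_def \<eta>_def weight_def)
      then show ?thesis by (subst (asm) pos_le_divide_eq[OF p])
    qed
    obtain lo up where h: "lo holomorphic_on {s. Im s < c l + r'}"
      "up holomorphic_on {s. c l - r' < Im s \<and> b l - r' < Re s}"
      "\<And>s. Im s < c l + r' \<Longrightarrow> cmod (lo s) \<le> 24 * \<eta> l / (r - r')"
      "\<And>s. Im s < c l + r' \<Longrightarrow> cmod (deriv lo s) * (1 + cmod s)^2 \<le> 200 * \<eta> l / (r - r')^2"
      "\<And>s. c l - r' < Im s \<Longrightarrow> b l - r' < Re s \<Longrightarrow> cmod (up s) \<le> 24 * \<eta> l / (r - r')"
      "\<And>s. c l - r' < Im s \<Longrightarrow> b l - r' < Re s \<Longrightarrow> cmod (deriv up s) * (1 + cmod s)^2 \<le> 200 * \<eta> l / (r - r')^2"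
      "\<And>s. \<bar>Im s - c l\<bar> < r' \<Longrightarrow> b l - r' < Re s \<Longrightarrow> up s - lo s = e l s"
      by (rule half_strip_jump[OF r \<eta>0 hol' bd']; (assumption | rule that; assumption))
    show ?thesis
      by (rule exI[of _ lo], rule exI[of _ up]) (unfold Q_def, intro conjI allI impI h; assumption)
  qed
  obtain lo up where Q: "\<And>l. Q l (lo l) (up l)" using ex by metis
  have lo: "\<And>l. lo l holomorphic_on {s. Im s < c l + r'}"
    and up: "\<And>l. up l holomorphic_on {s. c l - r' < Im s \<and> b l - r' < Re s}"
    and lo_b: "\<And>l s. Im s < c l + r' \<Longrightarrow> cmod (lo l s) \<le> 24 * \<eta> l / (r - r')"
    and lo_d: "\<And>l s. Im s < c l + r' \<Longrightarrow> cmod (deriv (lo l) s) * (1 + cmod s)^2 \<le> 200 * \<eta> l / (r - r')^2"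
    and up_b: "\<And>l s. c l - r' < Im s \<Longrightarrow> b l - r' < Re s \<Longrightarrow> cmod (up l s) \<le> 24 * \<eta> l / (r - r')"
    and up_d: "\<And>l s. c l - r' < Im s \<Longrightarrow> b l - r' < Re s \<Longrightarrow> cmod (deriv (up l) s) * (1 + cmod s)^2 \<le> 200 * \<eta> l / (r - r')^2"
    and jump: "\<And>l s. \<bar>Im s - c l\<bar> < r' \<Longrightarrow> b l - r' < Re s \<Longrightarrow> up l s - lo l s = e l s"
    using Q unfolding Q_def by blast+
  define P where "P k = patch b r' k" for k
  define f where "f k l s = (if k \<le> l then lo l s else up l s) + cnj (lo l (cnj s))" for k l s
  have openP: "open (P k)" for k by (simp add: P_def open_patch)
  have c_le: "c l \<le> c l'" if "l \<le> l'" for l l' using that by (simp add: c_def)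
  have Plo: "Im s < c l + r'" if "s \<in> P k" "k \<le> l" for s k l
  proof -
    have "c k = real k * pi + pi/2" by (simp add: c_def algebra_simps)
    moreover have "\<bar>Im s - real k * pi\<bar> < pi/2 + r'" using that by (simp add: P_def patch_def)
    ultimately show ?thesis using c_le[OF that(2)] by linarith
  qed
  have Pup: "c l - r' < Im s" "b l - r' < Re s" if kl: "s \<in> P k" "\<not> k \<le> l" for s k l
  proof -
    obtain k' where k': "k = Suc k'" "l \<le> k'" using kl(2) by (cases k) auto
    have 1: "c k' = (real k' + 1/2) * pi" by (simp add: c_def)
    have 2: "\<bar>Im s - (real k' + 1) * pi\<bar> < pi/2 + r'" "b k' - r' < Re s"
      using kl(1) k'(1) by (simp_all add: P_def patch_def add.commute)
    have 3: "(real k' + 1) * pi = (real k' + 1/2) * pi + pi/2" by (simp add: algebra_simps)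
    show "c l - r' < Im s" using 1 2(1) c_le[OF k'(2)] unfolding 3 by linarith
    show "b l - r' < Re s" using 2(2) monoD[OF b k'(2)] by linarith
  qed
  \<comment> \<open>Every patch lies above Im s = - pi/2 - r', so its reflection stays in the lower
    domain of all the \<open>lo l\<close>.\<close>
  have Pcnj: "Im (cnj s) < c l + r'" if "s \<in> P k" for s k l
  proof -
    have "- pi/2 - r' < Im s" using that by (auto simp: P_def patch_def abs_if split: if_splits) (smt (verit) mult_nonneg_nonneg of_nat_0_le_iff pi_ge_zero)+
    moreover have "pi/2 \<le> c l" by (simp add: c_def)
    ultimately show ?thesis by simp
  qed
  have lo': "(\<lambda>s. cnj (lo l (cnj s))) holomorphic_on P k" for k l
  proof -
    have "(cnj \<circ> lo l \<circ> cnj) holomorphic_on P k"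
      using Pcnj openP by (intro holomorphic_on_compose_cnj_cnj holomorphic_on_subset[OF lo]) auto
    then show ?thesis by (simp add: o_def)
  qed
  have main: "(\<lambda>s. if k \<le> l then lo l s else up l s) holomorphic_on P k" for k l
    using Plo Pup by (cases "k \<le> l") (auto intro: holomorphic_on_subset[OF lo] holomorphic_on_subset[OF up])
  have holf: "f k l holomorphic_on P k" for k l
    unfolding f_def by (intro holomorphic_intros main lo')
  have bf: "cmod (f k l s) \<le> (48 * \<epsilon> / (r - r')) * (1/2)^l" if "s \<in> P k" for k l s
  proof -
    have "cmod (if k \<le> l then lo l s else up l s) \<le> 24 * \<eta> l / (r - r')"
      using lo_b[OF Plo[OF that]] up_b[OF Pup[OF that]] by auto
    moreover have "cmod (cnj (lo l (cnj s))) \<le> 24 * \<eta> l / (r - r')" using lo_b[OF Pcnj[OF that]] by simp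
    ultimately have "cmod (f k l s) \<le> 24 * \<eta> l / (r - r') + 24 * \<eta> l / (r - r')"
      unfolding f_def by (rule order_trans[OF norm_triangle_ineq add_mono])
    then show ?thesis by (simp add: \<eta>_def field_simps)
  qed
  have df: "cmod (deriv (f k l) s) * (1 + cmod s)^2 \<le> (400 * \<epsilon> / (r - r')^2) * (1/2)^l" if s: "s \<in> P k" for k l s
  proof -
    have 1: "cmod (deriv (\<lambda>s. if k \<le> l then lo l s else up l s) s) * (1 + cmod s)^2 \<le> 200 * \<eta> l / (r - r')^2"
    proof (cases "k \<le> l")
      case True
      then have "(\<lambda>s. if k \<le> l then lo l s else up l s) = lo l" by auto
      then show ?thesis using lo_d[OF Plo[OF s True]] by (simp only:)
    next
      case False
      then have "(\<lambda>s. if k \<le> l then lo l s else up l s) = up l" by auto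
      then show ?thesis using up_d[OF Pup[OF s False]] by (simp only:)
    qed
    have o: "open {s. Im s < c l + r'}" by (rule open_halfspace_Im_lt)
    have "lo l field_differentiable at (cnj s)"
      using holomorphic_on_imp_differentiable_at[OF lo o] Pcnj[OF s] by auto
    then have "deriv (\<lambda>s. cnj (lo l (cnj s))) s = cnj (deriv (lo l) (cnj s))" by (rule deriv_cnj_cnj)
    then have 2: "cmod (deriv (\<lambda>s. cnj (lo l (cnj s))) s) * (1 + cmod s)^2 \<le> 200 * \<eta> l / (r - r')^2"
      using lo_d[OF Pcnj[OF s]] by simp
    have "deriv (f k l) s = deriv (\<lambda>s. if k \<le> l then lo l s else up l s) s + deriv (\<lambda>s. cnj (lo l (cnj s))) s"
      unfolding f_def using holomorphic_on_imp_differentiable_at[OF main openP s] holomorphic_on_imp_differentiable_at[OF lo' openP s]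
      by (intro deriv_add) auto
    then have "cmod (deriv (f k l) s) * (1 + cmod s)^2 \<le> (cmod (deriv (\<lambda>s. if k \<le> l then lo l s else up l s) s) + cmod (deriv (\<lambda>s. cnj (lo l (cnj s))) s)) * (1 + cmod s)^2"
      by (auto intro!: mult_right_mono norm_triangle_ineq)
    also have "\<dots> \<le> 200 * \<eta> l / (r - r')^2 + 200 * \<eta> l / (r - r')^2" using 1 2 by (simp add: distrib_right)
    finally show ?thesis by (simp add: \<eta>_def field_simps)
  qed
  have G: "(\<lambda>s. \<Sum>l. f k l s) holomorphic_on P k"
    "\<And>s. s \<in> P k \<Longrightarrow> summable (\<lambda>l. f k l s)"
    "\<And>s. s \<in> P k \<Longrightarrow> cmod (\<Sum>l. f k l s) \<le> 2 * (48 * \<epsilon> / (r - r'))"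
    "\<And>s. s \<in> P k \<Longrightarrow> cmod (deriv (\<lambda>s. \<Sum>l. f k l s) s) * (1 + cmod s)^2 \<le> 2 * (400 * \<epsilon> / (r - r')^2)" for k
    by (rule geometric_series_holomorphic[OF openP holf bf df]; assumption)+
  define D where "D k s = (\<Sum>l. f k l s)" for k s
  show ?thesis
  proof (rule that[of D])
    show "D k holomorphic_on patch b r' k" for k using G(1)[of k] by (simp add: D_def[abs_def] P_def)
    show "cmod (D k s) \<le> 100 * \<epsilon> / (r - r')" if "s \<in> patch b r' k" for k s
    proof -
      have "cmod (D k s) \<le> 2 * (48 * \<epsilon> / (r - r'))" unfolding D_def by (rule G(3)) (use that in \<open>simp add: P_def\<close>)
      also have "\<dots> = 96 * \<epsilon> / (r - r')" by simp
      also have "\<dots> \<le> 100 * \<epsilon> / (r - r')" using r \<epsilon> by (intro divide_right_mono) auto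
      finally show ?thesis .
    qed
    show "cmod (deriv (D k) s) * (1 + cmod s)^2 \<le> 800 * \<epsilon> / (r - r')^2" if "s \<in> patch b r' k" for k s
      using G(4) that by (simp add: D_def[abs_def] P_def)
    show "D (Suc k) s - D k s = e k s" if s: "s \<in> overlap b r' k" for k s
    proof -
      have sP: "s \<in> P k" "s \<in> P (Suc k)" using overlap_subset_patch[OF b, of r' k] s r by (auto simp: P_def)
      have "D (Suc k) s - D k s = (\<Sum>l. f (Suc k) l s - f k l s)"
        unfolding D_def by (rule suminf_diff[OF G(2)[OF sP(2)] G(2)[OF sP(1)]])
      also have "(\<lambda>l. f (Suc k) l s - f k l s) = (\<lambda>l. if l = k then up k s - lo k s else 0)"
        by (auto simp: f_def fun_eq_iff)
      also have "(\<Sum>l. if l = k then up k s - lo k s else 0) = up k s - lo k s"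
        using sums_unique[OF sums_single[of k "\<lambda>_. up k s - lo k s"]] by simp
      finally show ?thesis using jump[of s k] s by (auto simp: overlap_def c_def)
    qed
    show "D 0 (cnj s) = cnj (D 0 s)" if "s \<in> patch b r' 0" for s
    proof -
      have "cnj (D 0 s) = (\<Sum>l. cnj (f 0 l s))"
        unfolding D_def using G(2) that by (intro bounded_linear.suminf[OF bounded_linear_cnj]) (simp add: P_def)
      then show ?thesis unfolding D_def f_def by (simp add: add.commute)
    qed
  qed
qed

text \<open>The factor 12 is 3 from the exponential times 2^2 from the polynomial part. This allows
  Cauchy's estimate for functions that are bounded by the weight.\<close>

lemma weight_near:
  assumes "cmod (s' - s) \<le> 1"
  shows "weight b k s' \<le> 12 * weight b k s"
proof -
  have 1: "exp (b k - Re s') \<le> 3 * exp (b k - Re s)"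
  proof -
    have "\<bar>Re (s' - s)\<bar> \<le> 1" using abs_Re_le_cmod[of "s' - s"] assms by linarith
    then have "exp (b k - Re s') \<le> exp (1 + (b k - Re s))" by simp
    also have "\<dots> \<le> 3 * exp (b k - Re s)" unfolding exp_add using exp_le by (intro mult_right_mono) auto
    finally show ?thesis .
  qed
  have n: "1 + cmod s \<le> 2 * (1 + cmod s')"
    using norm_triangle_ineq2[of s s'] assms by (simp add: norm_minus_commute) (smt (verit) norm_ge_zero)
  then have 2: "(1 + cmod s)^2 \<le> 4 * (1 + cmod s')^2"
    using power_mono[OF n, of 2] by (simp only: power_mult_distrib) (simp add: add_nonneg_nonneg)
  have p: "0 < (1 + cmod s)^2" "0 < (1 + cmod s')^2" by (smt (verit) norm_ge_zero zero_less_power)+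
  have "1 / (1 + cmod s')^2 \<le> 4 / (1 + cmod s)^2"
    using 2 p by (simp add: frac_le_eq pos_divide_le_eq pos_le_divide_eq)
  then have "exp (b k - Re s') * (1 / (1 + cmod s')^2) \<le> 3 * exp (b k - Re s) * (4 / (1 + cmod s)^2)"
    using 1 by (intro mult_mono) auto
  then have "(1/2)^k * (exp (b k - Re s') * (1 / (1 + cmod s')^2)) \<le> (1/2)^k * (3 * exp (b k - Re s) * (4 / (1 + cmod s)^2))"
    by (rule mult_left_mono) auto
  then show ?thesis by (simp add: weight_def mult_ac)
qed

lemma cball_subset_patch:
  assumes "s \<in> patch b (r - \<delta> - \<delta>') k" "0 \<le> \<delta>" "0 \<le> \<delta>'"
  shows "cball s \<delta> \<subseteq> patch b (r - \<delta>') k"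
proof
  fix w assume "w \<in> cball s \<delta>"
  then have "cmod (s - w) \<le> \<delta>" by (simp add: dist_norm)
  then have "\<bar>Re s - Re w\<bar> \<le> \<delta>" "\<bar>Im s - Im w\<bar> \<le> \<delta>"
    using abs_Re_le_cmod[of "s - w"] abs_Im_le_cmod[of "s - w"] by auto
  then show "w \<in> patch b (r - \<delta>') k" using assms by (auto simp: patch_def)
qed

lemma cball_subset_overlap:
  assumes "s \<in> overlap b (r - \<delta>) k" "0 \<le> \<delta>"
  shows "cball s \<delta> \<subseteq> overlap b r k"
proof
  fix w assume "w \<in> cball s \<delta>"
  then have "cmod (s - w) \<le> \<delta>" by (simp add: dist_norm)
  then have "\<bar>Re s - Re w\<bar> \<le> \<delta>" "\<bar>Im s - Im w\<bar> \<le> \<delta>"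
    using abs_Re_le_cmod[of "s - w"] abs_Im_le_cmod[of "s - w"] by auto
  then show "w \<in> overlap b r k" using assms by (auto simp: overlap_def)
qed

lemma Cauchy_deriv_bound:
  assumes "f holomorphic_on S" "cball s \<delta> \<subseteq> S" "0 < \<delta>" "\<And>w. w \<in> cball s \<delta> \<Longrightarrow> cmod (f w) \<le> B"
  shows "cmod (deriv f s) \<le> B / \<delta>"
proof -
  have "cmod ((deriv ^^ 1) f s) \<le> fact 1 * B / \<delta>^1"
  proof (rule Cauchy_inequality)
    show "f holomorphic_on ball s \<delta>" using assms by (meson ball_subset_cball holomorphic_on_subset)
    show "continuous_on (cball s \<delta>) f" using assms by (meson holomorphic_on_imp_continuous_on holomorphic_on_subset)
  qed (use assms in \<open>auto simp: dist_norm\<close>)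
  then show ?thesis by simp
qed

text \<open>Both a and a + d have modulus at most 1/2. Cauchy's inequality on discs of radius 1/4
  around such points bounds the second derivative by 2 B / (1/4)^2, which is the constant 32
  B.\<close>

lemma second_order_remainder:
  assumes hol: "g holomorphic_on ball 0 1" and B: "\<And>z. cmod z < 1 \<Longrightarrow> cmod (g z) \<le> B"
    and a: "cmod a \<le> 1/4" and d: "cmod d \<le> 1/4"
  shows "cmod (g (a + d) - g a - deriv g a * d) \<le> 32 * B * (cmod d)^2"
proof -
  let ?S = "cball (0::complex) (1/2)"
  have hd: "(deriv ^^ i) g holomorphic_on ball 0 1" for i
    by (rule holomorphic_higher_deriv[OF hol open_ball])
  have b2: "cmod ((deriv ^^ 2) g x) \<le> 32 * B" if "x \<in> ?S" for x
  proof -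
    have sub: "cball x (1/4) \<subseteq> ball 0 1"
    proof
      fix y assume "y \<in> cball x (1/4)"
      then show "y \<in> ball 0 1" using that norm_triangle_ineq2[of y x] by (auto simp: dist_norm norm_minus_commute)
    qed
    have "cmod ((deriv ^^ 2) g x) \<le> fact 2 * B / (1/4)^2"
    proof (rule Cauchy_inequality)
      show "g holomorphic_on ball x (1/4)" using hol sub by (meson ball_subset_cball holomorphic_on_subset)
      show "continuous_on (cball x (1/4)) g" using hol sub by (meson holomorphic_on_imp_continuous_on holomorphic_on_subset)
      show "cmod (g w) \<le> B" if "cmod (x - w) = 1/4" for w
      proof -
        have "w \<in> cball x (1/4)" using that by (simp add: dist_norm)
        then show ?thesis using B sub by auto
      qed
    qed simp
    then show ?thesis by (simp add: power2_eq_square)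
  qed
  have "cmod ((deriv ^^ 0) g (a + d) - (\<Sum>i\<le>1. (deriv ^^ i) g a * ((a + d) - a)^i / fact i)) \<le> (32 * B) * cmod ((a + d) - a)^(Suc 1) / fact 1"
  proof (rule complex_Taylor[of ?S])
    fix i x assume "x \<in> ?S"
    then have "x \<in> ball 0 1" by auto
    then have "((deriv ^^ i) g has_field_derivative deriv ((deriv ^^ i) g) x) (at x)"
      using hd holomorphic_derivI open_ball by blast
    then show "((deriv ^^ i) g has_field_derivative (deriv ^^ Suc i) g x) (at x within ?S)"
      by (simp add: has_field_derivative_at_within)
  next
    show "a + d \<in> ?S" using norm_triangle_ineq[of a d] a d by auto
  qed (use b2 a in \<open>auto simp: numeral_2_eq_2\<close>)
  then show ?thesis by (simp add: algebra_simps numeral_2_eq_2)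
qed

section \<open>Newton iteration for the gluing problem\<close>

text \<open>The germ terms are controlled on unit discs around exp s, so that an unknown bounded by
  1/4 leaves room for Cauchy estimates. The condition \<open>decay\<close> says that the chain
  begins far enough to the right for exp(- s) to absorb the quadratic factor.\<close>

locale gluing_problem =
  fixes b :: "nat \<Rightarrow> real" and \<gamma> :: "nat \<Rightarrow> complex \<Rightarrow> complex" and \<tau> :: real
  assumes mono_b: "mono b"
    and decay: "\<And>k s. s \<in> patch b 1 k \<Longrightarrow> (1 + cmod s)^2 * exp (- Re s) \<le> 1"
    and \<gamma>_diff: "\<And>k s z. s \<in> overlap b 1 k \<Longrightarrow> cmod z < 1 \<Longrightarrow> \<gamma> k field_differentiable at (exp s + z)"
    and \<gamma>_bound: "\<And>k s z. s \<in> overlap b 1 k \<Longrightarrow> cmod z < 1 \<Longrightarrow> cmod (\<gamma> k (exp s + z)) \<le> \<tau> * weight b k s"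
    and \<tau>: "0 \<le> \<tau>" "\<tau> \<le> 1"
begin

definition mismatch :: "(nat \<Rightarrow> complex \<Rightarrow> complex) \<Rightarrow> nat \<Rightarrow> complex \<Rightarrow> complex" where
  "mismatch R k s = R k s + \<gamma> k (exp s + R k s) - R (Suc k) s"

definition regular :: "real \<Rightarrow> (nat \<Rightarrow> complex \<Rightarrow> complex) \<Rightarrow> bool" where
  "regular r R \<longleftrightarrow> (\<forall>k. R k holomorphic_on patch b r k) \<and> (\<forall>s\<in>patch b r 0. R 0 (cnj s) = cnj (R 0 s))"

definition size_le :: "real \<Rightarrow> real \<Rightarrow> real \<Rightarrow> (nat \<Rightarrow> complex \<Rightarrow> complex) \<Rightarrow> bool" where
  "size_le r c c' R \<longleftrightarrow> (\<forall>k. \<forall>s\<in>patch b r k. cmod (R k s) \<le> c \<and> cmod (deriv (R k) s) * (1 + cmod s)^2 \<le> c')"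

lemma size_le_mono: "size_le r c d R \<Longrightarrow> c \<le> c' \<Longrightarrow> d \<le> d' \<Longrightarrow> size_le r c' d' R"
  unfolding size_le_def by (meson order_trans)

definition mismatch_le :: "real \<Rightarrow> real \<Rightarrow> (nat \<Rightarrow> complex \<Rightarrow> complex) \<Rightarrow> bool" where
  "mismatch_le r \<epsilon> R \<longleftrightarrow> (\<forall>k. \<forall>s\<in>overlap b r k. cmod (mismatch R k s) \<le> \<epsilon> * weight b k s)"

lemma exp_patch: "s \<in> patch b 1 k \<Longrightarrow> cmod (exp (- s)) \<le> 1"
proof -
  assume s: "s \<in> patch b 1 k"
  have "1 * exp (- Re s) \<le> (1 + cmod s)^2 * exp (- Re s)" by (intro mult_right_mono) (auto simp: one_le_power)
  also note decay[OF s]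
  finally show ?thesis by simp
qed

text \<open>Let \<mu> k be the derivative of exp s + R k divided by exp s. Then (1 + L) \<mu> k =
  \<mu> (k + 1) + e' exp(- s), so D = \<mu> v, with v solving the Cousin problem for e / \<mu> (k +
  1), cancels e. What remains is the product e' exp(- s) v and the second-order Taylor remainder of
  \<open>\<gamma> k\<close>. The margin is spent on the Cousin problem and on Cauchy estimates for
  R'' and e'.\<close>

lemma newton_step:
  assumes \<delta>: "0 < \<delta>" "\<delta> \<le> 1/4" "2 * \<delta> < r" "r \<le> 1" and \<epsilon>: "0 \<le> \<epsilon>" "400 * \<epsilon> \<le> \<delta> / 4"
    and reg: "regular r R" and size: "size_le r (1/4) (1/4) R" and mis: "mismatch_le r \<epsilon> R"
  shows "\<exists>D. regular (r - 2 * \<delta>) D \<and> size_le (r - 2 * \<delta>) (400 * \<epsilon> / \<delta>) (4000 * \<epsilon> / \<delta>^2) D \<and>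
    mismatch_le (r - 2 * \<delta>) (3000000 * \<epsilon>^2 / \<delta>^2) (\<lambda>k s. R k s + D k s)"
proof -
  let ?P = "\<lambda>k. patch b r k" and ?O = "\<lambda>k. overlap b r k"
  have P1: "?P k \<subseteq> patch b 1 k" and O1: "?O k \<subseteq> overlap b 1 k" for k
    using patch_mono overlap_mono \<delta>(4) by auto
  have OP: "?O k \<subseteq> ?P k" "?O k \<subseteq> ?P (Suc k)" for k
    using overlap_subset_patch[OF mono_b \<delta>(4)] by auto
  have holR: "R k holomorphic_on ?P k" and symR: "s \<in> ?P 0 \<Longrightarrow> R 0 (cnj s) = cnj (R 0 s)" for k s
    using reg by (auto simp: regular_def)
  have bR: "cmod (R k s) \<le> 1/4" and dR: "cmod (deriv (R k) s) * (1 + cmod s)^2 \<le> 1/4" if "s \<in> ?P k" for k s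
    using size that by (auto simp: size_le_def)
  have hol_dR: "deriv (R k) holomorphic_on ?P k" for k by (rule holomorphic_deriv[OF holR open_patch])
  have one: "1 \<le> (1 + cmod s)^2" for s by (simp add: one_le_power)
  have dR1: "cmod (deriv (R k) s) \<le> 1/4" if "s \<in> ?P k" for k s
    using dR[OF that] mult_left_mono[OF one[of s], of "cmod (deriv (R k) s)"] by simp
  have derR: "(R k has_field_derivative deriv (R k) s) (at s)" if "s \<in> ?P k" for k s
    using holomorphic_derivI[OF holR open_patch that] .
  define e where "e = mismatch R"
  have e_bd: "cmod (e k s) \<le> \<epsilon> * weight b k s" if "s \<in> ?O k" for k s
    using mis that by (auto simp: mismatch_le_def e_def)
  have der\<gamma>: "(\<gamma> k has_field_derivative deriv (\<gamma> k) (exp s + z)) (at (exp s + z))" if "s \<in> ?O k" "cmod z < 1" for k s z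
    using \<gamma>_diff[of s k z] O1 that by (auto simp: DERIV_deriv_iff_field_differentiable)
  have der_e: "(e k has_field_derivative (deriv (R k) s + deriv (\<gamma> k) (exp s + R k s) * (exp s + deriv (R k) s) - deriv (R (Suc k)) s)) (at s)"
    if s: "s \<in> ?O k" for k s
  proof -
    have sP: "s \<in> ?P k" "s \<in> ?P (Suc k)" using OP s by auto
    have 1: "((\<lambda>s. exp s + R k s) has_field_derivative (exp s + deriv (R k) s)) (at s)"
      by (rule DERIV_add[OF DERIV_exp derR[OF sP(1)]])
    have "cmod (R k s) < 1" using bR[OF sP(1)] by linarith
    then have 2: "((\<lambda>s. \<gamma> k (exp s + R k s)) has_field_derivative (deriv (\<gamma> k) (exp s + R k s) * (exp s + deriv (R k) s))) (at s)"
      using DERIV_chain2[OF der\<gamma>[OF s] 1] by simp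
    show ?thesis unfolding e_def mismatch_def
      using DERIV_diff[OF DERIV_add[OF derR[OF sP(1)] 2] derR[OF sP(2)]] by simp
  qed
  have hol_e: "e k holomorphic_on ?O k" for k
    using der_e open_overlap by (auto simp: holomorphic_on_open)
  define \<mu> where "\<mu> k s = 1 + deriv (R k) s * exp (- s)" for k s
  have exps: "cmod (exp (- s)) \<le> 1" if "s \<in> ?P k" for k s using exp_patch P1 that by blast
  have \<mu>1: "cmod (\<mu> k s - 1) \<le> 1/4" if "s \<in> ?P k" for k s
    using mult_mono[OF dR1[OF that] exps[OF that]] by (simp add: \<mu>_def norm_mult)
  have \<mu>_bds: "1/2 \<le> cmod (\<mu> k s)" "cmod (\<mu> k s) \<le> 5/4" if "s \<in> ?P k" for k s
    using \<mu>1[OF that] norm_triangle_ineq2[of "\<mu> k s" 1] norm_triangle_ineq2[of 1 "\<mu> k s"] by (simp_all add: norm_minus_commute)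
  have \<mu>_nz: "\<mu> k s \<noteq> 0" if "s \<in> ?P k" for k s using \<mu>_bds[OF that] by auto
  have hol_\<mu>: "\<mu> k holomorphic_on ?P k" for k unfolding \<mu>_def[abs_def] by (intro holomorphic_intros hol_dR)
  have hol_q: "(\<lambda>s. e k s / \<mu> (Suc k) s) holomorphic_on ?O k" for k
    using OP(2) \<mu>_nz by (intro holomorphic_intros hol_e holomorphic_on_subset[OF hol_\<mu>]) blast+
  have q_bd: "cmod (e k s / \<mu> (Suc k) s) \<le> (2 * \<epsilon>) * weight b k s" if s: "s \<in> ?O k" for k s
  proof -
    have m: "1/2 \<le> cmod (\<mu> (Suc k) s)" using \<mu>_bds(1) OP s by blast
    have "cmod (e k s) / cmod (\<mu> (Suc k) s) \<le> (\<epsilon> * weight b k s) / (1/2)"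
      using e_bd[OF s] m \<epsilon> by (intro frac_le) auto
    then show ?thesis by (simp add: norm_divide)
  qed
  define r1 where "r1 = r - \<delta>"
  have r1: "0 < r1" "r1 < r" "r - r1 = \<delta>" using \<delta> by (auto simp: r1_def)
  have \<epsilon>2: "0 \<le> 2 * \<epsilon>" using \<epsilon> by simp
  obtain v where hol_v: "\<And>k. v k holomorphic_on patch b r1 k"
    and v_bd: "\<And>k s. s \<in> patch b r1 k \<Longrightarrow> cmod (v k s) \<le> 100 * (2 * \<epsilon>) / (r - r1)"
    and v_d: "\<And>k s. s \<in> patch b r1 k \<Longrightarrow> cmod (deriv (v k) s) * (1 + cmod s)^2 \<le> 800 * (2 * \<epsilon>) / (r - r1)^2"
    and v_jump: "\<And>k s. s \<in> overlap b r1 k \<Longrightarrow> v (Suc k) s - v k s = e k s / \<mu> (Suc k) s"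
    and v_sym: "\<And>s. s \<in> patch b r1 0 \<Longrightarrow> v 0 (cnj s) = cnj (v 0 s)"
    by (rule cousin_problem[OF mono_b r1(1,2) \<delta>(4) \<epsilon>2 hol_q q_bd]; (assumption | rule that; assumption))
  define r2 where "r2 = r - 2 * \<delta>"
  have r2: "r2 < r1" "0 < r2" "r2 = r - \<delta> - \<delta>" "r2 = r1 - \<delta>" using \<delta> by (auto simp: r1_def r2_def)
  have P2: "patch b r2 k \<subseteq> patch b r1 k" "patch b r2 k \<subseteq> ?P k" "patch b r1 k \<subseteq> ?P k" for k
    by (rule patch_mono, use r1 r2 in simp)+
  have O2: "overlap b r2 k \<subseteq> overlap b r1 k" "overlap b r2 k \<subseteq> ?O k" for k
    by (rule overlap_mono, use r1 r2 in simp)+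
  have OP2: "overlap b r2 k \<subseteq> patch b r2 k" "overlap b r2 k \<subseteq> patch b r2 (Suc k)" for k
    using overlap_subset_patch[OF mono_b, of r2 k] r1 r2 \<delta> by auto
  define D where "D k s = \<mu> k s * v k s" for k s
  have D_bd: "cmod (D k s) \<le> 250 * \<epsilon> / \<delta>" if "s \<in> patch b r2 k" for k s
  proof -
    have "cmod (D k s) \<le> 5/4 * (200 * \<epsilon> / \<delta>)"
      unfolding D_def norm_mult using \<mu>_bds(2)[of s k] v_bd[of s k] that P2 r1(3)
      by (intro mult_mono) auto
    then show ?thesis by simp
  qed
  have \<mu>_d: "cmod (deriv (\<mu> k) s) * (1 + cmod s)^2 \<le> 1 / (2 * \<delta>)" if s: "s \<in> patch b r2 k" for k s
  proof -
    have sP: "s \<in> ?P k" by (rule subsetD[OF P2(2) s])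
    have sub: "cball s \<delta> \<subseteq> ?P k" using cball_subset_patch[of s b r \<delta> 0 k] s P2(1) \<delta> by (auto simp: r1_def)
    have R2: "cmod (deriv (deriv (R k)) s) \<le> (1/4) / \<delta>"
      by (rule Cauchy_deriv_bound[OF hol_dR sub \<delta>(1)]) (use dR1 sub in blast)
    have "(deriv (R k) has_field_derivative deriv (deriv (R k)) s) (at s)"
      using holomorphic_derivI[OF hol_dR open_patch sP] .
    then have "(\<mu> k has_field_derivative (deriv (deriv (R k)) s - deriv (R k) s) * exp (- s)) (at s)"
      unfolding \<mu>_def[abs_def] by (auto intro!: derivative_eq_intros simp: algebra_simps)
    then have eq: "deriv (\<mu> k) s = (deriv (deriv (R k)) s - deriv (R k) s) * exp (- s)" by (rule DERIV_imp_deriv)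
    have "cmod (deriv (deriv (R k)) s - deriv (R k) s) \<le> (1/4)/\<delta> + 1/4"
      using norm_triangle_ineq4 R2 dR1[OF sP] by (smt (verit))
    also have "\<dots> \<le> 1 / (2 * \<delta>)" using \<delta> by (simp add: field_simps)
    finally have "cmod (deriv (deriv (R k)) s - deriv (R k) s) * ((1 + cmod s)^2 * exp (- Re s)) \<le> (1 / (2 * \<delta>)) * 1"
      using decay[of s k] sP P1 \<delta> by (intro mult_mono) auto
    then show ?thesis unfolding eq norm_mult by (simp add: mult_ac)
  qed
  have D_d: "cmod (deriv (D k) s) * (1 + cmod s)^2 \<le> 4000 * \<epsilon> / \<delta>^2" if s: "s \<in> patch b r2 k" for k s
  proof -
    have s1: "s \<in> patch b r1 k" by (rule subsetD[OF P2(1) s])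
    have sP: "s \<in> ?P k" by (rule subsetD[OF P2(2) s])
    have "deriv (D k) s = \<mu> k s * deriv (v k) s + deriv (\<mu> k) s * v k s"
      unfolding D_def[abs_def]
      using holomorphic_on_imp_differentiable_at[OF hol_\<mu> open_patch sP] holomorphic_on_imp_differentiable_at[OF hol_v open_patch s1]
      by (rule deriv_mult)
    then have "cmod (deriv (D k) s) \<le> cmod (\<mu> k s) * cmod (deriv (v k) s) + cmod (deriv (\<mu> k) s) * cmod (v k s)"
      by (metis norm_mult norm_triangle_ineq)
    then have "cmod (deriv (D k) s) * (1 + cmod s)^2 \<le> (cmod (\<mu> k s) * cmod (deriv (v k) s) + cmod (deriv (\<mu> k) s) * cmod (v k s)) * (1 + cmod s)^2"
      by (rule mult_right_mono) simp
    also have "\<dots> = cmod (\<mu> k s) * (cmod (deriv (v k) s) * (1 + cmod s)^2) + (cmod (deriv (\<mu> k) s) * (1 + cmod s)^2) * cmod (v k s)"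
      by (simp add: algebra_simps)
    also have "\<dots> \<le> 5/4 * (1600 * \<epsilon> / \<delta>^2) + (1 / (2 * \<delta>)) * (200 * \<epsilon> / \<delta>)"
      using \<mu>_bds(2)[OF sP] v_d[OF s1] \<mu>_d[OF s] v_bd[OF s1] r1(3) \<delta> by (intro add_mono mult_mono) auto
    also have "\<dots> = 2100 * \<epsilon> / \<delta>^2" by (simp add: power2_eq_square field_simps)
    also have "\<dots> \<le> 4000 * \<epsilon> / \<delta>^2" using \<epsilon> by (intro divide_right_mono) auto
    finally show ?thesis .
  qed
  have "regular r2 D"
    unfolding regular_def
  proof (intro conjI allI ballI)
    show "D k holomorphic_on patch b r2 k" for k
      unfolding D_def[abs_def] by (intro holomorphic_intros holomorphic_on_subset[OF hol_\<mu> P2(2)] holomorphic_on_subset[OF hol_v P2(1)])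
    show "D 0 (cnj s) = cnj (D 0 s)" if s: "s \<in> patch b r2 0" for s
    proof -
      have sP: "s \<in> ?P 0" and s1: "s \<in> patch b r1 0"
        by (rule subsetD[OF P2(2) s], rule subsetD[OF P2(1) s])
      have cs: "cnj s \<in> ?P 0" using sP by (simp add: patch_def)
      have eqR: "R 0 w = cnj (R 0 (cnj w))" if "w \<in> ?P 0" for w using symR[OF that] by simp
      have "deriv (R 0) s = deriv (\<lambda>z. cnj (R 0 (cnj z))) s"
        by (rule complex_derivative_transform_within_open[OF holR holomorphic_transform[OF holR eqR] open_patch sP eqR])
      also have "\<dots> = cnj (deriv (R 0) (cnj s))"
        by (rule deriv_cnj_cnj) (use holomorphic_on_imp_differentiable_at[OF holR open_patch cs] in simp)
      finally have "deriv (R 0) (cnj s) = cnj (deriv (R 0) s)" by simp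
      then show ?thesis using v_sym[OF s1] by (simp add: D_def \<mu>_def exp_cnj)
    qed
  qed
  moreover have "size_le r2 (400 * \<epsilon> / \<delta>) (4000 * \<epsilon> / \<delta>^2) D"
    unfolding size_le_def
  proof (intro conjI allI ballI)
    fix k s assume s: "s \<in> patch b r2 k"
    show "cmod (deriv (D k) s) * (1 + cmod s)^2 \<le> 4000 * \<epsilon> / \<delta>^2" by (rule D_d[OF s])
    have "250 * \<epsilon> / \<delta> \<le> 400 * \<epsilon> / \<delta>" using \<epsilon> \<delta> by (intro divide_right_mono) auto
    then show "cmod (D k s) \<le> 400 * \<epsilon> / \<delta>" using D_bd[OF s] by linarith
  qed
  moreover have "mismatch_le r2 (3000000 * \<epsilon>^2 / \<delta>^2) (\<lambda>k s. R k s + D k s)"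
    unfolding mismatch_le_def
  proof (intro allI ballI)
    fix k s assume s: "s \<in> overlap b r2 k"
    let ?w = "weight b k s"
    have s2: "s \<in> patch b r2 k" by (rule subsetD[OF OP2(1) s])
    have sO: "s \<in> ?O k" by (rule subsetD[OF O2(2) s])
    have sO1: "s \<in> overlap b r1 k" by (rule subsetD[OF O2(1) s])
    have sP: "s \<in> ?P k" "s \<in> ?P (Suc k)" by (rule subsetD[OF OP(1) sO], rule subsetD[OF OP(2) sO])
    have s1: "s \<in> patch b r1 k" by (rule subsetD[OF P2(1) s2])
    define L where "L = deriv (\<gamma> k) (exp s + R k s)"
    define rem where "rem = \<gamma> k (exp s + R k s + D k s) - \<gamma> k (exp s + R k s) - L * D k s"
    have de: "deriv (e k) s = deriv (R k) s + L * (exp s + deriv (R k) s) - deriv (R (Suc k)) s"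
      unfolding L_def by (rule DERIV_imp_deriv[OF der_e[OF sO]])
    have ee: "exp s * exp (- s) = (1::complex)" by (simp add: exp_minus_inverse)
    \<comment> \<open>The derivative of the mismatch, multiplied by exp(- s): the functions \<mu>
      satisfy the homogeneous linearised equation up to e'.\<close>
    have "(1 + L) * \<mu> k s = 1 + (deriv (R k) s + L * (exp s + deriv (R k) s)) * exp (- s)"
      using ee by (simp add: \<mu>_def algebra_simps)
    also have "\<dots> = \<mu> (Suc k) s + deriv (e k) s * exp (- s)"
      unfolding de \<mu>_def by (simp add: algebra_simps)
    finally have key: "(1 + L) * \<mu> k s = \<mu> (Suc k) s + deriv (e k) s * exp (- s)" .
    have "mismatch (\<lambda>k s. R k s + D k s) k s = e k s + (1 + L) * D k s + rem - D (Suc k) s"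
      by (simp add: mismatch_def e_def rem_def algebra_simps)
    also have "\<dots> = e k s + ((1 + L) * \<mu> k s) * v k s + rem - \<mu> (Suc k) s * v (Suc k) s"
      by (simp add: D_def mult.assoc)
    also have "\<dots> = e k s - \<mu> (Suc k) s * (v (Suc k) s - v k s) + deriv (e k) s * exp (- s) * v k s + rem"
      unfolding key by (simp add: algebra_simps)
    also have "\<dots> = deriv (e k) s * exp (- s) * v k s + rem"
      using v_jump[OF sO1] \<mu>_nz[OF sP(2)] by simp
    finally have eq: "mismatch (\<lambda>k s. R k s + D k s) k s = deriv (e k) s * exp (- s) * v k s + rem" .
    have "cmod (deriv (e k) s) \<le> (12 * (\<epsilon> * ?w)) / \<delta>"
    proof (rule Cauchy_deriv_bound[OF hol_e _ \<delta>(1)])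
      have "s \<in> overlap b (r - \<delta>) k" using sO1 by (simp add: r1_def)
      then show sub: "cball s \<delta> \<subseteq> ?O k" by (rule cball_subset_overlap) (use \<delta> in simp)
      show "cmod (e k w) \<le> 12 * (\<epsilon> * ?w)" if w: "w \<in> cball s \<delta>" for w
      proof -
        have "cmod (w - s) \<le> 1" using w \<delta> by (simp add: dist_norm norm_minus_commute)
        then have "\<epsilon> * weight b k w \<le> \<epsilon> * (12 * ?w)" using \<epsilon> by (intro mult_left_mono weight_near) auto
        then show ?thesis using e_bd[of w k] sub w by auto
      qed
    qed
    then have "cmod (deriv (e k) s) * cmod (exp (- s)) * cmod (v k s) \<le> (12 * (\<epsilon> * ?w)) / \<delta> * 1 * (200 * \<epsilon> / \<delta>)"
      using exps[OF sP(1)] v_bd[OF s1] r1(3) \<delta> \<epsilon> by (intro mult_mono) auto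
    then have t1: "cmod (deriv (e k) s * exp (- s) * v k s) \<le> 2400 * \<epsilon>^2 / \<delta>^2 * ?w"
      unfolding norm_mult by (simp add: power2_eq_square mult_ac)
    have D4: "cmod (D k s) \<le> 1/4"
    proof -
      have "250 * \<epsilon> / \<delta> \<le> 1/4" using \<epsilon> \<delta> by (simp add: field_simps)
      then show ?thesis using D_bd[OF s2] by linarith
    qed
    \<comment> \<open>The correction D does not decay. The weight in the new mismatch is supplied by
      the bound on \<open>\<gamma> k\<close> here, and by e' in the estimate t1.\<close>
    have t2: "cmod rem \<le> 2000000 * \<epsilon>^2 / \<delta>^2 * ?w"
    proof -
      let ?g = "\<lambda>z. \<gamma> k (exp s + z)"
      have gd: "(?g has_field_derivative deriv (\<gamma> k) (exp s + z)) (at z)" if "cmod z < 1" for z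
        using DERIV_shift[of "\<gamma> k" "deriv (\<gamma> k) (exp s + z)" z "exp s"] der\<gamma>[OF sO that] by (simp add: add.commute)
      then have hg: "?g holomorphic_on ball 0 1"
        unfolding holomorphic_on_open[OF open_ball] by (metis mem_ball_0)
      have gb: "cmod (?g z) \<le> \<tau> * ?w" if "cmod z < 1" for z using \<gamma>_bound[of s k z] O1 sO that by blast
      have "cmod (R k s) < 1" using bR[OF sP(1)] by linarith
      then have dg: "deriv ?g (R k s) = L" unfolding L_def by (intro DERIV_imp_deriv gd)
      have "cmod rem \<le> 32 * (\<tau> * ?w) * (cmod (D k s))^2"
        using second_order_remainder[OF hg gb bR[OF sP(1)] D4] unfolding dg by (simp add: rem_def add.assoc)
      also have "\<dots> \<le> 32 * (1 * ?w) * (250 * \<epsilon> / \<delta>)^2"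
        using \<tau> D_bd[OF s2] by (intro mult_mono power_mono) auto
      also have "\<dots> = 2000000 * \<epsilon>^2 / \<delta>^2 * ?w" by (simp add: power_mult_distrib power_divide)
      finally show ?thesis .
    qed
    have "cmod (mismatch (\<lambda>k s. R k s + D k s) k s) \<le> 2400 * \<epsilon>^2 / \<delta>^2 * ?w + 2000000 * \<epsilon>^2 / \<delta>^2 * ?w"
      unfolding eq by (rule order_trans[OF norm_triangle_ineq add_mono[OF t1 t2]])
    also have "\<dots> = 2002400 * (\<epsilon>^2 / \<delta>^2 * ?w)" by simp
    also have "\<dots> \<le> 3000000 * (\<epsilon>^2 / \<delta>^2 * ?w)" by (intro mult_right_mono) auto
    finally show "cmod (mismatch (\<lambda>k s. R k s + D k s) k s) \<le> 3000000 * \<epsilon>^2 / \<delta>^2 * ?w" by simp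
  qed
  ultimately show ?thesis unfolding r2_def by blast
qed

text \<open>Decreases from 1 to the limit 3/4; step n loses (1/8) (1/2)^n, which is 2 \<delta> for
  \<delta> = (1/2)^n / 16.\<close>

definition radius :: "nat \<Rightarrow> real" where "radius n = 3/4 + (1/4) * (1/2)^n"

text \<open>With h = (1/2)^n, a margin of order h and a mismatch of order h^3, the new mismatch is
  of order h^6 / h^2 = h^4 and hence again within the rate h^3, and the correction with its
  derivative is of order h^3 / h^2 = h, which is summable. The factor 1/10^10 absorbs the numerical
  constants of \<open>newton_step\<close>.\<close>

lemma newton_sequence:
  assumes "\<tau> \<le> 1/10^10"
  obtains f where "\<And>n. regular (radius n) (f n)"
    "\<And>n. size_le (radius n) ((1/4) * (1 - (1/2)^n)) ((1/4) * (1 - (1/2)^n)) (f n)"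
    "\<And>n. mismatch_le (radius n) ((1/10^10) * (1/8)^n) (f n)"
    "\<And>n. size_le (radius (Suc n)) ((1/8) * (1/2)^n) ((1/8) * (1/2)^n) (\<lambda>k s. f (Suc n) k s - f n k s)"
proof -
  define Inv where "Inv n R \<longleftrightarrow> regular (radius n) R \<and>
    size_le (radius n) ((1/4) * (1 - (1/2)^n)) ((1/4) * (1 - (1/2)^n)) R \<and>
    mismatch_le (radius n) ((1/10^10) * (1/8)^n) R" for n R
  define Step where "Step n R R' \<longleftrightarrow> size_le (radius (Suc n)) ((1/8) * (1/2)^n) ((1/8) * (1/2)^n) (\<lambda>k s. R' k s - R k s)" for n R R'
  have "\<exists>f. \<forall>n. Inv n (f n) \<and> Step n (f n) (f (Suc n))"
  proof (rule dependent_nat_choice)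
    have "mismatch_le (radius 0) ((1/10^10) * (1/8)^0) (\<lambda>k s. 0)"
      unfolding mismatch_le_def
    proof (intro allI ballI)
      fix k s assume "s \<in> overlap b (radius 0) k"
      then have s: "s \<in> overlap b 1 k" by (simp add: radius_def)
      have "cmod (mismatch (\<lambda>k s. 0) k s) \<le> \<tau> * weight b k s"
        using \<gamma>_bound[OF s, of 0] by (simp add: mismatch_def)
      also have "\<dots> \<le> ((1/10^10) * (1/8)^0) * weight b k s" using assms by (intro mult_right_mono) auto
      finally show "cmod (mismatch (\<lambda>k s. 0) k s) \<le> ((1/10^10) * (1/8)^0) * weight b k s" .
    qed
    moreover have "regular (radius 0) (\<lambda>k s. 0)" by (simp add: regular_def)
    moreover have "size_le (radius 0) ((1/4) * (1 - (1/2)^0)) ((1/4) * (1 - (1/2)^0)) (\<lambda>k s. 0)" by (simp add: size_le_def)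
    ultimately have "Inv 0 (\<lambda>k s. 0)" unfolding Inv_def by (intro conjI)
    then show "\<exists>R. Inv 0 R" by (rule exI[of _ "\<lambda>k s. 0"])
  next
    fix R n assume I: "Inv n R"
    define h where "h = (1/2::real)^n"
    have h: "0 < h" "h \<le> 1" by (auto simp: h_def power_le_one)
    have h8: "(1/8::real)^n = h^3"
  proof -
    have "(1/8::real) = (1/2)^3" by (simp add: power3_eq_cube)
    then show ?thesis unfolding h_def by (metis power_mult mult.commute)
  qed
    define \<delta> where "\<delta> = h / 16"
    define \<epsilon> where "\<epsilon> = h^3 / 10^10"
    have rad: "radius n = 3/4 + h/4" "radius (Suc n) = radius n - 2 * \<delta>" by (auto simp: radius_def h_def \<delta>_def)
    have size: "size_le (radius n) (1/4 * (1 - h)) (1/4 * (1 - h)) R" using I by (simp add: Inv_def h_def)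
    have size4: "size_le (radius n) (1/4) (1/4) R"
      by (rule size_le_mono[OF size]) (use h in auto)
    have h3: "h^3 \<le> h" using h power_decreasing[of 1 3 h] by simp
    have pre: "0 < \<delta>" "\<delta> \<le> 1/4" "2 * \<delta> < radius n" "radius n \<le> 1" "0 \<le> \<epsilon>" "400 * \<epsilon> \<le> \<delta> / 4"
      using h h3 by (auto simp: \<delta>_def rad \<epsilon>_def)
    have regR: "regular (radius n) R" and misR: "mismatch_le (radius n) \<epsilon> R" using I h8 by (simp_all add: Inv_def \<epsilon>_def)
    obtain D where D: "regular (radius n - 2 * \<delta>) D" "size_le (radius n - 2 * \<delta>) (400 * \<epsilon> / \<delta>) (4000 * \<epsilon> / \<delta>^2) D"
      "mismatch_le (radius n - 2 * \<delta>) (3000000 * \<epsilon>^2 / \<delta>^2) (\<lambda>k s. R k s + D k s)"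
      using newton_step[OF pre regR size4 misR] by blast
    have c1: "400 * \<epsilon> / \<delta> \<le> 1/8 * h"
    proof -
      have "400 * \<epsilon> / \<delta> = (6400 / 10^10) * h^2"
        using h by (simp add: \<epsilon>_def \<delta>_def power2_eq_square power3_eq_cube)
      also have "\<dots> \<le> (6400 / 10^10) * h" using h power_decreasing[of 1 2 h] by (intro mult_left_mono) auto
      also have "\<dots> \<le> 1/8 * h" using h by (intro mult_right_mono) auto
      finally show ?thesis .
    qed
    have c2: "4000 * \<epsilon> / \<delta>^2 \<le> 1/8 * h"
      using h by (simp add: \<epsilon>_def \<delta>_def power3_eq_cube power2_eq_square)
    have c3: "3000000 * \<epsilon>^2 / \<delta>^2 \<le> (1/10^10) * (1/8)^(Suc n)"
    proof -
      have "3000000 * \<epsilon>^2 / \<delta>^2 = (768000000 / 10^20) * h^4"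
        using h by (simp add: \<epsilon>_def \<delta>_def power_divide power2_eq_square eval_nat_numeral)
      also have "\<dots> \<le> (768000000 / 10^20) * h^3" using h power_decreasing[of 3 4 h] by (intro mult_left_mono) auto
      also have "\<dots> \<le> (1/(8*10^10)) * h^3" using h by (intro mult_right_mono) auto
      finally show ?thesis using h8 by simp
    qed
    let ?R = "\<lambda>k s. R k s + D k s"
    have sub: "patch b (radius n - 2 * \<delta>) k \<subseteq> patch b (radius n) k" for k using h by (intro patch_mono) (auto simp: \<delta>_def)
    have hR: "R k holomorphic_on patch b (radius n - 2 * \<delta>) k" for k
      using I sub by (auto simp: Inv_def regular_def intro: holomorphic_on_subset)
    have hD: "D k holomorphic_on patch b (radius n - 2 * \<delta>) k" for k using D(1) by (simp add: regular_def)
    have sD: "size_le (radius (Suc n)) (1/8 * h) (1/8 * h) D"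
      unfolding rad(2) by (rule size_le_mono[OF D(2) c1 c2])
    have "Inv (Suc n) ?R"
      unfolding Inv_def
    proof (intro conjI)
      show "regular (radius (Suc n)) ?R"
        unfolding rad(2) regular_def
      proof (intro conjI allI ballI)
        show "?R k holomorphic_on patch b (radius n - 2 * \<delta>) k" for k by (intro holomorphic_intros hR hD)
        show "?R 0 (cnj s) = cnj (?R 0 s)" if "s \<in> patch b (radius n - 2 * \<delta>) 0" for s
          using I D(1) that sub[of 0] by (auto simp: Inv_def regular_def)
      qed
      show "size_le (radius (Suc n)) (1/4 * (1 - (1/2)^Suc n)) (1/4 * (1 - (1/2)^Suc n)) ?R"
        unfolding size_le_def
      proof (intro allI ballI conjI)
        fix k s assume s: "s \<in> patch b (radius (Suc n)) k"
        then have sn: "s \<in> patch b (radius n - 2 * \<delta>) k" "s \<in> patch b (radius n) k" using sub rad(2) by auto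
        have b1: "cmod (R k s) \<le> 1/4 * (1 - h)" "cmod (deriv (R k) s) * (1 + cmod s)^2 \<le> 1/4 * (1 - h)"
          using size sn by (auto simp: size_le_def)
        have b2: "cmod (D k s) \<le> 1/8 * h" "cmod (deriv (D k) s) * (1 + cmod s)^2 \<le> 1/8 * h"
          using sD s by (auto simp: size_le_def)
        show "cmod (?R k s) \<le> 1/4 * (1 - (1/2)^Suc n)"
          using norm_triangle_ineq[of "R k s" "D k s"] b1 b2 by (simp add: h_def)
        have "deriv (?R k) s = deriv (R k) s + deriv (D k) s"
          using holomorphic_on_imp_differentiable_at[OF hR open_patch sn(1)] holomorphic_on_imp_differentiable_at[OF hD open_patch sn(1)]
          by (rule deriv_add)
        then have "cmod (deriv (?R k) s) * (1 + cmod s)^2 \<le> (cmod (deriv (R k) s) + cmod (deriv (D k) s)) * (1 + cmod s)^2"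
          by (auto intro!: mult_right_mono norm_triangle_ineq)
        then show "cmod (deriv (?R k) s) * (1 + cmod s)^2 \<le> 1/4 * (1 - (1/2)^Suc n)"
          using b1 b2 by (simp add: h_def distrib_right)
      qed
      show "mismatch_le (radius (Suc n)) (1/10^10 * (1/8)^Suc n) ?R"
        unfolding mismatch_le_def rad(2)
      proof (intro allI ballI)
        fix k s assume s: "s \<in> overlap b (radius n - 2 * \<delta>) k"
        have "cmod (mismatch ?R k s) \<le> 3000000 * \<epsilon>^2 / \<delta>^2 * weight b k s" using D(3) s by (auto simp: mismatch_le_def)
        also have "\<dots> \<le> (1/10^10 * (1/8)^Suc n) * weight b k s" using c3 by (intro mult_right_mono) auto
        finally show "cmod (mismatch ?R k s) \<le> (1/10^10 * (1/8)^Suc n) * weight b k s" .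
      qed
    qed
    moreover have "Step n R ?R" using sD by (simp add: Step_def h_def)
    ultimately show "\<exists>R'. Inv (Suc n) R' \<and> Step n R R'" by blast
  qed
  then obtain f where f: "\<forall>n. Inv n (f n) \<and> Step n (f n) (f (Suc n))" by (rule exE)
  then have I: "Inv n (f n)" and S: "Step n (f n) (f (Suc n))" for n by simp_all
  show thesis
    by (rule that[of f]) (use I S in \<open>simp_all only: Inv_def Step_def\<close>)
qed

lemma gluing_solution:
  assumes "\<tau> \<le> 1/10^10"
  obtains R where "regular (3/4) R" "size_le (3/4) (1/4) (1/4) R"
    "\<And>k s. s \<in> overlap b (3/4) k \<Longrightarrow> R (Suc k) s = R k s + \<gamma> k (exp s + R k s)"
proof -
  obtain f where reg: "\<And>n. regular (radius n) (f n)"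
    and size: "\<And>n. size_le (radius n) ((1/4) * (1 - (1/2)^n)) ((1/4) * (1 - (1/2)^n)) (f n)"
    and mis: "\<And>n. mismatch_le (radius n) ((1/10^10) * (1/8)^n) (f n)"
    and step: "\<And>n. size_le (radius (Suc n)) ((1/8) * (1/2)^n) ((1/8) * (1/2)^n) (\<lambda>k s. f (Suc n) k s - f n k s)"
    by (rule newton_sequence[OF assms]) (rule that; assumption)
  define P where "P k = patch b (3/4) k" for k
  have subP: "P k \<subseteq> patch b (radius n) k" and subO: "overlap b (3/4) k \<subseteq> overlap b (radius n) k" for n k
    unfolding P_def by (rule patch_mono overlap_mono, simp add: radius_def)+
  define g where "g k n s = f (Suc n) k s - f n k s" for k n s
  have openP: "open (P k)" for k by (simp add: P_def open_patch)
  have hg: "g k n holomorphic_on P k" for k n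
  proof -
    have "f m k holomorphic_on P k" for m using reg[of m] subP holomorphic_on_subset unfolding regular_def by blast
    then show ?thesis unfolding g_def[abs_def] by (intro holomorphic_intros)
  qed
  have bg: "cmod (g k n s) \<le> (1/8) * (1/2)^n" "cmod (deriv (g k n) s) * (1 + cmod s)^2 \<le> (1/8) * (1/2)^n" if "s \<in> P k" for k n s
    using step[of n] subP[of k "Suc n"] that unfolding size_le_def g_def[abs_def] by auto
  define R where "R k s = (\<Sum>n. g k n s)" for k s
  have G: "R k holomorphic_on P k" "\<And>s. s \<in> P k \<Longrightarrow> summable (\<lambda>n. g k n s)"
    "\<And>s. s \<in> P k \<Longrightarrow> cmod (R k s) \<le> 2 * (1/8)"
    "\<And>s. s \<in> P k \<Longrightarrow> cmod (deriv (R k) s) * (1 + cmod s)^2 \<le> 2 * (1/8)" for k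
    unfolding R_def[abs_def]
    by (rule geometric_series_holomorphic[OF openP hg bg]; assumption)+
  have lim: "(\<lambda>n. f n k s) \<longlonglongrightarrow> R k s" if s: "s \<in> P k" for k s
  proof -
    \<comment> \<open>The size bound vanishes for n = 0, so the iteration starts at 0 and the series
      of increments telescopes to \<open>f n\<close> itself.\<close>
    have "cmod (f 0 k s) \<le> 0" using size[of 0] subP[of k 0] s unfolding size_le_def by auto
    then have f0: "f 0 k s = 0" by simp
    have "(\<Sum>i<n. g k i s) = f n k s" for n
      unfolding g_def by (subst sum_lessThan_telescope) (simp add: f0)
    then show ?thesis using summable_LIMSEQ[OF G(2)[OF s]] by (simp add: R_def)
  qed
  show thesis
  proof (rule that[of R])
    show "regular (3/4) R"
      unfolding regular_def
    proof (intro conjI allI ballI)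
      show "R k holomorphic_on patch b (3/4) k" for k using G(1) by (simp add: P_def)
      show "R 0 (cnj s) = cnj (R 0 s)" if s: "s \<in> patch b (3/4) 0" for s
      proof -
        have s': "s \<in> P 0" "cnj s \<in> P 0" using s by (auto simp: P_def patch_def)
        have "f n 0 (cnj s) = cnj (f n 0 s)" for n using reg[of n] subP s'(1) unfolding regular_def by blast
        then have "(\<lambda>n. cnj (f n 0 s)) \<longlonglongrightarrow> R 0 (cnj s)" using lim[OF s'(2)] by simp
        moreover have "(\<lambda>n. cnj (f n 0 s)) \<longlonglongrightarrow> cnj (R 0 s)" by (intro tendsto_cnj lim s'(1))
        ultimately show ?thesis by (rule LIMSEQ_unique)
      qed
    qed
    show "size_le (3/4) (1/4) (1/4) R" using G(3,4) unfolding size_le_def P_def by simp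
    show "R (Suc k) s = R k s + \<gamma> k (exp s + R k s)" if s: "s \<in> overlap b (3/4) k" for k s
    proof -
      have sP: "s \<in> P k" "s \<in> P (Suc k)" using overlap_subset_patch[OF mono_b, of "3/4" k] s by (auto simp: P_def)
      have s1: "s \<in> overlap b 1 k" using s overlap_mono[of "3/4" 1] by auto
      have "cmod (R k s) < 1" using G(3)[OF sP(1)] by linarith
      then have "isCont (\<gamma> k) (exp s + R k s)" using \<gamma>_diff[OF s1] field_differentiable_imp_continuous_at by blast
      then have "(\<lambda>n. \<gamma> k (exp s + f n k s)) \<longlonglongrightarrow> \<gamma> k (exp s + R k s)"
        by (rule isCont_tendsto_compose) (intro tendsto_intros lim sP)
      then have m1: "(\<lambda>n. mismatch (f n) k s) \<longlonglongrightarrow> R k s + \<gamma> k (exp s + R k s) - R (Suc k) s"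
        unfolding mismatch_def by (intro tendsto_diff tendsto_add lim sP)
      have "(\<lambda>n. mismatch (f n) k s) \<longlonglongrightarrow> 0"
      proof (rule Lim_null_comparison)
        show "\<forall>\<^sub>F n in sequentially. cmod (mismatch (f n) k s) \<le> ((1/10^10) * (1/8)^n) * weight b k s"
          using mis subO s unfolding mismatch_le_def by (intro always_eventually allI) blast
        show "(\<lambda>n. ((1/10^10) * (1/8)^n) * weight b k s) \<longlonglongrightarrow> 0"
          by (intro tendsto_mult_left_zero tendsto_mult_right_zero LIMSEQ_power_zero) auto
      qed
      from LIMSEQ_unique[OF m1 this] show ?thesis by (simp add: algebra_simps)
    qed
  qed
qed

end

section \<open>Gluing of germs in the coordinate log Psi\<close>

text \<open>Sign in the exponent of the horn variable on overlap k: even k carry the germs at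
  infinity with exp(2 pi i w), odd k the germs at 0 with exp(- 2 pi i w).\<close>

definition altsign :: "int \<Rightarrow> real" where "altsign k = (if even k then 1 else -1)"

definition hexp :: "int \<Rightarrow> complex \<Rightarrow> complex" where
  "hexp k w = exp (of_real (altsign k) * (2 * pi * \<i>) * w)"

text \<open>The translation part of the germ in the Fatou coordinate: w + \<open>hlog k h w\<close>
  is a lift of h through \<open>hexp k\<close>. Taking the logarithm of the quotient h(t)/t, which
  is near 1, instead of that of h(t) makes it small and periodic with period 1.\<close>

definition hlog :: "int \<Rightarrow> (complex \<Rightarrow> complex) \<Rightarrow> complex \<Rightarrow> complex" where
  "hlog k h w = of_real (altsign k) / (2 * pi * \<i>) * Ln (h (hexp k w) / hexp k w)"

lemma altsign_square [simp]: "altsign k * altsign k = 1" "complex_of_real (altsign k) * complex_of_real (altsign k) = 1"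
  by (auto simp: altsign_def)

lemma norm_hexp: "cmod (hexp k w) = exp (- 2 * pi * altsign k * Im w)"
  by (simp add: hexp_def norm_exp_eq_Re)

lemma hexp_nz [simp]: "hexp k w \<noteq> 0" by (simp add: hexp_def)

lemma hexp_add: "hexp k (v + w) = hexp k v * hexp k w"
  by (simp add: hexp_def exp_add[symmetric] algebra_simps)

lemma hexp_hlog:
  assumes "h (hexp k w) \<noteq> 0"
  shows "hexp k (w + hlog k h w) = h (hexp k w)"
proof -
  have "of_real (altsign k) * (2 * pi * \<i>) * hlog k h w = (of_real (altsign k) * of_real (altsign k)) * Ln (h (hexp k w) / hexp k w)"
    by (simp add: hlog_def field_simps)
  also have "\<dots> = Ln (h (hexp k w) / hexp k w)" by simp
  finally have "hexp k (hlog k h w) = h (hexp k w) / hexp k w"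
    using assms unfolding hexp_def[of k "hlog k h w"] by simp
  then show ?thesis by (simp add: hexp_add)
qed

lemma hexp_plus_one [simp]: "hexp k (w + 1) = hexp k w"
proof -
  have "hexp k 1 = 1" by (simp add: hexp_def altsign_def exp_minus)
  then show ?thesis by (simp add: hexp_add)
qed

text \<open>On the line Im s = (k + 1/2) pi the number exp s equals \<open>altsign k\<close> times i
  exp(Re s). Hence the horn variable of exp s is doubly exponentially small around this line, for
  either parity of k.\<close>

lemma altsign_Im_exp:
  "altsign k * Im (exp s) = exp (Re s) * cos (Im s - (of_int k + 1/2) * pi)"
proof -
  define y where "y = Im s - (of_int k + 1/2) * pi"
  have "Im s = y + pi/2 + pi * of_int k" by (simp add: y_def algebra_simps)
  then have "sin (Im s) = altsign k * cos y"
    by (simp add: sin_add cos_add cos_npi_int sin_npi_int altsign_def)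
  then have "altsign k * sin (Im s) = cos y" by (simp add: mult.assoc[symmetric])
  then show ?thesis by (simp add: Im_exp y_def algebra_simps)
qed

lemma cos_ge_half: "\<bar>y\<bar> \<le> 1 \<Longrightarrow> 1/2 \<le> cos (y::real)"
  using cos_monotone_0_pi_le[of "\<bar>y\<bar>" "pi/3"] pi_gt3 by (simp add: cos_60)

text \<open>The cosine is at least 1/2, so the exponent is at most - 2 pi (exp(Re s)/2 - 1), the -1
  allowing for z; then 2 pi < 7 and pi > 3.\<close>

lemma norm_hexp_overlap:
  assumes "\<bar>Im s - (of_int k + 1/2) * pi\<bar> \<le> 1" "cmod z \<le> 1"
  shows "cmod (hexp k (exp s + z)) \<le> exp (7 - 3 * exp (Re s))"
proof -
  have "exp (Re s) * (1/2) \<le> altsign k * Im (exp s)"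
    unfolding altsign_Im_exp by (intro mult_left_mono cos_ge_half assms) auto
  moreover have "- 1 \<le> altsign k * Im z" using abs_Im_le_cmod[of z] assms by (auto simp: altsign_def)
  ultimately have "exp (Re s) / 2 - 1 \<le> altsign k * Im (exp s + z)" by (simp add: distrib_left)
  then have "pi * (exp (Re s) / 2 - 1) \<le> pi * (altsign k * Im (exp s + z))" by (intro mult_left_mono) auto
  then have "- 2 * pi * altsign k * Im (exp s + z) \<le> pi * (2 - exp (Re s))" by (simp add: algebra_simps)
  also have "\<dots> \<le> 7 - 3 * exp (Re s)"
  proof -
    have "3 * exp (Re s) \<le> pi * exp (Re s)" using pi_gt3 by (intro mult_right_mono) auto
    moreover have "pi * 2 \<le> 7" using pi_approx by simp
    ultimately show ?thesis unfolding right_diff_distrib by linarith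
  qed
  finally show ?thesis by (simp add: norm_hexp)
qed

lemma norm_Ln_le:
  assumes "cmod (z - 1) \<le> 1/2"
  shows "cmod (Ln z) \<le> 2 * cmod (z - 1)"
proof -
  have n: "cmod (z - 1) < 1" using assms by linarith
  have 1: "cmod (Ln (1 + (z - 1)) - (z - 1)) \<le> (cmod (z - 1))^2 / (1 - cmod (z - 1))"
    by (rule Ln_approx_linear[OF n])
  have "(cmod (z - 1))^2 / (1 - cmod (z - 1)) \<le> (cmod (z - 1))^2 / (1/2)"
    using assms by (intro divide_left_mono) auto
  also have "\<dots> \<le> cmod (z - 1)" using mult_left_mono[OF assms, of "cmod (z - 1)"] by (simp add: power2_eq_square)
  finally have "cmod (Ln z - (z - 1)) \<le> cmod (z - 1)" using 1 by simp
  then show ?thesis using norm_triangle_ineq[of "Ln z - (z - 1)" "z - 1"] by simp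
qed

lemma hlog_small:
  assumes t: "cmod (h (hexp k w) - hexp k w) \<le> d * (cmod (hexp k w))^2" and d: "0 \<le> d" "d * cmod (hexp k w) \<le> 1/2"
  shows "h (hexp k w) \<noteq> 0" "cmod (h (hexp k w) / hexp k w - 1) \<le> 1/2" "cmod (hlog k h w) \<le> d * cmod (hexp k w)"
proof -
  let ?t = "hexp k w"
  have t0: "cmod ?t > 0" by simp
  have "h ?t / ?t - 1 = (h ?t - ?t) / ?t" by (simp add: diff_divide_distrib)
  then have "cmod (h ?t / ?t - 1) = cmod (h ?t - ?t) / cmod ?t" by (simp add: norm_divide)
  also have "\<dots> \<le> (d * (cmod ?t)^2) / cmod ?t" using t by (intro divide_right_mono) auto
  also have "\<dots> = d * cmod ?t" using t0 by (simp add: power2_eq_square)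
  finally have 1: "cmod (h ?t / ?t - 1) \<le> d * cmod ?t" .
  then show 2: "cmod (h ?t / ?t - 1) \<le> 1/2" using d by linarith
  show "h ?t \<noteq> 0"
  proof
    assume "h ?t = 0"
    then show False using 2 by simp
  qed
  have "cmod (hlog k h w) = cmod (Ln (h ?t / ?t)) / (2 * pi)"
    by (simp add: hlog_def norm_mult norm_divide altsign_def)
  also have "\<dots> \<le> (2 * (d * cmod ?t)) / (2 * pi)"
    using norm_Ln_le[OF 2] 1 by (intro divide_right_mono) auto
  also have "\<dots> \<le> (2 * (d * cmod ?t)) / 2" using pi_gt3 d by (intro divide_left_mono) auto
  finally show "cmod (hlog k h w) \<le> d * cmod ?t" by simp
qed

lemma hlog_differentiable:
  assumes "h field_differentiable at (hexp k w)" "cmod (h (hexp k w) / hexp k w - 1) \<le> 1/2"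
  shows "hlog k h field_differentiable at w"
proof -
  have "hexp k holomorphic_on UNIV" unfolding hexp_def[abs_def] by (intro holomorphic_intros)
  then have e: "hexp k field_differentiable at w" by (rule holomorphic_on_imp_differentiable_at) auto
  have "(h \<circ> hexp k) field_differentiable at w" by (rule field_differentiable_compose[OF e assms(1)])
  then have q: "(\<lambda>w. h (hexp k w) / hexp k w) field_differentiable at w"
    unfolding o_def by (rule field_differentiable_divide[OF _ e]) simp
  have "h (hexp k w) / hexp k w \<notin> \<real>\<^sub>\<le>\<^sub>0"
  proof
    assume "h (hexp k w) / hexp k w \<in> \<real>\<^sub>\<le>\<^sub>0"
    then have "Re (h (hexp k w) / hexp k w) \<le> 0" by (simp add: complex_nonpos_Reals_iff)
    then show False using abs_Re_le_cmod[of "h (hexp k w) / hexp k w - 1"] assms(2) by simp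
  qed
  then have "(Ln \<circ> (\<lambda>w. h (hexp k w) / hexp k w)) field_differentiable at w"
    by (intro field_differentiable_compose[OF q] field_differentiable_within_Ln)
  then show ?thesis unfolding hlog_def[abs_def] o_def by (rule field_differentiable_mult[OF field_differentiable_const])
qed

text \<open>For Re s > A + B sqrt k with B > 2 C one has C sqrt k < Re s / 2, so the lower bound on
  \<sigma> k is at least K1 exp(- K exp(Re s / 2)), and the horn variable, of size exp(7 - 3 exp(Re
  s)), falls below it. The same inequality gives k \<le> (Re s)^2, so that all bounds in k and |s|
  become bounds in Re s alone.\<close>

lemma gluing_of_germs:
  fixes h :: "nat \<Rightarrow> complex \<Rightarrow> complex" and \<sigma> :: "nat \<Rightarrow> real"
  assumes hol: "\<And>k. h k holomorphic_on ball 0 (\<sigma> k)"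
    and d: "0 < d" "\<And>k t. 0 < cmod t \<Longrightarrow> cmod t < \<sigma> k \<Longrightarrow> cmod (h k t - t) \<le> d * (cmod t)^2"
    and gr: "0 < C" "0 < K" "0 < K1" "\<And>k. \<sigma> k \<ge> K1 * exp (- K * exp (C * sqrt (real k)))"
  shows "\<exists>A B R. 1 \<le> A \<and> 1 \<le> B \<and>
    (\<forall>k. R k holomorphic_on patch (\<lambda>k. A + B * sqrt (real k)) (3/4) k) \<and>
    (\<forall>k. \<forall>s\<in>patch (\<lambda>k. A + B * sqrt (real k)) (3/4) k. cmod (R k s) \<le> 1/4 \<and> cmod (deriv (R k) s) * (1 + cmod s)^2 \<le> 1/4) \<and>
    (\<forall>s\<in>patch (\<lambda>k. A + B * sqrt (real k)) (3/4) 0. R 0 (cnj s) = cnj (R 0 s)) \<and>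
    (\<forall>k. \<forall>s\<in>overlap (\<lambda>k. A + B * sqrt (real k)) (3/4) k.
        R (Suc k) s = R k s + hlog k (h k) (exp s + R k s) \<and>
        h k (hexp k (exp s + R k s)) \<noteq> 0)"
proof -
  \<comment> \<open>Here x stands for Re s. The polynomial 9 + x + 4 x^2 will dominate 1 + |s|, and
    exp(- x^2) will be at most (1/2)^k, so the second inequality is the weight bound on the germ
    terms.\<close>
  have ev: "\<forall>\<^sub>F x::real in at_top. (9 + x + 4 * x^2)^2 \<le> exp x \<and>
      d * exp (7 - 3 * exp x) \<le> (1/10^10) * (exp (- (x^2) - x) / (9 + x + 4 * x^2)^2) \<and>
      d * exp (7 - 3 * exp x) \<le> 1/2 \<and> exp (7 - 3 * exp x) < K1 * exp (- K * exp (x/2)) \<and> 1 \<le> x"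
    using d gr by (intro eventually_conj) real_asymp+
  then obtain X where X: "\<And>x. x \<ge> X \<Longrightarrow> (9 + x + 4 * x^2)^2 \<le> exp x \<and>
      d * exp (7 - 3 * exp x) \<le> (1/10^10) * (exp (- (x^2) - x) / (9 + x + 4 * x^2)^2) \<and>
      d * exp (7 - 3 * exp x) \<le> 1/2 \<and> exp (7 - 3 * exp x) < K1 * exp (- K * exp (x/2)) \<and> 1 \<le> x"
    unfolding eventually_at_top_linorder by blast
  have X1: "1 \<le> X" using X[of X] by simp
  define A where "A = X + 1"
  define B where "B = 2 * C + 1"
  define b where "b = (\<lambda>k. A + B * sqrt (real k))"
  have AB: "1 \<le> A" "1 \<le> B" using X1 gr by (auto simp: A_def B_def)
  have sq: "sqrt (real k) \<le> x - X" "real k \<le> x^2" "C * sqrt (real k) \<le> x / 2" "X \<le> x" if "b k - 1 < x" for k x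
  proof -
    have 1: "X + B * sqrt (real k) < x" using that by (simp add: b_def A_def)
    have s0: "0 \<le> sqrt (real k)" by simp
    have 2: "1 * sqrt (real k) \<le> B * sqrt (real k)" using AB by (intro mult_right_mono) auto
    show 3: "sqrt (real k) \<le> x - X" using 1 2 by linarith
    show "X \<le> x" using 3 s0 by linarith
    have "(sqrt (real k))^2 \<le> x^2" using 3 X1 s0 by (intro power_mono) auto
    then show "real k \<le> x^2" by simp
    have "2 * C * sqrt (real k) \<le> B * sqrt (real k)" by (intro mult_right_mono) (auto simp: B_def)
    then show "C * sqrt (real k) \<le> x / 2" using 1 X1 by linarith
  qed
  have ns: "1 + cmod s \<le> 9 + Re s + 4 * (Re s)^2" if "\<bar>Im s\<bar> \<le> (real k + 1) * pi + 1" "real k \<le> (Re s)^2" "0 \<le> Re s" for s k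
  proof -
    have "(real k + 1) * pi \<le> (real k + 1) * 4" using pi_less_4 by (intro mult_left_mono) auto
    then have "cmod s \<le> Re s + ((real k + 1) * 4 + 1)" using cmod_le[of s] that by linarith
    then show ?thesis using that by (simp add: algebra_simps)
  qed
  interpret gluing_problem b "\<lambda>k. hlog k (h k)" "1/10^10"
  proof
    show "mono b" unfolding b_def using AB by (intro monoI add_left_mono mult_left_mono) auto
    show "(1 + cmod s)^2 * exp (- Re s) \<le> 1" if s: "s \<in> patch b 1 k" for k s
    proof -
      have s': "b (k - 1) - 1 < Re s" "\<bar>Im s - real k * pi\<bar> < pi/2 + 1" using s by (auto simp: patch_def)
      define q where "q = real (k - 1)"
      have q: "0 \<le> q" "real k \<le> q + 1" "q \<le> (Re s)^2" "1 \<le> Re s"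
        using sq(2,4)[OF s'(1)] X1 by (auto simp: q_def)
      have "real k * pi \<le> (q + 1) * pi" using q by (intro mult_right_mono) auto
      moreover have "0 \<le> real k * pi" by simp
      ultimately have k: "\<bar>Im s\<bar> \<le> (q + 1) * pi + (pi / 2 + 1)" using s'(2) by linarith
      have "(q + 1) * pi + (pi / 2 + 1) \<le> (q + 1) * 4 + 3"
        using mult_left_mono[OF less_imp_le[OF pi_less_4], of "q + 1"] pi_less_4 q by linarith
      then have "cmod s \<le> Re s + ((q + 1) * 4 + 3)" using cmod_le[of s] k q by linarith
      moreover have "(q + 1) * 4 + 3 \<le> 4 * (Re s)^2 + 7" using q(3) by simp
      ultimately have "1 + cmod s \<le> 9 + Re s + 4 * (Re s)^2" by linarith
      then have "(1 + cmod s)^2 \<le> (9 + Re s + 4 * (Re s)^2)^2" by (intro power_mono) auto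
      also have "\<dots> \<le> exp (Re s)" using X sq(4)[OF s'(1)] by blast
      finally show ?thesis by (simp add: exp_minus field_simps)
    qed
    fix k s z assume s: "s \<in> overlap b 1 k" and z: "cmod z < 1"
    define x where "x = Re s"
    have s': "b k - 1 < x" "\<bar>Im s - (real k + 1/2) * pi\<bar> < 1" using s by (auto simp: overlap_def x_def)
    note sq = sq[OF s'(1)]
    note Xx = X[OF sq(4)]
    let ?w = "exp s + z"
    have t: "cmod (hexp k ?w) \<le> exp (7 - 3 * exp x)"
      unfolding x_def using norm_hexp_overlap[of s "int k" z] s'(2) z by simp
    also have "\<dots> < K1 * exp (- K * exp (x/2))" using Xx by blast
    also have "\<dots> \<le> K1 * exp (- K * exp (C * sqrt (real k)))" using gr sq(3) by simp
    also have "\<dots> \<le> \<sigma> k" by (rule gr(4))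
    finally have t\<sigma>: "cmod (hexp k ?w) < \<sigma> k" .
    have dt: "d * cmod (hexp k ?w) \<le> d * exp (7 - 3 * exp x)" using t d by (intro mult_left_mono) auto
    then have dt2: "d * cmod (hexp k ?w) \<le> 1/2" using Xx by linarith
    have hb: "cmod (h k (hexp k ?w) - hexp k ?w) \<le> d * (cmod (hexp k ?w))^2" using d(2) t\<sigma> by simp
    note sm = hlog_small[where h = "h k" and k = "int k" and w = ?w, OF hb less_imp_le[OF d(1)] dt2]
    have "h k field_differentiable at (hexp k ?w)"
      using holomorphic_on_imp_differentiable_at[OF hol[of k] open_ball] t\<sigma> by simp
    then show "hlog k (h k) field_differentiable at ?w" using sm(2) by (rule hlog_differentiable)
    have "cmod (hlog k (h k) ?w) \<le> d * exp (7 - 3 * exp x)" using sm(3) dt by linarith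
    also have "\<dots> \<le> (1/10^10) * (exp (- (x^2) - x) / (9 + x + 4 * x^2)^2)" using Xx by blast
    also have "\<dots> \<le> (1/10^10) * weight b k s"
    proof -
      have "exp (- (x^2)) \<le> (1/2)^k"
      proof -
        have "exp (- (x^2)) \<le> exp (- real k * ln 2)"
        proof -
          have "real k * ln 2 \<le> real k * 1" using ln_2_less_1 by (intro mult_left_mono) auto
          then show ?thesis using sq(2) by simp
        qed
        also have "\<dots> = (1/2)^k" by (simp add: exp_minus exp_of_nat_mult power_one_over inverse_eq_divide)
        finally show ?thesis .
      qed
      moreover have "exp (- x) \<le> exp (b k - x)" using AB by (simp add: b_def)
      ultimately have 1: "exp (- (x^2)) * exp (- x) \<le> (1/2)^k * exp (b k - x)" by (intro mult_mono) auto
      have n1: "1 + cmod s \<le> 9 + x + 4 * x^2" unfolding x_def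

      proof (rule ns[of s k])
        have "(real k + 1/2) * pi = real k * pi + pi/2" "(real k + 1) * pi = real k * pi + pi" "0 \<le> real k * pi"
          by (simp_all add: distrib_right)
        then show "\<bar>Im s\<bar> \<le> (real k + 1) * pi + 1" using s'(2) pi_gt3 by linarith
      qed (use sq X1 in \<open>auto simp: x_def\<close>)
      have p: "0 < (1 + cmod s)^2" by (smt (verit) norm_ge_zero zero_less_power)
      have "exp (- (x^2) - x) / (9 + x + 4 * x^2)^2 \<le> ((1/2)^k * exp (b k - x)) / (1 + cmod s)^2"
        using 1 n1 p by (intro frac_le power_mono) (auto simp: exp_diff exp_minus field_simps)
      then show ?thesis unfolding weight_def x_def by (intro mult_left_mono) auto
    qed
    finally show "cmod (hlog k (h k) ?w) \<le> (1/10^10) * weight b k s" .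
  qed auto
  obtain R where R: "regular (3/4) R" "size_le (3/4) (1/4) (1/4) R"
    "\<And>k s. s \<in> overlap b (3/4) k \<Longrightarrow> R (Suc k) s = R k s + hlog k (h k) (exp s + R k s)"
    by (rule gluing_solution) auto
  have nz: "h k (hexp k (exp s + R k s)) \<noteq> 0" if s: "s \<in> overlap b (3/4) k" for k s
  proof -
    have s1: "s \<in> overlap b 1 k" using s overlap_mono[of "3/4" 1] by auto
    have "s \<in> patch b (3/4) k" using overlap_subset_patch(1)[OF mono_b, of "3/4" k] s by auto
    then have "cmod (R k s) \<le> 1/4" using R(2) unfolding size_le_def by blast
    then have z: "cmod (R k s) \<le> 1" by linarith
    define x where "x = Re s"
    have s': "b k - 1 < x" "\<bar>Im s - (real k + 1/2) * pi\<bar> < 1" using s1 by (auto simp: overlap_def x_def)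
    note sq = sq[OF s'(1)]
    note Xx = X[OF sq(4)]
    let ?w = "exp s + R k s"
    have t: "cmod (hexp k ?w) \<le> exp (7 - 3 * exp x)"
      unfolding x_def using norm_hexp_overlap[of s "int k"] s'(2) z by simp
    also have "\<dots> < K1 * exp (- K * exp (x/2))" using Xx by blast
    also have "\<dots> \<le> K1 * exp (- K * exp (C * sqrt (real k)))" using gr sq(3) by simp
    also have "\<dots> \<le> \<sigma> k" by (rule gr(4))
    finally have t\<sigma>: "cmod (hexp k ?w) < \<sigma> k" .
    have dt: "d * cmod (hexp k ?w) \<le> d * exp (7 - 3 * exp x)" using t d by (intro mult_left_mono) auto
    then have dt2: "d * cmod (hexp k ?w) \<le> 1/2" using Xx by linarith
    have hb: "cmod (h k (hexp k ?w) - hexp k ?w) \<le> d * (cmod (hexp k ?w))^2" using d(2) t\<sigma> by simp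
    show ?thesis by (rule hlog_small(1)[where h = "h k" and k = "int k" and w = ?w, OF hb less_imp_le[OF d(1)] dt2])
  qed
  show ?thesis
    by (rule exI[of _ A], rule exI[of _ B], rule exI[of _ R], fold b_def)
       (use R AB nz in \<open>simp add: regular_def size_le_def\<close>)
qed

section \<open>The model Fatou coordinate\<close>

definition parabolic_dom :: "real \<Rightarrow> complex set" where
  "parabolic_dom X = {\<zeta>. X < Re \<zeta> \<and> \<bar>Im \<zeta>\<bar> < (Re \<zeta>)^2}"

text \<open>Its reciprocal is z ell^m, the leading displacement of the lift: f(z) = z (1 - z ell^m +
  ...) becomes F \<zeta> = \<zeta> + 1 / \<open>expo m \<zeta>\<close> + ... .\<close>

definition expo :: "int \<Rightarrow> complex \<Rightarrow> complex" where
  "expo m \<zeta> = exp (\<zeta> + of_int m * Ln \<zeta>)"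

lemma open_parabolic_dom: "open (parabolic_dom X)"
  unfolding parabolic_dom_def by (intro open_Collect_conj open_Collect_less continuous_intros)

lemma parabolic_dom_mono: "X \<le> Y \<Longrightarrow> parabolic_dom Y \<subseteq> parabolic_dom X"
  by (auto simp: parabolic_dom_def)

lemma norm_parabolic_dom:
  assumes "\<zeta> \<in> parabolic_dom X" "1 \<le> X"
  shows "1 \<le> Re \<zeta>" "1 \<le> cmod \<zeta>" "cmod \<zeta> \<le> 2 * (Re \<zeta>)^2" "\<zeta> \<noteq> 0" "\<zeta> \<notin> \<real>\<^sub>\<le>\<^sub>0"
proof -
  show 1: "1 \<le> Re \<zeta>" using assms by (simp add: parabolic_dom_def)
  then show "1 \<le> cmod \<zeta>" using abs_Re_le_cmod[of \<zeta>] by linarith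
  have "Re \<zeta> \<le> (Re \<zeta>)^2" using 1 by (simp add: power2_eq_square)
  then show "cmod \<zeta> \<le> 2 * (Re \<zeta>)^2" using cmod_le[of \<zeta>] assms 1 by (simp add: parabolic_dom_def)
  show "\<zeta> \<noteq> 0" using 1 by auto
  show "\<zeta> \<notin> \<real>\<^sub>\<le>\<^sub>0" using 1 by (auto simp: complex_nonpos_Reals_iff)
qed

lemma norm_expo: "\<zeta> \<noteq> 0 \<Longrightarrow> cmod (expo m \<zeta>) = exp (Re \<zeta> + real_of_int m * ln (cmod \<zeta>))"
  by (simp add: expo_def norm_exp_eq_Re)

lemma expo_nz [simp]: "expo m \<zeta> \<noteq> 0" by (simp add: expo_def)

lemma expo_powi: "\<zeta> \<noteq> 0 \<Longrightarrow> expo m \<zeta> = exp \<zeta> * \<zeta> powi m"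
  by (simp add: expo_def exp_add exp_power_int[symmetric] mult.commute)

lemma expo_deriv:
  assumes "\<zeta> \<notin> \<real>\<^sub>\<le>\<^sub>0"
  shows "(expo m has_field_derivative expo m \<zeta> * (1 + of_int m / \<zeta>)) (at \<zeta>)"
proof -
  have "((\<lambda>\<zeta>. \<zeta> + of_int m * Ln \<zeta>) has_field_derivative (1 + of_int m / \<zeta>)) (at \<zeta>)"
    using assms by (auto intro!: derivative_eq_intros simp: divide_inverse)
  then show ?thesis unfolding expo_def[abs_def] by (rule DERIV_chain2[OF DERIV_exp])
qed

lemma expo_cnj: "\<zeta> \<notin> \<real>\<^sub>\<le>\<^sub>0 \<Longrightarrow> expo m (cnj \<zeta>) = cnj (expo m \<zeta>)"
  by (simp add: expo_def cnj_Ln exp_cnj)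

text \<open>On the parabolic domain ln |\<zeta>| is at most ln (2 (Re \<zeta>)^2), so even a
  negative power of \<zeta> costs less than half of the exponent Re \<zeta>.\<close>

lemma expo_lower_bound:
  obtains X where "1 \<le> X" "\<And>\<zeta>. \<zeta> \<in> parabolic_dom X \<Longrightarrow> exp (Re \<zeta> / 2) \<le> cmod (expo m \<zeta>)"
proof -
  define M where "M = \<bar>real_of_int m\<bar>"
  have "\<forall>\<^sub>F x::real in at_top. M * ln (2 * x^2) \<le> x / 2 \<and> 1 \<le> x" by (intro eventually_conj) real_asymp+
  then obtain X where X: "\<And>x. X \<le> x \<Longrightarrow> M * ln (2 * x^2) \<le> x / 2 \<and> 1 \<le> x"
    unfolding eventually_at_top_linorder by blast
  have X1: "1 \<le> X" using X[of X] by simp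
  show thesis
  proof (rule that[OF X1])
    fix \<zeta> assume z: "\<zeta> \<in> parabolic_dom X"
    note n = norm_parabolic_dom[OF z X1]
    have l: "0 \<le> ln (cmod \<zeta>)" "ln (cmod \<zeta>) \<le> ln (2 * (Re \<zeta>)^2)" using n by (auto simp: ln_ge_zero)
    have "- (M * ln (cmod \<zeta>)) \<le> real_of_int m * ln (cmod \<zeta>)"
      using mult_right_mono[of "- M" "real_of_int m" "ln (cmod \<zeta>)"] l by (simp add: M_def)
    moreover have "M * ln (cmod \<zeta>) \<le> M * ln (2 * (Re \<zeta>)^2)" using l by (intro mult_left_mono) (auto simp: M_def)
    moreover have "M * ln (2 * (Re \<zeta>)^2) \<le> Re \<zeta> / 2" using X[of "Re \<zeta>"] z by (simp add: parabolic_dom_def)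
    ultimately have "Re \<zeta> / 2 \<le> Re \<zeta> + real_of_int m * ln (cmod \<zeta>)" by linarith
    then show "exp (Re \<zeta> / 2) \<le> cmod (expo m \<zeta>)" using norm_expo[OF n(4)] by simp
  qed
qed

lemma expo_primitive:
  obtains P where "\<And>\<zeta>. 0 < Re \<zeta> \<Longrightarrow> (P has_field_derivative expo m \<zeta>) (at \<zeta>)"
    "\<And>\<zeta>. 0 < Re \<zeta> \<Longrightarrow> P (cnj \<zeta>) = cnj (P \<zeta>)"
proof -
  let ?H = "{\<zeta>::complex. 0 < Re \<zeta>}"
  have nr: "\<zeta> \<notin> \<real>\<^sub>\<le>\<^sub>0" if "0 < Re \<zeta>" for \<zeta> using that by (auto simp: complex_nonpos_Reals_iff)
  have op: "open ?H" by (rule open_halfspace_Re_gt)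
  have "expo m holomorphic_on ?H"
    using expo_deriv nr op by (auto simp: holomorphic_on_open)
  then obtain g where g: "\<And>\<zeta>. \<zeta> \<in> ?H \<Longrightarrow> (g has_field_derivative expo m \<zeta>) (at \<zeta> within ?H)"
    using holomorphic_convex_primitive'[OF convex_halfspace_Re_gt op] by blast
  have g': "(g has_field_derivative expo m \<zeta>) (at \<zeta>)" if "0 < Re \<zeta>" for \<zeta>
  proof -
    have z: "\<zeta> \<in> ?H" using that by simp
    from g[OF z] show ?thesis unfolding at_within_open[OF z op] .
  qed
  have g'': "((\<lambda>\<zeta>. cnj (g (cnj \<zeta>))) has_field_derivative expo m \<zeta>) (at \<zeta>)" if "0 < Re \<zeta>" for \<zeta>
  proof -
    have "(g has_field_derivative expo m (cnj \<zeta>)) (at (cnj \<zeta>))" using g'[of "cnj \<zeta>"] that by simp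
    then have "(cnj \<circ> g \<circ> cnj has_field_derivative cnj (expo m (cnj \<zeta>))) (at \<zeta>)"
      using has_field_derivative_cnj_cnj[of g "expo m (cnj \<zeta>)" \<zeta>] by simp
    then show ?thesis using expo_cnj[OF nr[OF that]] by (simp add: o_def)
  qed
  show thesis
  \<comment> \<open>Averaging with the reflection keeps the derivative, because
    \<open>expo m\<close> commutes with conjugation, and makes the primitive symmetric.\<close>
  proof (rule that[of "\<lambda>\<zeta>. (g \<zeta> + cnj (g (cnj \<zeta>))) / 2"])
    show "((\<lambda>\<zeta>. (g \<zeta> + cnj (g (cnj \<zeta>))) / 2) has_field_derivative expo m \<zeta>) (at \<zeta>)" if "0 < Re \<zeta>" for \<zeta>
      using DERIV_cdivide[OF DERIV_add[OF g'[OF that] g''[OF that]], of 2] by simp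
  qed (simp add: add.commute)
qed

text \<open>The difference P - \<open>expo m\<close> has derivative - (m/\<zeta>)
  \<open>expo m\<close>. On a vertical line the exponential has constant modulus, so the difference
  grows only polynomially in y. This is the first leg of an integration path that then continues
  horizontally.\<close>

lemma expo_primitive_vertical:
  assumes P: "\<And>\<zeta>. 0 < Re \<zeta> \<Longrightarrow> (P has_field_derivative expo m \<zeta>) (at \<zeta>)" and X: "1 \<le> X"
  shows "cmod (P (Complex X y) - expo m (Complex X y)) \<le>
    cmod (P (Complex X 0) - expo m (Complex X 0)) + \<bar>real_of_int m\<bar> * exp X * (X + \<bar>y\<bar>) powr (\<bar>real_of_int m\<bar> + 1)"
proof -
  let ?Q = "\<lambda>\<zeta>. P \<zeta> - expo m \<zeta>" and ?M = "\<bar>real_of_int m\<bar>"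
  let ?S = "closed_segment (Complex X 0) (Complex X y)"
  have S: "Re z = X \<and> \<bar>Im z\<bar> \<le> \<bar>y\<bar>" if zS: "z \<in> ?S" for z
  proof -
    obtain u where u: "0 \<le> u" "u \<le> 1" "z = (1 - u) *\<^sub>R Complex X 0 + u *\<^sub>R Complex X y" using zS by (auto simp: in_segment)
    have "Re z = X" "Im z = u * y" by (simp_all add: u(3) algebra_simps)
    then show ?thesis using u mult_left_le_one_le[of "\<bar>y\<bar>" u] by (simp add: abs_mult)
  qed
  have "cmod (?Q (Complex X y) - ?Q (Complex X 0)) \<le> (?M * exp X * (X + \<bar>y\<bar>) powr ?M) * cmod (Complex X y - Complex X 0)"
  proof (rule field_differentiable_bound[of ?S])
    fix z assume "z \<in> ?S"
    note S = S[OF this]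
    have z: "0 < Re z" "z \<notin> \<real>\<^sub>\<le>\<^sub>0" "z \<noteq> 0" using S X by (auto simp: complex_nonpos_Reals_iff)
    show "(?Q has_field_derivative (expo m z - expo m z * (1 + of_int m / z))) (at z within ?S)"
      by (rule has_field_derivative_at_within[OF DERIV_diff[OF P[OF z(1)] expo_deriv[OF z(2)]]])
    have n: "1 \<le> cmod z" "cmod z \<le> X + \<bar>y\<bar>" using abs_Re_le_cmod[of z] cmod_le[of z] S X by auto
    have "cmod (expo m z - expo m z * (1 + of_int m / z)) = cmod (expo m z) * (?M / cmod z)"
      by (simp add: algebra_simps norm_mult norm_divide)
    also have "\<dots> \<le> (exp X * (X + \<bar>y\<bar>) powr ?M) * ?M"
    proof (intro mult_mono)
      have "real_of_int m * ln (cmod z) \<le> ?M * ln (cmod z)" using n by (intro mult_right_mono) auto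
      also have "\<dots> \<le> ?M * ln (X + \<bar>y\<bar>)"
      proof (rule mult_left_mono)
        have "0 < cmod z" "0 < X + \<bar>y\<bar>" using n X by linarith+
        then show "ln (cmod z) \<le> ln (X + \<bar>y\<bar>)" using n(2) by simp
      qed simp
      finally have "exp (Re z + real_of_int m * ln (cmod z)) \<le> exp (X + ?M * ln (X + \<bar>y\<bar>))" using S by simp
      then show "cmod (expo m z) \<le> exp X * (X + \<bar>y\<bar>) powr ?M"
        using X by (simp add: norm_expo[OF z(3)] exp_add powr_def)
      show "?M / cmod z \<le> ?M" using n by (simp add: divide_le_eq mult_le_cancel_left1)
    qed auto
    finally show "cmod (expo m z - expo m z * (1 + of_int m / z)) \<le> ?M * exp X * (X + \<bar>y\<bar>) powr ?M" by (simp add: mult_ac)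
  qed auto
  also have "\<dots> \<le> (?M * exp X * (X + \<bar>y\<bar>) powr ?M) * (X + \<bar>y\<bar>)"
  proof (rule mult_left_mono)
    have "Complex X y - Complex X 0 = Complex 0 y" by (simp add: complex_eq_iff)
    then show "cmod (Complex X y - Complex X 0) \<le> X + \<bar>y\<bar>" using X by (simp add: cmod_eq_Im)
  qed simp
  also have "\<dots> = ?M * exp X * (X + \<bar>y\<bar>) powr (?M + 1)" using X by (simp add: powr_add)
  finally show ?thesis using norm_triangle_ineq2[of "?Q (Complex X y)" "?Q (Complex X 0)"] by linarith
qed

text \<open>Along a horizontal line the derivative of P - \<open>expo m\<close> has modulus |m|
  g(u), where g = |\<open>expo m\<close> / \<zeta>|. Since g' \<ge> g / 2 for large u, the function
  2 |m| g majorises its integral, which is the gain 1/|\<zeta>| over \<open>expo m\<close>.\<close>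

lemma expo_primitive_horizontal:
  assumes P: "\<And>\<zeta>. 0 < Re \<zeta> \<Longrightarrow> (P has_field_derivative expo m \<zeta>) (at \<zeta>)"
    and X: "2 * \<bar>real_of_int m\<bar> + 2 \<le> X" "X < x"
  shows "cmod (P (Complex x y) - expo m (Complex x y)) \<le>
    cmod (P (Complex X y) - expo m (Complex X y)) + 2 * \<bar>real_of_int m\<bar> * cmod (expo m (Complex x y)) / cmod (Complex x y)"
proof -
  let ?Q = "\<lambda>\<zeta>. P \<zeta> - expo m \<zeta>" and ?M = "\<bar>real_of_int m\<bar>"
  define g where "g u = exp (u + (real_of_int m - 1) * (ln (u^2 + y^2) / 2))" for u
  have ng: "g u = cmod (expo m (Complex u y)) / cmod (Complex u y)" if "0 < u" for u
  proof -
    have nz: "Complex u y \<noteq> 0" "0 < cmod (Complex u y)" using that by (auto simp: complex_eq_iff)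
    have p: "0 < u^2 + y^2" using that by (simp add: add_pos_nonneg)
    have "ln (u^2 + y^2) / 2 = ln (cmod (Complex u y))" using p by (simp add: cmod_def ln_sqrt)
    then have "g u = exp (u + real_of_int m * ln (cmod (Complex u y)) - ln (cmod (Complex u y)))"
      by (simp add: g_def algebra_simps)
    then show ?thesis using nz by (simp add: norm_expo exp_diff)
  qed
  have "cmod (?Q (Complex x y) - ?Q (Complex X y)) \<le> 2 * ?M * g x - 2 * ?M * g X"
  proof (rule differentiable_bound_general[where f = "\<lambda>u. ?Q (Complex u y)" and \<phi> = "\<lambda>u. 2 * ?M * g u"
      and f' = "\<lambda>u. expo m (Complex u y) - expo m (Complex u y) * (1 + of_int m / Complex u y)"
      and \<phi>' = "\<lambda>u. 2 * ?M * (g u * (1 + (real_of_int m - 1) * (u / (u^2 + y^2))))"])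
    have dQ: "((\<lambda>u. ?Q (Complex u y)) has_vector_derivative (expo m (Complex u y) - expo m (Complex u y) * (1 + of_int m / Complex u y))) (at u)"
      if "X \<le> u" for u
    proof -
      have z: "0 < Re (Complex u y)" "Complex u y \<notin> \<real>\<^sub>\<le>\<^sub>0" using that X by (auto simp: complex_nonpos_Reals_iff)
      have "((\<lambda>u. Complex u y) has_vector_derivative 1) (at u)"
        unfolding Complex_eq by (auto intro!: derivative_eq_intros has_vector_derivative_real_field)
      from field_vector_diff_chain_at[OF this DERIV_diff[OF P[OF z(1)] expo_deriv[OF z(2)]]]
      show ?thesis by (simp add: o_def)
    qed
    have dg: "(g has_real_derivative g u * (1 + (real_of_int m - 1) * (u / (u^2 + y^2)))) (at u)" if "X \<le> u" for u
    proof -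
      have p: "0 < u^2 + y^2" using that X by (simp add: add_pos_nonneg)
      have "((\<lambda>u. u^2 + y^2) has_real_derivative 2 * u) (at u)" by (auto intro!: derivative_eq_intros)
      from DERIV_cdivide[OF DERIV_chain2[OF DERIV_ln_divide[OF p] this], of 2]
      moreover have "1 / c * (2 * u) / 2 = u / c" for c :: real by simp
      ultimately have "((\<lambda>u. ln (u^2 + y^2) / 2) has_real_derivative u / (u^2 + y^2)) (at u)" by (simp only:)
      from DERIV_chain2[OF DERIV_exp DERIV_add[OF DERIV_ident DERIV_cmult[OF this, of "real_of_int m - 1"]]]
      show ?thesis unfolding g_def[abs_def] .
    qed
    show "continuous_on {X..x} (\<lambda>u. ?Q (Complex u y))"
      by (intro continuous_at_imp_continuous_on ballI has_vector_derivative_continuous[OF dQ]) auto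
    show "continuous_on {X..x} (\<lambda>u. 2 * ?M * g u)"
      by (intro continuous_on_mult_left continuous_at_imp_continuous_on ballI DERIV_isCont[OF dg]) auto
    fix u assume u: "X < u" "u < x"
    show "((\<lambda>u. ?Q (Complex u y)) has_vector_derivative (expo m (Complex u y) - expo m (Complex u y) * (1 + of_int m / Complex u y))) (at u)"
      using dQ u by simp
    show "((\<lambda>u. 2 * ?M * g u) has_vector_derivative 2 * ?M * (g u * (1 + (real_of_int m - 1) * (u / (u^2 + y^2))))) (at u)"
      using DERIV_cmult[OF dg[of u], of "2 * ?M"] u by (simp add: has_real_derivative_iff_has_vector_derivative)
    have u0: "0 < u" using u X by linarith
    have "cmod (expo m (Complex u y) - expo m (Complex u y) * (1 + of_int m / Complex u y)) = ?M * g u"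
      unfolding ng[OF u0] by (simp add: algebra_simps norm_mult norm_divide)
    also have "\<dots> \<le> 2 * ?M * (g u * (1 + (real_of_int m - 1) * (u / (u^2 + y^2))))"
    proof -
      have "u / (u^2 + y^2) \<le> u / u^2" using u0 by (intro divide_left_mono) (auto simp: add_pos_nonneg)
      then have "u / (u^2 + y^2) \<le> 1 / u" using u0 by (simp add: power2_eq_square)
      then have "(?M + 1) * (u / (u^2 + y^2)) \<le> (?M + 1) * (1 / u)" by (intro mult_left_mono) auto
      also have "\<dots> \<le> 1/2" using u X u0 by (simp add: field_simps)
      finally have "(?M + 1) * (u / (u^2 + y^2)) \<le> 1/2" .
      moreover have "- (?M + 1) * (u / (u^2 + y^2)) \<le> (real_of_int m - 1) * (u / (u^2 + y^2))"
        using u0 by (intro mult_right_mono) auto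
      ultimately have "1/2 \<le> 1 + (real_of_int m - 1) * (u / (u^2 + y^2))" unfolding mult_minus_left by linarith
      then have "2 * ?M * (g u * (1/2)) \<le> 2 * ?M * (g u * (1 + (real_of_int m - 1) * (u / (u^2 + y^2))))"
        by (intro mult_left_mono) (auto simp: g_def)
      then show ?thesis by simp
    qed
    finally show "cmod (expo m (Complex u y) - expo m (Complex u y) * (1 + of_int m / Complex u y)) \<le>
      2 * ?M * (g u * (1 + (real_of_int m - 1) * (u / (u^2 + y^2))))" .
  qed (use X in auto)
  moreover have "0 \<le> 2 * ?M * g X" by (simp add: g_def)
  moreover have "2 * ?M * g x = 2 * ?M * cmod (expo m (Complex x y)) / cmod (Complex x y)"
    using X by (subst ng) auto
  ultimately show ?thesis using norm_triangle_ineq2[of "?Q (Complex x y)" "?Q (Complex X y)"] by linarith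
qed

text \<open>The primitive of \<open>expo m\<close> equals \<open>expo m\<close> up to a relative
  error O(1 / Re \<zeta>). The vertical leg and the terms \<zeta> + \<kappa> Ln \<zeta> are
  polynomially bounded in Re \<zeta>, because |Im \<zeta>| < (Re \<zeta>)^2, and are swallowed by
  exp(Re \<zeta> / 2).\<close>

lemma fatou_model:
  obtains X K Psi where "1 \<le> X" "0 \<le> K"
    "\<And>\<zeta>. \<zeta> \<in> parabolic_dom X \<Longrightarrow> (Psi has_field_derivative (expo m \<zeta> - 1 - of_real \<kappa> / \<zeta>)) (at \<zeta>)"
    "\<And>\<zeta>. \<zeta> \<in> parabolic_dom X \<Longrightarrow> cmod (Psi \<zeta> / expo m \<zeta> - 1) \<le> K / Re \<zeta>"
    "\<And>\<zeta>. \<zeta> \<in> parabolic_dom X \<Longrightarrow> cmod ((1 + of_real \<kappa> / \<zeta>) / expo m \<zeta>) \<le> K / Re \<zeta>"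
    "\<And>\<zeta>. \<zeta> \<in> parabolic_dom X \<Longrightarrow> Psi (cnj \<zeta>) = cnj (Psi \<zeta>)"
proof -
  define M where "M = \<bar>real_of_int m\<bar>"
  define X0 where "X0 = 2 * M + 2"
  obtain P where P: "\<And>\<zeta>. 0 < Re \<zeta> \<Longrightarrow> (P has_field_derivative expo m \<zeta>) (at \<zeta>)"
    "\<And>\<zeta>. 0 < Re \<zeta> \<Longrightarrow> P (cnj \<zeta>) = cnj (P \<zeta>)"
    by (rule expo_primitive[of m]) (rule that; assumption)
  obtain X1 where X1: "1 \<le> X1" "\<And>\<zeta>. \<zeta> \<in> parabolic_dom X1 \<Longrightarrow> exp (Re \<zeta> / 2) \<le> cmod (expo m \<zeta>)"
    by (rule expo_lower_bound[of m]) (rule that; assumption)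
  define c0 where "c0 = cmod (P (Complex X0 0) - expo m (Complex X0 0))"
  have M0: "0 \<le> M" by (simp add: M_def)
  have "\<forall>\<^sub>F x::real in at_top. c0 + M * exp X0 * (X0 + x^2) powr (M + 1) \<le> exp (x/2) / x \<and>
     (1 + \<bar>\<kappa>\<bar>) * (2 * x^2 + 4) \<le> exp (x/2) / x \<and> 1 + \<bar>\<kappa>\<bar> \<le> exp (x/2) / x \<and> X0 < x \<and> X1 < x \<and> 1 \<le> x"
    using M0 by (intro eventually_conj) real_asymp+
  then obtain X where X: "\<And>x. X \<le> x \<Longrightarrow> c0 + M * exp X0 * (X0 + x^2) powr (M + 1) \<le> exp (x/2) / x \<and>
     (1 + \<bar>\<kappa>\<bar>) * (2 * x^2 + 4) \<le> exp (x/2) / x \<and> 1 + \<bar>\<kappa>\<bar> \<le> exp (x/2) / x \<and> X0 < x \<and> X1 < x \<and> 1 \<le> x"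
    unfolding eventually_at_top_linorder by blast
  have XX: "1 \<le> X" "X1 \<le> X" "X0 \<le> X" using X[of X] by auto
  define K where "K = 2 + 2 * M"
  define Psi where "Psi \<zeta> = P \<zeta> - \<zeta> - of_real \<kappa> * Ln \<zeta>" for \<zeta>
  have basic: "0 < Re \<zeta>" "\<zeta> \<notin> \<real>\<^sub>\<le>\<^sub>0" "\<zeta> \<noteq> 0" "exp (Re \<zeta> / 2) \<le> cmod (expo m \<zeta>)" "X \<le> Re \<zeta>" if "\<zeta> \<in> parabolic_dom X" for \<zeta>
    using norm_parabolic_dom[OF that XX(1)] X1(2)[of \<zeta>] parabolic_dom_mono[OF XX(2)] that by (auto simp: parabolic_dom_def)
  show thesis
  proof (rule that[of X K Psi])
    show "1 \<le> X" "0 \<le> K" using XX M0 by (auto simp: K_def)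
    fix \<zeta> assume z: "\<zeta> \<in> parabolic_dom X"
    note bz = basic[OF z] and nz = norm_parabolic_dom[OF z XX(1)]
    define x where "x = Re \<zeta>"
    define p where "p = cmod (expo m \<zeta>)"
    note Xx = X[OF bz(5), folded x_def]
    have x: "0 < x" using bz by (simp add: x_def)
    have p: "0 < p" "exp (x/2) \<le> p" using bz by (auto simp: p_def x_def)
    have px: "exp (x/2) / x \<le> p / x" using p x by (intro divide_right_mono) auto
    show "(Psi has_field_derivative (expo m \<zeta> - 1 - of_real \<kappa> / \<zeta>)) (at \<zeta>)"
    proof -
      have "(Ln has_field_derivative inverse \<zeta>) (at \<zeta>)" using bz(2) by (rule has_field_derivative_Ln)
      from DERIV_diff[OF DERIV_diff[OF P(1)[OF bz(1)] DERIV_ident] DERIV_cmult[OF this, of "of_real \<kappa>"]]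
      show ?thesis unfolding Psi_def[abs_def] by (simp add: divide_inverse)
    qed
    show "Psi (cnj \<zeta>) = cnj (Psi \<zeta>)" using P(2)[OF bz(1)] bz(2) by (simp add: Psi_def cnj_Ln)
    show "cmod ((1 + of_real \<kappa> / \<zeta>) / expo m \<zeta>) \<le> K / Re \<zeta>"
    proof -
      have "cmod (of_real \<kappa> / \<zeta>) \<le> \<bar>\<kappa>\<bar>" using nz(2) by (simp add: norm_divide divide_le_eq mult_le_cancel_left1)
      then have "cmod (1 + of_real \<kappa> / \<zeta>) \<le> 1 + \<bar>\<kappa>\<bar>" using norm_triangle_ineq[of 1 "of_real \<kappa> / \<zeta>"] by simp
      also have "\<dots> \<le> p / x" using Xx px by linarith
      finally have "cmod (1 + of_real \<kappa> / \<zeta>) / p \<le> 1 / x" using p x by (simp add: field_simps)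
      also have "\<dots> \<le> K / x" using x M0 by (intro divide_right_mono) (auto simp: K_def)
      finally show ?thesis by (simp add: norm_divide p_def x_def)
    qed
    show "cmod (Psi \<zeta> / expo m \<zeta> - 1) \<le> K / Re \<zeta>"
    proof -
      define y where "y = Im \<zeta>"
      have zz: "\<zeta> = Complex x y" by (simp add: x_def y_def)
      have y: "\<bar>y\<bar> \<le> x^2" using z by (simp add: parabolic_dom_def x_def y_def)
      have X0: "2 * \<bar>real_of_int m\<bar> + 2 \<le> X0" "X0 < x" "1 \<le> X0" using Xx M0 by (auto simp: X0_def M_def)
      have v: "cmod (P (Complex X0 y) - expo m (Complex X0 y)) \<le> c0 + M * exp X0 * (X0 + \<bar>y\<bar>) powr (M + 1)"
        using expo_primitive_vertical[OF P(1) X0(3)] by (simp add: c0_def M_def)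
      have "(X0 + \<bar>y\<bar>) powr (M + 1) \<le> (X0 + x^2) powr (M + 1)" using y X0 M0 by (intro powr_mono2) auto
      then have "M * exp X0 * (X0 + \<bar>y\<bar>) powr (M + 1) \<le> M * exp X0 * (X0 + x^2) powr (M + 1)"
        using M0 by (intro mult_left_mono) auto
      then have v': "cmod (P (Complex X0 y) - expo m (Complex X0 y)) \<le> p / x" using v Xx px by linarith
      have "cmod (P \<zeta> - expo m \<zeta>) \<le> p / x + 2 * M * p / cmod \<zeta>"
        using expo_primitive_horizontal[OF P(1) X0(1,2), of y] v' by (simp add: zz[symmetric] M_def p_def)
      also have "2 * M * p / cmod \<zeta> \<le> 2 * M * p / x"
        using M0 p x abs_Re_le_cmod[of \<zeta>] nz(2) by (intro divide_left_mono mult_pos_pos) (auto simp: x_def)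
      finally have 1: "cmod (P \<zeta> - expo m \<zeta>) \<le> p / x + 2 * M * p / x" by simp
      have L: "cmod (Ln \<zeta>) \<le> cmod \<zeta> + 4"
      proof -
        have "\<bar>ln (cmod \<zeta>)\<bar> \<le> cmod \<zeta>" using nz(2) bz(3) ln_le_minus_one[of "cmod \<zeta>"] by (simp add: ln_ge_zero)
        moreover have "\<bar>Im (Ln \<zeta>)\<bar> \<le> 4" using mpi_less_Im_Ln[OF bz(3)] Im_Ln_le_pi[OF bz(3)] pi_less_4 by auto
        ultimately show ?thesis using cmod_le[of "Ln \<zeta>"] bz(3) by simp
      qed
      have "cmod (\<zeta> + of_real \<kappa> * Ln \<zeta>) \<le> cmod \<zeta> + \<bar>\<kappa>\<bar> * cmod (Ln \<zeta>)"
        using norm_triangle_ineq[of \<zeta> "of_real \<kappa> * Ln \<zeta>"] by (simp add: norm_mult)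
      also have "\<dots> \<le> (2 * x^2 + 4) + \<bar>\<kappa>\<bar> * (2 * x^2 + 4)"
        using L nz(3) by (intro add_mono mult_left_mono) (auto simp: x_def)
      also have "\<dots> = (1 + \<bar>\<kappa>\<bar>) * (2 * x^2 + 4)" by (simp add: algebra_simps)
      also have "\<dots> \<le> p / x" using Xx px by linarith
      finally have 2: "cmod (\<zeta> + of_real \<kappa> * Ln \<zeta>) \<le> p / x" .
      have "Psi \<zeta> / expo m \<zeta> - 1 = ((P \<zeta> - expo m \<zeta>) - (\<zeta> + of_real \<kappa> * Ln \<zeta>)) / expo m \<zeta>"
        by (simp add: Psi_def field_simps)
      then have "cmod (Psi \<zeta> / expo m \<zeta> - 1) = cmod ((P \<zeta> - expo m \<zeta>) - (\<zeta> + of_real \<kappa> * Ln \<zeta>)) / p"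
        by (simp add: norm_divide p_def)
      also have "\<dots> \<le> ((p / x + 2 * M * p / x) + p / x) / p"
        using p by (intro divide_right_mono order_trans[OF norm_triangle_ineq4 add_mono[OF 1 2]]) auto
      also have "\<dots> = K / x" using p x by (simp add: K_def field_simps)
      finally show ?thesis by (simp add: x_def)
    qed
  qed
qed

text \<open>The logarithm of \<open>Psi\<close> is formed as \<zeta> + m Ln \<zeta> plus the
  principal logarithm of \<open>Psi\<close> / \<open>expo m\<close>. The quotient is near 1, so no
  branch cut is met although the imaginary part of \<open>sg\<close> is unbounded.\<close>

lemma log_coordinate:
  obtains X K Psi sg where "1 \<le> X" "0 \<le> K" "8 * K \<le> X"
    "\<And>\<zeta>. \<zeta> \<in> parabolic_dom X \<Longrightarrow> (Psi has_field_derivative (expo m \<zeta> - 1 - of_real \<kappa> / \<zeta>)) (at \<zeta>)"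
    "\<And>\<zeta>. \<zeta> \<in> parabolic_dom X \<Longrightarrow> exp (sg \<zeta>) = Psi \<zeta>"
    "\<And>\<zeta>. \<zeta> \<in> parabolic_dom X \<Longrightarrow> (sg has_field_derivative deriv sg \<zeta>) (at \<zeta>)"
    "\<And>\<zeta>. \<zeta> \<in> parabolic_dom X \<Longrightarrow> cmod (deriv sg \<zeta> - 1) \<le> K / Re \<zeta>"
    "\<And>\<zeta>. \<zeta> \<in> parabolic_dom X \<Longrightarrow> cmod (sg \<zeta> - (\<zeta> + of_int m * Ln \<zeta>)) \<le> K / Re \<zeta>"
    "\<And>\<zeta>. \<zeta> \<in> parabolic_dom X \<Longrightarrow> sg (cnj \<zeta>) = cnj (sg \<zeta>)"
proof -
  obtain X0 K0 Psi where X0: "1 \<le> X0" "0 \<le> K0"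
    and dPsi: "\<And>\<zeta>. \<zeta> \<in> parabolic_dom X0 \<Longrightarrow> (Psi has_field_derivative (expo m \<zeta> - 1 - of_real \<kappa> / \<zeta>)) (at \<zeta>)"
    and q: "\<And>\<zeta>. \<zeta> \<in> parabolic_dom X0 \<Longrightarrow> cmod (Psi \<zeta> / expo m \<zeta> - 1) \<le> K0 / Re \<zeta>"
    and q': "\<And>\<zeta>. \<zeta> \<in> parabolic_dom X0 \<Longrightarrow> cmod ((1 + of_real \<kappa> / \<zeta>) / expo m \<zeta>) \<le> K0 / Re \<zeta>"
    and Psi_cnj: "\<And>\<zeta>. \<zeta> \<in> parabolic_dom X0 \<Longrightarrow> Psi (cnj \<zeta>) = cnj (Psi \<zeta>)"
    using fatou_model[of m \<kappa>] by metis
  \<comment> \<open>The final constant is K = 4 K0, and 32 K0 = 8 K; later this bounds the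
    derivative error of \<open>sg\<close> by 1/8.\<close>
  define X where "X = X0 + 32 * K0"
  define sg where "sg \<zeta> = \<zeta> + of_int m * Ln \<zeta> + Ln (Psi \<zeta> / expo m \<zeta>)" for \<zeta>
  have sub: "parabolic_dom X \<subseteq> parabolic_dom X0" using X0 by (intro parabolic_dom_mono) (simp add: X_def)
  have bz: "0 < Re \<zeta>" "\<zeta> \<notin> \<real>\<^sub>\<le>\<^sub>0" "\<zeta> \<noteq> 0" "K0 / Re \<zeta> \<le> 1/2" "cmod (Psi \<zeta> / expo m \<zeta> - 1) \<le> K0 / Re \<zeta>"
    if "\<zeta> \<in> parabolic_dom X" for \<zeta>
  proof -
    have z0: "\<zeta> \<in> parabolic_dom X0" using sub that by blast
    show a: "0 < Re \<zeta>" "\<zeta> \<notin> \<real>\<^sub>\<le>\<^sub>0" "\<zeta> \<noteq> 0" using norm_parabolic_dom[OF z0 X0(1)] by auto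
    have "X \<le> Re \<zeta>" using that by (simp add: parabolic_dom_def)
    then have "2 * K0 \<le> Re \<zeta>" using X0 by (simp add: X_def)
    then show "K0 / Re \<zeta> \<le> 1/2" using a(1) by (simp add: field_simps)
    show "cmod (Psi \<zeta> / expo m \<zeta> - 1) \<le> K0 / Re \<zeta>" by (rule q[OF z0])
  qed
  have nonpos: "Psi \<zeta> / expo m \<zeta> \<notin> \<real>\<^sub>\<le>\<^sub>0" if "\<zeta> \<in> parabolic_dom X" for \<zeta>
  proof
    assume "Psi \<zeta> / expo m \<zeta> \<in> \<real>\<^sub>\<le>\<^sub>0"
    then have "Re (Psi \<zeta> / expo m \<zeta>) \<le> 0" by (simp add: complex_nonpos_Reals_iff)
    then show False using abs_Re_le_cmod[of "Psi \<zeta> / expo m \<zeta> - 1"] bz(4,5)[OF that] by simp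
  qed
  have exp_sg: "exp (sg \<zeta>) = Psi \<zeta>" if "\<zeta> \<in> parabolic_dom X" for \<zeta>
  proof -
    have "Psi \<zeta> / expo m \<zeta> \<noteq> 0" using nonpos[OF that] by (metis complex_nonpos_Reals_iff order_refl zero_complex.simps)
    then have "exp (sg \<zeta>) = expo m \<zeta> * (Psi \<zeta> / expo m \<zeta>)" by (simp add: sg_def exp_add expo_def)
    then show ?thesis by simp
  qed
  have Psi_nz: "1/2 \<le> cmod (Psi \<zeta> / expo m \<zeta>)" if "\<zeta> \<in> parabolic_dom X" for \<zeta>
  proof -
    have "1 - cmod (1 - Psi \<zeta> / expo m \<zeta>) \<le> cmod (Psi \<zeta> / expo m \<zeta>)"
      using norm_triangle_ineq2[of 1 "1 - Psi \<zeta> / expo m \<zeta>"] by simp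
    then show ?thesis using bz(4,5)[OF that] norm_minus_commute[of 1 "Psi \<zeta> / expo m \<zeta>"] by linarith
  qed
  have diff: "sg field_differentiable at \<zeta>" if "\<zeta> \<in> parabolic_dom X" for \<zeta>
  proof -
    have 1: "Psi field_differentiable at \<zeta>" using dPsi that sub unfolding field_differentiable_def by blast
    have 2: "expo m field_differentiable at \<zeta>" using expo_deriv[OF bz(2)[OF that]] unfolding field_differentiable_def by blast
    have 3: "(\<lambda>\<zeta>. Psi \<zeta> / expo m \<zeta>) field_differentiable at \<zeta>" by (rule field_differentiable_divide[OF 1 2]) simp
    have 4: "(Ln \<circ> (\<lambda>\<zeta>. Psi \<zeta> / expo m \<zeta>)) field_differentiable at \<zeta>"
      by (rule field_differentiable_compose[OF 3]) (rule field_differentiable_at_Ln[OF nonpos[OF that]])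
    have 5: "Ln field_differentiable at \<zeta>" by (rule field_differentiable_at_Ln[OF bz(2)[OF that]])
    show ?thesis unfolding sg_def[abs_def]
      using field_differentiable_add[OF field_differentiable_add[OF field_differentiable_ident field_differentiable_mult[OF field_differentiable_const 5, of "of_int m"]] 4]
      by (simp add: o_def)
  qed
  show thesis
  proof (rule that[of X "4 * K0" Psi sg])
    show "1 \<le> X" "0 \<le> 4 * K0" "8 * (4 * K0) \<le> X" using X0 by (auto simp: X_def)
    fix \<zeta> assume z: "\<zeta> \<in> parabolic_dom X"
    then have z0: "\<zeta> \<in> parabolic_dom X0" using sub by blast
    note b = bz[OF z]
    show "(Psi has_field_derivative (expo m \<zeta> - 1 - of_real \<kappa> / \<zeta>)) (at \<zeta>)" by (rule dPsi[OF z0])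
    show "exp (sg \<zeta>) = Psi \<zeta>" by (rule exp_sg[OF z])
    show ds: "(sg has_field_derivative deriv sg \<zeta>) (at \<zeta>)" using diff[OF z] by (simp add: DERIV_deriv_iff_field_differentiable)
    show "cmod (deriv sg \<zeta> - 1) \<le> 4 * K0 / Re \<zeta>"
    proof -
      have "((\<lambda>\<zeta>. exp (sg \<zeta>)) has_field_derivative (exp (sg \<zeta>) * deriv sg \<zeta>)) (at \<zeta>)"
        by (rule DERIV_chain2[OF DERIV_exp ds])
      then have "(Psi has_field_derivative (exp (sg \<zeta>) * deriv sg \<zeta>)) (at \<zeta>)"
        by (rule has_field_derivative_transform_within_open[OF _ open_parabolic_dom z]) (rule exp_sg)
      then have eq: "Psi \<zeta> * deriv sg \<zeta> = expo m \<zeta> - 1 - of_real \<kappa> / \<zeta>"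
        using DERIV_unique[OF _ dPsi[OF z0]] exp_sg[OF z] by simp
      define a where "a = Psi \<zeta> / expo m \<zeta>"
      have Pa: "Psi \<zeta> = a * expo m \<zeta>" by (simp add: a_def)
      have "a * (deriv sg \<zeta> - 1) = (expo m \<zeta> - 1 - of_real \<kappa> / \<zeta>) / expo m \<zeta> - a"
        using eq unfolding Pa by (simp add: field_simps)
      also have "\<dots> = (1 - a) - (1 + of_real \<kappa> / \<zeta>) / expo m \<zeta>" by (simp add: diff_divide_distrib add_divide_distrib)
      finally have "cmod a * cmod (deriv sg \<zeta> - 1) \<le> cmod (1 - a) + cmod ((1 + of_real \<kappa> / \<zeta>) / expo m \<zeta>)"
        using norm_triangle_ineq4[of "1 - a" "(1 + of_real \<kappa> / \<zeta>) / expo m \<zeta>"] by (simp add: norm_mult[symmetric])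
      also have "\<dots> \<le> K0 / Re \<zeta> + K0 / Re \<zeta>" using b(5) q'[OF z0] by (simp add: a_def norm_minus_commute)
      finally have 1: "cmod a * cmod (deriv sg \<zeta> - 1) \<le> 2 * (K0 / Re \<zeta>)" by simp
      have "1/2 * cmod (deriv sg \<zeta> - 1) \<le> cmod a * cmod (deriv sg \<zeta> - 1)"
        using Psi_nz[OF z] by (intro mult_right_mono) (auto simp: a_def)
      then have "cmod (deriv sg \<zeta> - 1) \<le> 4 * (K0 / Re \<zeta>)" using 1 by linarith
      then show ?thesis by simp
    qed
    show "cmod (sg \<zeta> - (\<zeta> + of_int m * Ln \<zeta>)) \<le> 4 * K0 / Re \<zeta>"
    proof -
      have "cmod (Psi \<zeta> / expo m \<zeta> - 1) \<le> 1/2" using b by linarith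
      then have "cmod (Ln (Psi \<zeta> / expo m \<zeta>)) \<le> 2 * (K0 / Re \<zeta>)" using norm_Ln_le[of "Psi \<zeta> / expo m \<zeta>"] b(5) by linarith
      also have "\<dots> \<le> 4 * K0 / Re \<zeta>" using X0 b(1) by (simp add: divide_right_mono)
      finally show ?thesis by (simp add: sg_def)
    qed
    show "sg (cnj \<zeta>) = cnj (sg \<zeta>)"
      using Psi_cnj[OF z0] expo_cnj[OF b(2)] nonpos[OF z] b(2) by (simp add: sg_def cnj_Ln)
  qed
qed

section \<open>Charts and the parabolic map\<close>

text \<open>The second-order Taylor equation for the step u is solved by substitution: v = p u is 1
  + O(1/p), so the quadratic part may be frozen at v = 1, which yields u = 1/p + (1/2 -
  \<rho>/z)/p^2 + O(1/(p^2 z^2)). In exp(- u) the summand 1/2 cancels against u^2/2. The assumption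
  |z|^2 \<le> |p| trades a factor 1/p for 1/z^2.\<close>

lemma step_expansion:
  fixes p u z :: complex and \<kappa> \<rho> C1 :: real and m :: int
  assumes z: "1 \<le> cmod z" "(cmod z)^2 \<le> cmod p" and u: "cmod u \<le> 2 / cmod p" and C1: "0 \<le> C1"
    and \<kappa>: "\<kappa> = of_int m / 2 - \<rho>"
    and eq: "cmod (1 - (p * u + p * (1 + of_int m / z) * u^2 / 2 - u - of_real \<kappa> / z * u)) \<le> C1 / (cmod p * (cmod z)^2)"
    and M: "M = 1 + \<bar>real_of_int m\<bar> + \<bar>\<kappa>\<bar>" and N: "N = 4 * M + C1"
  shows "cmod (exp (- u) - 1 + 1 / p - of_real \<rho> / (p^2 * z)) \<le> (36 + 2 * N + 3 * M * N + C1) / ((cmod p)^2 * (cmod z)^2)"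
    and "cmod (p * u - 1) \<le> N / cmod p"
proof -
  define P where "P = cmod p"
  define Z where "Z = cmod z"
  have Z: "1 \<le> Z" "Z^2 \<le> P" using z by (auto simp: Z_def P_def)
  have Z2: "1 \<le> Z^2" using Z by (simp add: one_le_power)
  have P: "1 \<le> P" using Z Z2 by linarith
  have p0: "p \<noteq> 0" and z0: "z \<noteq> 0" using P Z by (auto simp: P_def Z_def)
  have M1: "1 \<le> M" and N0: "0 \<le> N" using C1 by (auto simp: M N)
  define v where "v = p * u"
  have v2: "cmod v \<le> 2" using u P by (simp add: v_def norm_mult P_def[symmetric] field_simps)
  define a where "a = 1 + of_int m / z"
  define c where "c = 1 + of_real \<kappa> / z"
  have mz: "cmod (of_int m / z) \<le> \<bar>real_of_int m\<bar>" "cmod (of_real \<kappa> / z) \<le> \<bar>\<kappa>\<bar>"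
    using Z by (auto simp: norm_divide Z_def[symmetric] divide_le_eq mult_le_cancel_left1)
  have a: "cmod a \<le> M" using norm_triangle_ineq[of 1 "of_int m / z"] mz by (simp add: a_def M)
  have c: "cmod c \<le> M" using norm_triangle_ineq[of 1 "of_real \<kappa> / z"] mz by (simp add: c_def M)
  define q where "q = a * v^2 / 2 - c * v"
  define e1 where "e1 = 1 - (v + q / p)"
  have "p * u + p * (1 + of_int m / z) * u^2 / 2 - u - of_real \<kappa> / z * u = v + q / p"
    using p0 by (simp add: v_def q_def a_def c_def power2_eq_square field_simps)
  then have e1: "cmod e1 \<le> C1 / (P * Z^2)" using eq by (simp add: e1_def P_def Z_def)
  have pos: "0 < P" "0 < Z^2" using P Z2 by linarith+
  have PZ: "C1 / (P * Z^2) \<le> C1 / P"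
  proof (rule divide_left_mono)
    show "P \<le> P * Z^2" using mult_left_mono[OF Z2, of P] P by simp
    show "0 < P * Z^2 * P" using pos by (intro mult_pos_pos)
  qed (rule C1)
  have q: "cmod q \<le> 4 * M"
  proof -
    have "cmod a * cmod v^2 \<le> M * 2^2" using a v2 M1 by (intro mult_mono power_mono) auto
    then have "cmod (a * v^2 / 2) \<le> M * 2^2 / 2" by (simp add: norm_divide norm_mult norm_power)
    moreover have "cmod (c * v) \<le> M * 2" unfolding norm_mult using c v2 M1 by (intro mult_mono) auto
    ultimately show ?thesis using norm_triangle_ineq4[of "a * v^2 / 2" "c * v"] by (simp add: q_def)
  qed
  have v1: "cmod (v - 1) \<le> N / P"
  proof -
    have "v - 1 = - (q / p) - e1" by (simp add: e1_def)
    then have "cmod (v - 1) \<le> cmod (q / p) + cmod e1" using norm_triangle_ineq4[of "- (q/p)" e1] by simp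
    also have "\<dots> \<le> 4 * M / P + C1 / P" using q e1 PZ P by (intro add_mono) (auto simp: norm_divide P_def[symmetric] divide_right_mono)
    finally show ?thesis by (simp add: N add_divide_distrib)
  qed
  then show "cmod (p * u - 1) \<le> N / cmod p" by (simp add: v_def P_def)
  have v21: "cmod (v^2 - 1) \<le> 3 * (N / P)"
  proof -
    have "v^2 - 1 = (v + 1) * (v - 1)" by (simp add: power2_eq_square algebra_simps)
    moreover have "cmod (v + 1) \<le> 3" using norm_triangle_ineq[of v 1] v2 by simp
    ultimately show ?thesis using mult_mono[OF _ v1, of "cmod (v + 1)" 3] by (simp add: norm_mult)
  qed
  define q1 where "q1 = a / 2 - c"
  \<comment> \<open>Here the relation \<kappa> = m/2 - \<rho> enters: m/(2z) - \<kappa>/z =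
    \<rho>/z.\<close>
  have q1: "- q1 = 1/2 - of_real \<rho> / z" using z0 by (simp add: q1_def a_def c_def \<kappa> field_simps)
  have qq: "cmod (q - q1) \<le> 3 * M * (N / P)"
  proof -
    have "q - q1 = a / 2 * (v^2 - 1) - c * (v - 1)" by (simp add: q_def q1_def algebra_simps diff_divide_distrib)
    then have "cmod (q - q1) \<le> cmod (a / 2) * cmod (v^2 - 1) + cmod c * cmod (v - 1)"
      using norm_triangle_ineq4[of "a / 2 * (v^2 - 1)" "c * (v - 1)"] by (simp add: norm_mult)
    also have "\<dots> \<le> (M / 2) * (3 * (N / P)) + M * (N / P)"
      using a c v1 v21 M1 by (intro add_mono mult_mono) (auto simp: norm_divide)
    also have "\<dots> \<le> 3 * M * (N / P)" using M1 N0 P by (simp add: field_simps)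
    finally show ?thesis .
  qed
  define e2 where "e2 = v - 1 + q1 / p"
  have e2: "cmod e2 \<le> (3 * M * N + C1) / (P * Z^2)"
  proof -
    have "e2 = - ((q - q1) / p) - e1" by (simp add: e2_def e1_def diff_divide_distrib)
    then have "cmod e2 \<le> cmod ((q - q1) / p) + cmod e1" using norm_triangle_ineq4[of "- ((q-q1)/p)" e1] by simp
    also have "\<dots> \<le> 3 * M * (N / P) / P + C1 / (P * Z^2)"
    proof (rule add_mono[OF _ e1])
      have "cmod ((q - q1) / p) = cmod (q - q1) / P" by (simp add: norm_divide P_def)
      also have "\<dots> \<le> 3 * M * (N / P) / P" using pos by (intro divide_right_mono qq) auto
      finally show "cmod ((q - q1) / p) \<le> 3 * M * (N / P) / P" .
    qed
    also have "3 * M * (N / P) / P \<le> 3 * M * N / (P * Z^2)"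
    proof -
      have "3 * M * N / (P * P) \<le> 3 * M * N / (P * Z^2)" using Z P M1 N0 pos by (intro divide_left_mono mult_left_mono mult_pos_pos mult_nonneg_nonneg) auto
      then show ?thesis by simp
    qed
    finally show ?thesis by (simp add: add_divide_distrib)
  qed
  have u2: "cmod u \<le> 2 / P" using u by (simp add: P_def)
  have ex: "cmod (exp (- u) - 1 + u - u^2 / 2) \<le> 36 / P^3"
  proof -
    have "2 / P \<le> 2" using P pos by (simp add: divide_le_eq)
    then have ul: "cmod u \<le> 2" using u2 by linarith
    have "cmod (exp (- u) - (\<Sum>i\<le>2. (- u)^i / fact i)) \<le> exp \<bar>Re (- u)\<bar> * cmod (- u)^Suc 2 / fact 2"
      by (rule Taylor_exp)
    moreover have "(\<Sum>i\<le>2. (- u)^i / fact i) = 1 - u + u^2 / 2" by (simp add: numeral_2_eq_2)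
    moreover have "exp \<bar>Re (- u)\<bar> * cmod (- u)^Suc 2 / fact 2 \<le> 9 * (2 / P)^3 / 2"
    proof -
      have "exp \<bar>Re (- u)\<bar> \<le> exp 2" using abs_Re_le_cmod[of u] ul by simp
      also have "exp (2::real) = exp 1 * exp 1" by (simp add: exp_add[symmetric])
      also have "\<dots> \<le> 3 * 3" using exp_le by (intro mult_mono) auto
      finally have "exp \<bar>Re (- u)\<bar> \<le> 9" by simp
      moreover have "cmod u^3 \<le> (2 / P)^3" using u2 by (intro power_mono) auto
      ultimately have "exp \<bar>Re (- u)\<bar> * cmod u^3 \<le> 9 * (2 / P)^3" by (intro mult_mono) auto
      then show ?thesis by (simp add: eval_nat_numeral)
    qed
    moreover have "9 * (2 / P)^3 / 2 = 36 / P^3" by (simp add: power_divide)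
    ultimately show ?thesis by (simp add: algebra_simps)
  qed
  have uu: "cmod (u^2 / 2 - 1 / (2 * p^2)) \<le> 3/2 * N / P^3"
  proof -
    have "u^2 / 2 - 1 / (2 * p^2) = (v^2 - 1) / (2 * p^2)" using p0 by (simp add: v_def power_mult_distrib field_simps)
    then have "cmod (u^2 / 2 - 1 / (2 * p^2)) = cmod (v^2 - 1) / (2 * P^2)" by (simp add: norm_divide norm_mult norm_power P_def)
    also have "\<dots> \<le> 3 * (N / P) / (2 * P^2)" using v21 by (intro divide_right_mono) auto
    finally show ?thesis by (simp add: power2_eq_square power3_eq_cube)
  qed
  have "u = v / p" using p0 by (simp add: v_def)
  also have "v = e2 + 1 + (- q1) / p" by (simp add: e2_def)
  finally have ueq: "u = e2 / p + 1 / p + (1/2 - of_real \<rho> / z) / p^2"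
    unfolding q1 by (simp add: add_divide_distrib power2_eq_square)
  have "exp (- u) - 1 + 1 / p - of_real \<rho> / (p^2 * z) = (exp (- u) - 1 + u - u^2 / 2) + (u^2 / 2 - 1 / (2 * p^2)) - e2 / p"
  proof -
    have "(1/2 - of_real \<rho> / z) / p^2 = 1 / (2 * p^2) - of_real \<rho> / (p^2 * z)"
      by (simp add: diff_divide_distrib mult.commute)
    then have "u - e2 / p = 1 / p + (1 / (2 * p^2) - of_real \<rho> / (p^2 * z))"
      using ueq by (metis (no_types, lifting) add_diff_cancel_left' add.assoc)
    then have "1 / p - of_real \<rho> / (p^2 * z) = u - e2 / p - 1 / (2 * p^2)" by (simp only:) simp
    then show ?thesis by simp
  qed
  then have "cmod (exp (- u) - 1 + 1 / p - of_real \<rho> / (p^2 * z)) \<le>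
      cmod (exp (- u) - 1 + u - u^2 / 2) + cmod (u^2 / 2 - 1 / (2 * p^2)) + cmod (e2 / p)"
    using order_trans[OF norm_triangle_ineq4 add_right_mono[OF norm_triangle_ineq]] by (simp only:)
  also have "cmod (e2 / p) \<le> ((3 * M * N + C1) / (P * Z^2)) / P"
    using divide_right_mono[OF e2, of P] pos by (simp add: norm_divide P_def[symmetric])
  finally have "cmod (exp (- u) - 1 + 1 / p - of_real \<rho> / (p^2 * z)) \<le> 36 / P^3 + 3/2 * N / P^3 + ((3 * M * N + C1) / (P * Z^2)) / P"
    using ex uu by linarith
  also have "36 / P^3 + 3/2 * N / P^3 \<le> (36 + 2 * N) / (P^2 * Z^2)"
  proof -
    have "(36 + 3/2 * N) / (P^2 * P) \<le> (36 + 2 * N) / (P^2 * Z^2)"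
      using Z P N0 pos by (intro frac_le mult_left_mono mult_pos_pos) auto
    then show ?thesis by (simp add: add_divide_distrib power2_eq_square power3_eq_cube)
  qed
  finally show "cmod (exp (- u) - 1 + 1 / p - of_real \<rho> / (p^2 * z)) \<le> (36 + 2 * N + 3 * M * N + C1) / ((cmod p)^2 * (cmod z)^2)"
    by (simp add: P_def[symmetric] Z_def[symmetric] add_divide_distrib power2_eq_square mult_ac)
qed

text \<open>The difference f(w) - a w has Lipschitz constant |a|/2, so f expands distances by at
  least |a|/2, and the Newton map with frozen slope a is a contraction by 1/2 that maps the closed
  disc of radius 2|c|/|a| into itself.\<close>

lemma local_solve:
  fixes f :: "complex \<Rightarrow> complex"
  assumes r: "0 < r" and a: "a \<noteq> 0"
    and der: "\<And>w. w \<in> ball z r \<Longrightarrow> (f has_field_derivative f' w) (at w)"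
    and near: "\<And>w. w \<in> ball z r \<Longrightarrow> cmod (f' w - a) \<le> cmod a / 2"
  shows "inj_on f (ball z r)"
    and "\<And>w w'. w \<in> ball z r \<Longrightarrow> w' \<in> ball z r \<Longrightarrow> cmod a / 2 * cmod (w - w') \<le> cmod (f w - f w')"
    and "\<And>c. cmod c < cmod a * r / 2 \<Longrightarrow> \<exists>w\<in>ball z r. f w = f z + c"
proof -
  have lip: "cmod ((f w - a * w) - (f w' - a * w')) \<le> cmod a / 2 * cmod (w - w')" if "w \<in> ball z r" "w' \<in> ball z r" for w w'
  proof (rule field_differentiable_bound[of "ball z r" "\<lambda>w. f w - a * w" "\<lambda>w. f' w - a"])
    show "((\<lambda>w. f w - a * w) has_field_derivative f' x - a) (at x within ball z r)" if "x \<in> ball z r" for x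
      using DERIV_diff[OF der[OF that] DERIV_cmult_Id[of a]] by (rule has_field_derivative_at_within)
  qed (use that near in auto)
  show exp: "cmod a / 2 * cmod (w - w') \<le> cmod (f w - f w')" if "w \<in> ball z r" "w' \<in> ball z r" for w w'
  proof -
    have "a * (w - w') = (f w - f w') - ((f w - a * w) - (f w' - a * w'))" by (simp add: algebra_simps)
    then have "cmod a * cmod (w - w') \<le> cmod (f w - f w') + cmod a / 2 * cmod (w - w')"
      using norm_triangle_ineq4[of "f w - f w'" "(f w - a * w) - (f w' - a * w')"] lip[OF that] by (simp add: norm_mult[symmetric])
    then show ?thesis by simp
  qed
  show "inj_on f (ball z r)"
  proof (rule inj_onI)
    fix w w' assume "w \<in> ball z r" "w' \<in> ball z r" "f w = f w'"
    then show "w = w'" using exp[of w w'] a by (simp add: mult_le_0_iff)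
  qed
  show "\<exists>w\<in>ball z r. f w = f z + c" if c: "cmod c < cmod a * r / 2" for c
  proof -
    define s where "s = 2 * cmod c / cmod a"
    have s: "0 \<le> s" "s < r" using c a r by (auto simp: s_def field_simps)
    have sub: "cball z s \<subseteq> ball z r" using s by auto
    define T where "T w = w - (f w - f z - c) / a" for w
    have Tl: "dist (T w) (T w') \<le> 1/2 * dist w w'" if "w \<in> cball z s" "w' \<in> cball z s" for w w'
    proof -
      have "T w - T w' = - ((f w - a * w) - (f w' - a * w')) / a" using a by (simp add: T_def field_simps)
      then have "cmod (T w - T w') \<le> (cmod a / 2 * cmod (w - w')) / cmod a"
        using lip[OF subsetD[OF sub that(1)] subsetD[OF sub that(2)]]
        by (simp only: norm_divide norm_minus_cancel) (rule divide_right_mono, auto)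
      then show ?thesis using a by (simp add: dist_norm)
    qed
    have "\<exists>!w\<in>cball z s. T w = w"
    proof (rule Banach_fix[where c = "1/2"])
      show "T ` cball z s \<subseteq> cball z s"
      proof
        fix y assume "y \<in> T ` cball z s"
        then obtain w where w: "w \<in> cball z s" "y = T w" by blast
        have zs: "z \<in> cball z s" using s by simp
        have "dist (T w) z \<le> dist (T w) (T z) + dist (T z) z" by (rule dist_triangle)
        also have "dist (T z) z = cmod c / cmod a" by (simp add: T_def dist_norm norm_divide)
        also have "dist (T w) (T z) \<le> 1/2 * dist w z" by (rule Tl[OF w(1) zs])
        also have "1/2 * dist w z \<le> 1/2 * s" using w(1) by (simp add: dist_commute)
        finally show "y \<in> cball z s" using w(2) by (simp add: s_def dist_commute)
      qed
    qed (use s Tl in \<open>auto simp: complete_eq_closed\<close>)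
    then obtain w where "w \<in> cball z s" "T w = w" by blast
    then have "w \<in> ball z r" "f w = f z + c" using sub a by (auto simp: T_def)
    then show ?thesis by blast
  qed
qed

text \<open>The exponent \<zeta> + m Ln \<zeta> has a derivative of modulus at most 3/2 here, so
  over a distance 1/16 it changes by at most 3/32, and \<open>expo m\<close> by a relative amount of
  at most 3 times 3/32.\<close>

lemma expo_near:
  assumes "2 * \<bar>real_of_int m\<bar> + 2 \<le> Re \<zeta>" "cmod (w - \<zeta>) \<le> 1/16"
  shows "0 < Re w" "cmod \<zeta> / 2 \<le> cmod w" "1 \<le> cmod w" "cmod (expo m w / expo m \<zeta> - 1) \<le> 9/32"
proof -
  have Re: "Re \<zeta> - 1/16 \<le> Re w" using abs_Re_le_cmod[of "w - \<zeta>"] assms(2) by simp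
  then show w: "0 < Re w" "1 \<le> cmod w" using assms(1) abs_Re_le_cmod[of w] by linarith+
  have z: "2 \<le> cmod \<zeta>" "0 < Re \<zeta>" using assms(1) abs_Re_le_cmod[of \<zeta>] by linarith+
  have "cmod \<zeta> - cmod w \<le> 1/16" using norm_triangle_ineq2[of \<zeta> w] assms(2) by (simp add: norm_minus_commute)
  then show "cmod \<zeta> / 2 \<le> cmod w" using z by linarith
  let ?S = "closed_segment \<zeta> w"
  have S: "2 * \<bar>real_of_int m\<bar> + 1 \<le> Re x" if "x \<in> ?S" for x
  proof -
    have "cmod (x - \<zeta>) \<le> cmod (w - \<zeta>)" using that segment_bound1[of x \<zeta> w] by simp
    then show ?thesis using abs_Re_le_cmod[of "x - \<zeta>"] assms by simp
  qed
  have "cmod ((w + of_int m * Ln w) - (\<zeta> + of_int m * Ln \<zeta>)) \<le> (3/2) * cmod (w - \<zeta>)"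
  proof (rule field_differentiable_bound[of ?S "\<lambda>w. w + of_int m * Ln w" "\<lambda>w. 1 + of_int m / w"])
    fix x assume x: "x \<in> ?S"
    have nr: "x \<notin> \<real>\<^sub>\<le>\<^sub>0" using S[OF x] by (auto simp: complex_nonpos_Reals_iff)
    have "((\<lambda>w. w + of_int m * Ln w) has_field_derivative 1 + of_int m * inverse x) (at x)"
      by (rule DERIV_add[OF DERIV_ident DERIV_cmult[OF has_field_derivative_Ln[OF nr]]])
    then show "((\<lambda>w. w + of_int m * Ln w) has_field_derivative 1 + of_int m / x) (at x within ?S)"
      unfolding divide_inverse by (rule has_field_derivative_at_within)
    have "2 * \<bar>real_of_int m\<bar> + 1 \<le> cmod x" using S[OF x] abs_Re_le_cmod[of x] by linarith
    then have "cmod (of_int m / x) \<le> 1/2" by (simp add: norm_divide divide_le_eq)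
    then show "cmod (1 + of_int m / x) \<le> 3/2" using norm_triangle_ineq[of 1 "of_int m / x"] by simp
  qed auto
  then have \<delta>: "cmod ((w + of_int m * Ln w) - (\<zeta> + of_int m * Ln \<zeta>)) \<le> 3/32" (is "cmod ?\<delta> \<le> _") using assms(2) by simp
  have "expo m w / expo m \<zeta> = exp ?\<delta>" by (simp add: expo_def exp_diff)
  moreover have "cmod (exp ?\<delta> - (\<Sum>i\<le>0. ?\<delta>^i / fact i)) \<le> exp \<bar>Re ?\<delta>\<bar> * cmod ?\<delta>^Suc 0 / fact 0" by (rule Taylor_exp)
  moreover have "exp \<bar>Re ?\<delta>\<bar> * cmod ?\<delta>^Suc 0 / fact 0 \<le> 3 * (3/32)"
  proof -
    have "exp \<bar>Re ?\<delta>\<bar> \<le> exp 1" using abs_Re_le_cmod[of ?\<delta>] \<delta> by (subst exp_le_cancel_iff) linarith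
    then have "exp \<bar>Re ?\<delta>\<bar> \<le> 3" using exp_le by linarith
    then have "exp \<bar>Re ?\<delta>\<bar> * cmod ?\<delta> \<le> 3 * (3/32)" using \<delta> by (intro mult_mono) auto
    then show ?thesis by simp
  qed
  ultimately show "cmod (expo m w / expo m \<zeta> - 1) \<le> 9/32" by simp
qed

lemma segment_in_ball: "z + u \<in> ball z r \<Longrightarrow> w \<in> closed_segment z (z + u) \<Longrightarrow> cmod (w - z) \<le> cmod u \<and> w \<in> ball z r"
  using segment_bound1[of w z "z + u"] by (auto simp: dist_norm norm_minus_commute)

section \<open>The glued solution pulled back to the zeta-chart\<close>

definition narrow_dom :: "real \<Rightarrow> real \<Rightarrow> complex set" where
  "narrow_dom \<eta> Y = {\<zeta>. Y < Re \<zeta> \<and> \<bar>Im \<zeta>\<bar> < \<eta> * (Re \<zeta>)^2}"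

lemma open_narrow_dom: "open (narrow_dom \<eta> Y)"
  unfolding narrow_dom_def by (intro open_Collect_conj open_Collect_less continuous_intros)

text \<open>Joins the outputs of \<open>log_coordinate\<close> and \<open>gluing_of_germs\<close>.
  Only strips with index k \<ge> 0 are given; the others are obtained by reflection.\<close>

locale atlas =
  fixes m :: int and \<kappa> \<rho> X K A B :: real and Psi sg :: "complex \<Rightarrow> complex"
    and R h :: "nat \<Rightarrow> complex \<Rightarrow> complex"
  assumes \<kappa>: "\<kappa> = of_int m / 2 - \<rho>"
    and XK: "1 \<le> X" "0 \<le> K" "8 * K \<le> X" and AB: "1 \<le> A" "1 \<le> B"
    and Psi_deriv: "\<And>\<zeta>. \<zeta> \<in> parabolic_dom X \<Longrightarrow> (Psi has_field_derivative (expo m \<zeta> - 1 - of_real \<kappa> / \<zeta>)) (at \<zeta>)"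
    and exp_sg: "\<And>\<zeta>. \<zeta> \<in> parabolic_dom X \<Longrightarrow> exp (sg \<zeta>) = Psi \<zeta>"
    and sg_deriv: "\<And>\<zeta>. \<zeta> \<in> parabolic_dom X \<Longrightarrow> (sg has_field_derivative deriv sg \<zeta>) (at \<zeta>)"
    and sg_deriv_near: "\<And>\<zeta>. \<zeta> \<in> parabolic_dom X \<Longrightarrow> cmod (deriv sg \<zeta> - 1) \<le> K / Re \<zeta>"
    and sg_near: "\<And>\<zeta>. \<zeta> \<in> parabolic_dom X \<Longrightarrow> cmod (sg \<zeta> - (\<zeta> + of_int m * Ln \<zeta>)) \<le> K / Re \<zeta>"
    and sg_cnj: "\<And>\<zeta>. \<zeta> \<in> parabolic_dom X \<Longrightarrow> sg (cnj \<zeta>) = cnj (sg \<zeta>)"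
    and R_hol: "\<And>k. R k holomorphic_on patch (\<lambda>k. A + B * sqrt (real k)) (3/4) k"
    and R_bound: "\<And>k s. s \<in> patch (\<lambda>k. A + B * sqrt (real k)) (3/4) k \<Longrightarrow> cmod (R k s) \<le> 1/4"
    and R_deriv_bound: "\<And>k s. s \<in> patch (\<lambda>k. A + B * sqrt (real k)) (3/4) k \<Longrightarrow> cmod (deriv (R k) s) * (1 + cmod s)^2 \<le> 1/4"
    and R_cnj: "\<And>s. s \<in> patch (\<lambda>k. A + B * sqrt (real k)) (3/4) 0 \<Longrightarrow> R 0 (cnj s) = cnj (R 0 s)"
    and R_glue: "\<And>k s. s \<in> overlap (\<lambda>k. A + B * sqrt (real k)) (3/4) k \<Longrightarrow>
        R (Suc k) s = R k s + hlog k (h k) (exp s + R k s)"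
    and h_nz: "\<And>k s. s \<in> overlap (\<lambda>k. A + B * sqrt (real k)) (3/4) k \<Longrightarrow> h k (hexp k (exp s + R k s)) \<noteq> 0"
begin

abbreviation b where "b \<equiv> (\<lambda>k. A + B * sqrt (real k))"

definition M where "M = \<bar>real_of_int m\<bar>"
text \<open>Chosen so that B sqrt(\<eta> x^2) = x/4: the strips met at abscissa x in the domain have
  numbers up to about \<eta> x^2, so their starting abscissas stay well below x.\<close>

definition \<eta> where "\<eta> = (1 / (4 * B))^2"

definition W :: "int \<Rightarrow> complex set" where
  "W k = {s. b (nat \<bar>k\<bar> - 1) - 3/4 < Re s \<and> \<bar>Im s - of_int k * pi\<bar> < pi/2 + 3/4}"

text \<open>Extension to negative strips by reflection. At k = 0 the two branches agree by
  \<open>R_cnj\<close>, which makes the gluing across k = -1 consistent.\<close>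

definition Rz :: "int \<Rightarrow> complex \<Rightarrow> complex" where
  "Rz k s = (if 0 \<le> k then R (nat k) s else cnj (R (nat (- k)) (cnj s)))"

lemma W_nonneg: "0 \<le> k \<Longrightarrow> W k = patch b (3/4) (nat k)"
  by (simp add: W_def patch_def)

lemma W_neg:
  assumes "k < 0" "s \<in> W k"
  shows "cnj s \<in> patch b (3/4) (nat (- k))"
proof -
  have "\<bar>- Im s - real (nat (- k)) * pi\<bar> = \<bar>Im s - of_int k * pi\<bar>" using assms(1) by simp
  moreover have "nat \<bar>k\<bar> = nat (- k)" using assms(1) by simp
  ultimately show ?thesis using assms(2) by (simp add: W_def patch_def)
qed

lemma Rz_props:
  assumes s: "s \<in> W k"
  shows "cmod (Rz k s) \<le> 1/4" "(Rz k has_field_derivative deriv (Rz k) s) (at s)"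
    "cmod (deriv (Rz k) s) * (1 + cmod s)^2 \<le> 1/4"
proof -
  have "cmod (Rz k s) \<le> 1/4 \<and> Rz k field_differentiable at s \<and> cmod (deriv (Rz k) s) * (1 + cmod s)^2 \<le> 1/4"
  proof (cases "0 \<le> k")
    case True
    then have eq: "Rz k = R (nat k)" by (simp add: Rz_def fun_eq_iff)
    show ?thesis unfolding eq
      using R_bound R_deriv_bound s W_nonneg[OF True] holomorphic_on_imp_differentiable_at[OF R_hol open_patch] by simp
  next
    case False
    then have k: "k < 0" by simp
    have eq: "Rz k = (\<lambda>s. cnj (R (nat (- k)) (cnj s)))" using k by (simp add: Rz_def fun_eq_iff)
    note c = W_neg[OF k s]
    have d: "R (nat (- k)) field_differentiable at (cnj s)" by (rule holomorphic_on_imp_differentiable_at[OF R_hol open_patch c])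
    then obtain f' where "(R (nat (- k)) has_field_derivative f') (at (cnj s))" unfolding field_differentiable_def by blast
    then have "((\<lambda>s. cnj (R (nat (- k)) (cnj s))) has_field_derivative cnj f') (at s)"
      using has_field_derivative_cnj_cnj[of "R (nat (- k))" f' s] by (simp add: o_def)
    then have d2: "(\<lambda>s. cnj (R (nat (- k)) (cnj s))) field_differentiable at s" unfolding field_differentiable_def by blast
    show ?thesis unfolding eq deriv_cnj_cnj[OF d] using R_bound[OF c] R_deriv_bound[OF c] d2 by simp
  qed
  then show "cmod (Rz k s) \<le> 1/4" "(Rz k has_field_derivative deriv (Rz k) s) (at s)"
    "cmod (deriv (Rz k) s) * (1 + cmod s)^2 \<le> 1/4" by (auto simp: DERIV_deriv_iff_field_differentiable)
qed

lemma \<eta>_pos: "0 < \<eta>" "\<eta> \<le> 1"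
proof -
  show "0 < \<eta>" using AB by (simp add: \<eta>_def)
  have "1 / (4 * B) \<le> 1" "0 \<le> 1 / (4 * B)" using AB by (auto simp: divide_le_eq)
  then show "\<eta> \<le> 1" unfolding \<eta>_def by (simp add: power_le_one)
qed

definition good0 where "good0 Y \<longleftrightarrow> X \<le> Y \<and> 2 * M + 3 \<le> Y \<and> (\<forall>\<zeta>\<in>narrow_dom \<eta> Y. \<zeta> \<in> parabolic_dom X \<and>
    (\<forall>k. \<bar>Im (sg \<zeta>) - of_int k * pi\<bar> < pi/2 + 3/4 \<longrightarrow> sg \<zeta> \<in> W k) \<and> cmod \<zeta> / 2 \<le> cmod (sg \<zeta>) \<and>
    exp (Re \<zeta> / 2) \<le> cmod (expo m \<zeta>))"

text \<open>The matching of the quadratic shape with the square root in \<open>b\<close>: if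
  \<open>sg \<zeta>\<close> has the height of strip k, then |k| \<le> \<eta> x^2 + 4 M + 4 with x =
  Re \<zeta>, so that \<open>b\<close> is at most A + x/4 + B sqrt(4 M + 4) there, while Re
  (\<open>sg \<zeta>\<close>) is at least x minus a logarithm. The 4 M accounts for the argument of
  \<zeta> in m Ln \<zeta>.\<close>

lemma good0_ex: "\<exists>Y. good0 Y"
proof -
  obtain X1 where X1: "1 \<le> X1" "\<And>\<zeta>. \<zeta> \<in> parabolic_dom X1 \<Longrightarrow> exp (Re \<zeta> / 2) \<le> cmod (expo m \<zeta>)"
    by (rule expo_lower_bound[of m]) (rule that; assumption)
  have M0: "0 \<le> M" by (simp add: M_def)
  have "\<forall>\<^sub>F x::real in at_top. A + x / 4 + B * sqrt (4 * M + 4) \<le> x - M * ln (2 * x^2) - 1 \<and>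
      M * (ln x + 4) + 1 \<le> x / 2 \<and> X \<le> x \<and> X1 \<le> x \<and> 2 * M + 3 \<le> x"
    using M0 AB by (intro eventually_conj) real_asymp+
  then obtain Y where Y: "\<And>x. Y \<le> x \<Longrightarrow> A + x / 4 + B * sqrt (4 * M + 4) \<le> x - M * ln (2 * x^2) - 1 \<and>
      M * (ln x + 4) + 1 \<le> x / 2 \<and> X \<le> x \<and> X1 \<le> x \<and> 2 * M + 3 \<le> x"
    unfolding eventually_at_top_linorder by blast
  have "good0 Y"
    unfolding good0_def
  proof (intro conjI ballI allI impI)
    show "X \<le> Y" "2 * M + 3 \<le> Y" using Y[of Y] by auto
    fix \<zeta> assume z: "\<zeta> \<in> narrow_dom \<eta> Y"
    define x where "x = Re \<zeta>"
    have zx: "Y < x" "\<bar>Im \<zeta>\<bar> < \<eta> * x^2" using z by (auto simp: narrow_dom_def x_def)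
    note Yx = Y[OF less_imp_le[OF zx(1)]]
    have X1x: "X1 < x" "X < x" using zx Y[of Y] by linarith+
    have "\<eta> * x^2 \<le> 1 * x^2" using \<eta>_pos by (intro mult_right_mono) auto
    then have ys: "\<bar>Im \<zeta>\<bar> < x^2" using zx by simp
    show zp: "\<zeta> \<in> parabolic_dom X" using X1x ys by (simp add: parabolic_dom_def x_def)
    have zp1: "\<zeta> \<in> parabolic_dom X1" using X1x ys by (simp add: parabolic_dom_def x_def)
    show "exp (Re \<zeta> / 2) \<le> cmod (expo m \<zeta>)" by (rule X1(2)[OF zp1])
    note n = norm_parabolic_dom[OF zp XK(1)]
    have x0: "1 \<le> x" using n by (simp add: x_def)
    have Kx: "K / x \<le> 1/8" using XK X1x x0 by (simp add: divide_le_eq)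
    define e where "e = sg \<zeta> - (\<zeta> + of_int m * Ln \<zeta>)"
    have e: "cmod e \<le> 1/8" using sg_near[OF zp, folded x_def e_def] Kx by linarith
    have sg: "sg \<zeta> = \<zeta> + of_int m * Ln \<zeta> + e" by (simp add: e_def)
    have ln0: "0 \<le> ln (cmod \<zeta>)" using n by (simp add: ln_ge_zero)
    have ImLn: "\<bar>Im (Ln \<zeta>)\<bar> \<le> 4" using mpi_less_Im_Ln[OF n(4)] Im_Ln_le_pi[OF n(4)] pi_less_4 by auto
    show "cmod \<zeta> / 2 \<le> cmod (sg \<zeta>)"
    proof -
      have cx: "Y \<le> cmod \<zeta>" using zx(1) abs_Re_le_cmod[of \<zeta>] by (simp add: x_def)
      have "cmod (Ln \<zeta>) \<le> ln (cmod \<zeta>) + 4" using cmod_le[of "Ln \<zeta>"] ImLn ln0 n(4) by simp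
      then have "cmod (of_int m * Ln \<zeta>) \<le> M * (ln (cmod \<zeta>) + 4)" unfolding norm_mult M_def by (simp add: mult_left_mono)
      moreover have "M * (ln (cmod \<zeta>) + 4) + 1 \<le> cmod \<zeta> / 2" using Y[OF cx] by blast
      moreover have "cmod \<zeta> \<le> cmod (sg \<zeta>) + cmod (of_int m * Ln \<zeta> + e)" using norm_triangle_ineq4[of "sg \<zeta>" "of_int m * Ln \<zeta> + e"] by (simp add: sg)
      ultimately show ?thesis using norm_triangle_ineq[of "of_int m * Ln \<zeta>" e] e by linarith
    qed
    fix k :: int assume k: "\<bar>Im (sg \<zeta>) - of_int k * pi\<bar> < pi/2 + 3/4"
    have Res: "x - M * ln (2 * x^2) - 1/8 \<le> Re (sg \<zeta>)"
    proof -
      have "ln (cmod \<zeta>) \<le> ln (2 * x^2)" using n by (simp add: x_def)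
      then have "M * ln (cmod \<zeta>) \<le> M * ln (2 * x^2)" using M0 by (rule mult_left_mono)
      moreover have "- (M * ln (cmod \<zeta>)) \<le> real_of_int m * ln (cmod \<zeta>)"
        using mult_right_mono[of "- M" "real_of_int m" "ln (cmod \<zeta>)"] ln0 by (simp add: M_def)
      moreover have "Re (sg \<zeta>) = x + real_of_int m * ln (cmod \<zeta>) + Re e" using n(4) by (simp add: sg x_def)
      ultimately show ?thesis using abs_Re_le_cmod[of e] e by linarith
    qed
    have "\<bar>real_of_int m * Im (Ln \<zeta>)\<bar> \<le> M * 4" unfolding abs_mult M_def using ImLn by (intro mult_left_mono) auto
    moreover have "Im (sg \<zeta>) = Im \<zeta> + real_of_int m * Im (Ln \<zeta>) + Im e" by (simp add: sg)
    ultimately have "\<bar>Im (sg \<zeta>)\<bar> \<le> \<eta> * x^2 + 4 * M + 1/8" using zx(2) abs_Im_le_cmod[of e] e by linarith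
    then have "\<bar>of_int k * pi\<bar> \<le> \<eta> * x^2 + 4 * M + 3" using k pi_less_4 by linarith
    moreover have "\<bar>of_int k * pi\<bar> = \<bar>real_of_int k\<bar> * pi" by (simp add: abs_mult)
    moreover have "\<bar>real_of_int k\<bar> * 1 \<le> \<bar>real_of_int k\<bar> * pi" using pi_gt3 by (intro mult_left_mono) auto
    ultimately have "\<bar>real_of_int k\<bar> \<le> \<eta> * x^2 + (4 * M + 4)" by linarith
    moreover have "real (nat \<bar>k\<bar> - 1) \<le> \<bar>real_of_int k\<bar>" by linarith
    ultimately have kk: "real (nat \<bar>k\<bar> - 1) \<le> \<eta> * x^2 + (4 * M + 4)" by linarith
    have "sqrt (real (nat \<bar>k\<bar> - 1)) \<le> sqrt (\<eta> * x^2 + (4 * M + 4))" using kk by simp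
    also have "\<dots> \<le> sqrt (\<eta> * x^2) + sqrt (4 * M + 4)" using \<eta>_pos M0 by (intro sqrt_add_le_add_sqrt) auto
    also have "sqrt (\<eta> * x^2) = x / (4 * B)" using AB x0 by (simp add: \<eta>_def real_sqrt_mult)
    finally have "B * sqrt (real (nat \<bar>k\<bar> - 1)) \<le> B * (x / (4 * B) + sqrt (4 * M + 4))" using AB by (intro mult_left_mono) auto
    also have "\<dots> = x / 4 + B * sqrt (4 * M + 4)" using AB by (simp add: distrib_left)
    finally have "b (nat \<bar>k\<bar> - 1) - 3/4 < Re (sg \<zeta>)" using Yx Res by linarith
    then show "sg \<zeta> \<in> W k" using k by (simp add: W_def)
  qed
  then show ?thesis by blast
qed

text \<open>The thresholds are fixed by choice so that the domains and the map can be defined inside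
  the locale without parameters.\<close>

definition Y0 where "Y0 = (SOME Y. good0 Y)"

lemma good0_Y0: "good0 Y0" unfolding Y0_def by (rule someI_ex[OF good0_ex])

text \<open>The bound 64 lets a Fatou coordinate advance by 1 inside a disc of radius 1/16 even at
  half of the speed |\<open>expo m\<close>|; the summand 10 (3 + |\<kappa>|) makes the lower-order
  terms of its derivative small against \<open>expo m\<close>; 1/16 \<le> (\<eta>/4) x^2 keeps these
  discs inside \<open>D0\<close>.\<close>

definition good1 where "good1 Y \<longleftrightarrow> (\<forall>x\<ge>Y. (2 * x^2)^2 \<le> exp (x/2) \<and> 64 + 10 * (3 + \<bar>\<kappa>\<bar>) \<le> exp (x/2) \<and>
   1/16 \<le> (\<eta> / 4) * x^2 \<and> Y0 + 1 \<le> x)"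

definition Y1 where "Y1 = (SOME Y. good1 Y)"

lemma good1_Y1: "good1 Y1"
proof -
  have e0: "0 < \<eta>" by (rule \<eta>_pos)
  have "\<forall>\<^sub>F x::real in at_top. (2 * x^2)^2 \<le> exp (x/2) \<and> 64 + 10 * (3 + \<bar>\<kappa>\<bar>) \<le> exp (x/2) \<and>
     1/16 \<le> (\<eta> / 4) * x^2 \<and> Y0 + 1 \<le> x"
    using e0 by (intro eventually_conj eventually_ge_at_top) real_asymp+
  then have "\<exists>Y. good1 Y" unfolding eventually_at_top_linorder good1_def by blast
  then show ?thesis unfolding Y1_def by (rule someI_ex)
qed

definition D0 where "D0 = narrow_dom \<eta> Y0"
definition D1 where "D1 = narrow_dom (\<eta> / 4) Y1"

text \<open>Domain of the chart \<open>Phi k\<close>. It is wider than \<open>core k\<close> by 1/4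
  on each side; \<open>sg\<close> varies by at most 1/8 over a disc of radius 1/16, so such discs
  around core points remain in \<open>E k\<close>.\<close>

definition E :: "int \<Rightarrow> complex set" where "E k = {\<zeta>\<in>D0. \<bar>Im (sg \<zeta>) - of_int k * pi\<bar> < pi/2 + 3/4}"

definition Phi :: "int \<Rightarrow> complex \<Rightarrow> complex" where "Phi k \<zeta> = Psi \<zeta> + Rz k (sg \<zeta>)"

lemma D0_props:
  assumes "\<zeta> \<in> D0"
  shows "\<zeta> \<in> parabolic_dom X" "cmod \<zeta> / 2 \<le> cmod (sg \<zeta>)" "exp (Re \<zeta> / 2) \<le> cmod (expo m \<zeta>)"
    "2 * M + 3 < Re \<zeta>" "Y0 < Re \<zeta>" "1 \<le> cmod \<zeta>" "\<zeta> \<noteq> 0" "K / Re \<zeta> \<le> 1/8"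
    "(sg has_field_derivative deriv sg \<zeta>) (at \<zeta>)" "cmod (deriv sg \<zeta>) \<le> 9/8" "cmod (deriv sg \<zeta> - 1) \<le> 1/8"
proof -
  show zp: "\<zeta> \<in> parabolic_dom X" "cmod \<zeta> / 2 \<le> cmod (sg \<zeta>)" "exp (Re \<zeta> / 2) \<le> cmod (expo m \<zeta>)"
    using assms good0_Y0 by (auto simp: good0_def D0_def)
  show Y: "Y0 < Re \<zeta>" using assms by (simp add: D0_def narrow_dom_def)
  then show "2 * M + 3 < Re \<zeta>" using good0_Y0 by (simp add: good0_def)
  show "1 \<le> cmod \<zeta>" "\<zeta> \<noteq> 0" using norm_parabolic_dom[OF zp(1) XK(1)] by auto
  have "X < Re \<zeta>" using zp(1) by (simp add: parabolic_dom_def)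
  then show Kx: "K / Re \<zeta> \<le> 1/8" using XK by (simp add: divide_le_eq)
  show "(sg has_field_derivative deriv sg \<zeta>) (at \<zeta>)" by (rule sg_deriv[OF zp(1)])
  show d: "cmod (deriv sg \<zeta> - 1) \<le> 1/8" using sg_deriv_near[OF zp(1)] Kx by linarith
  then show "cmod (deriv sg \<zeta>) \<le> 9/8" using norm_triangle_ineq2[of "deriv sg \<zeta>" 1] by simp
qed

lemma E_W: "\<zeta> \<in> E k \<Longrightarrow> sg \<zeta> \<in> W k" and E_D0: "\<zeta> \<in> E k \<Longrightarrow> \<zeta> \<in> D0"
  using good0_Y0 by (auto simp: E_def D0_def good0_def)

text \<open>The weighted bound on R' turns into 1/|\<zeta>|^2, because |\<open>sg \<zeta>\<close>|
  \<ge> |\<zeta>|/2. The bound does not depend on k, and this is the source of the uniform error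
  term of the theorem.\<close>

lemma Phi_deriv:
  assumes z: "\<zeta> \<in> E k"
  obtains e where "(Phi k has_field_derivative (expo m \<zeta> - 1 - of_real \<kappa> / \<zeta> + e)) (at \<zeta>)" "cmod e \<le> 2 / (cmod \<zeta>)^2"
proof -
  note D = D0_props[OF E_D0[OF z]] and Rp = Rz_props[OF E_W[OF z]]
  define e where "e = deriv (Rz k) (sg \<zeta>) * deriv sg \<zeta>"
  have "(Phi k has_field_derivative (expo m \<zeta> - 1 - of_real \<kappa> / \<zeta> + e)) (at \<zeta>)"
    unfolding Phi_def[abs_def] e_def
    by (rule DERIV_add[OF Psi_deriv[OF D(1)] DERIV_chain2[OF Rp(2) D(9)]])
  moreover have "cmod e \<le> 2 / (cmod \<zeta>)^2"
  proof -
    have "(cmod \<zeta> / 2)^2 \<le> (1 + cmod (sg \<zeta>))^2" using D(2) by (intro power_mono) auto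
    then have "cmod (deriv (Rz k) (sg \<zeta>)) * (cmod \<zeta> / 2)^2 \<le> cmod (deriv (Rz k) (sg \<zeta>)) * (1 + cmod (sg \<zeta>))^2"
      by (intro mult_left_mono) auto
    also have "\<dots> \<le> 1/4" by (rule Rp(3))
    finally have 1: "cmod (deriv (Rz k) (sg \<zeta>)) * (cmod \<zeta>)^2 \<le> 1" by (simp add: power_divide)
    have "cmod e * (cmod \<zeta>)^2 = (cmod (deriv (Rz k) (sg \<zeta>)) * (cmod \<zeta>)^2) * cmod (deriv sg \<zeta>)" by (simp add: e_def norm_mult)
    also have "\<dots> \<le> 1 * (9/8)" using 1 D(10) by (intro mult_mono) auto
    also have "\<dots> \<le> 2" by simp
    finally show ?thesis using D(7) by (simp add: pos_le_divide_eq)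
  qed
  ultimately show thesis by (rule that)
qed

lemma D1_props:
  assumes "\<zeta> \<in> D1"
  shows "\<zeta> \<in> D0" "ball \<zeta> (1/16) \<subseteq> D0" "64 + 10 * (3 + \<bar>\<kappa>\<bar>) \<le> cmod (expo m \<zeta>)" "(cmod \<zeta>)^2 \<le> cmod (expo m \<zeta>)"
proof -
  define x where "x = Re \<zeta>"
  have z: "Y1 < x" "\<bar>Im \<zeta>\<bar> < \<eta> / 4 * x^2" using assms by (auto simp: D1_def narrow_dom_def x_def)
  have g: "(2 * x^2)^2 \<le> exp (x/2)" "64 + 10 * (3 + \<bar>\<kappa>\<bar>) \<le> exp (x/2)" "1/16 \<le> (\<eta> / 4) * x^2" "Y0 + 1 \<le> x"
    using good1_Y1 z by (auto simp: good1_def)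
  have x3: "3 \<le> x"
  proof -
    have "2 * M + 3 \<le> Y0" using good0_Y0 unfolding good0_def by blast
    moreover have "0 \<le> M" by (simp add: M_def)
    ultimately show ?thesis using g(4) by linarith
  qed
  show sub: "ball \<zeta> (1/16) \<subseteq> D0"
  proof
    fix w assume "w \<in> ball \<zeta> (1/16)"
    then have w: "cmod (\<zeta> - w) < 1/16" by (simp add: dist_norm)
    then have "\<bar>x - Re w\<bar> < 1/16" "\<bar>Im \<zeta> - Im w\<bar> < 1/16"
      using abs_Re_le_cmod[of "\<zeta> - w"] abs_Im_le_cmod[of "\<zeta> - w"] by (auto simp: x_def)
    then have 1: "Y0 < Re w" "\<bar>Im w\<bar> < \<eta> / 4 * x^2 + 1/16" "x - 1/16 \<le> Re w" using g z by linarith+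
    have "x^2 \<le> 2 * (x - 1/16)^2"
    proof -
      have "2 * (x - 1/16)^2 - x^2 = x * (x - 1/4) + 1/128" by (simp add: power2_eq_square algebra_simps)
      moreover have "0 \<le> x * (x - 1/4)" using x3 by (intro mult_nonneg_nonneg) auto
      ultimately show ?thesis by linarith
    qed
    moreover have "(x - 1/16)^2 \<le> (Re w)^2" using 1 x3 by (intro power_mono) auto
    ultimately have "\<eta> / 2 * x^2 \<le> \<eta> / 2 * (2 * (Re w)^2)" using \<eta>_pos by (intro mult_left_mono) auto
    then have "\<bar>Im w\<bar> < \<eta> * (Re w)^2" using 1(2) g(3) by simp
    then show "w \<in> D0" using 1(1) by (simp add: D0_def narrow_dom_def)
  qed
  then show zD: "\<zeta> \<in> D0" by auto
  note D = D0_props[OF zD]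
  show "64 + 10 * (3 + \<bar>\<kappa>\<bar>) \<le> cmod (expo m \<zeta>)" using g(2) D(3) by (simp add: x_def)
  have "(cmod \<zeta>)^2 \<le> (2 * x^2)^2" using norm_parabolic_dom(3)[OF D(1) XK(1)] by (intro power_mono) (auto simp: x_def)
  then show "(cmod \<zeta>)^2 \<le> cmod (expo m \<zeta>)" using g(1) D(3) by (simp add: x_def)
qed

definition core :: "int \<Rightarrow> complex set" where "core k = {\<zeta>\<in>D1. \<bar>Im (sg \<zeta>) - of_int k * pi\<bar> \<le> pi/2 + 1/2}"

lemma sg_near_ball:
  assumes "\<zeta> \<in> D1" "w \<in> ball \<zeta> (1/16)"
  shows "cmod (sg w - sg \<zeta>) \<le> 1/8"
proof -
  have "cmod (sg w - sg \<zeta>) \<le> 9/8 * cmod (w - \<zeta>)"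
  proof (rule field_differentiable_bound[of "ball \<zeta> (1/16)" sg "deriv sg"])
    show "(sg has_field_derivative deriv sg x) (at x within ball \<zeta> (1/16))" if "x \<in> ball \<zeta> (1/16)" for x
      using D0_props(9)[of x] D1_props(2)[OF assms(1)] that has_field_derivative_at_within by blast
    show "cmod (deriv sg x) \<le> 9/8" if "x \<in> ball \<zeta> (1/16)" for x
      using D0_props(10)[of x] D1_props(2)[OF assms(1)] that by blast
  qed (use assms in auto)
  also have "\<dots> \<le> 9/8 * (1/16)" using assms(2) by (intro mult_left_mono) (auto simp: dist_norm norm_minus_commute)
  finally show ?thesis by simp
qed

lemma core_ball:
  assumes "\<zeta> \<in> core k"
  shows "ball \<zeta> (1/16) \<subseteq> E k"
proof
  fix w assume w: "w \<in> ball \<zeta> (1/16)"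
  have z: "\<zeta> \<in> D1" "\<bar>Im (sg \<zeta>) - of_int k * pi\<bar> \<le> pi/2 + 1/2" using assms by (auto simp: core_def)
  have "\<bar>Im (sg w - sg \<zeta>)\<bar> \<le> 1/8" using sg_near_ball[OF z(1) w] abs_Im_le_cmod[of "sg w - sg \<zeta>"] by linarith
  moreover have "Im (sg w - sg \<zeta>) = Im (sg w) - Im (sg \<zeta>)" by simp
  ultimately have "\<bar>Im (sg w) - of_int k * pi\<bar> < pi/2 + 3/4" using z(2) by linarith
  then show "w \<in> E k" using D1_props(2)[OF z(1)] w by (auto simp: E_def)
qed

text \<open>\<open>local_solve\<close> with slope \<open>expo m \<zeta>\<close>: over the disc
  \<open>expo m\<close> changes by at most 9/32 of its size, and the remaining terms of the
  derivative are at most 3 + |\<kappa>|.\<close>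

lemma core_solve:
  assumes z: "\<zeta> \<in> core k"
  shows "inj_on (Phi k) (ball \<zeta> (1/16))"
    and "\<And>w w'. w \<in> ball \<zeta> (1/16) \<Longrightarrow> w' \<in> ball \<zeta> (1/16) \<Longrightarrow> cmod (expo m \<zeta>) / 2 * cmod (w - w') \<le> cmod (Phi k w - Phi k w')"
    and "\<exists>w\<in>ball \<zeta> (1/16). Phi k w = Phi k \<zeta> + 1"
proof -
  define f' where "f' w = deriv (Phi k) w" for w
  have zD: "\<zeta> \<in> D1" using z by (simp add: core_def)
  note P = D1_props[OF zD] and D = D0_props[OF D1_props(1)[OF zD]]
  have der: "(Phi k has_field_derivative f' w) (at w)" and near: "cmod (f' w - expo m \<zeta>) \<le> cmod (expo m \<zeta>) / 2"
    if w: "w \<in> ball \<zeta> (1/16)" for w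
  proof -
    have wE: "w \<in> E k" using core_ball[OF z] w by blast
    obtain e where e: "(Phi k has_field_derivative (expo m w - 1 - of_real \<kappa> / w + e)) (at w)" "cmod e \<le> 2 / (cmod w)^2"
      by (rule Phi_deriv[OF wE])
    have f': "f' w = expo m w - 1 - of_real \<kappa> / w + e" unfolding f'_def by (rule DERIV_imp_deriv[OF e(1)])
    show "(Phi k has_field_derivative f' w) (at w)" unfolding f' by (rule e(1))
    have wz: "cmod (w - \<zeta>) \<le> 1/16" using w by (simp add: dist_norm norm_minus_commute)
    have "2 * \<bar>real_of_int m\<bar> + 2 \<le> Re \<zeta>" using D(4) by (simp add: M_def)
    note en = expo_near[OF this wz]
    have 1: "cmod (expo m w - expo m \<zeta>) \<le> 9/32 * cmod (expo m \<zeta>)"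
    proof -
      have "expo m w - expo m \<zeta> = (expo m w / expo m \<zeta> - 1) * expo m \<zeta>" by (simp add: field_simps)
      then show ?thesis using en(4) by (simp add: norm_mult mult_right_mono)
    qed
    have "2 / (cmod w)^2 \<le> 2" using en(3) by (simp add: divide_le_eq one_le_power)
    then have e2: "cmod e \<le> 2" using e(2) by linarith
    have kw: "cmod (of_real \<kappa> / w) \<le> \<bar>\<kappa>\<bar>" using en(3) by (simp add: norm_divide divide_le_eq mult_le_cancel_left1)
    have "f' w - expo m \<zeta> = (expo m w - expo m \<zeta>) + (e - (1 + of_real \<kappa> / w))" by (simp add: f')
    then have "cmod (f' w - expo m \<zeta>) \<le> cmod (expo m w - expo m \<zeta>) + (cmod e + cmod (1 + of_real \<kappa> / w))"
      by (metis norm_triangle_ineq norm_triangle_ineq4 add_left_mono order_trans)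
    also have "\<dots> \<le> 9/32 * cmod (expo m \<zeta>) + (2 + (1 + \<bar>\<kappa>\<bar>))"
      using 1 e2 kw norm_triangle_ineq[of 1 "of_real \<kappa> / w"] by simp
    also have "\<dots> \<le> cmod (expo m \<zeta>) / 2" using P(3) by simp
    finally show "cmod (f' w - expo m \<zeta>) \<le> cmod (expo m \<zeta>) / 2" .
  qed
  have a: "expo m \<zeta> \<noteq> 0" and r: "0 < (1/16::real)" by simp_all
  note L = local_solve[OF r a der near]
  show "inj_on (Phi k) (ball \<zeta> (1/16))" by (rule L(1))
  show "\<And>w w'. w \<in> ball \<zeta> (1/16) \<Longrightarrow> w' \<in> ball \<zeta> (1/16) \<Longrightarrow> cmod (expo m \<zeta>) / 2 * cmod (w - w') \<le> cmod (Phi k w - Phi k w')" by (rule L(2))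
  show "\<exists>w\<in>ball \<zeta> (1/16). Phi k w = Phi k \<zeta> + 1" using P(3) by (intro L(3)) auto
qed

end

section \<open>Compatibility of the charts and construction of the map\<close>

context atlas
begin

lemma E_overlap:
  assumes "\<zeta> \<in> E k" "\<zeta> \<in> E (k + 1)"
  shows "\<bar>Im (sg \<zeta>) - (of_int k + 1/2) * pi\<bar> < 3/4"
proof -
  have "\<bar>Im (sg \<zeta>) - of_int k * pi\<bar> < pi/2 + 3/4" "\<bar>Im (sg \<zeta>) - of_int (k + 1) * pi\<bar> < pi/2 + 3/4"
    using assms by (auto simp: E_def)
  moreover have "of_int (k + 1) * pi = of_int k * pi + pi" "(of_int k + 1/2) * pi = of_int k * pi + pi/2"
    by (simp_all add: algebra_simps)
  ultimately show ?thesis by linarith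
qed

lemma Psi_sg: "\<zeta> \<in> E k \<Longrightarrow> Phi k \<zeta> = exp (sg \<zeta>) + Rz k (sg \<zeta>)"
  using exp_sg[OF D0_props(1)[OF E_D0]] by (simp add: Phi_def)

lemma Phi_glue_nonneg:
  assumes k: "0 \<le> k" and z: "\<zeta> \<in> E k" "\<zeta> \<in> E (k + 1)"
  shows "Phi (k + 1) \<zeta> = Phi k \<zeta> + hlog k (h (nat k)) (Phi k \<zeta>)" "h (nat k) (hexp k (Phi k \<zeta>)) \<noteq> 0"
proof -
  have kn: "int (nat k) = k" "nat (k + 1) = Suc (nat k)" "nat \<bar>k + 1\<bar> - 1 = nat k" using k by auto
  have "b (nat k) - 3/4 < Re (sg \<zeta>)" using E_W[OF z(2)] kn(3) by (simp add: W_def)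
  then have s: "sg \<zeta> \<in> overlap b (3/4) (nat k)" using E_overlap[OF z] k by (simp add: overlap_def)
  have Rk: "Rz k (sg \<zeta>) = R (nat k) (sg \<zeta>)" "Rz (k + 1) (sg \<zeta>) = R (Suc (nat k)) (sg \<zeta>)"
    using k kn(2) by (simp_all add: Rz_def)
  show "Phi (k + 1) \<zeta> = Phi k \<zeta> + hlog k (h (nat k)) (Phi k \<zeta>)"
    using R_glue[OF s, unfolded kn(1)] unfolding Psi_sg[OF z(1)] Psi_sg[OF z(2)] Rk by simp
  show "h (nat k) (hexp k (Phi k \<zeta>)) \<noteq> 0"
    using h_nz[OF s, unfolded kn(1)] unfolding Psi_sg[OF z(1)] Rk .
qed

text \<open>Reflection sends overlap k to overlap l = - k - 1 and reverses the order of the two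
  strips. The germ of index l therefore expresses the conjugate of \<open>Phi k\<close> through that
  of \<open>Phi (k + 1)\<close>, in the opposite direction to the case k \<ge> 0.\<close>

lemma Phi_glue_neg:
  assumes k: "k < 0" and z: "\<zeta> \<in> E k" "\<zeta> \<in> E (k + 1)"
  defines "l \<equiv> - k - 1"
  shows "cnj (Phi k \<zeta>) = cnj (Phi (k + 1) \<zeta>) + hlog l (h (nat l)) (cnj (Phi (k + 1) \<zeta>))"
    "h (nat l) (hexp l (cnj (Phi (k + 1) \<zeta>))) \<noteq> 0"
proof -
  have l: "0 \<le> l" "nat (- k) = Suc (nat l)" "nat \<bar>k\<bar> - 1 = nat l" "- (k + 1) = l" "k + 1 \<le> 0" "of_int l = - of_int k - (1::real)"
    using k by (auto simp: l_def)
  define s where "s = cnj (sg \<zeta>)"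
  have "b (nat l) - 3/4 < Re s" using E_W[OF z(1)] l(3) by (simp add: W_def s_def)
  moreover have "\<bar>Im s - (of_int l + 1/2) * pi\<bar> < 3/4"
  proof -
    have "Im s - (of_int l + 1/2) * pi = - (Im (sg \<zeta>) - (of_int k + 1/2) * pi)" by (simp add: s_def l(6) algebra_simps)
    then show ?thesis using E_overlap[OF z] by linarith
  qed
  ultimately have s: "s \<in> overlap b (3/4) (nat l)" using l(1) by (simp add: overlap_def)
  have R1: "cnj (Rz k (sg \<zeta>)) = R (Suc (nat l)) s" using k l by (simp add: Rz_def s_def)
  have R2: "cnj (Rz (k + 1) (sg \<zeta>)) = R (nat l) s"
  \<comment> \<open>For k = -1 the upper strip is strip 0, which is its own reflection; there R 0
    commutes with conjugation.\<close>
  proof (cases "k + 1 = 0")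
    case True
    then have l0: "l = 0" by (simp add: l_def)
    have "s \<in> patch b (3/4) 0" using s overlap_subset_patch(1)[of b "3/4" 0] AB l0 by (auto simp: mono_def)
    then have "R 0 (cnj s) = cnj (R 0 s)" by (rule R_cnj)
    then show ?thesis using True l0 by (simp add: Rz_def s_def)
  next
    case False
    then have "\<not> 0 \<le> k + 1" using k by simp
    then show ?thesis using l(4) by (simp add: Rz_def s_def)
  qed
  have e: "cnj (exp (sg \<zeta>)) = exp s" by (simp add: s_def exp_cnj)
  show "cnj (Phi k \<zeta>) = cnj (Phi (k + 1) \<zeta>) + hlog l (h (nat l)) (cnj (Phi (k + 1) \<zeta>))"
    using R_glue[OF s] l(1) unfolding Psi_sg[OF z(1)] Psi_sg[OF z(2)] complex_cnj_add R1 R2 e by simp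
  show "h (nat l) (hexp l (cnj (Phi (k + 1) \<zeta>))) \<noteq> 0"
    using h_nz[OF s] l(1) unfolding Psi_sg[OF z(2)] complex_cnj_add R2 e by simp
qed

lemma hlog_plus_one: "hlog k g (w + 1) = hlog k g w" by (simp add: hlog_def)

text \<open>The translation part \<open>hlog\<close> has period 1, so a step by 1 passes through the
  gluing relation, but only in the direction in which the germ expresses one coordinate by the
  other.\<close>

lemma Phi_step_transfer:
  assumes z: "\<zeta> \<in> E k" "\<zeta> \<in> E (k + 1)" "\<zeta>' \<in> E k" "\<zeta>' \<in> E (k + 1)"
  shows "0 \<le> k \<Longrightarrow> Phi k \<zeta>' = Phi k \<zeta> + 1 \<Longrightarrow> Phi (k + 1) \<zeta>' = Phi (k + 1) \<zeta> + 1"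
    and "k < 0 \<Longrightarrow> Phi (k + 1) \<zeta>' = Phi (k + 1) \<zeta> + 1 \<Longrightarrow> Phi k \<zeta>' = Phi k \<zeta> + 1"
proof -
  show "Phi (k + 1) \<zeta>' = Phi (k + 1) \<zeta> + 1" if "0 \<le> k" "Phi k \<zeta>' = Phi k \<zeta> + 1"
    using Phi_glue_nonneg(1)[OF that(1) z(1,2)] Phi_glue_nonneg(1)[OF that(1) z(3,4)] that(2) by (simp add: hlog_plus_one)
  show "Phi k \<zeta>' = Phi k \<zeta> + 1" if k: "k < 0" and eq: "Phi (k + 1) \<zeta>' = Phi (k + 1) \<zeta> + 1"
  proof -
    have "cnj (Phi k \<zeta>') = cnj (Phi k \<zeta>) + 1"
      using Phi_glue_neg(1)[OF k z(1,2)] Phi_glue_neg(1)[OF k z(3,4)] eq by (simp add: hlog_plus_one)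
    then have "cnj (cnj (Phi k \<zeta>')) = cnj (cnj (Phi k \<zeta>) + 1)" by (rule arg_cong)
    then show ?thesis by simp
  qed
qed

lemma core_unique:
  assumes "\<zeta> \<in> core k" "w \<in> ball \<zeta> (1/16)" "w' \<in> ball \<zeta> (1/16)" "Phi k w = Phi k w'"
  shows "w = w'"
  using core_solve(1)[OF assms(1)] assms(2-4) by (auto dest: inj_onD)

definition idx :: "complex \<Rightarrow> int" where "idx \<zeta> = round (Im (sg \<zeta>) / pi)"

lemma idx: "\<bar>Im (sg \<zeta>) - of_int (idx \<zeta>) * pi\<bar> \<le> pi/2"
proof -
  have "\<bar>of_int (idx \<zeta>) - Im (sg \<zeta>) / pi\<bar> * pi \<le> 1/2 * pi"
    unfolding idx_def by (intro mult_right_mono of_int_round_abs_le) auto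
  moreover have "\<bar>of_int (idx \<zeta>) - Im (sg \<zeta>) / pi\<bar> * pi = \<bar>(of_int (idx \<zeta>) - Im (sg \<zeta>) / pi) * pi\<bar>"
    unfolding abs_mult by simp
  moreover have "(of_int (idx \<zeta>) - Im (sg \<zeta>) / pi) * pi = - (Im (sg \<zeta>) - of_int (idx \<zeta>) * pi)"
    by (simp add: left_diff_distrib)
  ultimately have "\<bar>- (Im (sg \<zeta>) - of_int (idx \<zeta>) * pi)\<bar> \<le> 1/2 * pi" by (simp only:)
  then show ?thesis unfolding abs_minus_cancel by simp
qed

lemma idx_core: "\<zeta> \<in> D1 \<Longrightarrow> \<zeta> \<in> core (idx \<zeta>)"
  using idx[of \<zeta>] by (simp add: core_def)

definition F :: "complex \<Rightarrow> complex" where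
  "F \<zeta> = (SOME w. w \<in> ball \<zeta> (1/16) \<and> Phi (idx \<zeta>) w = Phi (idx \<zeta>) \<zeta> + 1)"

lemma F_idx:
  assumes z: "\<zeta> \<in> D1"
  shows "F \<zeta> \<in> ball \<zeta> (1/16) \<and> Phi (idx \<zeta>) (F \<zeta>) = Phi (idx \<zeta>) \<zeta> + 1"
proof -
  have "\<exists>w. w \<in> ball \<zeta> (1/16) \<and> Phi (idx \<zeta>) w = Phi (idx \<zeta>) \<zeta> + 1"
    using core_solve(3)[OF idx_core[OF z]] by blast
  from someI_ex[OF this] show ?thesis unfolding F_def .
qed

text \<open>Neighbouring charts define the same map. Along the gluing relation the equation is
  transferred directly; against it, the solution in the source chart is transferred instead and
  identified with the given one by injectivity on the disc.\<close>

lemma F_core: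
  assumes z: "\<zeta> \<in> core k"
  shows "F \<zeta> \<in> ball \<zeta> (1/16)" "Phi k (F \<zeta>) = Phi k \<zeta> + 1"
proof -
  have zD: "\<zeta> \<in> D1" using z by (simp add: core_def)
  note Fi = F_idx[OF zD]
  show "F \<zeta> \<in> ball \<zeta> (1/16)" using Fi by blast
  have neighbour: "Phi j (F \<zeta>) = Phi j \<zeta> + 1 \<longleftrightarrow> Phi (j + 1) (F \<zeta>) = Phi (j + 1) \<zeta> + 1" if c: "\<zeta> \<in> core j" "\<zeta> \<in> core (j + 1)" for j
  proof -
    have zz: "\<zeta> \<in> ball \<zeta> (1/16)" by simp
    have E: "w \<in> E j" "w \<in> E (j + 1)" if "w \<in> ball \<zeta> (1/16)" for w
      using core_ball[OF c(1)] core_ball[OF c(2)] that by blast+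
    obtain w where w: "w \<in> ball \<zeta> (1/16)" "Phi j w = Phi j \<zeta> + 1" using core_solve(3)[OF c(1)] by blast
    obtain w' where w': "w' \<in> ball \<zeta> (1/16)" "Phi (j + 1) w' = Phi (j + 1) \<zeta> + 1" using core_solve(3)[OF c(2)] by blast
    have Fb: "F \<zeta> \<in> ball \<zeta> (1/16)" using Fi by blast
    show ?thesis
    proof (cases "0 \<le> j")
      case True
      have "Phi (j + 1) w = Phi (j + 1) \<zeta> + 1" by (rule Phi_step_transfer(1)[OF E[OF zz] E[OF w(1)] True w(2)])
      then have "Phi j (F \<zeta>) = Phi j \<zeta> + 1" if "Phi (j + 1) (F \<zeta>) = Phi (j + 1) \<zeta> + 1"
        using core_unique[OF c(2) w(1) Fb] w(2) that by simp
      then show ?thesis using Phi_step_transfer(1)[OF E[OF zz] E[OF Fb] True] by blast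
    next
      case False
      then have j: "j < 0" by simp
      have "Phi j w' = Phi j \<zeta> + 1" by (rule Phi_step_transfer(2)[OF E[OF zz] E[OF w'(1)] j w'(2)])
      then have "Phi (j + 1) (F \<zeta>) = Phi (j + 1) \<zeta> + 1" if "Phi j (F \<zeta>) = Phi j \<zeta> + 1"
        using core_unique[OF c(1) w'(1) Fb] w'(2) that by simp
      then show ?thesis using Phi_step_transfer(2)[OF E[OF zz] E[OF Fb] j] by blast
    qed
  qed
  have "\<bar>of_int k * pi - of_int (idx \<zeta>) * pi\<bar> \<le> pi + 1/2"
  proof -
    have "\<bar>Im (sg \<zeta>) - of_int k * pi\<bar> \<le> pi/2 + 1/2" using z by (simp add: core_def)
    then show ?thesis using idx[of \<zeta>] by linarith
  qed
  moreover have "of_int (k - idx \<zeta>) * pi = of_int k * pi - of_int (idx \<zeta>) * pi" by (simp add: left_diff_distrib)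
  moreover have "\<bar>real_of_int (k - idx \<zeta>)\<bar> * pi = \<bar>of_int (k - idx \<zeta>) * pi\<bar>" unfolding abs_mult by simp
  ultimately have "\<bar>real_of_int (k - idx \<zeta>)\<bar> * pi \<le> pi + 1/2" by (simp only:)
  \<comment> \<open>The cores of two strips whose numbers differ by 2 or more are too far apart to
    share a point with such a nearest strip: pi + 1/2 < 2 pi.\<close>
  then have k2: "\<bar>k - idx \<zeta>\<bar> < 2"
  proof -
    assume a: "\<bar>real_of_int (k - idx \<zeta>)\<bar> * pi \<le> pi + 1/2"
    show ?thesis
    proof (rule ccontr)
      assume "\<not> \<bar>k - idx \<zeta>\<bar> < 2"
      then have "2 \<le> \<bar>real_of_int (k - idx \<zeta>)\<bar>" by linarith
      then have "2 * pi \<le> \<bar>real_of_int (k - idx \<zeta>)\<bar> * pi" by (intro mult_right_mono) auto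
      then show False using a pi_gt3 by linarith
    qed
  qed
  then consider "k = idx \<zeta>" | "k = idx \<zeta> + 1" | "idx \<zeta> = k + 1" by linarith
  then show "Phi k (F \<zeta>) = Phi k \<zeta> + 1"
  proof cases
    case 1
    then show ?thesis using Fi by simp
  next
    case 2
    then show ?thesis using neighbour[of "idx \<zeta>"] Fi idx_core[OF zD] z by simp
  next
    case 3
    then show ?thesis using neighbour[of k] Fi idx_core[OF zD] z by simp
  qed
qed

lemma F_step:
  assumes z: "\<zeta> \<in> D1"
  shows "cmod (F \<zeta> - \<zeta>) \<le> 2 / cmod (expo m \<zeta>)" "cmod (F \<zeta> - \<zeta>) \<le> 1/32"
proof -
  note c = idx_core[OF z]
  note Fi = F_core[OF c]
  have "cmod (expo m \<zeta>) / 2 * cmod (F \<zeta> - \<zeta>) \<le> 1"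
    using core_solve(2)[OF c Fi(1), of \<zeta>] Fi(2) by simp
  then show 1: "cmod (F \<zeta> - \<zeta>) \<le> 2 / cmod (expo m \<zeta>)" by (simp add: field_simps)
  have "2 / cmod (expo m \<zeta>) \<le> 2 / 64" using D1_props(3)[OF z] by (intro divide_left_mono) auto
  then show "cmod (F \<zeta> - \<zeta>) \<le> 1/32" using 1 by linarith
qed

lemma F_unique:
  assumes "\<zeta> \<in> core k" "w \<in> ball \<zeta> (1/16)" "Phi k w = Phi k \<zeta> + 1"
  shows "w = F \<zeta>"
  using core_unique[OF assms(1,2) F_core(1)[OF assms(1)]] F_core(2)[OF assms(1)] assms(3) by simp

lemma open_D1: "open D1" by (simp add: D1_def open_narrow_dom)

lemma Phi_hol: "Phi k holomorphic_on S" if "S \<subseteq> E k" "open S"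
  unfolding holomorphic_on_open[OF that(2)] using Phi_deriv that(1) by (metis subsetD)

text \<open>Near \<zeta> the map is the local inverse of \<open>Phi k\<close> after
  \<open>Phi k\<close> + 1 for the single chart k = \<open>idx \<zeta>\<close>. At nearby points
  \<open>idx\<close> may pick another chart, but by \<open>F_core\<close> the value is the
  same.\<close>

lemma F_hol: "F holomorphic_on D1"
  unfolding holomorphic_on_def
proof
  fix \<zeta> assume z: "\<zeta> \<in> D1"
  define k where "k = idx \<zeta>"
  have c: "\<zeta> \<in> core k" by (simp add: k_def idx_core[OF z])
  let ?B = "ball \<zeta> (1/16)"
  have hol: "Phi k holomorphic_on ?B" by (rule Phi_hol[OF core_ball[OF c] open_ball])
  obtain g where g: "g holomorphic_on Phi k ` ?B" "\<And>w. w \<in> ?B \<Longrightarrow> g (Phi k w) = w"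
    using holomorphic_has_inverse[OF hol open_ball core_solve(1)[OF c]] by metis
  have op: "open (Phi k ` ?B)" by (rule open_mapping_thm3[OF hol open_ball core_solve(1)[OF c]])
  define N where "N = D1 \<inter> ball \<zeta> (1/32)"
  have N: "open N" "\<zeta> \<in> N" using open_D1 z by (auto simp: N_def)
  have main: "F w \<in> ?B" "Phi k w + 1 = Phi k (F w)" if w: "w \<in> N" for w
  proof -
    have wD: "w \<in> D1" and wz: "cmod (\<zeta> - w) < 1/32" using w by (auto simp: N_def dist_norm)
    have "dist \<zeta> (F w) \<le> dist \<zeta> w + dist w (F w)" by (rule dist_triangle)
    also have "\<dots> < 1/32 + 1/32" using wz F_step(2)[OF wD] by (simp add: dist_norm norm_minus_commute)
    finally show "F w \<in> ?B" by simp
    have "w \<in> ?B" using wz by (simp add: dist_norm)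
    then have "\<bar>Im (sg w - sg \<zeta>)\<bar> \<le> 1/8" using sg_near_ball[OF z] abs_Im_le_cmod order_trans by blast
    moreover have "\<bar>Im (sg \<zeta>) - of_int k * pi\<bar> \<le> pi/2" unfolding k_def by (rule idx)
    moreover have "Im (sg w - sg \<zeta>) = Im (sg w) - Im (sg \<zeta>)" by simp
    ultimately have "\<bar>Im (sg w) - of_int k * pi\<bar> \<le> pi/2 + 1/2" by linarith
    then have "w \<in> core k" using wD by (simp add: core_def)
    then show "Phi k w + 1 = Phi k (F w)" using F_core(2) by simp
  qed
  have Phi_N: "Phi k holomorphic_on N"
    by (rule holomorphic_on_subset[OF hol]) (auto simp: N_def)
  have "(g \<circ> (\<lambda>w. Phi k w + 1)) holomorphic_on N"
  proof (rule holomorphic_on_compose_gen)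
    show "(\<lambda>w. Phi k w + 1) holomorphic_on N" by (intro holomorphic_intros Phi_N)
    show "g holomorphic_on Phi k ` ?B" by (rule g(1))
    show "(\<lambda>w. Phi k w + 1) ` N \<subseteq> Phi k ` ?B" using main by auto
  qed
  then have "F holomorphic_on N"
    by (rule holomorphic_transform) (use main g(2) in \<open>simp add: o_def\<close>)
  then have "F field_differentiable at \<zeta>" using N by (rule holomorphic_on_imp_differentiable_at)
  then show "F field_differentiable at \<zeta> within D1" by (rule field_differentiable_at_within)
qed

text \<open>\<open>Phi 0\<close> commutes with conjugation, so for real \<zeta> the conjugate of
  \<open>F \<zeta>\<close> solves the equation that characterises \<open>F \<zeta>\<close> in the
  same disc.\<close>

lemma F_real:
  assumes z: "\<zeta> \<in> D1" and r: "Im \<zeta> = 0"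
  shows "Im (F \<zeta>) = 0"
proof -
  have zr: "cnj \<zeta> = \<zeta>" using r by (simp add: complex_eq_iff)
  have sym: "cnj w \<in> E 0 \<and> Phi 0 (cnj w) = cnj (Phi 0 w)" if w: "w \<in> E 0" for w
  proof -
    note D = D0_props[OF E_D0[OF w]]
    have s: "sg (cnj w) = cnj (sg w)" by (rule sg_cnj[OF D(1)])
    have cw: "cnj w \<in> E 0" using w s by (auto simp: E_def D0_def narrow_dom_def)
    have "sg w \<in> patch b (3/4) 0" using E_W[OF w] W_nonneg[of 0] by simp
    then have "R 0 (cnj (sg w)) = cnj (R 0 (sg w))" by (rule R_cnj)
    then show ?thesis using cw s unfolding Psi_sg[OF cw] Psi_sg[OF w] by (simp add: Rz_def exp_cnj)
  qed
  have "sg \<zeta> = cnj (sg \<zeta>)" using sg_cnj[OF D0_props(1)[OF D1_props(1)[OF z]]] zr by simp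
  then have "Im (sg \<zeta>) = 0" by (simp add: complex_eq_iff)
  then have c: "\<zeta> \<in> core 0" using z by (simp add: core_def)
  note Fc = F_core[OF c]
  have E: "F \<zeta> \<in> E 0" "\<zeta> \<in> E 0" using core_ball[OF c] Fc(1) by auto
  have "\<zeta> - cnj (F \<zeta>) = cnj (\<zeta> - F \<zeta>)" unfolding complex_cnj_diff zr ..
  then have "cmod (\<zeta> - cnj (F \<zeta>)) = cmod (\<zeta> - F \<zeta>)" by (simp only: complex_mod_cnj)
  then have b: "cnj (F \<zeta>) \<in> ball \<zeta> (1/16)" using Fc(1) by (simp add: dist_norm)
  have "Phi 0 (cnj (F \<zeta>)) = cnj (Phi 0 \<zeta> + 1)" using sym[OF E(1)] Fc(2) by simp
  also have "\<dots> = Phi 0 \<zeta> + 1" using sym[OF E(2)] zr by simp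
  finally have "cnj (F \<zeta>) = F \<zeta>" by (rule F_unique[OF c b])
  then show ?thesis by (simp add: complex_eq_iff)
qed

end

section \<open>The asymptotic expansion of the map\<close>

context atlas
begin

text \<open>H is \<open>Phi k\<close> minus those terms of its expansion at \<zeta> that matter for
  one step. Its derivative is O(|\<zeta>|^(-2)) on the segment to \<open>F \<zeta>\<close>: the
  second-order remainder of \<open>expo m\<close> is of size |p| |w - \<zeta>|^2 \<le> 4/|p| \<le>
  4/|\<zeta>|^2, and the correction R contributes the same order. Integration over a length of at
  most 2/|p| gives the hypothesis of \<open>step_expansion\<close>.\<close>

lemma F_expansion:
  obtains c1 N where "0 < c1" "0 \<le> N"
    "\<And>\<zeta>. \<zeta> \<in> D1 \<Longrightarrow> cmod (exp (- (F \<zeta> - \<zeta>)) - 1 + 1 / expo m \<zeta> - of_real \<rho> / ((expo m \<zeta>)^2 * \<zeta>)) \<le> c1 / ((cmod (expo m \<zeta>))^2 * (cmod \<zeta>)^2)"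
    "\<And>\<zeta>. \<zeta> \<in> D1 \<Longrightarrow> cmod (expo m \<zeta> * (F \<zeta> - \<zeta>) - 1) \<le> N / cmod (expo m \<zeta>)"
proof -
  define C2 where "C2 = 2 * ((1 + M)^2 + M)"
  define C1 where "C1 = 2 * (4 * C2 + \<bar>\<kappa>\<bar> + 8)"
  have M0: "0 \<le> M" by (simp add: M_def)
  have C20: "0 \<le> C2" using M0 by (simp add: C2_def)
  have C10: "0 \<le> C1" using C20 by (simp add: C1_def)
  have key: "cmod (1 - (p * u + p * (1 + of_int m / \<zeta>) * u^2 / 2 - u - of_real \<kappa> / \<zeta> * u)) \<le> C1 / (cmod p * (cmod \<zeta>)^2)"
    if z: "\<zeta> \<in> D1" and pu: "p = expo m \<zeta>" "u = F \<zeta> - \<zeta>" for \<zeta> p u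
  proof -
    define k where "k = idx \<zeta>"
    have c: "\<zeta> \<in> core k" by (simp add: k_def idx_core[OF z])
    note P = D1_props[OF z] and D = D0_props[OF D1_props(1)[OF z]] and Fc = F_core[OF c] and Fs = F_step[OF z]
    let ?B = "ball \<zeta> (1/16)" and ?S = "closed_segment \<zeta> (\<zeta> + u)"
    have zu: "\<zeta> + u \<in> ?B" using Fc(1) by (simp add: pu)
    have near: "0 < Re w" "cmod \<zeta> / 2 \<le> cmod w" "1 \<le> cmod w" "cmod (expo m w) \<le> 2 * cmod p" "w \<notin> \<real>\<^sub>\<le>\<^sub>0" "w \<noteq> 0" if w: "w \<in> ?B" for w
    proof -
      have wz: "cmod (w - \<zeta>) \<le> 1/16" using w by (simp add: dist_norm norm_minus_commute)
      have "2 * \<bar>real_of_int m\<bar> + 2 \<le> Re \<zeta>" using D(4) by (simp add: M_def)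
      note en = expo_near[OF this wz]
      show r: "0 < Re w" "cmod \<zeta> / 2 \<le> cmod w" "1 \<le> cmod w" by (rule en)+
      show "w \<notin> \<real>\<^sub>\<le>\<^sub>0" "w \<noteq> 0" using r by (auto simp: complex_nonpos_Reals_iff)
      have "cmod (expo m w / expo m \<zeta>) \<le> 2" using en(4) norm_triangle_ineq2[of "expo m w / expo m \<zeta>" 1] by simp
      then show "cmod (expo m w) \<le> 2 * cmod p" by (simp add: norm_divide pu divide_le_eq)
    qed
    have S: "cmod (w - \<zeta>) \<le> cmod u" "w \<in> ?B" if "w \<in> ?S" for w
      using segment_in_ball[OF zu that] by auto
    have second: "cmod (expo m w - p - p * (1 + of_int m / \<zeta>) * (w - \<zeta>)) \<le> C2 * cmod p * (cmod (w - \<zeta>))^2" if w: "w \<in> ?B" for w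
    proof -
      \<comment> \<open>The function \<open>expo m\<close> with its first two derivatives, in the
        form in which Taylor's theorem expects them.\<close>
      define f where "f i = (if i = 0 then expo m else if i = (1::nat) then (\<lambda>z. expo m z * (1 + of_int m / z))
         else (\<lambda>z. expo m z * (1 + of_int m / z) * (1 + of_int m / z) + expo m z * (- (of_int m / z^2))))" for i
      have "cmod (f 0 w - (\<Sum>i\<le>1. f i \<zeta> * (w - \<zeta>)^i / fact i)) \<le> (C2 * cmod p) * cmod (w - \<zeta>)^(Suc 1) / fact 1"
      proof (rule complex_Taylor[of ?B])
        fix i x assume x: "x \<in> ?B" and i: "i \<le> (1::nat)"
        note nx = near[OF x]
        have d0: "(expo m has_field_derivative expo m x * (1 + of_int m / x)) (at x)" by (rule expo_deriv[OF nx(5)])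
        have "((\<lambda>z. 1 + of_int m / z) has_field_derivative (- (of_int m / x^2))) (at x)"
          using nx(6) by (auto intro!: derivative_eq_intros simp: power2_eq_square field_simps)
        from DERIV_mult'[OF d0 this]
        have d1: "((\<lambda>z. expo m z * (1 + of_int m / z)) has_field_derivative
           (expo m x * (1 + of_int m / x) * (1 + of_int m / x) + expo m x * (- (of_int m / x^2)))) (at x)"
          by (simp add: algebra_simps)
        have "i = 0 \<or> i = 1" using i by auto
        then show "(f i has_field_derivative f (Suc i) x) (at x within ?B)"
          using d0 d1 by (auto simp: f_def intro: has_field_derivative_at_within)
      next
        fix x assume x: "x \<in> ?B"
        note nx = near[OF x]
        have mx: "cmod (of_int m / x) \<le> M" using nx(3) by (simp add: norm_divide M_def divide_le_eq mult_le_cancel_left1)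
        have mx2: "cmod (of_int m / x^2) \<le> M"
        proof -
          have "1 \<le> (cmod x)^2" using nx(3) by (simp add: one_le_power)
          then show ?thesis by (simp add: norm_divide norm_power M_def divide_le_eq mult_le_cancel_left1)
        qed
        have a: "cmod (1 + of_int m / x) \<le> 1 + M" using norm_triangle_ineq[of 1 "of_int m / x"] mx by simp
        have "f (Suc 1) x = expo m x * ((1 + of_int m / x)^2 - of_int m / x^2)"
          using nx(6) by (simp add: f_def power2_eq_square field_simps)
        then have "cmod (f (Suc 1) x) = cmod (expo m x) * cmod ((1 + of_int m / x)^2 - of_int m / x^2)" by (simp add: norm_mult)
        also have "\<dots> \<le> (2 * cmod p) * ((1 + M)^2 + M)"
        proof (intro mult_mono)
          have "(cmod (1 + of_int m / x))^2 \<le> (1 + M)^2" using a by (intro power_mono) auto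
          then show "cmod ((1 + of_int m / x)^2 - of_int m / x^2) \<le> (1 + M)^2 + M"
            using norm_triangle_ineq4[of "(1 + of_int m / x)^2" "of_int m / x^2"] mx2 by (simp add: norm_power)
        qed (use nx(4) in auto)
        finally show "cmod (f (Suc 1) x) \<le> C2 * cmod p" by (simp add: C2_def mult_ac)
      qed (use w in auto)
      then show ?thesis by (simp add: f_def pu(1) numeral_2_eq_2 algebra_simps)
    qed
    define H where "H w = Phi k w - (p * (w - \<zeta>) + p * (1 + of_int m / \<zeta>) * (w - \<zeta>)^2 / 2 - (w - \<zeta>) - of_real \<kappa> / \<zeta> * (w - \<zeta>))" for w
    define H' where "H' w = deriv (Phi k) w - (p + p * (1 + of_int m / \<zeta>) * (w - \<zeta>) - 1 - of_real \<kappa> / \<zeta>)" for w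
    have p64: "64 \<le> cmod p" "(cmod \<zeta>)^2 \<le> cmod p" using P(3,4) by (simp_all add: pu)
    have ub: "cmod u \<le> 2 / cmod p" "cmod u \<le> 1/32" using Fs by (simp_all add: pu)
    have "cmod (H (\<zeta> + u) - H \<zeta>) \<le> ((4 * C2 + \<bar>\<kappa>\<bar> + 8) / (cmod \<zeta>)^2) * cmod ((\<zeta> + u) - \<zeta>)"
    proof (rule field_differentiable_bound[of ?S H H'])
      fix w assume w: "w \<in> ?S"
      note Sw = S[OF w] and nw = near[OF S(2)[OF w]]
      obtain e where e: "(Phi k has_field_derivative (expo m w - 1 - of_real \<kappa> / w + e)) (at w)" "cmod e \<le> 2 / (cmod w)^2"
        using Phi_deriv core_ball[OF c] Sw(2) by blast
      have dP: "deriv (Phi k) w = expo m w - 1 - of_real \<kappa> / w + e" by (rule DERIV_imp_deriv[OF e(1)])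
      have "(H has_field_derivative H' w) (at w)"
        unfolding H_def[abs_def] H'_def dP by (rule derivative_eq_intros e(1) refl | simp)+
      then show "(H has_field_derivative H' w) (at w within ?S)" by (rule has_field_derivative_at_within)
      have "H' w = (expo m w - p - p * (1 + of_int m / \<zeta>) * (w - \<zeta>)) + of_real \<kappa> * (w - \<zeta>) / (\<zeta> * w) + e"
        using nw(6) D(7) by (simp add: H'_def dP field_simps)
      then have "cmod (H' w) \<le> cmod (expo m w - p - p * (1 + of_int m / \<zeta>) * (w - \<zeta>)) + cmod (of_real \<kappa> * (w - \<zeta>) / (\<zeta> * w)) + cmod e"
        by (metis norm_triangle_ineq add_right_mono order_trans)
      also have "\<dots> \<le> 4 * C2 / (cmod \<zeta>)^2 + \<bar>\<kappa>\<bar> / (cmod \<zeta>)^2 + 8 / (cmod \<zeta>)^2"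
      proof (intro add_mono)
        have z2: "0 < (cmod \<zeta>)^2" using D(7) by simp
        have "C2 * cmod p * (cmod (w - \<zeta>))^2 \<le> C2 * cmod p * (2 / cmod p)^2"
          using Sw(1) ub C20 by (intro mult_left_mono power_mono) auto
        also have "\<dots> = 4 * C2 / cmod p" using p64(1) by (simp add: power2_eq_square)
        also have "\<dots> \<le> 4 * C2 / (cmod \<zeta>)^2"
        proof (rule divide_left_mono[OF p64(2)])
          have "0 < cmod p" using p64(1) by linarith
          then show "0 < cmod p * (cmod \<zeta>)^2" using z2 by (rule mult_pos_pos)
        qed (use C20 in simp)
        finally show "cmod (expo m w - p - p * (1 + of_int m / \<zeta>) * (w - \<zeta>)) \<le> 4 * C2 / (cmod \<zeta>)^2"
          using second[OF Sw(2)] by linarith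
        have "cmod (of_real \<kappa> * (w - \<zeta>) / (\<zeta> * w)) = \<bar>\<kappa>\<bar> * cmod (w - \<zeta>) / (cmod \<zeta> * cmod w)" by (simp add: norm_divide norm_mult)
        also have "\<dots> \<le> \<bar>\<kappa>\<bar> * (1/2) / (cmod \<zeta> * (cmod \<zeta> / 2))"
          using Sw(1) ub(2) nw(2) D(6) by (intro frac_le mult_left_mono mult_pos_pos) auto
        also have "\<dots> = \<bar>\<kappa>\<bar> / (cmod \<zeta>)^2" by (simp add: power2_eq_square)
        finally show "cmod (of_real \<kappa> * (w - \<zeta>) / (\<zeta> * w)) \<le> \<bar>\<kappa>\<bar> / (cmod \<zeta>)^2" .
        have "(cmod \<zeta> / 2)^2 \<le> (cmod w)^2" using nw(2) by (intro power_mono) auto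
        then have "2 / (cmod w)^2 \<le> 2 / (cmod \<zeta> / 2)^2" using D(7) nw(6) by (intro divide_left_mono mult_pos_pos) auto
        then show "cmod e \<le> 8 / (cmod \<zeta>)^2" using e(2) by (simp add: power_divide)
      qed
      finally show "cmod (H' w) \<le> (4 * C2 + \<bar>\<kappa>\<bar> + 8) / (cmod \<zeta>)^2" by (simp add: add_divide_distrib)
    qed auto
    also have "cmod ((\<zeta> + u) - \<zeta>) = cmod u" by simp
    also have "((4 * C2 + \<bar>\<kappa>\<bar> + 8) / (cmod \<zeta>)^2) * cmod u \<le> ((4 * C2 + \<bar>\<kappa>\<bar> + 8) / (cmod \<zeta>)^2) * (2 / cmod p)"
      using ub(1) C20 by (intro mult_left_mono divide_nonneg_nonneg) auto
    also have "\<dots> = C1 / (cmod p * (cmod \<zeta>)^2)" by (simp add: C1_def mult_ac)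
    finally have "cmod (H (\<zeta> + u) - H \<zeta>) \<le> C1 / (cmod p * (cmod \<zeta>)^2)" .
    moreover have "H (\<zeta> + u) - H \<zeta> = 1 - (p * u + p * (1 + of_int m / \<zeta>) * u^2 / 2 - u - of_real \<kappa> / \<zeta> * u)"
      using Fc(2) by (simp add: H_def pu)
    ultimately show ?thesis by simp
  qed
  define MM where "MM = 1 + \<bar>real_of_int m\<bar> + \<bar>\<kappa>\<bar>"
  define N where "N = 4 * MM + C1"
  define c1 where "c1 = 36 + 2 * N + 3 * MM * N + C1"
  have N0: "0 \<le> N" "0 \<le> MM" using C10 by (auto simp: N_def MM_def)
  have c10: "0 < c1" using N0 C10 by (simp add: c1_def add_pos_nonneg)
  show thesis
  proof (rule that[OF c10 N0(1)])
    fix \<zeta> assume z: "\<zeta> \<in> D1"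
    note se = step_expansion[where m = m and \<kappa> = \<kappa> and \<rho> = \<rho>, OF D0_props(6)[OF D1_props(1)[OF z]] D1_props(4)[OF z] F_step(1)[OF z] C10 \<kappa> key[OF z refl refl] MM_def N_def]
    show "cmod (exp (- (F \<zeta> - \<zeta>)) - 1 + 1 / expo m \<zeta> - of_real \<rho> / ((expo m \<zeta>)^2 * \<zeta>)) \<le> c1 / ((cmod (expo m \<zeta>))^2 * (cmod \<zeta>)^2)"
      unfolding c1_def by (rule se(1))
    show "cmod (expo m \<zeta> * (F \<zeta> - \<zeta>) - 1) \<le> N / cmod (expo m \<zeta>)" by (rule se(2))
  qed
qed

text \<open>The expansion of exp(- (F \<zeta> - \<zeta>)) multiplied by z = exp(- \<zeta>); since
  1/p = z ell^m and 1/\<zeta> = ell, the term \<rho>/(p^2 \<zeta>) becomes \<rho> z^3 ell^(2m+1),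
  and the error c1/(|p|^2 |\<zeta>|^2) becomes |z^3 ell^(2m+2)|.\<close>

lemma F_estimate:
  obtains c where "0 < c" "\<And>\<zeta>. \<zeta> \<in> D1 \<Longrightarrow>
    cmod (exp (- F \<zeta>) - exp (- \<zeta>) + exp (- \<zeta>) ^ 2 * inverse \<zeta> powi m - of_real \<rho> * exp (- \<zeta>) ^ 3 * inverse \<zeta> powi (2 * m + 1))
    \<le> c * cmod (exp (- \<zeta>) ^ 3 * inverse \<zeta> powi (2 * m + 2))"
proof -
  obtain c1 N where c1: "0 < c1" "0 \<le> N"
    and e: "\<And>\<zeta>. \<zeta> \<in> D1 \<Longrightarrow> cmod (exp (- (F \<zeta> - \<zeta>)) - 1 + 1 / expo m \<zeta> - of_real \<rho> / ((expo m \<zeta>)^2 * \<zeta>)) \<le> c1 / ((cmod (expo m \<zeta>))^2 * (cmod \<zeta>)^2)"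
    "\<And>\<zeta>. \<zeta> \<in> D1 \<Longrightarrow> cmod (expo m \<zeta> * (F \<zeta> - \<zeta>) - 1) \<le> N / cmod (expo m \<zeta>)"
    by (rule F_expansion) (rule that; assumption)
  show thesis
  proof (rule that[OF c1(1)])
    fix \<zeta> assume z: "\<zeta> \<in> D1"
    have z0: "\<zeta> \<noteq> 0" by (rule D0_props(7)[OF D1_props(1)[OF z]])
    define E where "E = exp (- \<zeta>)"
    define q where "q = inverse \<zeta> powi m"
    have pq: "1 / expo m \<zeta> = E * q"
      using z0 by (simp add: expo_powi E_def q_def exp_minus power_int_inverse field_simps)
    have q1: "inverse \<zeta> powi (2 * m + 1) = q^2 * inverse \<zeta>" "inverse \<zeta> powi (2 * m + 2) = q^2 * (inverse \<zeta>)^2"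
      using z0 by (simp_all add: q_def power_int_add power_int_mult mult.commute[of 2 m] power2_eq_square)
    have r: "of_real \<rho> / ((expo m \<zeta>)^2 * \<zeta>) = of_real \<rho> * (E * q)^2 * inverse \<zeta>"
      by (simp add: pq[symmetric] power_divide divide_inverse power_inverse)
    have "exp (- F \<zeta>) = E * exp (- (F \<zeta> - \<zeta>))" by (simp add: E_def exp_add[symmetric])
    then have "exp (- F \<zeta>) - E + E^2 * q - of_real \<rho> * E^3 * (q^2 * inverse \<zeta>) = E * (exp (- (F \<zeta> - \<zeta>)) - 1 + 1 / expo m \<zeta> - of_real \<rho> / ((expo m \<zeta>)^2 * \<zeta>))"
      unfolding pq r by (simp add: algebra_simps power2_eq_square power3_eq_cube)
    then have "cmod (exp (- F \<zeta>) - E + E^2 * q - of_real \<rho> * E^3 * (q^2 * inverse \<zeta>)) =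
        cmod E * cmod (exp (- (F \<zeta> - \<zeta>)) - 1 + 1 / expo m \<zeta> - of_real \<rho> / ((expo m \<zeta>)^2 * \<zeta>))"
      by (simp only: norm_mult)
    also have "\<dots> \<le> cmod E * (c1 / ((cmod (expo m \<zeta>))^2 * (cmod \<zeta>)^2))"
      by (rule mult_left_mono[OF e(1)[OF z] norm_ge_zero])
    also have "c1 / ((cmod (expo m \<zeta>))^2 * (cmod \<zeta>)^2) = c1 * (cmod (1 / expo m \<zeta>))^2 * (cmod (inverse \<zeta>))^2"
      by (simp add: norm_divide norm_inverse power_divide divide_inverse power_inverse)
    also have "cmod E * (c1 * (cmod (1 / expo m \<zeta>))^2 * (cmod (inverse \<zeta>))^2) = c1 * cmod (E^3 * (q^2 * (inverse \<zeta>)^2))"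
      unfolding pq by (simp add: norm_mult norm_power power_mult_distrib power2_eq_square power3_eq_cube)
    finally show "cmod (exp (- F \<zeta>) - exp (- \<zeta>) + exp (- \<zeta>) ^ 2 * inverse \<zeta> powi m - of_real \<rho> * exp (- \<zeta>) ^ 3 * inverse \<zeta> powi (2 * m + 1))
      \<le> c1 * cmod (exp (- \<zeta>) ^ 3 * inverse \<zeta> powi (2 * m + 2))"
      unfolding q1 by (simp only: E_def q_def)
  qed
qed

end

section \<open>Petals\<close>

lemma sin_ge_cubic: "0 \<le> x \<Longrightarrow> x - x^3 / 6 \<le> sin (x::real)"
proof -
  assume x: "0 \<le> x"
  have "\<bar>sin x - (\<Sum>m<3. sin_coeff m * x ^ m)\<bar> \<le> inverse (fact 3) * \<bar>x\<bar> ^ 3" by (rule Maclaurin_sin_bound)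
  moreover have "(\<Sum>m<3. sin_coeff m * x ^ m) = x" by (simp add: sin_coeff_def eval_nat_numeral)
  moreover have "inverse (fact 3) * \<bar>x\<bar> ^ 3 = x^3 / 6" using x by (simp add: eval_nat_numeral fact_numeral)
  ultimately show ?thesis by linarith
qed

text \<open>To first order the inverse square shrinks by the relative amount 2 c v; the constant
  16/10 leaves room for the higher-order terms when c v \<le> 1/10.\<close>

lemma inverse_square_gain:
  fixes \<delta> v c d :: real
  assumes "0 < \<delta>" "0 \<le> v" "v \<le> 1/10" "0 \<le> c" "c \<le> 1" "\<delta> * (1 + c * v) \<le> d"
  shows "8 / d^2 \<le> 8 / \<delta>^2 - (8 / \<delta>^2) * ((16/10) * c * v)"
proof -
  define q where "q = c * v"
  have q: "0 \<le> q" "q \<le> 1/10"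
    using assms mult_mono[of c 1 v "1/10"] by (auto simp: q_def)
  have d2: "(\<delta> * (1 + q))^2 \<le> d^2" using assms q by (intro power_mono) (auto simp: q_def)
  have "8 / d^2 \<le> 8 / (\<delta> * (1 + q))^2" using d2 assms(1) q by (intro divide_left_mono mult_pos_pos) (auto intro: order_less_le_trans)
  also have "\<dots> = (8 / \<delta>^2) * (1 / (1 + q)^2)" by (simp add: power_mult_distrib)
  also have "1 / (1 + q)^2 \<le> 1 - (16/10) * q"
  proof -
    have "1 \<le> (1 - (16/10) * q) * (1 + q)^2"
    proof -
      have "(1 - (16/10) * q) * (1 + q)^2 - 1 = q * ((4/10) - (22/10) * q - (16/10) * q * q)" by (simp add: power2_eq_square algebra_simps)
      moreover have "q * q \<le> 1/10 * (1/10)" using q by (intro mult_mono) auto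
      then have "0 \<le> (4/10) - (22/10) * q - (16/10) * q * q" using q by (simp add: mult.assoc)
      then have "0 \<le> q * ((4/10) - (22/10) * q - (16/10) * q * q)" using q(1) by (intro mult_nonneg_nonneg)
      ultimately show ?thesis by linarith
    qed
    moreover have "0 < (1 + q)^2" using q by simp
    ultimately show ?thesis by (subst pos_divide_le_eq)
  qed
  then have "(8 / \<delta>^2) * (1 / (1 + q)^2) \<le> (8 / \<delta>^2) * (1 - (16/10) * q)" by (intro mult_left_mono) auto
  finally show ?thesis by (simp add: q_def algebra_simps)
qed

text \<open>The curve \<open>x = 8 / (pi - |y|)^2\<close> is steeper than the direction field \<open>exp (- i y)\<close> of the dynamics,
  with a margin that absorbs a relative error that is small against the distance \<open>pi - |y|\<close>.\<close>

lemma petal_curve_step: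
  fixes \<delta> v e d x :: real
  assumes \<delta>: "0 < \<delta>" "\<delta> \<le> pi" and v: "0 \<le> v" "v \<le> 1/10" and e: "0 \<le> e" "e \<le> \<delta> / 100" "e \<le> 1/100"
    and d: "\<delta> + v * (sin \<delta> - e) \<le> d" and x: "v * (- cos \<delta> - e) \<le> x"
  shows "0 < d" "8 / d^2 \<le> 8 / \<delta>^2 + x"
proof -
  have pi: "3 < pi" "pi < (32/10)" using pi_gt3 pi_approx by auto
  have s0: "0 \<le> sin \<delta>" using \<delta> by (intro sin_ge_zero) auto
  have "v * e \<le> 1/10 * (\<delta> / 100)" using v e by (intro mult_mono) auto
  moreover have "0 \<le> v * sin \<delta>" using v s0 by simp
  ultimately have d1: "\<delta> - v * e \<le> d" "v * e \<le> \<delta> / 1000" using d by (auto simp: right_diff_distrib)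
  then show d0: "0 < d" using \<delta> by linarith
  \<comment> \<open>Near the edge the sine moves the point inwards fast enough to pay for a motion
    to the left, since 8/\<delta>^2 \<ge> 31/10 there. In the middle range the sine still gains and
    the real part hardly decreases. Near the axis the real part grows by more than the error can
    cost in the distance.\<close>
  consider "\<delta> \<le> (16/10)" | "(16/10) < \<delta>" "1/2 \<le> sin \<delta>" | "(16/10) < \<delta>" "sin \<delta> < 1/2" by linarith
  then show "8 / d^2 \<le> 8 / \<delta>^2 + x"
  proof cases
    case 1
    have dd: "\<delta> * \<delta> \<le> (16/10) * (16/10)" using 1 \<delta> by (intro mult_mono) auto
    have "\<delta> * (\<delta> * \<delta>) \<le> \<delta> * (256/100)" using dd \<delta> by (intro mult_left_mono) auto
    then have "\<delta>^3 \<le> (256/100) * \<delta>" by (simp add: power3_eq_cube)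
    then have "\<delta> - \<delta>^3 / 6 \<ge> (57/100) * \<delta>" using \<delta> by linarith
    then have "(55/100) * \<delta> \<le> sin \<delta> - e" using sin_ge_cubic[of \<delta>] \<delta> e by linarith
    then have "v * ((55/100) * \<delta>) \<le> v * (sin \<delta> - e)" using v by (intro mult_left_mono)
    then have "\<delta> * (1 + (55/100) * v) \<le> d" using d by (simp add: algebra_simps)
    from inverse_square_gain[OF \<delta>(1) v _ _ this]
    have 1: "8 / d^2 \<le> 8 / \<delta>^2 - (8 / \<delta>^2) * ((88/100) * v)" by simp
    have "(31/10) \<le> 8 / \<delta>^2" using dd \<delta> by (simp add: pos_le_divide_eq power2_eq_square)
    then have "(31/10) * ((88/100) * v) \<le> (8 / \<delta>^2) * ((88/100) * v)" using v by (intro mult_right_mono) auto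
    moreover have "v * (-2) \<le> v * (- cos \<delta> - e)" using v e cos_le_one[of \<delta>] by (intro mult_left_mono) linarith+
    ultimately show ?thesis using 1 x v by linarith
  next
    case 2
    have c: "cos \<delta> \<le> 0" using cos_monotone_0_pi_le[of "pi/2" \<delta>] 2 \<delta> pi by simp
    have "(15/100) * \<delta> \<le> sin \<delta> - e" using 2 e \<delta> pi by linarith
    then have "v * ((15/100) * \<delta>) \<le> v * (sin \<delta> - e)" using v by (intro mult_left_mono)
    then have "\<delta> * (1 + (15/100) * v) \<le> d" using d by (simp add: algebra_simps)
    from inverse_square_gain[OF \<delta>(1) v _ _ this]
    have 1: "8 / d^2 \<le> 8 / \<delta>^2 - (8 / \<delta>^2) * ((24/100) * v)" by simp
    have "\<delta> * \<delta> \<le> (32/10) * (32/10)" using \<delta> pi by (intro mult_mono) auto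
    then have "(5/10) \<le> 8 / \<delta>^2" using \<delta> by (simp add: pos_le_divide_eq power2_eq_square)
    then have "(5/10) * ((24/100) * v) \<le> (8 / \<delta>^2) * ((24/100) * v)" using v by (intro mult_right_mono) auto
    moreover have "v * (- (1/100)) \<le> v * (- cos \<delta> - e)" using v e c by (intro mult_left_mono) auto
    ultimately show ?thesis using 1 x v by linarith
  next
    case 3
    have c: "cos \<delta> \<le> 0" using cos_monotone_0_pi_le[of "pi/2" \<delta>] 3 \<delta> pi by simp
    have "sin \<delta> * sin \<delta> \<le> 1/2 * (1/2)" using 3 s0 by (intro mult_mono) auto
    then have "(75/100) \<le> (- cos \<delta>)^2" using sin_cos_squared_add[of \<delta>] by (simp add: power2_eq_square)
    have c8: "(5/10) \<le> - cos \<delta>"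
    proof (rule ccontr)
      assume "\<not> (5/10) \<le> - cos \<delta>"
      then have "(- cos \<delta>) * (- cos \<delta>) \<le> (5/10) * (5/10)" using c by (intro mult_mono) auto
      then show False using \<open>(75/100) \<le> (- cos \<delta>)^2\<close> by (simp add: power2_eq_square)
    qed
    have xb: "v * (49/100) \<le> x"
    proof -
      have "v * (49/100) \<le> v * (- cos \<delta> - e)" using v c8 e by (intro mult_left_mono) auto
      then show ?thesis using x by linarith
    qed
    define t where "t = v * e"
    have t: "0 \<le> t" "t \<le> v / 100" "t \<le> 1/1000" using v e mult_left_mono[OF e(3), of v] by (auto simp: t_def)
    have dt: "\<delta> - t \<le> d" using d1 by (simp add: t_def)
    have pos: "0 < \<delta> - t" using t 3 by linarith
    have "8 / d^2 \<le> 8 / (\<delta> - t)^2" using dt pos by (intro divide_left_mono power_mono mult_pos_pos) (auto intro: zero_less_power d0)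
    also have "8 / (\<delta> - t)^2 \<le> 8 / \<delta>^2 + 10 * t"
    proof -
      have "8 / (\<delta> - t)^2 - 8 / \<delta>^2 = 8 * (t * (2 * \<delta> - t)) / (\<delta>^2 * (\<delta> - t)^2)"
        using pos \<delta> by (simp add: divide_simps power2_eq_square) (simp add: algebra_simps)
      also have "\<dots> \<le> 8 * (t * (64/10)) / ((16/10)^2 * (159/100)^2)"
        using t 3 \<delta> pi pos by (intro frac_le mult_left_mono mult_mono power_mono mult_pos_pos mult_nonneg_nonneg) auto
      also have "\<dots> \<le> 10 * t" using t by (simp add: power2_eq_square)
      finally show ?thesis by linarith
    qed
    finally show ?thesis using t xb by linarith
  qed
qed

text \<open>With \<delta> the distance to the lines bounding the strip, the curve 8/\<delta>^2
  forces \<delta> \<ge> 2 / sqrt(Re \<zeta>) for large Re \<zeta>, far more than the error O(1 / Re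
  \<zeta>) of the direction field. The constant 8 is what makes the curve steep enough in
  \<open>petal_curve_step\<close>.\<close>

definition petal :: "int \<Rightarrow> real \<Rightarrow> complex set" where
  "petal k M = {\<zeta>. \<bar>Im \<zeta> - of_int k * pi\<bar> < pi \<and> M + 8 / (pi - \<bar>Im \<zeta> - of_int k * pi\<bar>)^2 < Re \<zeta>}"

lemma petal_is_petal: "is_petal (- of_int k * pi) (2 * pi) (petal k M)"
proof -
  define r where "r \<alpha> = exp (- (M + 8 / (pi - \<alpha> / 2)^2))" for \<alpha> :: real
  have lnr: "- ln (r \<alpha>) = M + 8 / (pi - \<alpha> / 2)^2" for \<alpha> by (simp add: r_def)
  have cont: "continuous_on {0<..<2 * pi} (\<lambda>\<alpha>. M + 8 / (pi - \<alpha> / 2)^2)"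
    by (intro continuous_intros) auto
  show ?thesis
    unfolding is_petal_def
  proof (intro exI[of _ r] conjI ballI allI impI)
    show "0 < r \<alpha>" for \<alpha> by (simp add: r_def)
    show "continuous_on {0<..<2 * pi} r" unfolding r_def[abs_def] by (intro continuous_on_exp continuous_on_minus cont)
    show "r \<beta> \<le> r \<alpha>" if "0 < \<alpha> \<and> \<alpha> \<le> \<beta> \<and> \<beta> < 2 * pi" for \<alpha> \<beta>
    proof -
      have "8 / (pi - \<alpha> / 2)^2 \<le> 8 / (pi - \<beta> / 2)^2" using that by (intro divide_left_mono power_mono mult_pos_pos) auto
      then show ?thesis by (simp add: r_def)
    qed
    show "petal k M = (\<Union>\<alpha>\<in>{0<..<2 * pi}. sector (- of_int k * pi) \<alpha> (r \<alpha>))"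
    proof (intro set_eqI iffI)
      fix \<zeta> assume z: "\<zeta> \<in> petal k M"
      define y where "y = \<bar>Im \<zeta> - of_int k * pi\<bar>"
      have y: "0 \<le> y" "y < pi" "M + 8 / (pi - y)^2 < Re \<zeta>" using z by (auto simp: petal_def y_def)
      \<comment> \<open>A slightly larger half-opening t > y still satisfies the strict inequality,
        by continuity; the sector with half-opening y itself would not contain the point.\<close>
      have "((\<lambda>t. M + 8 / (pi - t)^2) \<longlongrightarrow> M + 8 / (pi - y)^2) (at_right y)"
        using y by (intro tendsto_intros) auto
      then have "\<forall>\<^sub>F t in at_right y. M + 8 / (pi - t)^2 < Re \<zeta>" using y(3) by (rule order_tendstoD)
      moreover have "\<forall>\<^sub>F t in at_right y. t < pi" by (rule order_tendstoD(2)[OF tendsto_ident_at y(2)])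
      moreover have "\<forall>\<^sub>F t in at_right y. y < t" by (rule eventually_at_right_less)
      ultimately have "\<forall>\<^sub>F t in at_right y. M + 8 / (pi - t)^2 < Re \<zeta> \<and> t < pi \<and> y < t" by eventually_elim auto
      then obtain t where t: "M + 8 / (pi - t)^2 < Re \<zeta>" "t < pi" "y < t"
        using eventually_happens'[OF trivial_limit_at_right_real] by blast
      have "\<zeta> \<in> sector (- of_int k * pi) (2 * t) (r (2 * t))" using t by (simp add: sector_def lnr y_def)
      then show "\<zeta> \<in> (\<Union>\<alpha>\<in>{0<..<2 * pi}. sector (- of_int k * pi) \<alpha> (r \<alpha>))" using t y by (intro UN_I[of "2 * t"]) auto
    next
      fix \<zeta> assume "\<zeta> \<in> (\<Union>\<alpha>\<in>{0<..<2 * pi}. sector (- of_int k * pi) \<alpha> (r \<alpha>))"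
      then obtain \<alpha> where a: "0 < \<alpha>" "\<alpha> < 2 * pi" "\<zeta> \<in> sector (- of_int k * pi) \<alpha> (r \<alpha>)" by auto
      define y where "y = \<bar>Im \<zeta> - of_int k * pi\<bar>"
      have y: "y < \<alpha> / 2" "M + 8 / (pi - \<alpha> / 2)^2 < Re \<zeta>" using a(3) by (simp_all add: sector_def lnr y_def)
      have "8 / (pi - y)^2 \<le> 8 / (pi - \<alpha> / 2)^2" using a y by (intro divide_left_mono power_mono mult_pos_pos) auto
      then show "\<zeta> \<in> petal k M" using a y by (simp add: petal_def y_def)
    qed
  qed
qed

text \<open>In terms of \<delta> = pi - |y| the direction exp(- i y) has real part - cos \<delta>,
  and its vertical component increases \<delta> at rate sin \<delta>. The lemma serves for forward
  steps on attracting petals and for backward steps on repelling ones, since both follow this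
  direction up to a relative error e.\<close>

lemma petal_step:
  assumes z: "\<zeta> \<in> petal k M" and v: "0 \<le> v" "v \<le> 1/10"
    and u: "cmod (u - of_real v * exp (- \<i> * of_real (Im \<zeta> - of_int k * pi))) \<le> v * e"
    and e: "0 \<le> e" "e \<le> (pi - \<bar>Im \<zeta> - of_int k * pi\<bar>) / 100" "e \<le> 1/100"
  shows "\<zeta> + u \<in> petal k M"
proof -
  define y where "y = Im \<zeta> - of_int k * pi"
  define \<delta> where "\<delta> = pi - \<bar>y\<bar>"
  define d where "d = pi - \<bar>y + Im u\<bar>"
  have zy: "\<bar>y\<bar> < pi" "M + 8 / \<delta>^2 < Re \<zeta>" using z by (auto simp: petal_def y_def \<delta>_def)
  have \<delta>: "0 < \<delta>" "\<delta> \<le> pi" using zy by (auto simp: \<delta>_def)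
  have ex: "exp (- \<i> * of_real y) = Complex (cos y) (- sin y)"
    by (simp add: complex_eq_iff Re_exp Im_exp)
  have Re: "\<bar>Re u - v * cos y\<bar> \<le> v * e" and Im: "\<bar>Im u + v * sin y\<bar> \<le> v * e"
    using abs_Re_le_cmod[of "u - of_real v * exp (- \<i> * of_real y)"] abs_Im_le_cmod[of "u - of_real v * exp (- \<i> * of_real y)"] u
    unfolding y_def[symmetric] ex by auto
  have ya: "\<bar>y - v * sin y\<bar> = \<bar>y\<bar> - v * sin \<bar>y\<bar>"
  proof -
    have "v * sin \<bar>y\<bar> \<le> \<bar>y\<bar>"
    proof -
      have "sin \<bar>y\<bar> \<le> \<bar>y\<bar>" by (rule sin_x_le_x) simp
      moreover have "0 \<le> sin \<bar>y\<bar>" using zy(1) by (intro sin_ge_zero) auto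
      ultimately have "v * sin \<bar>y\<bar> \<le> 1 * \<bar>y\<bar>" using v by (intro mult_mono) auto
      then show ?thesis by simp
    qed
    then show ?thesis by (cases "0 \<le> y") auto
  qed
  have "\<bar>y + Im u\<bar> \<le> \<bar>y - v * sin y\<bar> + \<bar>Im u + v * sin y\<bar>" by linarith
  then have "\<bar>y + Im u\<bar> \<le> \<bar>y\<bar> - v * sin \<bar>y\<bar> + v * e" using ya Im by linarith
  moreover have "sin \<delta> = sin \<bar>y\<bar>" by (simp add: \<delta>_def)
  ultimately have 1: "\<delta> + v * (sin \<delta> - e) \<le> d" by (simp add: d_def \<delta>_def right_diff_distrib)
  have "cos \<delta> = - cos y" by (simp add: \<delta>_def)
  then have 2: "v * (- cos \<delta> - e) \<le> Re u" using Re by (simp add: right_diff_distrib)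
  have e': "e \<le> \<delta> / 100" using e(2) by (simp add: \<delta>_def y_def)
  note c = petal_curve_step[OF \<delta> v e(1) e' e(3) 1 2]
  have Imu: "Im (\<zeta> + u) - of_int k * pi = y + Im u" by (simp add: y_def)
  have dd: "pi - \<bar>Im (\<zeta> + u) - of_int k * pi\<bar> = d" unfolding Imu d_def ..
  have "M + 8 / d^2 < Re (\<zeta> + u)" using c(2) zy(2) by simp
  moreover have "\<bar>Im (\<zeta> + u) - of_int k * pi\<bar> < pi" using c(1) dd by linarith
  ultimately show ?thesis unfolding petal_def using dd by simp
qed

text \<open>The hypothesis on the derivative excludes t = 0; its value there is a limit of values
  within 1/2 of 1. Then \<open>local_solve\<close> with slope 1 on a disc of radius r, where d r
  \<le> 1/2, gives injectivity, and an image that contains the disc of radius r/2. Since |G t| \<le>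
  2 |t|, the quadratic bound passes to G with d replaced by 4 d.\<close>

lemma tangent_germ_inverse:
  assumes hol: "H holomorphic_on ball 0 \<sigma>" and \<sigma>: "0 < \<sigma>" and d: "0 < d" and H0: "H 0 = 0"
    and near: "\<And>t. 0 < cmod t \<Longrightarrow> cmod t < \<sigma> \<Longrightarrow> cmod (H t - t) \<le> d * (cmod t)^2 \<and> cmod (deriv H t - 1) \<le> d * cmod t"
  obtains G \<epsilon> where "0 < \<epsilon>" "\<epsilon> \<le> \<sigma>" "G holomorphic_on ball 0 \<epsilon>" "G 0 = 0"
    "\<And>t. cmod t < \<epsilon> \<Longrightarrow> cmod (G t) < \<sigma> \<and> H (G t) = t \<and> cmod (G t - t) \<le> 4 * d * (cmod t)^2"
    "\<And>t. cmod t < \<epsilon> \<Longrightarrow> G (H t) = t"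
proof -
  define r where "r = min \<sigma> (1 / (2 * d))"
  have r: "0 < r" "r \<le> \<sigma>" "d * r \<le> 1/2"
  proof -
    have "d * r \<le> d * (1 / (2 * d))" using d by (intro mult_left_mono) (auto simp: r_def)
    then show "d * r \<le> 1/2" using d by simp
  qed (use \<sigma> d in \<open>auto simp: r_def\<close>)
  let ?B = "ball (0::complex) r"
  have der: "(H has_field_derivative deriv H t) (at t)" if "t \<in> ?B" for t
    using holomorphic_derivI[OF hol open_ball] that r by auto
  have d1: "cmod (deriv H t - 1) \<le> 1/2" if t: "t \<in> ?B - {0}" for t
  proof -
    have "d * cmod t \<le> d * r" using t d by (intro mult_left_mono) auto
    then show ?thesis using near[of t] t r by auto
  qed
  have d2: "cmod (deriv H t - 1) \<le> cmod 1 / 2" if t: "t \<in> ?B" for t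
  proof (cases "t = 0")
    case True
    have "continuous_on ?B (\<lambda>t. deriv H t - 1)"
      using holomorphic_on_imp_continuous_on[OF holomorphic_deriv[OF hol open_ball]] r
      by (intro continuous_intros) (auto intro: continuous_on_subset)
    then have c0: "isCont (\<lambda>t. deriv H t - 1) 0" using r by (simp add: continuous_on_eq_continuous_at)
    have "((\<lambda>t. cmod (deriv H t - 1)) \<longlongrightarrow> cmod (deriv H 0 - 1)) (at 0)"
      using c0 by (intro tendsto_norm) (simp add: isCont_def)
    moreover have "\<forall>\<^sub>F t in at 0. cmod (deriv H t - 1) \<le> 1/2"
      unfolding eventually_at using r d1 by (intro exI[of _ r]) (auto simp: dist_norm)
    ultimately show ?thesis using True tendsto_upperbound[of "\<lambda>t. cmod (deriv H t - 1)" _ "at 0" "1/2"] by simp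
  qed (use d1 t in auto)
  have r0: "0 < r" "(1::complex) \<noteq> 0" using r by auto
  have L: "inj_on H ?B" "\<And>w w'. w \<in> ?B \<Longrightarrow> w' \<in> ?B \<Longrightarrow> cmod 1 / 2 * cmod (w - w') \<le> cmod (H w - H w')"
     "\<And>c. cmod c < cmod 1 * r / 2 \<Longrightarrow> \<exists>w\<in>?B. H w = H 0 + c"
    using local_solve[OF r0 der d2] by blast+
  have holB: "H holomorphic_on ?B" using hol r by (auto intro: holomorphic_on_subset)
  obtain G where G: "G holomorphic_on H ` ?B" "\<And>w. w \<in> ?B \<Longrightarrow> G (H w) = w"
    using holomorphic_has_inverse[OF holB open_ball L(1)] by metis
  define \<epsilon> where "\<epsilon> = r / 2"
  have sub: "ball 0 \<epsilon> \<subseteq> H ` ?B"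
  proof
    fix t :: complex assume "t \<in> ball 0 \<epsilon>"
    then have "cmod t < cmod 1 * r / 2" by (simp add: \<epsilon>_def)
    then obtain w where "w \<in> ?B" "H w = H 0 + t" using L(3) by blast
    then show "t \<in> H ` ?B" using H0 by (intro image_eqI[of _ _ w]) auto
  qed
  show thesis
  proof (rule that[of \<epsilon> G])
    show "0 < \<epsilon>" "\<epsilon> \<le> \<sigma>" using r by (auto simp: \<epsilon>_def)
    show "G holomorphic_on ball 0 \<epsilon>" by (rule holomorphic_on_subset[OF G(1) sub])
    show "G 0 = 0" using G(2)[of 0] H0 r by simp
    show "cmod (G t) < \<sigma> \<and> H (G t) = t \<and> cmod (G t - t) \<le> 4 * d * (cmod t)^2" if t: "cmod t < \<epsilon>" for t
    proof -
      obtain w where w: "w \<in> ?B" "t = H w" using sub t by (metis imageE mem_ball_0 subsetD)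
      have Gt: "G t = w" using G(2) w by simp
      have "cmod w \<le> 2 * cmod t" using L(2)[OF w(1), of 0] H0 r w(2) by simp
      then have "(cmod w)^2 \<le> (2 * cmod t)^2" by (intro power_mono) auto
      then have "d * (cmod w)^2 \<le> d * (2 * cmod t)^2" using d by (intro mult_left_mono) auto
      moreover have "cmod (H w - w) \<le> d * (cmod w)^2"
        using near[of w] w(1) r H0 by (cases "w = 0") auto
      ultimately have "cmod (H w - w) \<le> 4 * d * (cmod t)^2" by (simp add: power_mult_distrib)
      then show ?thesis using Gt w r by (auto simp: norm_minus_commute)
    qed
    show "G (H t) = t" if "cmod t < \<epsilon>" for t using that r by (intro G(2)) (auto simp: \<epsilon>_def)
  qed
qed

section \<open>Fatou coordinates on full petals\<close>

text \<open>The periods of \<open>hexp k\<close> are exactly the integers, so two numbers at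
  distance less than 1 are determined by their images.\<close>

lemma hexp_eq_close:
  assumes "hexp k v = hexp k w" "cmod (v - w) < 1"
  shows "v = w"
proof -
  obtain n :: int where n: "of_real (altsign k) * (2 * pi * \<i>) * v = of_real (altsign k) * (2 * pi * \<i>) * w + complex_of_real (2 * of_int n * pi) * \<i>"
    using assms(1) unfolding hexp_def exp_eq by auto
  have "of_real (altsign k) * (v - w) * (2 * pi * \<i>) = of_int n * (2 * pi * \<i>)"
    using n by (simp add: algebra_simps)
  then have "of_real (altsign k) * (v - w) = of_int n" by simp
  then have "cmod (of_real (altsign k) * (v - w)) = \<bar>of_int n\<bar>" by simp
  then have "cmod (v - w) = \<bar>of_int n\<bar>" by (simp add: norm_mult altsign_def split: if_splits)
  then have "n = 0" using assms(2) by linarith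
  then show ?thesis using \<open>cmod (v - w) = \<bar>of_int n\<bar>\<close> by simp
qed

lemma hexp_cnj: "hexp (- k - 1) (cnj w) = cnj (hexp k w)"
proof -
  have "altsign (- k - 1) = - altsign k" by (simp add: altsign_def)
  then show ?thesis by (simp add: hexp_def exp_cnj)
qed

text \<open>H lists all germs by the overlap number k. For k < 0 it is tied to the gluing data only
  near 0, as the inverse of the conjugated germ of index - k - 1, and G is a local inverse of
  H.\<close>

locale atlas_horn = atlas +
  fixes H G :: "int \<Rightarrow> complex \<Rightarrow> complex" and \<sigma>H eG :: "int \<Rightarrow> real" and dH :: real
  assumes dH: "0 < dH" and \<sigma>H: "\<And>k. 0 < \<sigma>H k"
    and H_hol: "\<And>k. H k holomorphic_on ball 0 (\<sigma>H k)"
    and H_near: "\<And>k t. 0 < cmod t \<Longrightarrow> cmod t < \<sigma>H k \<Longrightarrow> cmod (H k t - t) \<le> dH * (cmod t)^2"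
    and H_nonneg: "\<And>k. 0 \<le> k \<Longrightarrow> H k = h (nat k)"
    and H_neg: "\<And>k. k < 0 \<Longrightarrow> \<exists>\<epsilon>>0. \<forall>t. cmod t < \<epsilon> \<longrightarrow> H k (cnj (h (nat (- k - 1)) (cnj t))) = t"
    and eG: "\<And>k. 0 < eG k" "\<And>k. eG k \<le> \<sigma>H k"
    and G_hol: "\<And>k. G k holomorphic_on ball 0 (eG k)"
    and G_props: "\<And>k t. cmod t < eG k \<Longrightarrow> cmod (G k t) < \<sigma>H k \<and> H k (G k t) = t \<and> cmod (G k t - t) \<le> 4 * dH * (cmod t)^2"
    and G_H: "\<And>k t. cmod t < eG k \<Longrightarrow> G k (H k t) = t"
begin

text \<open>For negative k the gluing relation is known for the inverse of \<open>H k\<close>, and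
  turning it round works for small horn variables only. The radius may depend on k because every
  petal will have its own M.\<close>

definition tiny where "tiny k \<epsilon> \<longleftrightarrow> 0 < \<epsilon> \<and> \<epsilon> \<le> eG k \<and> 4 * dH * \<epsilon> \<le> 1/4 \<and>
  (\<forall>\<zeta>. \<zeta> \<in> E k \<longrightarrow> \<zeta> \<in> E (k + 1) \<longrightarrow> cmod (hexp k (Phi (k + 1) \<zeta>)) < \<epsilon> \<longrightarrow> H k (hexp k (Phi k \<zeta>)) = hexp k (Phi (k + 1) \<zeta>))"

lemma tiny_ex: "\<exists>\<epsilon>. tiny k \<epsilon>"
proof -
  obtain \<epsilon> where \<epsilon>: "0 < \<epsilon>" "\<forall>\<zeta>. \<zeta> \<in> E k \<longrightarrow> \<zeta> \<in> E (k + 1) \<longrightarrow> cmod (hexp k (Phi (k + 1) \<zeta>)) < \<epsilon> \<longrightarrow> H k (hexp k (Phi k \<zeta>)) = hexp k (Phi (k + 1) \<zeta>)"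
  proof (cases "0 \<le> k")
    case True
    have "H k (hexp k (Phi k \<zeta>)) = hexp k (Phi (k + 1) \<zeta>)" if "\<zeta> \<in> E k" "\<zeta> \<in> E (k + 1)" for \<zeta>
      using Phi_glue_nonneg[OF True that] hexp_hlog[of "h (nat k)" k "Phi k \<zeta>"] H_nonneg[OF True] by simp
    then show ?thesis using that[of 1] by simp
  next
    case False
    then have k: "k < 0" by simp
    obtain \<epsilon> where e: "0 < \<epsilon>" "\<forall>t. cmod t < \<epsilon> \<longrightarrow> H k (cnj (h (nat (- k - 1)) (cnj t))) = t" using H_neg[OF k] by blast
    have "H k (hexp k (Phi k \<zeta>)) = hexp k (Phi (k + 1) \<zeta>)" if z: "\<zeta> \<in> E k" "\<zeta> \<in> E (k + 1)" and small: "cmod (hexp k (Phi (k + 1) \<zeta>)) < \<epsilon>" for \<zeta>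
    proof -
      let ?l = "- k - 1" and ?t = "hexp k (Phi (k + 1) \<zeta>)"
      note g = Phi_glue_neg[OF k z]
      have "hexp ?l (cnj (Phi k \<zeta>)) = h (nat ?l) (hexp ?l (cnj (Phi (k + 1) \<zeta>)))"
        using hexp_hlog[where h = "h (nat ?l)" and k = ?l and w = "cnj (Phi (k + 1) \<zeta>)", OF g(2)] unfolding g(1)[symmetric] .
      then have "cnj (hexp k (Phi k \<zeta>)) = h (nat ?l) (cnj ?t)" by (simp only: hexp_cnj)
      then have "hexp k (Phi k \<zeta>) = cnj (h (nat ?l) (cnj ?t))" by (metis complex_cnj_cnj)
      then show ?thesis using e(2) small by simp
    qed
    then show ?thesis using that[OF e(1)] by blast
  qed
  define \<epsilon>' where "\<epsilon>' = min \<epsilon> (min (eG k) (1 / (16 * dH)))"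
  have "4 * dH * \<epsilon>' \<le> 4 * dH * (1 / (16 * dH))" using dH by (intro mult_left_mono) (auto simp: \<epsilon>'_def)
  also have "\<dots> = 1/4" using dH by simp
  finally have 1: "4 * dH * \<epsilon>' \<le> 1/4" .
  have "0 < \<epsilon>'" "\<epsilon>' \<le> eG k" "\<epsilon>' \<le> \<epsilon>" using \<epsilon>(1) eG dH by (auto simp: \<epsilon>'_def)
  then have "tiny k \<epsilon>'" using 1 \<epsilon>(2) unfolding tiny_def by (meson order_less_le_trans)
  then show ?thesis ..
qed

definition eps where "eps k = (SOME \<epsilon>. tiny k \<epsilon>)"

lemma tiny_eps: "tiny k (eps k)" unfolding eps_def by (rule someI_ex[OF tiny_ex])

lemma hlog_H:
  assumes "cmod (hexp k w) < eps k"
  shows "hexp k (w + hlog k (H k) w) = H k (hexp k w)" "cmod (hlog k (H k) w) \<le> 1/4" "hlog k (H k) field_differentiable at w"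
proof -
  have T: "4 * dH * eps k \<le> 1/4" "eps k \<le> eG k" using tiny_eps[of k] by (auto simp: tiny_def)
  have dt: "dH * cmod (hexp k w) \<le> dH * eps k" using assms dH by (intro mult_left_mono) auto
  have t: "dH * cmod (hexp k w) \<le> 1/4" using dt T(1) by linarith
  have s: "cmod (hexp k w) < \<sigma>H k" using assms T(2) eG(2)[of k] by linarith
  have "cmod (H k (hexp k w) - hexp k w) \<le> dH * (cmod (hexp k w))^2" using s by (intro H_near) auto
  note L = hlog_small[where h = "H k", OF this less_imp_le[OF dH]]
  have t2: "dH * cmod (hexp k w) \<le> 1/2" using t by linarith
  show "hexp k (w + hlog k (H k) w) = H k (hexp k w)" by (rule hexp_hlog[where h = "H k" and k = k and w = w, OF L(1)[OF t2]])
  show "cmod (hlog k (H k) w) \<le> 1/4" using L(3)[OF t2] t by linarith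
  have "H k field_differentiable at (hexp k w)" using holomorphic_on_imp_differentiable_at[OF H_hol open_ball] s by simp
  then show "hlog k (H k) field_differentiable at w" by (rule hlog_differentiable[where h = "H k" and k = k and w = w, OF _ L(2)[OF t2]])
qed

lemma hlog_G:
  assumes "cmod (hexp k w) < eps k"
  shows "hexp k (w + hlog k (G k) w) = G k (hexp k w)" "cmod (hlog k (G k) w) \<le> 1/4" "hlog k (G k) field_differentiable at w"
proof -
  have T: "4 * dH * eps k \<le> 1/4" "eps k \<le> eG k" using tiny_eps[of k] by (auto simp: tiny_def)
  have d4: "0 \<le> 4 * dH" using dH by simp
  have dt: "4 * dH * cmod (hexp k w) \<le> 4 * dH * eps k" using assms d4 by (intro mult_left_mono) auto
  have t: "4 * dH * cmod (hexp k w) \<le> 1/4" using dt T(1) by linarith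
  have s: "cmod (hexp k w) < eG k" using assms T(2) by linarith
  have "cmod (G k (hexp k w) - hexp k w) \<le> 4 * dH * (cmod (hexp k w))^2" using G_props[OF s] by blast
  note L = hlog_small[where h = "G k", OF this d4]
  have t2: "4 * dH * cmod (hexp k w) \<le> 1/2" using t by linarith
  show "hexp k (w + hlog k (G k) w) = G k (hexp k w)" by (rule hexp_hlog[where h = "G k" and k = k and w = w, OF L(1)[OF t2]])
  show "cmod (hlog k (G k) w) \<le> 1/4" using L(3)[OF t2] t by linarith
  have "G k field_differentiable at (hexp k w)" using holomorphic_on_imp_differentiable_at[OF G_hol open_ball] s by simp
  then show "hlog k (G k) field_differentiable at w" by (rule hlog_differentiable[where h = "G k" and k = k and w = w, OF _ L(2)[OF t2]])
qed

text \<open>A relation between horn variables determines Fatou coordinates modulo integers only. The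
  two candidates differ by at most 1/2 from the bounds on \<open>Rz\<close> and 1/4 from
  \<open>hlog\<close>, hence by less than 1, which fixes the integer.\<close>

lemma Phi_glue:
  assumes z: "\<zeta> \<in> E k" "\<zeta> \<in> E (k + 1)" and s: "cmod (hexp k (Phi k \<zeta>)) < eps k" "cmod (hexp k (Phi (k + 1) \<zeta>)) < eps k"
  shows "Phi (k + 1) \<zeta> = Phi k \<zeta> + hlog k (H k) (Phi k \<zeta>)" "Phi k \<zeta> = Phi (k + 1) \<zeta> + hlog k (G k) (Phi (k + 1) \<zeta>)"
    "H k (hexp k (Phi k \<zeta>)) = hexp k (Phi (k + 1) \<zeta>)"
proof -
  show HH: "H k (hexp k (Phi k \<zeta>)) = hexp k (Phi (k + 1) \<zeta>)" using tiny_eps[of k] z s(2) by (auto simp: tiny_def)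
  have "Phi k \<zeta> - Phi (k + 1) \<zeta> = Rz k (sg \<zeta>) - Rz (k + 1) (sg \<zeta>)" by (simp add: Phi_def)
  then have "cmod (Phi k \<zeta> - Phi (k + 1) \<zeta>) \<le> cmod (Rz k (sg \<zeta>)) + cmod (Rz (k + 1) (sg \<zeta>))" by (simp add: norm_triangle_ineq4)
  then have close: "cmod (Phi k \<zeta> - Phi (k + 1) \<zeta>) \<le> 1/2"
    using Rz_props(1)[OF E_W[OF z(1)]] Rz_props(1)[OF E_W[OF z(2)]] by linarith
  have "hexp k (Phi k \<zeta> + hlog k (H k) (Phi k \<zeta>)) = hexp k (Phi (k + 1) \<zeta>)" using hlog_H(1)[OF s(1)] HH by simp
  moreover have "cmod (Phi k \<zeta> + hlog k (H k) (Phi k \<zeta>) - Phi (k + 1) \<zeta>) < 1"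
  proof -
    have eq: "Phi k \<zeta> + hlog k (H k) (Phi k \<zeta>) - Phi (k + 1) \<zeta> = (Phi k \<zeta> - Phi (k + 1) \<zeta>) + hlog k (H k) (Phi k \<zeta>)" by simp
    show ?thesis unfolding eq
      using norm_triangle_ineq[of "Phi k \<zeta> - Phi (k + 1) \<zeta>" "hlog k (H k) (Phi k \<zeta>)"] close hlog_H(2)[OF s(1)] by linarith
  qed
  ultimately show "Phi (k + 1) \<zeta> = Phi k \<zeta> + hlog k (H k) (Phi k \<zeta>)" by (metis hexp_eq_close)
  have t: "cmod (hexp k (Phi k \<zeta>)) < eG k" using s(1) tiny_eps[of k] by (auto simp: tiny_def)
  have "hexp k (Phi (k + 1) \<zeta> + hlog k (G k) (Phi (k + 1) \<zeta>)) = hexp k (Phi k \<zeta>)"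
    unfolding hlog_G(1)[OF s(2)] HH[symmetric] by (rule G_H[OF t])
  moreover have "cmod (Phi (k + 1) \<zeta> + hlog k (G k) (Phi (k + 1) \<zeta>) - Phi k \<zeta>) < 1"
  proof -
    have eq: "Phi (k + 1) \<zeta> + hlog k (G k) (Phi (k + 1) \<zeta>) - Phi k \<zeta> = hlog k (G k) (Phi (k + 1) \<zeta>) - (Phi k \<zeta> - Phi (k + 1) \<zeta>)" by simp
    show ?thesis unfolding eq
      using norm_triangle_ineq4[of "hlog k (G k) (Phi (k + 1) \<zeta>)" "Phi k \<zeta> - Phi (k + 1) \<zeta>"] close hlog_G(2)[OF s(2)] by linarith
  qed
  ultimately show "Phi k \<zeta> = Phi (k + 1) \<zeta> + hlog k (G k) (Phi (k + 1) \<zeta>)" by (metis hexp_eq_close)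
qed

text \<open>On a half-strip of bounded height Ln \<zeta> = ln (Re \<zeta>) + O(1 / Re \<zeta>), so
  \<open>sg\<close> is a real translation up to O(1 / Re \<zeta>) and asymptotically preserves
  imaginary parts.\<close>

lemma right_strip:
  fixes q :: real
  assumes q: "0 \<le> q"
  obtains Xr where "1 \<le> Xr"
    "\<And>\<zeta>. Xr \<le> Re \<zeta> \<Longrightarrow> \<bar>Im \<zeta>\<bar> \<le> q \<Longrightarrow> \<zeta> \<in> D1"
    "\<And>\<zeta>. Xr \<le> Re \<zeta> \<Longrightarrow> \<bar>Im \<zeta>\<bar> \<le> q \<Longrightarrow> cmod (Ln \<zeta> - of_real (ln (Re \<zeta>))) \<le> 2 * q / Re \<zeta>"
    "\<And>\<zeta>. Xr \<le> Re \<zeta> \<Longrightarrow> \<bar>Im \<zeta>\<bar> \<le> q \<Longrightarrow> cmod (sg \<zeta> - (\<zeta> + of_int m * of_real (ln (Re \<zeta>)))) \<le> (2 * q * M + K) / Re \<zeta>"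
    "\<And>\<zeta>. Xr \<le> Re \<zeta> \<Longrightarrow> \<bar>Im \<zeta>\<bar> \<le> q \<Longrightarrow> \<bar>Im (sg \<zeta>) - Im \<zeta>\<bar> \<le> (2 * q * M + K) / Re \<zeta>"
    "\<And>\<zeta>. Xr \<le> Re \<zeta> \<Longrightarrow> \<bar>Im \<zeta>\<bar> \<le> q \<Longrightarrow> Re \<zeta> / 2 \<le> Re (sg \<zeta>)"
proof -
  have e0: "0 < \<eta>" by (rule \<eta>_pos)
  have M0: "0 \<le> M" by (simp add: M_def)
  have "\<forall>\<^sub>F x::real in at_top. q < \<eta> / 4 * x^2 \<and> 2 * q \<le> x \<and> M * ln x + (2 * q * M + K) / x \<le> x / 2 \<and> Y1 + 1 \<le> x \<and> 1 \<le> x"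
    using e0 q M0 by (intro eventually_conj eventually_ge_at_top) real_asymp+
  then obtain X where X: "\<And>x. X \<le> x \<Longrightarrow> q < \<eta> / 4 * x^2 \<and> 2 * q \<le> x \<and> M * ln x + (2 * q * M + K) / x \<le> x / 2 \<and> Y1 + 1 \<le> x \<and> 1 \<le> x"
    unfolding eventually_at_top_linorder by blast
  show thesis
  proof (rule that[of X])
    show "1 \<le> X" using X[of X] by simp
    fix \<zeta> assume z: "X \<le> Re \<zeta>" "\<bar>Im \<zeta>\<bar> \<le> q"
    define x where "x = Re \<zeta>"
    note Xx = X[OF z(1), folded x_def]
    have x0: "1 \<le> x" using Xx by blast
    show zD: "\<zeta> \<in> D1" using Xx z by (auto simp: D1_def narrow_dom_def x_def)
    note D = D0_props[OF D1_props(1)[OF zD]]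
    have zx: "\<zeta> = of_real x * (\<zeta> / of_real x)" using x0 by simp
    have "\<zeta> / of_real x - 1 = \<i> * of_real (Im \<zeta> / x)" using x0 by (simp add: complex_eq_iff x_def)
    then have "cmod (\<zeta> / of_real x - 1) = \<bar>Im \<zeta>\<bar> / x" using x0 by (simp add: norm_mult norm_divide)
    also have "\<dots> \<le> q / x" using z x0 by (intro divide_right_mono) auto
    finally have 1: "cmod (\<zeta> / of_real x - 1) \<le> q / x" .
    have "q / x \<le> 1/2" using Xx x0 by (simp add: divide_le_eq)
    then have 2: "cmod (Ln (\<zeta> / of_real x)) \<le> 2 * (q / x)" using norm_Ln_le[of "\<zeta> / of_real x"] 1 by linarith
    have "Ln \<zeta> = of_real (ln x) + Ln (\<zeta> / of_real x)"
      using Ln_times_of_real[of x "\<zeta> / of_real x"] x0 D(7) by (simp add: Ln_of_real)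
    then show L: "cmod (Ln \<zeta> - of_real (ln (Re \<zeta>))) \<le> 2 * q / Re \<zeta>" using 2 by (simp add: x_def)
    have "sg \<zeta> - (\<zeta> + of_int m * of_real (ln x)) = (sg \<zeta> - (\<zeta> + of_int m * Ln \<zeta>)) + of_int m * (Ln \<zeta> - of_real (ln x))" by (simp add: algebra_simps)
    then have "cmod (sg \<zeta> - (\<zeta> + of_int m * of_real (ln x))) \<le> cmod (sg \<zeta> - (\<zeta> + of_int m * Ln \<zeta>)) + M * cmod (Ln \<zeta> - of_real (ln x))"
      by (metis M_def norm_mult norm_of_int norm_triangle_ineq)
    also have "\<dots> \<le> K / x + M * (2 * q / x)"
      using sg_near[OF D(1)] L M0 by (intro add_mono mult_left_mono) (auto simp: x_def)
    also have "\<dots> = (2 * q * M + K) / x" by (simp add: add_divide_distrib)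
    finally have S: "cmod (sg \<zeta> - (\<zeta> + of_int m * of_real (ln x))) \<le> (2 * q * M + K) / x" .
    then show "cmod (sg \<zeta> - (\<zeta> + of_int m * of_real (ln (Re \<zeta>)))) \<le> (2 * q * M + K) / Re \<zeta>" by (simp only: x_def)
    have ri: "Im (sg \<zeta> - (\<zeta> + of_int m * of_real (ln x))) = Im (sg \<zeta>) - Im \<zeta>" "Re (sg \<zeta> - (\<zeta> + of_int m * of_real (ln x))) = Re (sg \<zeta>) - (x + of_int m * ln x)"
      by (simp_all add: x_def)
    show "\<bar>Im (sg \<zeta>) - Im \<zeta>\<bar> \<le> (2 * q * M + K) / Re \<zeta>"
      using abs_Im_le_cmod[of "sg \<zeta> - (\<zeta> + of_int m * of_real (ln x))"] S unfolding ri x_def[symmetric] by linarith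
    have "\<bar>of_int m * ln x\<bar> \<le> M * ln x" using x0 by (simp add: abs_mult M_def ln_ge_zero)
    then show "Re \<zeta> / 2 \<le> Re (sg \<zeta>)"
      using abs_Re_le_cmod[of "sg \<zeta> - (\<zeta> + of_int m * of_real (ln x))"] S Xx unfolding ri x_def[symmetric] by linarith
  qed
qed

text \<open>Even at distance t = 1 / sqrt x from the ends of the half-plane where
  \<open>hexp j\<close> is small, the cosine is at least sin t \<ge> t/2, and exp(x/2) / sqrt x
  still tends to infinity.\<close>

lemma hexp_small:
  assumes "0 < \<epsilon>"
  obtains Xr where "1 \<le> Xr" "\<And>x s \<phi> j. Xr \<le> x \<Longrightarrow> x / 2 \<le> Re s \<Longrightarrow> \<bar>Im s - (of_int j + 1/2) * pi\<bar> \<le> pi/2 - 1 / sqrt x \<Longrightarrow> cmod \<phi> \<le> 1/4 \<Longrightarrow>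
     cmod (hexp j (exp s + \<phi>)) < \<epsilon>"
proof -
  have "\<forall>\<^sub>F x::real in at_top. exp (2 - exp (x / 2) / sqrt x) < \<epsilon> \<and> 1 \<le> x"
    using assms by (intro eventually_conj eventually_ge_at_top) real_asymp+
  then obtain X where X: "\<And>x. X \<le> x \<Longrightarrow> exp (2 - exp (x / 2) / sqrt x) < \<epsilon> \<and> 1 \<le> x"
    unfolding eventually_at_top_linorder by blast
  show thesis
  proof (rule that[of X])
    show "1 \<le> X" using X[of X] by simp
    fix x s \<phi> j
    assume a: "X \<le> x" "x / 2 \<le> Re s" "\<bar>Im s - (of_int j + 1/2) * pi\<bar> \<le> pi/2 - 1 / sqrt x" "cmod \<phi> \<le> 1/4"
    note Xx = X[OF a(1)]
    define t where "t = 1 / sqrt x"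
    have sx: "1 \<le> sqrt x" using Xx by simp
    have t: "0 < t" "t \<le> 1" using sx by (auto simp: t_def)
    define yy where "yy = Im s - (of_int j + 1/2) * pi"
    have yy: "\<bar>yy\<bar> \<le> pi/2 - t" using a(3) by (simp add: yy_def t_def)
    have "cos (pi/2 - t) \<le> cos \<bar>yy\<bar>" using yy t by (intro cos_monotone_0_pi_le) auto
    then have "sin t \<le> cos yy" by (simp add: cos_diff)
    moreover have "t^3 \<le> t" using t power_decreasing[of 1 3 t] by simp
    then have "t / 2 \<le> sin t" using sin_ge_cubic[of t] t by linarith
    ultimately have "t / 2 \<le> cos yy" by linarith
    then have "exp (x / 2) * (t / 2) \<le> exp (Re s) * cos yy" using a(2) t by (intro mult_mono) auto
    also have "\<dots> = altsign j * Im (exp s)" by (simp add: altsign_Im_exp yy_def)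
    finally have 1: "exp (x / 2) * t / 2 \<le> altsign j * Im (exp s)" by simp
    have "- 1/4 \<le> altsign j * Im \<phi>" using abs_Im_le_cmod[of \<phi>] a(4) by (auto simp: altsign_def)
    then have 2: "exp (x / 2) * t / 2 - 1/4 \<le> altsign j * Im (exp s + \<phi>)" using 1 by (simp add: distrib_left)
    then have "(2 * pi) * (exp (x / 2) * t / 2 - 1/4) \<le> (2 * pi) * (altsign j * Im (exp s + \<phi>))" by (intro mult_left_mono) auto
    moreover have "exp (x / 2) * t \<le> pi * (exp (x / 2) * t)" using pi_gt3 t mult_right_mono[of 1 pi "exp (x / 2) * t"] by simp
    moreover have "(2 * pi) * (exp (x / 2) * t / 2 - 1/4) = pi * (exp (x / 2) * t) - pi / 2" by (simp add: algebra_simps)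
    ultimately have "exp (x / 2) * t - 2 \<le> (2 * pi) * (altsign j * Im (exp s + \<phi>))" using pi_less_4 by linarith
    then have "cmod (hexp j (exp s + \<phi>)) \<le> exp (2 - exp (x / 2) * t)" by (simp add: norm_hexp mult.assoc)
    also have "\<dots> = exp (2 - exp (x / 2) / sqrt x)" by (simp add: t_def)
    also have "\<dots> < \<epsilon>" using Xx by blast
    finally show "cmod (hexp j (exp s + \<phi>)) < \<epsilon>" .
  qed
qed

text \<open>What the extension of \<open>Phi k\<close> needs at a point of petal k. The horn
  variables of both adjacent overlaps are required to be small under every perturbation \<phi> with
  |\<phi>| \<le> 1/4, so that the condition covers every available \<open>Phi j\<close>, whichever
  strip is used.\<close>

definition good_point :: "int \<Rightarrow> complex \<Rightarrow> bool" where
  "good_point k \<zeta> \<longleftrightarrow> \<zeta> \<in> D1 \<and> \<bar>Im (sg \<zeta>) - of_int k * pi\<bar> \<le> pi - 1 / sqrt (Re \<zeta>) \<and> 1 / sqrt (Re \<zeta>) \<le> 1/4 \<and>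
    64 * exp (- (Re \<zeta> / 2)) < 1 / sqrt (Re \<zeta>) \<and> Re \<zeta> / 2 \<le> Re (sg \<zeta>) \<and> \<bar>Im \<zeta> - of_int k * pi\<bar> < pi \<and> 1 \<le> Re \<zeta> \<and>
    (\<forall>j\<in>{k - 1, k}. \<bar>Im (sg \<zeta>) - (of_int j + 1/2) * pi\<bar> \<le> pi/2 - 1 / sqrt (Re \<zeta>) \<longrightarrow>
       (\<forall>\<phi>. cmod \<phi> \<le> 1/4 \<longrightarrow> cmod (hexp j (exp (sg \<zeta>) + \<phi>)) < eps j))"

text \<open>The petal curve gives a distance of at least 2 / sqrt x to the edge. One half of it is
  kept as the margin; the other half absorbs the difference between Im (\<open>sg \<zeta>\<close>)
  and Im \<zeta>, which is at most C / x \<le> 1 / sqrt x.\<close>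

lemma petal_good:
  obtains Xr where "\<And>M' \<zeta>. Xr \<le> M' \<Longrightarrow> \<zeta> \<in> petal k M' \<Longrightarrow> good_point k \<zeta>" "1 \<le> Xr"
proof -
  define q where "q = (\<bar>of_int k\<bar> + 1) * pi"
  have q0: "0 \<le> q" by (simp add: q_def)
  define C where "C = 2 * q * M + K"
  obtain X1 where X1: "1 \<le> X1" "\<And>\<zeta>. X1 \<le> Re \<zeta> \<Longrightarrow> \<bar>Im \<zeta>\<bar> \<le> q \<Longrightarrow> \<zeta> \<in> D1"
    "\<And>\<zeta>. X1 \<le> Re \<zeta> \<Longrightarrow> \<bar>Im \<zeta>\<bar> \<le> q \<Longrightarrow> \<bar>Im (sg \<zeta>) - Im \<zeta>\<bar> \<le> C / Re \<zeta>"
    "\<And>\<zeta>. X1 \<le> Re \<zeta> \<Longrightarrow> \<bar>Im \<zeta>\<bar> \<le> q \<Longrightarrow> Re \<zeta> / 2 \<le> Re (sg \<zeta>)"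
    by (rule right_strip[OF q0, folded C_def]) (rule that; assumption)
  have e: "0 < min (eps (k - 1)) (eps k)" using tiny_eps by (auto simp: tiny_def)
  obtain X2 where X2: "1 \<le> X2" "\<And>x s \<phi> j. X2 \<le> x \<Longrightarrow> x / 2 \<le> Re s \<Longrightarrow> \<bar>Im s - (of_int j + 1/2) * pi\<bar> \<le> pi/2 - 1 / sqrt x \<Longrightarrow> cmod \<phi> \<le> 1/4 \<Longrightarrow>
     cmod (hexp j (exp s + \<phi>)) < min (eps (k - 1)) (eps k)"
    by (rule hexp_small[OF e]) (rule that; assumption)
  have "\<forall>\<^sub>F x::real in at_top. C / x \<le> 1 / sqrt x \<and> 1 / sqrt x \<le> 1/4 \<and> 64 * exp (- (x / 2)) < 1 / sqrt x \<and> X1 \<le> x \<and> X2 \<le> x"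
    by (intro eventually_conj eventually_ge_at_top) real_asymp+
  then obtain X where X: "\<And>x. X \<le> x \<Longrightarrow> C / x \<le> 1 / sqrt x \<and> 1 / sqrt x \<le> 1/4 \<and> 64 * exp (- (x / 2)) < 1 / sqrt x \<and> X1 \<le> x \<and> X2 \<le> x"
    unfolding eventually_at_top_linorder by blast
  show thesis
  proof (rule that[of X])
    show "1 \<le> X" using X[of X] X1(1) by simp
    fix M' \<zeta> assume M': "X \<le> M'" and z: "\<zeta> \<in> petal k M'"
    define x where "x = Re \<zeta>"
    define y where "y = Im \<zeta> - of_int k * pi"
    define \<delta> where "\<delta> = pi - \<bar>y\<bar>"
    have p: "\<bar>y\<bar> < pi" "M' + 8 / \<delta>^2 < x" using z by (auto simp: petal_def x_def y_def \<delta>_def)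
    have \<delta>: "0 < \<delta>" using p by (simp add: \<delta>_def)
    have d8: "0 < 8 / \<delta>^2" using \<delta> by simp
    have xX: "X \<le> x" using p M' d8 by linarith
    note Xx = X[OF xX]
    have X1x: "X1 \<le> x" and X2x: "X2 \<le> x" and Cx: "C / x \<le> 1 / sqrt x" by (intro Xx[THEN conjunct2, THEN conjunct2, THEN conjunct2, THEN conjunct1] Xx[THEN conjunct2, THEN conjunct2, THEN conjunct2, THEN conjunct2] Xx[THEN conjunct1])+
    have x1: "1 \<le> x" using X1x X1(1) by linarith
    have "8 / \<delta>^2 \<le> x" using p M' X[of X] X1(1) by linarith
    then have "8 \<le> x * \<delta>^2" using \<delta> by (simp add: divide_le_eq)
    then have "2^2 \<le> (sqrt x * \<delta>)^2" using x1 by (simp add: power_mult_distrib)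
    moreover have "0 \<le> sqrt x * \<delta>" using \<delta> x1 by simp
    ultimately have "2 \<le> sqrt x * \<delta>" by (rule power2_le_imp_le)
    then have \<delta>x: "2 * (1 / sqrt x) \<le> \<delta>" using x1 by (simp add: divide_le_eq mult.commute)
    have Imq: "\<bar>Im \<zeta>\<bar> \<le> q"
    proof -
      have "\<bar>of_int k * pi\<bar> = \<bar>of_int k\<bar> * pi" by (simp add: abs_mult)
      then show ?thesis using p(1) by (simp add: q_def y_def distrib_right)
    qed
    note X1x = X1x[unfolded x_def]
    note S = X1(2)[OF X1x Imq] X1(3)[OF X1x Imq] X1(4)[OF X1x Imq]
    have "\<bar>Im (sg \<zeta>) - of_int k * pi\<bar> \<le> \<bar>y\<bar> + C / x" using S(2) unfolding y_def x_def by linarith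
    then have st: "\<bar>Im (sg \<zeta>) - of_int k * pi\<bar> \<le> pi - 1 / sqrt x" using Cx \<delta>x unfolding \<delta>_def by linarith
    have hx: "cmod (hexp j (exp (sg \<zeta>) + \<phi>)) < eps j"
      if a: "j \<in> {k - 1, k}" "\<bar>Im (sg \<zeta>) - (of_int j + 1/2) * pi\<bar> \<le> pi/2 - 1 / sqrt x" "cmod \<phi> \<le> 1/4" for j \<phi>
    proof -
      have "x / 2 \<le> Re (sg \<zeta>)" using S(3) by (simp only: x_def)
      from X2(2)[OF X2x this a(2,3)] have 1: "cmod (hexp j (exp (sg \<zeta>) + \<phi>)) < min (eps (k - 1)) (eps k)" .
      have "j = k - 1 \<or> j = k" using a(1) by simp
      then have "min (eps (k - 1)) (eps k) \<le> eps j" by (elim disjE) (simp_all only: min.cobounded1 min.cobounded2)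
      then show ?thesis using 1 by linarith
    qed
    show "good_point k \<zeta>"
      unfolding good_point_def x_def[symmetric]
    proof (intro conjI)
      show "\<zeta> \<in> D1" by (rule S(1))
      show "\<bar>Im (sg \<zeta>) - of_int k * pi\<bar> \<le> pi - 1 / sqrt x" by (rule st)
      show "1 / sqrt x \<le> 1/4" by (rule Xx[THEN conjunct2, THEN conjunct1])
      show "64 * exp (- (x / 2)) < 1 / sqrt x" by (rule Xx[THEN conjunct2, THEN conjunct2, THEN conjunct1])
      show "x / 2 \<le> Re (sg \<zeta>)" using S(3) by (simp only: x_def)
      show "\<bar>Im \<zeta> - of_int k * pi\<bar> < pi" using p(1) by (simp only: y_def)
      show "1 \<le> x" by (rule x1)
      show "\<forall>j\<in>{k - 1, k}. \<bar>Im (sg \<zeta>) - (of_int j + 1/2) * pi\<bar> \<le> pi/2 - 1 / sqrt x \<longrightarrow>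
       (\<forall>\<phi>. cmod \<phi> \<le> 1/4 \<longrightarrow> cmod (hexp j (exp (sg \<zeta>) + \<phi>)) < eps j)"
        by (intro ballI impI allI) (rule hx; assumption)
    qed
  qed
qed

end

section \<open>Extension of the Fatou coordinates to petals of opening 2 pi\<close>

context atlas_horn
begin

text \<open>The Fatou coordinate of petal k computed in strip j: the germ \<open>H (k - 1)\<close>
  carries \<open>Phi (k - 1)\<close> up to strip k, and the inverse \<open>G k\<close> carries
  \<open>Phi (k + 1)\<close> down.\<close>

definition val :: "int \<Rightarrow> int \<Rightarrow> complex \<Rightarrow> complex" where
  "val k j \<zeta> = (if j = k then Phi k \<zeta> else if j = k + 1 then Phi (k + 1) \<zeta> + hlog k (G k) (Phi (k + 1) \<zeta>)
     else Phi (k - 1) \<zeta> + hlog (k - 1) (H (k - 1)) (Phi (k - 1) \<zeta>))"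

definition FC :: "int \<Rightarrow> complex \<Rightarrow> complex" where "FC k \<zeta> = val k (idx \<zeta>) \<zeta>"

lemma idx_E:
  assumes "\<zeta> \<in> D1"
  shows "\<zeta> \<in> E (idx \<zeta>)" "ball \<zeta> (1/16) \<subseteq> E (idx \<zeta>)"
proof -
  show b: "ball \<zeta> (1/16) \<subseteq> E (idx \<zeta>)" by (rule core_ball[OF idx_core[OF assms]])
  have "\<zeta> \<in> ball \<zeta> (1/16)" by simp
  then show "\<zeta> \<in> E (idx \<zeta>)" using b by blast
qed

lemma Phi_near: "\<zeta> \<in> E j \<Longrightarrow> cmod (Phi j \<zeta> - exp (sg \<zeta>)) \<le> 1/4"
  using Psi_sg[of \<zeta> j] Rz_props(1)[OF E_W, of \<zeta> j] by simp

lemma pi_multiple_lt: "\<bar>real_of_int i - real_of_int j\<bar> * pi < real n * pi \<Longrightarrow> \<bar>i - j\<bar> < int n"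
proof -
  assume "\<bar>real_of_int i - real_of_int j\<bar> * pi < real n * pi"
  then have "\<bar>real_of_int i - real_of_int j\<bar> < real n" by (simp add: mult_less_cancel_right)
  then show ?thesis by linarith
qed

lemma good_bounds:
  assumes "good_point k \<zeta>"
  shows "\<zeta> \<in> D1" "\<bar>Im (sg \<zeta>) - of_int k * pi\<bar> \<le> pi - 1 / sqrt (Re \<zeta>)" "1 / sqrt (Re \<zeta>) \<le> 1/4" "0 < 1 / sqrt (Re \<zeta>)"
    "64 * exp (- (Re \<zeta> / 2)) < 1 / sqrt (Re \<zeta>)" "Re \<zeta> / 2 \<le> Re (sg \<zeta>)"
proof -
  have "1 \<le> Re \<zeta>" using assms unfolding good_point_def by blast
  then show "0 < 1 / sqrt (Re \<zeta>)" by simp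
qed (use assms in \<open>unfold good_point_def, blast+\<close>)

lemma good_E_near:
  assumes g: "good_point k \<zeta>" and z: "\<zeta> \<in> E j"
  shows "j = k - 1 \<or> j = k \<or> j = k + 1"
proof -
  have "\<bar>Im (sg \<zeta>) - of_int j * pi\<bar> < pi/2 + 3/4" using z by (simp add: E_def)
  then have "\<bar>of_int j * pi - of_int k * pi\<bar> < 2 * pi" using good_bounds(2,4)[OF g] pi_gt3 by linarith
  moreover have "\<bar>of_int j * pi - of_int k * pi\<bar> = \<bar>of_int j - of_int k\<bar> * pi" by (simp add: left_diff_distrib[symmetric] abs_mult)
  ultimately have "\<bar>j - k\<bar> < int 2" using pi_multiple_lt[of j k 2] by simp
  then show ?thesis by linarith
qed

text \<open>Lying in the neighbouring strip forces Im (\<open>sg \<zeta>\<close>) towards that side,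
  and the margin of the petal bounds it from outside; together they give the range of
  \<open>hexp_small\<close> on the overlap j.\<close>

lemma good_small:
  assumes g: "good_point k \<zeta>" and j: "j = k - 1 \<or> j = k" and z: "\<zeta> \<in> E j'" and j': "j' = j \<or> j' = j + 1" and o: "\<zeta> \<in> E (if j = k then k + 1 else k - 1)"
  shows "cmod (hexp j (Phi j' \<zeta>)) < eps j"
proof -
  have "\<bar>Im (sg \<zeta>) - (of_int j + 1/2) * pi\<bar> \<le> pi/2 - 1 / sqrt (Re \<zeta>)"
  proof (cases "j = k")
    case True
    have "\<bar>Im (sg \<zeta>) - of_int (k + 1) * pi\<bar> < pi/2 + 3/4" using o True by (simp add: E_def)
    then have "\<bar>Im (sg \<zeta>) - (of_int k * pi + pi)\<bar> < pi/2 + 3/4" by (simp add: distrib_right)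
    then have "\<bar>Im (sg \<zeta>) - (of_int k * pi + pi/2)\<bar> \<le> pi/2 - 1 / sqrt (Re \<zeta>)"
      using good_bounds(2,3)[OF g] pi_gt3 by linarith
    then show ?thesis using True by (simp add: distrib_right)
  next
    case False
    then have jk: "j = k - 1" using j by simp
    have "\<bar>Im (sg \<zeta>) - of_int (k - 1) * pi\<bar> < pi/2 + 3/4" using o False by (simp add: E_def)
    then have "\<bar>Im (sg \<zeta>) - (of_int k * pi - pi)\<bar> < pi/2 + 3/4" by (simp add: left_diff_distrib)
    then have "\<bar>Im (sg \<zeta>) - (of_int k * pi - pi/2)\<bar> \<le> pi/2 - 1 / sqrt (Re \<zeta>)"
      using good_bounds(2,3)[OF g] pi_gt3 by linarith
    moreover have "(of_int j + 1/2) * pi = of_int k * pi - pi/2" by (simp add: jk algebra_simps)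
    ultimately show ?thesis by simp
  qed
  moreover have "j \<in> {k - 1, k}" using j by blast
  ultimately have "\<forall>\<phi>. cmod \<phi> \<le> 1/4 \<longrightarrow> cmod (hexp j (exp (sg \<zeta>) + \<phi>)) < eps j" using g unfolding good_point_def by blast
  then have "cmod (hexp j (exp (sg \<zeta>) + (Phi j' \<zeta> - exp (sg \<zeta>)))) < eps j" using Phi_near[OF z] by blast
  then show ?thesis by simp
qed

lemma E_disjoint: "\<zeta> \<in> E (k - 1) \<Longrightarrow> \<zeta> \<in> E (k + 1) \<Longrightarrow> False"
proof -
  assume "\<zeta> \<in> E (k - 1)" "\<zeta> \<in> E (k + 1)"
  then have "\<bar>Im (sg \<zeta>) - of_int (k - 1) * pi\<bar> < pi/2 + 3/4" "\<bar>Im (sg \<zeta>) - of_int (k + 1) * pi\<bar> < pi/2 + 3/4" by (simp_all add: E_def)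
  then have "\<bar>Im (sg \<zeta>) - (of_int k * pi - pi)\<bar> < pi/2 + 3/4" "\<bar>Im (sg \<zeta>) - (of_int k * pi + pi)\<bar> < pi/2 + 3/4"
    by (simp_all add: distrib_right left_diff_distrib)
  then show False using pi_gt3 by linarith
qed

lemma val_center:
  assumes g: "good_point k \<zeta>" and z: "\<zeta> \<in> E j" "\<zeta> \<in> E k"
  shows "val k j \<zeta> = Phi k \<zeta>"
  using good_E_near[OF g z(1)]
proof (elim disjE)
  assume j: "j = k - 1"
  have 1: "\<zeta> \<in> E (k - 1)" "\<zeta> \<in> E (k - 1 + 1)" using z j by auto
  have s: "cmod (hexp (k - 1) (Phi (k - 1) \<zeta>)) < eps (k - 1)" "cmod (hexp (k - 1) (Phi (k - 1 + 1) \<zeta>)) < eps (k - 1)"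
    by (rule good_small[OF g]; use 1 in simp)+
  show ?thesis using Phi_glue(1)[OF 1 s] by (simp add: val_def j)
next
  assume j: "j = k + 1"
  have 1: "\<zeta> \<in> E k" "\<zeta> \<in> E (k + 1)" using z j by auto
  have s: "cmod (hexp k (Phi k \<zeta>)) < eps k" "cmod (hexp k (Phi (k + 1) \<zeta>)) < eps k"
    by (rule good_small[OF g]; use 1 in simp)+
  show ?thesis using Phi_glue(2)[OF 1 s] by (simp add: val_def j)
qed (simp add: val_def)

text \<open>Two different strips through \<zeta> cannot be k - 1 and k + 1, which are disjoint.
  Hence \<zeta> lies in strip k, where both computations return \<open>Phi k\<close>.\<close>

lemma FC_val:
  assumes g: "good_point k \<zeta>" and z: "\<zeta> \<in> E j"
  shows "FC k \<zeta> = val k j \<zeta>"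
proof -
  have i: "\<zeta> \<in> E (idx \<zeta>)" by (rule idx_E(1)[OF good_bounds(1)[OF g]])
  note n = good_E_near[OF g z] good_E_near[OF g i]
  show ?thesis
  proof (cases "idx \<zeta> = j")
    case True then show ?thesis by (simp add: FC_def)
  next
    case ne: False
    show ?thesis
    proof (cases "\<zeta> \<in> E k")
      case True
      show ?thesis unfolding FC_def val_center[OF g i True] val_center[OF g z True] ..
    next
      case False
      then have "j \<noteq> k" "idx \<zeta> \<noteq> k" using z i by auto
      then have "\<zeta> \<in> E (k - 1) \<and> \<zeta> \<in> E (k + 1)" using n ne z i by auto
      then show ?thesis using E_disjoint[of \<zeta> k] by blast
    qed
  qed
qed

lemma val_props:
  assumes g: "good_point k \<zeta>" and z: "\<zeta> \<in> E j"
  shows "cmod (val k j \<zeta> - Phi j \<zeta>) \<le> 1/4" "val k j field_differentiable at \<zeta>"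
proof -
  have P: "Phi i field_differentiable at \<zeta>" if zi: "\<zeta> \<in> E i" for i
    by (rule Phi_deriv[OF zi]) (auto simp: field_differentiable_def)
  have "cmod (val k j \<zeta> - Phi j \<zeta>) \<le> 1/4 \<and> val k j field_differentiable at \<zeta>"
    using good_E_near[OF g z]
  proof (elim disjE)
    assume j: "j = k"
    have "val k j = Phi k" by (rule ext) (simp add: val_def j)
    then show ?thesis using P z j by simp
  next
    assume j: "j = k + 1"
    have v: "val k j = (\<lambda>\<zeta>. Phi (k + 1) \<zeta> + hlog k (G k) (Phi (k + 1) \<zeta>))" by (rule ext) (simp add: val_def j)
    have s: "cmod (hexp k (Phi (k + 1) \<zeta>)) < eps k" by (rule good_small[OF g]; use z j in simp)
    have Pz: "Phi (k + 1) field_differentiable at \<zeta>" using P z j by simp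
    have "(\<lambda>\<zeta>. hlog k (G k) (Phi (k + 1) \<zeta>)) field_differentiable at \<zeta>"
      using field_differentiable_compose[OF Pz hlog_G(3)[OF s]] by (simp add: o_def)
    then show ?thesis unfolding v using field_differentiable_add[OF Pz] hlog_G(2)[OF s] j by simp
  next
    assume j: "j = k - 1"
    have v: "val k j = (\<lambda>\<zeta>. Phi (k - 1) \<zeta> + hlog (k - 1) (H (k - 1)) (Phi (k - 1) \<zeta>))" by (rule ext) (simp add: val_def j)
    have s: "cmod (hexp (k - 1) (Phi (k - 1) \<zeta>)) < eps (k - 1)" by (rule good_small[OF g]; use z j in simp)
    have Pz: "Phi (k - 1) field_differentiable at \<zeta>" using P z j by simp
    have "(\<lambda>\<zeta>. hlog (k - 1) (H (k - 1)) (Phi (k - 1) \<zeta>)) field_differentiable at \<zeta>"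
      using field_differentiable_compose[OF Pz hlog_H(3)[OF s]] by (simp add: o_def)
    then show ?thesis unfolding v using field_differentiable_add[OF Pz] hlog_H(2)[OF s] j by simp
  qed
  then show "cmod (val k j \<zeta> - Phi j \<zeta>) \<le> 1/4" "val k j field_differentiable at \<zeta>" by blast+
qed

lemma FC_near:
  assumes g: "good_point k \<zeta>"
  shows "cmod (FC k \<zeta> - exp (sg \<zeta>)) \<le> 1/2"
proof -
  have i: "\<zeta> \<in> E (idx \<zeta>)" by (rule idx_E(1)[OF good_bounds(1)[OF g]])
  have "FC k \<zeta> - exp (sg \<zeta>) = (val k (idx \<zeta>) \<zeta> - Phi (idx \<zeta>) \<zeta>) + (Phi (idx \<zeta>) \<zeta> - exp (sg \<zeta>))" by (simp add: FC_def)
  then show ?thesis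
    using norm_triangle_ineq[of "val k (idx \<zeta>) \<zeta> - Phi (idx \<zeta>) \<zeta>" "Phi (idx \<zeta>) \<zeta> - exp (sg \<zeta>)"] val_props(1)[OF g i] Phi_near[OF i] by simp
qed

lemma FC_hol:
  assumes S: "open S" "\<And>\<zeta>. \<zeta> \<in> S \<Longrightarrow> good_point k \<zeta>"
  shows "FC k holomorphic_on S"
proof -
  have "FC k field_differentiable at \<zeta> within S" if z: "\<zeta> \<in> S" for \<zeta>
  proof -
    note g = S(2)[OF z]
    note i = idx_E[OF good_bounds(1)[OF g]]
    obtain f' where f': "(val k (idx \<zeta>) has_field_derivative f') (at \<zeta>)" using val_props(2)[OF g i(1)] by (auto simp: field_differentiable_def)
    have "(FC k has_field_derivative f') (at \<zeta>)"
    proof (rule has_field_derivative_transform_within_open[OF f', where S = "S \<inter> ball \<zeta> (1/16)"])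
      show "val k (idx \<zeta>) w = FC k w" if "w \<in> S \<inter> ball \<zeta> (1/16)" for w
        using FC_val[OF S(2), of w "idx \<zeta>"] that i(2) by auto
    qed (use S z in auto)
    then show ?thesis using has_field_derivative_at_within field_differentiable_def by blast
  qed
  then show ?thesis by (simp add: holomorphic_on_def)
qed

lemma FC_step:
  assumes g: "good_point k \<zeta>" "good_point k (F \<zeta>)"
  shows "FC k (F \<zeta>) = FC k \<zeta> + 1"
proof -
  have zD: "\<zeta> \<in> D1" by (rule good_bounds(1)[OF g(1)])
  note c = F_core[OF idx_core[OF zD]]
  \<comment> \<open>The nearest strip of \<open>F \<zeta>\<close> may differ from that of \<zeta>,
    but \<open>FC_val\<close> allows evaluation in the strip of \<zeta>; there the step is 1 and
    \<open>hlog\<close> is unchanged by periodicity.\<close>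
  have "F \<zeta> \<in> E (idx \<zeta>)" using c(1) idx_E(2)[OF zD] by blast
  then have 1: "FC k (F \<zeta>) = val k (idx \<zeta>) (F \<zeta>)" by (rule FC_val[OF g(2)])
  note i = good_E_near[OF g(1) idx_E(1)[OF zD]]
  show ?thesis unfolding 1 FC_def[of k \<zeta>]
    using i c(2) by (elim disjE) (simp_all add: val_def hlog_plus_one)
qed

text \<open>A point of both petals has its nearest strip equal to k or k + 1. In the first case
  \<open>FC (k + 1)\<close> is by definition the image of \<open>Phi k\<close> under the germ; in
  the second \<open>FC k\<close> is the image of \<open>Phi (k + 1)\<close> under its
  inverse.\<close>

lemma FC_horn:
  assumes g: "good_point k \<zeta>" "good_point (k + 1) \<zeta>"
  shows "H k (hexp k (FC k \<zeta>)) = hexp k (FC (k + 1) \<zeta>)"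
proof -
  have i: "\<zeta> \<in> E (idx \<zeta>)" by (rule idx_E(1)[OF good_bounds(1)[OF g(1)]])
  have "idx \<zeta> = k \<or> idx \<zeta> = k + 1" using good_E_near[OF g(1) i] good_E_near[OF g(2) i] by auto
  then show ?thesis
  proof
    assume j: "idx \<zeta> = k"
    have s: "cmod (hexp k (Phi k \<zeta>)) < eps k" using good_small[OF g(2), of k k] i j by simp
    show ?thesis using hlog_H(1)[OF s] j by (simp add: FC_def val_def)
  next
    assume j: "idx \<zeta> = k + 1"
    have s: "cmod (hexp k (Phi (k + 1) \<zeta>)) < eps k" using good_small[OF g(1), of k "k + 1"] i j by simp
    have e: "cmod (hexp k (Phi (k + 1) \<zeta>)) < eG k" using s tiny_eps[of k] by (auto simp: tiny_def)
    show ?thesis using hlog_G(1)[OF s] G_props[OF e] j by (simp add: FC_def val_def)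
  qed
qed

text \<open>Equal values give equal horn variables of \<open>Phi j\<close>, because the germ is
  injective near 0; the values of \<open>Phi j\<close> are within 1/2 of each other, so no period
  can intervene.\<close>

lemma val_inj:
  assumes g: "good_point k z1" "good_point k z2" and z: "z1 \<in> E j" "z2 \<in> E j" and eq: "val k j z1 = val k j z2"
  shows "Phi j z1 = Phi j z2"
  using good_E_near[OF g(1) z(1)]
proof (elim disjE)
  assume "j = k" then show ?thesis using eq by (simp add: val_def)
next
  have "Phi j z1 - Phi j z2 = (val k j z2 - Phi j z2) - (val k j z1 - Phi j z1)" using eq by simp
  then have close: "cmod (Phi j z1 - Phi j z2) < 1"
    using norm_triangle_ineq4[of "val k j z2 - Phi j z2" "val k j z1 - Phi j z1"] val_props(1)[OF g(1) z(1)] val_props(1)[OF g(2) z(2)] by simp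
  {
    assume j: "j = k + 1"
    have s: "cmod (hexp k (Phi (k + 1) z1)) < eps k" "cmod (hexp k (Phi (k + 1) z2)) < eps k"
      using good_small[OF g(1), of k "k + 1"] good_small[OF g(2), of k "k + 1"] z j by simp_all
    have "eps k \<le> eG k" using tiny_eps[of k] by (auto simp: tiny_def)
    then have e: "cmod (hexp k (Phi (k + 1) z1)) < eG k" "cmod (hexp k (Phi (k + 1) z2)) < eG k" using s by linarith+
    have "hexp k (val k j z1) = hexp k (val k j z2)" using eq by simp
    then have "G k (hexp k (Phi (k + 1) z1)) = G k (hexp k (Phi (k + 1) z2))" using hlog_G(1)[OF s(1)] hlog_G(1)[OF s(2)] by (simp add: val_def j)
    then have "hexp k (Phi (k + 1) z1) = hexp k (Phi (k + 1) z2)" using G_props[OF e(1)] G_props[OF e(2)] by metis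
    then show ?thesis using hexp_eq_close close j by blast
  next
    assume j: "j = k - 1"
    have s: "cmod (hexp (k - 1) (Phi (k - 1) z1)) < eps (k - 1)" "cmod (hexp (k - 1) (Phi (k - 1) z2)) < eps (k - 1)"
      using good_small[OF g(1), of "k - 1" "k - 1"] good_small[OF g(2), of "k - 1" "k - 1"] z j by simp_all
    have "eps (k - 1) \<le> eG (k - 1)" using tiny_eps[of "k - 1"] by (auto simp: tiny_def)
    then have e: "cmod (hexp (k - 1) (Phi (k - 1) z1)) < eG (k - 1)" "cmod (hexp (k - 1) (Phi (k - 1) z2)) < eG (k - 1)" using s by linarith+
    have "hexp (k - 1) (val k j z1) = hexp (k - 1) (val k j z2)" using eq by simp
    then have "H (k - 1) (hexp (k - 1) (Phi (k - 1) z1)) = H (k - 1) (hexp (k - 1) (Phi (k - 1) z2))"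
      using hlog_H(1)[OF s(1)] hlog_H(1)[OF s(2)] by (simp add: val_def j)
    then have "hexp (k - 1) (Phi (k - 1) z1) = hexp (k - 1) (Phi (k - 1) z2)" using G_H[OF e(1)] G_H[OF e(2)] by metis
    then show ?thesis using hexp_eq_close close j by blast
  }
qed

text \<open>Since \<open>FC k\<close> is within 1/2 of exp (\<open>sg\<close>), equal values make
  \<open>sg z1\<close> and \<open>sg z2\<close> nearly equal modulo 2 pi i. Both imaginary parts lie
  in a strip narrower than 2 pi by the margins, which excludes a nonzero period. As
  \<open>sg\<close> is close to a translation, z1 then lies in the disc of radius 1/16 around z2,
  where \<open>Phi\<close> is injective.\<close>

lemma FC_inj:
  assumes S: "convex S" "S \<subseteq> D1" and z: "z1 \<in> S" "z2 \<in> S" and g: "good_point k z1" "good_point k z2" and eq: "FC k z1 = FC k z2"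
  shows "z1 = z2"
proof -
  define s1 s2 where "s1 = sg z1" and "s2 = sg z2"
  define x where "x = exp (- (Re z2 / 2))"
  define r where "r = 1 / sqrt (Re z2)"
  have x1: "r \<le> 1/4" "64 * x < r" using good_bounds(3,5)[OF g(2)] by (simp_all only: x_def r_def)
  have x0: "0 < x" by (simp add: x_def)
  have "x < 1/256" using x1 by linarith
  note x = this x1(2) x0
  have "exp s1 - exp s2 = (FC k z2 - exp s2) - (FC k z1 - exp s1)" using eq by simp
  then have "cmod (exp s1 - exp s2) \<le> 1"
    using norm_triangle_ineq4[of "FC k z2 - exp s2" "FC k z1 - exp s1"] FC_near[OF g(1)] FC_near[OF g(2)] by (simp add: s1_def s2_def)
  moreover have "exp s1 - exp s2 = exp s2 * (exp (s1 - s2) - 1)" by (simp add: exp_diff field_simps)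
  ultimately have "exp (Re s2) * cmod (exp (s1 - s2) - 1) \<le> 1" by (simp add: norm_mult norm_exp_eq_Re)
  then have "cmod (exp (s1 - s2) - 1) \<le> exp (- Re s2)" by (simp add: exp_minus field_simps)
  also have "\<dots> \<le> x" using good_bounds(6)[OF g(2)] by (simp add: x_def s2_def)
  finally have d: "cmod (exp (s1 - s2) - 1) \<le> x" .
  define w where "w = Ln (exp (s1 - s2))"
  have w: "cmod w \<le> 2 * x" using norm_Ln_le[of "exp (s1 - s2)"] d x by (simp add: w_def)
  have "exp w = exp (s1 - s2)" by (simp add: w_def)
  then obtain n :: int where n: "w = s1 - s2 + complex_of_real (2 * of_int n * pi) * \<i>" unfolding exp_eq by auto
  have "Im w = Im s1 - Im s2 + 2 * of_int n * pi" using n by simp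
  then have "\<bar>2 * of_int n * pi\<bar> \<le> \<bar>Im s1 - Im s2\<bar> + 2 * x" using w abs_Im_le_cmod[of w] by linarith
  moreover have "\<bar>Im s1 - Im s2\<bar> \<le> 2 * pi - r"
    using good_bounds(2,4)[OF g(1)] good_bounds(2)[OF g(2)] unfolding s1_def s2_def r_def[symmetric] by linarith
  ultimately have "\<bar>2 * of_int n * pi\<bar> < 2 * pi" using x by linarith
  then have "\<bar>of_int n - of_int 0\<bar> * pi < real 1 * pi" by (simp add: abs_mult)
  then have "n = 0" using pi_multiple_lt[of n 0 1] by simp
  then have ws: "cmod (s1 - s2) \<le> 2 * x" using w n by simp
  have "cmod ((sg z1 - z1) - (sg z2 - z2)) \<le> 1/8 * cmod (z1 - z2)"
  proof (rule field_differentiable_bound[OF S(1), of "\<lambda>z. sg z - z" "\<lambda>z. deriv sg z - 1"])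
    fix u assume "u \<in> S"
    then have u: "u \<in> D0" using S(2) D1_props(1) by blast
    show "((\<lambda>z. sg z - z) has_field_derivative deriv sg u - 1) (at u within S)"
      by (intro DERIV_diff has_field_derivative_at_within[OF D0_props(9)[OF u]] DERIV_ident)
    show "cmod (deriv sg u - 1) \<le> 1/8" by (rule D0_props(11)[OF u])
  qed (use z in auto)
  moreover have "cmod (z1 - z2) \<le> cmod (s1 - s2) + cmod ((sg z1 - z1) - (sg z2 - z2))"
  proof -
    have "z1 - z2 = (s1 - s2) - ((sg z1 - z1) - (sg z2 - z2))" by (simp add: s1_def s2_def)
    then show ?thesis by (metis norm_triangle_ineq4)
  qed
  ultimately have "cmod (z1 - z2) \<le> 2 * x + 1/8 * cmod (z1 - z2)" using ws by linarith
  then have "cmod (z1 - z2) < 1/16" using x by linarith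
  then have b: "z1 \<in> ball z2 (1/16)" by (simp add: dist_norm norm_minus_commute)
  have zD: "z2 \<in> D1" by (rule good_bounds(1)[OF g(2)])
  note i = idx_E[OF zD]
  have i1: "z1 \<in> E (idx z2)" using i(2) b by blast
  have "val k (idx z2) z1 = val k (idx z2) z2" using eq FC_val[OF g(1) i1] by (simp add: FC_def)
  from val_inj[OF g i1 i(1) this] have "Phi (idx z2) z1 = Phi (idx z2) z2" .
  from core_unique[OF idx_core[OF zD] b _ this] show ?thesis by simp
qed

end

section \<open>Dynamics on the petals\<close>

lemma exp_int_pi: "exp (\<i> * of_real (of_int k * pi)) = of_real (altsign k)"
proof -
  have "cos (of_int k * pi) = altsign k" "sin (of_int k * pi) = 0"
    using cos_npi_int[of k] sin_npi_int[of k] by (simp_all add: mult.commute altsign_def)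
  then show ?thesis by (simp add: complex_eq_iff Re_exp Im_exp)
qed

lemma norm_exp_i_diff: "cmod (exp (\<i> * of_real a) - exp (\<i> * of_real b)) \<le> \<bar>a - b\<bar>"
proof -
  have "cmod (exp (\<i> * of_real a) - exp (\<i> * of_real b)) \<le> 1 * cmod (of_real a - of_real b :: complex)"
  proof (rule field_differentiable_bound[of \<real> "\<lambda>z. exp (\<i> * z)" "\<lambda>z. \<i> * exp (\<i> * z)"])
    show "convex \<real>" by (auto simp: convex_def scaleR_conv_of_real)
    show "((\<lambda>z. exp (\<i> * z)) has_field_derivative \<i> * exp (\<i> * z)) (at z within \<real>)" for z
      by (auto intro!: derivative_eq_intros)
    show "cmod (\<i> * exp (\<i> * z)) \<le> 1" if "z \<in> \<real>" for z using that by (auto elim!: Reals_cases simp: norm_mult)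
  qed auto
  also have "cmod (of_real a - of_real b :: complex) = \<bar>a - b\<bar>" by (simp only: of_real_diff[symmetric] norm_of_real real_norm_def)
  finally show ?thesis by simp
qed

text \<open>From Re \<zeta> > a^2 + 8/\<delta>^2 and the inequality a \<delta> \<le> a^2 \<delta>^2
  + 8. This converts an error O(1 / Re \<zeta>) into one that is small relative to the distance
  \<delta> to the edge.\<close>

lemma petal_room:
  assumes z: "\<zeta> \<in> petal k M" and a: "0 \<le> a" "a^2 \<le> M" "a \<le> M"
  shows "a / Re \<zeta> \<le> pi - \<bar>Im \<zeta> - of_int k * pi\<bar>" "a / Re \<zeta> \<le> 1"
proof -
  define \<delta> where "\<delta> = pi - \<bar>Im \<zeta> - of_int k * pi\<bar>"
  have \<delta>: "0 < \<delta>" and x: "M + 8 / \<delta>^2 < Re \<zeta>" using z by (auto simp: petal_def \<delta>_def)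
  have d8: "0 < 8 / \<delta>^2" using \<delta> by simp
  have x0: "0 < Re \<zeta>" using a x d8 by linarith
  have "0 \<le> (a * \<delta> - 1)^2 + a * \<delta> + 7" using a \<delta> by (intro add_nonneg_nonneg) auto
  then have "a * \<delta> \<le> a^2 * \<delta>^2 + 8" by (simp add: power2_eq_square algebra_simps)
  also have "\<dots> = (a^2 + 8 / \<delta>^2) * \<delta>^2" using \<delta> by (simp add: distrib_right)
  also have "\<dots> \<le> Re \<zeta> * \<delta>^2" using a x by (intro mult_right_mono) auto
  finally have "a * \<delta> \<le> (Re \<zeta> * \<delta>) * \<delta>" by (simp add: power2_eq_square mult.assoc)
  then have "a \<le> Re \<zeta> * \<delta>" using \<delta> by (rule mult_right_le_imp_le)
  then have "a \<le> \<delta> * Re \<zeta>" by (simp only: mult.commute)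
  then have "a / Re \<zeta> \<le> \<delta>" by (simp only: pos_divide_le_eq[OF x0])
  then show "a / Re \<zeta> \<le> pi - \<bar>Im \<zeta> - of_int k * pi\<bar>" by (simp only: \<delta>_def)
  have "a \<le> Re \<zeta>" using a x d8 by linarith
  then show "a / Re \<zeta> \<le> 1" using x0 by simp
qed

context atlas_horn
begin

lemma strip_bound:
  assumes "\<bar>Im \<zeta> - of_int k * pi\<bar> \<le> pi + 1"
  shows "\<bar>Im \<zeta>\<bar> \<le> (\<bar>of_int k\<bar> + 1) * pi + 1"
proof -
  have "\<bar>of_int k * pi\<bar> = \<bar>of_int k\<bar> * pi" by (simp add: abs_mult)
  then show ?thesis using assms unfolding distrib_right by linarith
qed

text \<open>The step is 1/p up to a relative error O(1 / Re \<zeta>), and the argument of 1/p is -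
  Im \<zeta> up to m Im (Ln \<zeta>), of order 1 / Re \<zeta> on a strip of bounded height.
  Splitting off k pi produces \<open>altsign k\<close>: the same field points forwards on attracting
  strips and backwards on repelling ones.\<close>

lemma step_direction:
  obtains Xr C where "1 \<le> Xr" "0 \<le> C"
    "\<And>\<zeta>. Xr \<le> Re \<zeta> \<Longrightarrow> \<bar>Im \<zeta> - of_int k * pi\<bar> \<le> pi + 1 \<Longrightarrow> \<zeta> \<in> D1"
    "\<And>\<zeta>. Xr \<le> Re \<zeta> \<Longrightarrow> \<bar>Im \<zeta> - of_int k * pi\<bar> \<le> pi + 1 \<Longrightarrow>
       cmod ((F \<zeta> - \<zeta>) - of_real (altsign k) * (of_real (1 / cmod (expo m \<zeta>)) * exp (- \<i> * of_real (Im \<zeta> - of_int k * pi))))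
       \<le> 1 / cmod (expo m \<zeta>) * (C / Re \<zeta>)"
proof -
  define q where "q = (\<bar>real_of_int k\<bar> + 1) * pi + 1"
  have q0: "0 \<le> q" by (simp add: q_def)
  have M0: "0 \<le> M" by (simp add: M_def)
  obtain X1 where X1: "1 \<le> X1" "\<And>\<zeta>. X1 \<le> Re \<zeta> \<Longrightarrow> \<bar>Im \<zeta>\<bar> \<le> q \<Longrightarrow> \<zeta> \<in> D1"
    "\<And>\<zeta>. X1 \<le> Re \<zeta> \<Longrightarrow> \<bar>Im \<zeta>\<bar> \<le> q \<Longrightarrow> cmod (Ln \<zeta> - of_real (ln (Re \<zeta>))) \<le> 2 * q / Re \<zeta>"
    by (rule right_strip[OF q0]) (rule that; assumption)
  obtain c1 N where N': "0 < c1" and N: "0 \<le> N"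
    "\<And>\<zeta>. \<zeta> \<in> D1 \<Longrightarrow> cmod (exp (- (F \<zeta> - \<zeta>)) - 1 + 1 / expo m \<zeta> - of_real \<rho> / ((expo m \<zeta>)^2 * \<zeta>)) \<le> c1 / ((cmod (expo m \<zeta>))^2 * (cmod \<zeta>)^2)"
    "\<And>\<zeta>. \<zeta> \<in> D1 \<Longrightarrow> cmod (expo m \<zeta> * (F \<zeta> - \<zeta>) - 1) \<le> N / cmod (expo m \<zeta>)"
    by (rule F_expansion) (rule that; assumption)
  show thesis
  proof (rule that[of X1 "N + 2 * q * M"])
    show "1 \<le> X1" by (rule X1(1))
    show "0 \<le> N + 2 * q * M" using N(1) M0 q0 by simp
    fix \<zeta> assume z: "X1 \<le> Re \<zeta>" "\<bar>Im \<zeta> - of_int k * pi\<bar> \<le> pi + 1"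
    have zq: "\<bar>Im \<zeta>\<bar> \<le> q" unfolding q_def by (rule strip_bound[OF z(2)])
    show zD: "\<zeta> \<in> D1" by (rule X1(2)[OF z(1) zq])
    define p where "p = expo m \<zeta>"
    define v where "v = 1 / cmod p"
    define u where "u = F \<zeta> - \<zeta>"
    define y where "y = Im \<zeta> - of_int k * pi"
    have x1: "1 \<le> Re \<zeta>" using X1(1) z(1) by linarith
    have p0: "p \<noteq> 0" "0 < cmod p" by (simp_all add: p_def)
    have v0: "0 < v" using p0 by (simp add: v_def)
    have "Re \<zeta> \<le> cmod \<zeta>" by (rule complex_Re_le_cmod)
    also have "\<dots> \<le> (cmod \<zeta>)^2" using complex_Re_le_cmod[of \<zeta>] x1 by (simp add: power2_eq_square mult_le_cancel_left1)
    also have "\<dots> \<le> cmod p" using D1_props(4)[OF zD] by (simp add: p_def)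
    finally have xp: "Re \<zeta> \<le> cmod p" .
    have inv: "1 / p = of_real v * exp (- \<i> * of_real (Im (\<zeta> + of_int m * Ln \<zeta>)))"
    proof -
      have "p = of_real (cmod p) * exp (\<i> * of_real (Im (\<zeta> + of_int m * Ln \<zeta>)))"
        unfolding p_def expo_def norm_exp_eq_Re by (subst complex_eq[of "\<zeta> + of_int m * Ln \<zeta>"]) (simp only: exp_add exp_of_real mult.commute)
      then have "1 / p = 1 / of_real (cmod p) * (1 / exp (\<i> * of_real (Im (\<zeta> + of_int m * Ln \<zeta>))))" by (metis mult_1 times_divide_times_eq)
      then show ?thesis by (simp add: v_def exp_minus divide_inverse)
    qed
    have "Im (\<zeta> + of_int m * Ln \<zeta>) = (y + of_int k * pi) + of_int m * Im (Ln \<zeta>)" by (simp add: y_def)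
    then have ip: "- \<i> * of_real (Im (\<zeta> + of_int m * Ln \<zeta>)) = \<i> * of_real (- (y + of_int m * Im (Ln \<zeta>))) + \<i> * of_real (of_int (- k) * pi)"
      by (simp add: algebra_simps)
    have "altsign (- k) = altsign k" by (simp add: altsign_def)
    then have inv2: "1 / p = of_real v * (of_real (altsign k) * exp (\<i> * of_real (- (y + of_int m * Im (Ln \<zeta>)))))"
      unfolding inv ip exp_add exp_int_pi by simp
    have LnI: "\<bar>Im (Ln \<zeta>)\<bar> \<le> 2 * q / Re \<zeta>"
      using abs_Im_le_cmod[of "Ln \<zeta> - of_real (ln (Re \<zeta>))"] X1(3)[OF z(1) zq] by simp
    have 1: "cmod (1 / p - of_real (altsign k) * (of_real v * exp (- \<i> * of_real y))) \<le> v * (2 * q * M / Re \<zeta>)"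
    proof -
      have "1 / p - of_real (altsign k) * (of_real v * exp (- \<i> * of_real y))
         = of_real (altsign k) * of_real v * (exp (\<i> * of_real (- (y + of_int m * Im (Ln \<zeta>)))) - exp (\<i> * of_real (- y)))"
        unfolding inv2 by (simp add: algebra_simps)
      then have "cmod (1 / p - of_real (altsign k) * (of_real v * exp (- \<i> * of_real y)))
        = v * cmod (exp (\<i> * of_real (- (y + of_int m * Im (Ln \<zeta>)))) - exp (\<i> * of_real (- y)))"
        using v0 by (simp add: norm_mult altsign_def)
      also have "\<dots> \<le> v * \<bar>- (y + of_int m * Im (Ln \<zeta>)) - (- y)\<bar>" using v0 by (intro mult_left_mono norm_exp_i_diff) simp
      also have "\<bar>- (y + of_int m * Im (Ln \<zeta>)) - (- y)\<bar> = M * \<bar>Im (Ln \<zeta>)\<bar>" by (simp add: abs_mult M_def)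
      also have "\<dots> \<le> M * (2 * q / Re \<zeta>)" using LnI M0 by (rule mult_left_mono)
      finally show ?thesis using v0 by (simp add: mult.commute mult.left_commute)
    qed
    have "u - 1 / p = (p * u - 1) / p" using p0 by (simp add: field_simps)
    then have "cmod (u - 1 / p) = v * cmod (p * u - 1)" by (simp add: norm_divide v_def)
    also have "\<dots> \<le> v * (N / Re \<zeta>)"
    proof (rule mult_left_mono)
      have "N / cmod p \<le> N / Re \<zeta>" using xp x1 N(1) by (intro divide_left_mono mult_pos_pos) auto
      then show "cmod (p * u - 1) \<le> N / Re \<zeta>" using N(3)[OF zD] unfolding p_def u_def by linarith
    qed (use v0 in simp)
    finally have 2: "cmod (u - 1 / p) \<le> v * (N / Re \<zeta>)" .
    have "cmod (u - of_real (altsign k) * (of_real v * exp (- \<i> * of_real y))) \<le> v * (N / Re \<zeta>) + v * (2 * q * M / Re \<zeta>)"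
      using norm_triangle_ineq[of "u - 1 / p" "1 / p - of_real (altsign k) * (of_real v * exp (- \<i> * of_real y))"] 1 2 by simp
    also have "\<dots> = v * ((N + 2 * q * M) / Re \<zeta>)" by (simp add: distrib_left add_divide_distrib)
    finally show "cmod ((F \<zeta> - \<zeta>) - of_real (altsign k) * (of_real (1 / cmod (expo m \<zeta>)) * exp (- \<i> * of_real (Im \<zeta> - of_int k * pi))))
       \<le> 1 / cmod (expo m \<zeta>) * ((N + 2 * q * M) / Re \<zeta>)" by (simp only: u_def v_def p_def y_def)
  qed
qed

lemma petal_dynamics:
  obtains Xr where "1 \<le> Xr"
    "\<And>M'. Xr \<le> M' \<Longrightarrow> even k \<Longrightarrow> F ` petal k M' \<subseteq> petal k M'"
    "\<And>M' w. Xr \<le> M' \<Longrightarrow> odd k \<Longrightarrow> w \<in> petal k M' \<Longrightarrow> \<exists>\<zeta>\<in>petal k M'. F \<zeta> = w"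
proof -
  obtain X1 C where X1: "1 \<le> X1" "0 \<le> C"
    "\<And>\<zeta>. X1 \<le> Re \<zeta> \<Longrightarrow> \<bar>Im \<zeta> - of_int k * pi\<bar> \<le> pi + 1 \<Longrightarrow> \<zeta> \<in> D1"
    "\<And>\<zeta>. X1 \<le> Re \<zeta> \<Longrightarrow> \<bar>Im \<zeta> - of_int k * pi\<bar> \<le> pi + 1 \<Longrightarrow>
       cmod ((F \<zeta> - \<zeta>) - of_real (altsign k) * (of_real (1 / cmod (expo m \<zeta>)) * exp (- \<i> * of_real (Im \<zeta> - of_int k * pi))))
       \<le> 1 / cmod (expo m \<zeta>) * (C / Re \<zeta>)"
    by (rule step_direction) (rule that; assumption)
  \<comment> \<open>For backward steps the direction is known at the preimage \<zeta> but needed at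
    w. Turning it costs at most 2 / Re \<zeta>, and the factor 2 replaces Re \<zeta> by Re w. The
    100 in the next constant gives the error bound \<delta>/100 of
    \<open>petal_step\<close>.\<close>
  define C2 where "C2 = 2 * (C + 2)"
  define a where "a = 100 * C2"
  have a0: "400 \<le> a" using X1(2) by (simp add: a_def C2_def)
  define Xr where "Xr = X1 + a^2 + a + 1"
  have Xr: "X1 + 1 \<le> Xr" "a^2 \<le> Xr" "a \<le> Xr" using a0 X1(1) by (auto simp: Xr_def)
  have prep: "X1 + 1 \<le> Re \<zeta>" "\<bar>Im \<zeta> - of_int k * pi\<bar> < pi"
      "C2 / Re \<zeta> \<le> (pi - \<bar>Im \<zeta> - of_int k * pi\<bar>) / 100" "C2 / Re \<zeta> \<le> 1/100" "1 \<le> Re \<zeta>"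
    if M': "Xr \<le> M'" and z: "\<zeta> \<in> petal k M'" for M' \<zeta>
  proof -
    have "0 \<le> 8 / (pi - \<bar>Im \<zeta> - of_int k * pi\<bar>)^2" by simp
    moreover have "M' + 8 / (pi - \<bar>Im \<zeta> - of_int k * pi\<bar>)^2 < Re \<zeta>" using z by (simp add: petal_def)
    ultimately show x: "X1 + 1 \<le> Re \<zeta>" using Xr(1) M' by linarith
    then show "1 \<le> Re \<zeta>" using X1(1) by linarith
    show "\<bar>Im \<zeta> - of_int k * pi\<bar> < pi" using z by (simp add: petal_def)
    have "0 \<le> a" "a^2 \<le> M'" "a \<le> M'" using a0 Xr M' by linarith+
    note r = petal_room[OF z this]
    define t where "t = C2 / Re \<zeta>"
    have "a / Re \<zeta> = 100 * t" by (simp add: a_def t_def)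
    note r' = r[unfolded this]
    show "C2 / Re \<zeta> \<le> 1/100" unfolding t_def[symmetric] using r'(2) by linarith
    show "C2 / Re \<zeta> \<le> (pi - \<bar>Im \<zeta> - of_int k * pi\<bar>) / 100"
      unfolding t_def[symmetric] using divide_right_mono[OF r'(1), of 100] by simp
  qed
  have vle: "1 / cmod (expo m \<zeta>) \<le> 1/10" if "\<zeta> \<in> D1" for \<zeta>
  proof -
    have "64 \<le> cmod (expo m \<zeta>)" using D1_props(3)[OF that] by (smt (verit) abs_ge_zero)
    then show ?thesis by (simp add: divide_le_eq)
  qed
  show thesis
  proof (rule that[of Xr])
    show "1 \<le> Xr" using Xr X1(1) by linarith
    show "F ` petal k M' \<subseteq> petal k M'" if M': "Xr \<le> M'" and ev: "even k" for M'
    proof safe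
      fix \<zeta> assume z: "\<zeta> \<in> petal k M'"
      note P = prep[OF M' z]
      have x: "X1 \<le> Re \<zeta>" "\<bar>Im \<zeta> - of_int k * pi\<bar> \<le> pi + 1" using P by linarith+
      have al: "altsign k = 1" using ev by (simp add: altsign_def)
      have CC: "0 \<le> C / Re \<zeta>" "C / Re \<zeta> \<le> C2 / Re \<zeta>" using X1(2) P(5) by (auto simp: C2_def intro!: divide_right_mono)
      have "\<zeta> + (F \<zeta> - \<zeta>) \<in> petal k M'"
      proof (rule petal_step[OF z, where v = "1 / cmod (expo m \<zeta>)" and e = "C / Re \<zeta>"])
        show "1 / cmod (expo m \<zeta>) \<le> 1/10" by (rule vle[OF X1(3)[OF x]])
        show "cmod (F \<zeta> - \<zeta> - complex_of_real (1 / cmod (expo m \<zeta>)) * exp (- \<i> * complex_of_real (Im \<zeta> - real_of_int k * pi))) \<le> 1 / cmod (expo m \<zeta>) * (C / Re \<zeta>)"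
          using X1(4)[OF x] unfolding al of_real_1 mult_1_left .
      qed (use CC P in \<open>simp, linarith+\<close>)
      then show "F \<zeta> \<in> petal k M'" by simp
    qed
    show "\<exists>\<zeta>\<in>petal k M'. F \<zeta> = w" if M': "Xr \<le> M'" and od: "odd k" and w: "w \<in> petal k M'" for M' w
    proof -
      note P = prep[OF M' w]
      have strip: "X1 \<le> Re \<zeta> \<and> \<bar>Im \<zeta> - of_int k * pi\<bar> \<le> pi + 1 \<and> Re w / 2 \<le> Re \<zeta>" if "\<zeta> \<in> cball w (1/32)" for \<zeta>
      proof -
        have "cmod (\<zeta> - w) \<le> 1/32" using that by (simp add: dist_norm norm_minus_commute)
        then have "\<bar>Re \<zeta> - Re w\<bar> \<le> 1/32" "\<bar>Im \<zeta> - Im w\<bar> \<le> 1/32"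
          using abs_Re_le_cmod[of "\<zeta> - w"] abs_Im_le_cmod[of "\<zeta> - w"] by simp_all
        then show ?thesis using P(1,2,5) by linarith
      qed
      have inD: "\<zeta> \<in> D1" if "\<zeta> \<in> cball w (1/32)" for \<zeta> using X1(3) strip[OF that] by blast
      \<comment> \<open>A preimage of w is a fixed point of \<zeta> \<mapsto> w - (F \<zeta> -
        \<zeta>), which maps the disc into itself because every displacement is at most 1/32;
        Brouwer's theorem asks for nothing but continuity.\<close>
      have "continuous_on (cball w (1/32)) F" using inD by (intro continuous_on_subset[OF holomorphic_on_imp_continuous_on[OF F_hol]]) blast
      then have "continuous_on (cball w (1/32)) (\<lambda>\<zeta>. w - (F \<zeta> - \<zeta>))" by (intro continuous_intros)
      moreover have "(\<lambda>\<zeta>. w - (F \<zeta> - \<zeta>)) \<in> cball w (1/32) \<rightarrow> cball w (1/32)"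
        using F_step(2)[OF inD] by (auto simp: dist_norm)
      ultimately obtain \<zeta> where z: "\<zeta> \<in> cball w (1/32)" "w - (F \<zeta> - \<zeta>) = \<zeta>"
        using brouwer_ball[of "1/32" w "\<lambda>\<zeta>. w - (F \<zeta> - \<zeta>)"] by auto
      define v where "v = 1 / cmod (expo m \<zeta>)"
      have v0: "0 < v" by (simp add: v_def)
      note s = strip[OF z(1)]
      have zD: "\<zeta> \<in> D1" by (rule inD[OF z(1)])
      have al: "altsign k = - 1" using od by (simp add: altsign_def)
      have x0: "1/2 \<le> Re \<zeta>" "0 < Re \<zeta>" using s P(5) by linarith+
      have d: "cmod (- (F \<zeta> - \<zeta>) - of_real v * exp (- \<i> * of_real (Im \<zeta> - of_int k * pi))) \<le> v * (C / Re \<zeta>)"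
      proof -
        have "cmod (F \<zeta> - \<zeta> - - 1 * (of_real v * exp (- \<i> * of_real (Im \<zeta> - of_int k * pi)))) \<le> v * (C / Re \<zeta>)"
          using X1(4)[of \<zeta>] s unfolding al v_def by simp
        moreover have "- (F \<zeta> - \<zeta>) - of_real v * exp (- \<i> * of_real (Im \<zeta> - of_int k * pi)) = - (F \<zeta> - \<zeta> - - 1 * (of_real v * exp (- \<i> * of_real (Im \<zeta> - of_int k * pi))))" by simp
        ultimately show ?thesis by (simp only: norm_minus_cancel)
      qed
      have e1: "\<zeta> - w = - (F \<zeta> - \<zeta>)" using z(2) by (simp add: algebra_simps)
      have "cmod (\<zeta> - w) \<le> 2 * v" using F_step(1)[OF zD] unfolding e1 norm_minus_cancel v_def by simp
      then have dI: "\<bar>Im \<zeta> - Im w\<bar> \<le> 2 * v" using abs_Im_le_cmod[of "\<zeta> - w"] by simp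
      have vx: "v \<le> 1 / Re \<zeta>"
      proof -
        have "1 \<le> cmod \<zeta>" by (rule D0_props(6)[OF D1_props(1)[OF zD]])
        then have "cmod \<zeta> \<le> (cmod \<zeta>)^2" by (simp add: power2_eq_square mult_le_cancel_left1)
        then have "Re \<zeta> \<le> cmod (expo m \<zeta>)" using complex_Re_le_cmod[of \<zeta>] D1_props(4)[OF zD] by linarith
        then show ?thesis unfolding v_def using x0 by (intro divide_left_mono mult_pos_pos) auto
      qed
      have "w + (\<zeta> - w) \<in> petal k M'"
      proof (rule petal_step[OF w, where v = v and e = "C2 / Re w"])
        show "0 \<le> v" using v0 by simp
        show "v \<le> 1/10" unfolding v_def by (rule vle[OF zD])
        show "0 \<le> C2 / Re w" using P(5) X1(2) by (simp add: C2_def)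
        have E: "cmod (exp (- \<i> * of_real (Im \<zeta> - of_int k * pi)) - exp (- \<i> * of_real (Im w - of_int k * pi))) \<le> 2 / Re \<zeta>"
        proof -
          have eq: "- \<i> * of_real t = \<i> * of_real (- t)" for t :: real by simp
          have "cmod (exp (- \<i> * of_real (Im \<zeta> - of_int k * pi)) - exp (- \<i> * of_real (Im w - of_int k * pi))) \<le> \<bar>Im \<zeta> - Im w\<bar>"
            unfolding eq using norm_exp_i_diff[of "- (Im \<zeta> - of_int k * pi)" "- (Im w - of_int k * pi)"] by linarith
          then show ?thesis using dI vx by (simp add: divide_inverse)
        qed
        have split: "A - V * D = (A - V * C) + V * (C - D)" for A C D V :: complex by (simp add: algebra_simps)
        have "\<zeta> - w - of_real v * exp (- \<i> * of_real (Im w - of_int k * pi))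
          = (- (F \<zeta> - \<zeta>) - of_real v * exp (- \<i> * of_real (Im \<zeta> - of_int k * pi)))
          + of_real v * (exp (- \<i> * of_real (Im \<zeta> - of_int k * pi)) - exp (- \<i> * of_real (Im w - of_int k * pi)))"
          unfolding e1 by (rule split)
        then have "cmod (\<zeta> - w - of_real v * exp (- \<i> * of_real (Im w - of_int k * pi))) \<le> v * (C / Re \<zeta>) + v * (2 / Re \<zeta>)"
          using d mult_left_mono[OF E less_imp_le[OF v0]] v0
            norm_triangle_ineq[of "- (F \<zeta> - \<zeta>) - of_real v * exp (- \<i> * of_real (Im \<zeta> - of_int k * pi))"
             "of_real v * (exp (- \<i> * of_real (Im \<zeta> - of_int k * pi)) - exp (- \<i> * of_real (Im w - of_int k * pi)))"]
          by (simp only: norm_mult norm_of_real)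
        also have "\<dots> = v * ((C + 2) / Re \<zeta>)" by (simp add: distrib_left add_divide_distrib)
        also have "\<dots> \<le> v * (C2 / Re w)"
        proof (rule mult_left_mono)
          have "(C + 2) / Re \<zeta> \<le> (C + 2) / (Re w / 2)" using s P(5) X1(2) by (intro divide_left_mono mult_pos_pos) auto
          then show "(C + 2) / Re \<zeta> \<le> C2 / Re w" by (simp add: C2_def mult.commute)
        qed (use v0 in simp)
        finally show "cmod (\<zeta> - w - of_real v * exp (- \<i> * of_real (Im w - of_int k * pi))) \<le> v * (C2 / Re w)" .
      qed (use P in auto)
      then have "\<zeta> \<in> petal k M'" by simp
      moreover have "F \<zeta> = w" using z(2) by (simp add: algebra_simps)
      ultimately show ?thesis by blast
    qed
  qed
qed

end

text \<open>Multiplying by the squared distance replaces the quotient, which blows up at the edge,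
  by a condition between functions continuous on the whole plane.\<close>

lemma open_petal: "open (petal k M)"
proof -
  have "petal k M = {\<zeta>. \<bar>Im \<zeta> - of_int k * pi\<bar> < pi} \<inter> {\<zeta>. M * (pi - \<bar>Im \<zeta> - of_int k * pi\<bar>)^2 + 8 < Re \<zeta> * (pi - \<bar>Im \<zeta> - of_int k * pi\<bar>)^2}"
  proof (intro set_eqI)
    fix \<zeta>
    have "M + 8 / d^2 < Re \<zeta> \<longleftrightarrow> M * d^2 + 8 < Re \<zeta> * d^2" if "0 < d" for d :: real
    proof -
      have "M + 8 / d^2 = (M * d^2 + 8) / d^2" using that by (simp add: field_simps)
      then show ?thesis using that by (simp add: pos_divide_less_eq)
    qed
    then show "\<zeta> \<in> petal k M \<longleftrightarrow> \<zeta> \<in> {\<zeta>. \<bar>Im \<zeta> - of_int k * pi\<bar> < pi} \<inter> {\<zeta>. M * (pi - \<bar>Im \<zeta> - of_int k * pi\<bar>)^2 + 8 < Re \<zeta> * (pi - \<bar>Im \<zeta> - of_int k * pi\<bar>)^2}"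
      by (auto simp: petal_def)
  qed
  then show ?thesis by (auto intro!: open_Int open_Collect_less continuous_intros)
qed

context atlas_horn
begin

definition petal_ok where "petal_ok k M' \<longleftrightarrow> (\<forall>\<zeta>\<in>petal k M'. good_point k \<zeta>) \<and> inj_on (FC k) (petal k M') \<and>
  (even k \<longrightarrow> F ` petal k M' \<subseteq> petal k M') \<and> (odd k \<longrightarrow> (\<forall>w\<in>petal k M'. \<exists>\<zeta>\<in>petal k M'. F \<zeta> = w))"

lemma petal_threshold: "\<exists>T. \<forall>M'\<ge>T. petal_ok k M'"
proof -
  obtain T1 where T1: "\<And>M' \<zeta>. T1 \<le> M' \<Longrightarrow> \<zeta> \<in> petal k M' \<Longrightarrow> good_point k \<zeta>" "1 \<le> T1"
    by (rule petal_good) (rule that; assumption)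
  obtain T2 where T2: "1 \<le> T2" "\<And>M'. T2 \<le> M' \<Longrightarrow> even k \<Longrightarrow> F ` petal k M' \<subseteq> petal k M'"
    "\<And>M' w. T2 \<le> M' \<Longrightarrow> odd k \<Longrightarrow> w \<in> petal k M' \<Longrightarrow> \<exists>\<zeta>\<in>petal k M'. F \<zeta> = w"
    by (rule petal_dynamics) (rule that; assumption)
  define q where "q = (\<bar>real_of_int k\<bar> + 1) * pi + 1"
  have q0: "0 \<le> q" by (simp add: q_def)
  obtain T3 where T3: "1 \<le> T3" "\<And>\<zeta>. T3 \<le> Re \<zeta> \<Longrightarrow> \<bar>Im \<zeta>\<bar> \<le> q \<Longrightarrow> \<zeta> \<in> D1"
    by (rule right_strip[OF q0]) (rule that; assumption)
  \<comment> \<open>A convex half-strip containing the petal: the mean value estimate for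
    \<open>sg \<zeta>\<close> - \<zeta> in \<open>FC_inj\<close> is taken along segments.\<close>
  define S where "S = {\<zeta>. T3 < Re \<zeta>} \<inter> ({\<zeta>. of_int k * pi - pi < Im \<zeta>} \<inter> {\<zeta>. Im \<zeta> < of_int k * pi + pi})"
  have S: "convex S" unfolding S_def by (intro convex_Int convex_halfspace_Re_gt convex_halfspace_Im_gt convex_halfspace_Im_lt)
  have SD: "S \<subseteq> D1"
  proof
    fix \<zeta> assume "\<zeta> \<in> S"
    then have s: "T3 < Re \<zeta>" "of_int k * pi - pi < Im \<zeta>" "Im \<zeta> < of_int k * pi + pi" by (auto simp: S_def)
    then have "\<bar>Im \<zeta> - of_int k * pi\<bar> \<le> pi + 1" by linarith
    from strip_bound[OF this] show "\<zeta> \<in> D1" using T3(2)[of \<zeta>] s(1) by (simp add: q_def)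
  qed
  have "petal_ok k M'" if M': "max T1 (max T2 T3) \<le> M'" for M'
  proof -
    have M1: "T1 \<le> M'" "T2 \<le> M'" "T3 \<le> M'" using M' by auto
    have sub: "petal k M' \<subseteq> S"
    proof
      fix \<zeta> assume z: "\<zeta> \<in> petal k M'"
      have "0 \<le> 8 / (pi - \<bar>Im \<zeta> - of_int k * pi\<bar>)^2" by simp
      moreover have "M' + 8 / (pi - \<bar>Im \<zeta> - of_int k * pi\<bar>)^2 < Re \<zeta>" "\<bar>Im \<zeta> - of_int k * pi\<bar> < pi" using z by (auto simp: petal_def)
      ultimately have "T3 < Re \<zeta>" "of_int k * pi - pi < Im \<zeta>" "Im \<zeta> < of_int k * pi + pi" using M1 by linarith+
      then show "\<zeta> \<in> S" by (simp add: S_def)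
    qed
    have "inj_on (FC k) (petal k M')"
    proof (rule inj_onI)
      fix z1 z2 assume z: "z1 \<in> petal k M'" "z2 \<in> petal k M'" "FC k z1 = FC k z2"
      show "z1 = z2" by (rule FC_inj[OF S SD _ _ T1(1)[OF M1(1) z(1)] T1(1)[OF M1(1) z(2)] z(3)]) (use z sub in auto)
    qed
    then show ?thesis unfolding petal_ok_def using T1(1)[OF M1(1)] T2(2)[OF M1(2)] T2(3)[OF M1(2)] by blast
  qed
  then show ?thesis by blast
qed

text \<open>Such points keep a distance of at least 3/4 from the edges of both petals, and 8/(3/4)^2
  < 16.\<close>

lemma near_axis_in_petals:
  assumes "\<bar>Im \<zeta> - (of_int k + 1/2) * pi\<bar> \<le> 3/4" "M' + 16 \<le> Re \<zeta>"
  shows "\<zeta> \<in> petal k M'" "\<zeta> \<in> petal (k + 1) M'"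
proof -
  have gen: "\<zeta> \<in> petal l M'" if l: "\<bar>Im \<zeta> - of_int l * pi\<bar> \<le> pi/2 + 3/4" for l
  proof -
    have d: "3/4 \<le> pi - \<bar>Im \<zeta> - of_int l * pi\<bar>" using l pi_gt3 by linarith
    then have "(3/4)^2 \<le> (pi - \<bar>Im \<zeta> - of_int l * pi\<bar>)^2" by (rule power_mono) simp
    then have "8 / (pi - \<bar>Im \<zeta> - of_int l * pi\<bar>)^2 \<le> 8 / (3/4)^2" using d by (intro divide_left_mono) auto
    also have "\<dots> < 16" by (simp add: power2_eq_square)
    finally have "M' + 8 / (pi - \<bar>Im \<zeta> - of_int l * pi\<bar>)^2 < Re \<zeta>" using assms(2) by linarith
    then show ?thesis using d by (simp add: petal_def)
  qed
  have e: "(of_int k + 1/2) * pi = of_int k * pi + pi/2" "of_int (k + 1) * pi = of_int k * pi + pi" by (simp_all add: distrib_right)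
  show "\<zeta> \<in> petal k M'" by (rule gen) (use assms(1) pi_gt3 in \<open>unfold e, linarith\<close>)
  show "\<zeta> \<in> petal (k + 1) M'" by (rule gen) (use assms(1) pi_gt3 in \<open>unfold e, linarith\<close>)
qed

text \<open>Given t, choose w0 with \<open>hexp k w0\<close> = t on the branch belonging to overlap
  k and solve \<open>FC k \<zeta>\<close> = w0. As \<open>FC k\<close> = exp (\<open>sg\<close>) +
  \<psi> with |\<psi>| \<le> 1/2, the equation reads \<open>sg \<zeta>\<close> = a + Ln (1 -
  \<psi>/w0), where exp a = w0, and it becomes a fixed point problem on a small disc.\<close>

lemma horn_point:
  assumes good: "\<And>\<zeta>. \<zeta> \<in> petal k M1 \<Longrightarrow> good_point k \<zeta>"
  obtains \<epsilon> where "0 < \<epsilon>" "\<And>t. 0 < cmod t \<Longrightarrow> cmod t < \<epsilon> \<Longrightarrow> \<exists>\<zeta>\<in>petal k M1 \<inter> petal (k + 1) M2. hexp k (FC k \<zeta>) = t"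
proof -
  define q where "q = (\<bar>real_of_int k\<bar> + 1) * pi + 1"
  have q0: "0 \<le> q" by (simp add: q_def)
  define C where "C = 2 * q * M + K"
  have M0: "0 \<le> M" by (simp add: M_def)
  obtain Xr where Xr: "1 \<le> Xr" "\<And>\<zeta>. Xr \<le> Re \<zeta> \<Longrightarrow> \<bar>Im \<zeta>\<bar> \<le> q \<Longrightarrow> \<zeta> \<in> D1"
    "\<And>\<zeta>. Xr \<le> Re \<zeta> \<Longrightarrow> \<bar>Im \<zeta>\<bar> \<le> q \<Longrightarrow> cmod (sg \<zeta> - (\<zeta> + of_int m * of_real (ln (Re \<zeta>)))) \<le> C / Re \<zeta>"
    by (rule right_strip[OF q0, folded C_def]) (rule that; assumption)
  define T0 where "T0 = max Xr (max M1 M2 + 16)"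
  define Mp where "Mp = M + 1"
  have Mp: "0 < Mp" using M0 by (simp add: Mp_def)
  define C' where "C' = C + 1"
  have C': "0 < C'" using M0 q0 XK by (simp add: C'_def C_def add_pos_nonneg add_nonneg_pos)
  have "\<forall>\<^sub>F x::real in at_top. T0 \<le> x - (Mp * ln x + 1/4) \<and> Mp * ((Mp * ln x + 1/4) / (x - (Mp * ln x + 1/4))) \<le> 1/16 \<and>
      C' / (x - (Mp * ln x + 1/4)) \<le> 1/16 \<and> exp (- x) \<le> 1/16 \<and> 1 \<le> x"
    using Mp C' by (intro eventually_conj eventually_ge_at_top) real_asymp+
  then obtain X where X: "\<And>x. X \<le> x \<Longrightarrow> T0 \<le> x - (Mp * ln x + 1/4) \<and> Mp * ((Mp * ln x + 1/4) / (x - (Mp * ln x + 1/4))) \<le> 1/16 \<and>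
      C' / (x - (Mp * ln x + 1/4)) \<le> 1/16 \<and> exp (- x) \<le> 1/16 \<and> 1 \<le> x"
    unfolding eventually_at_top_linorder by blast
  show thesis
  \<comment> \<open>This bound on |t| makes Re z > exp X + 2 for z = - Ln t / (2 pi), hence ln |z|
    \<ge> X; the 2 keeps the argument of z small.\<close>
  proof (rule that[of "exp (- (2 * pi) * (exp X + 2))"])
    fix t :: complex assume t: "0 < cmod t" "cmod t < exp (- (2 * pi) * (exp X + 2))"
    have t0: "t \<noteq> 0" using t by auto
    define z where "z = - Ln t / of_real (2 * pi)"
    define P where "P = Re z"
    have Pe: "P = - ln (cmod t) / (2 * pi)" using t0 by (simp add: P_def z_def Re_divide_of_real)
    have "ln (cmod t) < - (2 * pi) * (exp X + 2)" using t by (metis exp_gt_zero ln_exp ln_less_cancel_iff)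
    then have "(exp X + 2) * (2 * pi) < - ln (cmod t)" by (simp add: algebra_simps)
    then have P: "exp X + 2 < P" unfolding Pe by (subst pos_less_divide_eq) (simp, assumption)
    have P2: "2 < P" using P exp_gt_zero[of X] by linarith
    have "\<bar>Im (Ln t)\<bar> \<le> pi" using mpi_less_Im_Ln[OF t0] Im_Ln_le_pi[OF t0] by linarith
    then have Iz: "\<bar>Im z\<bar> \<le> 1/2" by (simp add: z_def Im_divide_of_real divide_le_eq)
    have z0: "z \<noteq> 0" using P2 by (auto simp: P_def)
    have Imz: "\<bar>Im (Ln z)\<bar> \<le> 1/2"
    proof -
      have "z / of_real P - 1 = \<i> * of_real (Im z / P)" using P2 by (simp add: complex_eq_iff P_def Re_divide_of_real Im_divide_of_real)
      then have "cmod (z / of_real P - 1) = \<bar>Im z\<bar> / P" using P2 by (simp add: norm_mult norm_divide)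
      also have "\<dots> \<le> 1/4" using Iz P2 by (simp add: divide_le_eq)
      finally have n: "cmod (z / of_real P - 1) \<le> 1/4" .
      then have "cmod (Ln (z / of_real P)) \<le> 1/2" using norm_Ln_le[of "z / of_real P"] by linarith
      moreover have "Ln z = of_real (ln P) + Ln (z / of_real P)"
        using Ln_times_of_real[of P "z / of_real P"] P2 z0 by (simp add: Ln_of_real)
      ultimately show ?thesis using abs_Im_le_cmod[of "Ln (z / of_real P)"] by simp
    qed
    define w0 where "w0 = of_real (altsign k) * (\<i> * z)"
    have hw: "hexp k w0 = t"
    proof -
      have "of_real (altsign k) * (2 * pi * \<i>) * w0 = (of_real (altsign k) * of_real (altsign k)) * (\<i> * \<i>) * (2 * pi * z)"
        unfolding w0_def by (simp only: mult_ac)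
      also have "\<dots> = Ln t" using pi_gt_zero by (simp add: z_def)
      finally show ?thesis unfolding hexp_def using t0 by simp
    qed
    \<comment> \<open>The logarithm of w0 whose imaginary part is close to (k + 1/2) pi, the middle
      of overlap k.\<close>
    define a where "a = \<i> * of_real ((of_int k + 1/2) * pi) + Ln z"
    define xa where "xa = Re a"
    have Ia: "\<bar>Im a - (of_int k + 1/2) * pi\<bar> \<le> 1/2" using Imz by (simp add: a_def)
    have xaz: "xa = ln (cmod z)" using z0 by (simp add: xa_def a_def)
    have nz: "exp xa = cmod z" using z0 by (simp add: xaz)
    have ea: "exp a = w0"
    proof -
      have "\<i> * of_real ((of_int k + 1/2) * pi) = \<i> * of_real (of_int k * pi) + \<i> * of_real (pi/2)" by (simp add: algebra_simps)
      then have "exp a = of_real (altsign k) * exp (\<i> * of_real (pi/2)) * exp (Ln z)" by (simp only: a_def exp_add exp_int_pi)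
      then have "exp a = of_real (altsign k) * exp (\<i> * of_real (pi/2)) * z" using z0 by simp
      moreover have "exp (\<i> * of_real (pi/2)) = \<i>" by (simp add: complex_eq_iff Re_exp Im_exp)
      ultimately show ?thesis by (simp add: w0_def mult.assoc)
    qed
    have nw: "cmod w0 = exp xa" using nz by (simp add: w0_def norm_mult altsign_def)
    have "exp X \<le> cmod z" using P complex_Re_le_cmod[of z] by (simp add: P_def)
    then have Xxa: "X \<le> xa" unfolding nz[symmetric] by simp
    note Y = X[OF Xxa]
    \<comment> \<open>L bounds the horizontal distance from a to the points of the disc: the shift m
      ln xa of its centre plus its radius.\<close>
    define L where "L = Mp * ln xa + 1/4"
    have YY: "T0 \<le> xa - L" "Mp * (L / (xa - L)) \<le> 1/16" "C' / (xa - L) \<le> 1/16" "exp (- xa) \<le> 1/16" "1 \<le> xa"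
      using Y unfolding L_def by blast+
    have ln0: "0 \<le> ln xa" using YY(5) by simp
    have T1: "1 \<le> T0" using Xr(1) by (simp add: T0_def)
    have mln: "\<bar>of_int m * ln xa\<bar> \<le> L - 1/4"
    proof -
      have "\<bar>of_int m * ln xa\<bar> = M * ln xa" using ln0 by (simp add: abs_mult M_def)
      also have "\<dots> \<le> Mp * ln xa" using ln0 by (intro mult_right_mono) (auto simp: Mp_def)
      finally show ?thesis by (simp add: L_def)
    qed
    have L0: "0 \<le> L" using mln by linarith
    \<comment> \<open>Since \<open>sg \<zeta>\<close> is about \<zeta> + m ln (Re \<zeta>), the
      solution is expected near a - m ln xa. The map T deviates from this centre by three errors of
      at most 1/16 each, within the radius 1/4.\<close>
    define c0 where "c0 = a - of_real (of_int m * ln xa)"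
    define \<psi> where "\<psi> \<zeta> = FC k \<zeta> - exp (sg \<zeta>)" for \<zeta>
    define T where "T \<zeta> = a + Ln (1 - \<psi> \<zeta> / w0) - (sg \<zeta> - \<zeta>)" for \<zeta>
    have B: "xa - L \<le> Re \<zeta>" "Re \<zeta> \<le> xa + L" "\<zeta> \<in> petal k M1" "\<zeta> \<in> petal (k + 1) M2" "\<zeta> \<in> D1" "\<bar>Im \<zeta>\<bar> \<le> q"
      if z: "\<zeta> \<in> cball c0 (1/4)" for \<zeta>
    proof -
      have "cmod (\<zeta> - c0) \<le> 1/4" using z by (simp add: dist_norm norm_minus_commute)
      then have "\<bar>Re (\<zeta> - c0)\<bar> \<le> 1/4" "\<bar>Im (\<zeta> - c0)\<bar> \<le> 1/4" using abs_Re_le_cmod[of "\<zeta> - c0"] abs_Im_le_cmod[of "\<zeta> - c0"] by linarith+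
      then have RI: "\<bar>Re \<zeta> - (xa - of_int m * ln xa)\<bar> \<le> 1/4" "\<bar>Im \<zeta> - Im a\<bar> \<le> 1/4" by (simp_all add: c0_def xa_def)
      show r: "xa - L \<le> Re \<zeta>" "Re \<zeta> \<le> xa + L" using RI(1) mln by linarith+
      have ax: "\<bar>Im \<zeta> - (of_int k + 1/2) * pi\<bar> \<le> 3/4" using RI(2) Ia by linarith
      have "M1 + 16 \<le> T0" "M2 + 16 \<le> T0" by (simp_all add: T0_def)
      then have "M1 + 16 \<le> Re \<zeta>" "M2 + 16 \<le> Re \<zeta>" using r YY(1) by linarith+
      then show "\<zeta> \<in> petal k M1" "\<zeta> \<in> petal (k + 1) M2" using near_axis_in_petals[OF ax] by blast+
      have "(of_int k + 1/2) * pi = of_int k * pi + pi/2" by (simp add: distrib_right)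
      then have "\<bar>Im \<zeta> - of_int k * pi\<bar> \<le> pi + 1" using ax pi_gt3 by linarith
      from strip_bound[OF this] show Iq: "\<bar>Im \<zeta>\<bar> \<le> q" by (simp add: q_def)
      have "Xr \<le> T0" by (simp add: T0_def)
      then have "Xr \<le> Re \<zeta>" using r YY(1) by linarith
      then show "\<zeta> \<in> D1" using Xr(2) Iq by blast
    qed
    have ps: "cmod (\<psi> \<zeta> / w0) \<le> 1/2 * (1/16)" if z: "\<zeta> \<in> cball c0 (1/4)" for \<zeta>
    proof -
      have "cmod (\<psi> \<zeta> / w0) = cmod (\<psi> \<zeta>) * exp (- xa)" unfolding norm_divide nw by (simp add: exp_minus divide_inverse)
      also have "\<dots> \<le> 1/2 * (1/16)" using FC_near[OF good[OF B(3)[OF z]]] YY(4) unfolding \<psi>_def[symmetric] by (intro mult_mono) auto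
      finally show ?thesis .
    qed
    have "continuous_on (cball c0 (1/4)) T"
    proof -
      have "FC k holomorphic_on petal k M1" by (rule FC_hol[OF open_petal good])
      then have c1: "continuous_on (cball c0 (1/4)) (FC k)" using B(3) by (intro continuous_on_subset[OF holomorphic_on_imp_continuous_on]) auto
      have c2: "continuous_on (cball c0 (1/4)) sg"
      proof (rule continuous_at_imp_continuous_on, rule ballI)
        fix \<zeta> assume "\<zeta> \<in> cball c0 (1/4)"
        then have "\<zeta> \<in> D0" using B(5) D1_props(1) by blast
        from D0_props(9)[OF this] show "isCont sg \<zeta>" by (rule DERIV_isCont)
      qed
      have w00: "w0 \<noteq> 0" using z0 by (auto simp: w0_def altsign_def)
      have c3: "continuous_on (cball c0 (1/4)) (\<lambda>\<zeta>. 1 - \<psi> \<zeta> / w0)" unfolding \<psi>_def using c1 c2 w00 by (intro continuous_intros) auto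
      have nn: "1 - \<psi> \<zeta> / w0 \<notin> \<real>\<^sub>\<le>\<^sub>0" if z: "\<zeta> \<in> cball c0 (1/4)" for \<zeta>
      proof -
        have "Re (\<psi> \<zeta> / w0) < 1" using ps[OF z] complex_Re_le_cmod[of "\<psi> \<zeta> / w0"] by linarith
        then have "0 < Re (1 - \<psi> \<zeta> / w0)" by (simp only: minus_complex.sel one_complex.sel diff_gt_0_iff_gt)
        then show ?thesis by (auto simp: complex_nonpos_Reals_iff)
      qed
      have c4: "continuous_on (cball c0 (1/4)) (\<lambda>\<zeta>. Ln (1 - \<psi> \<zeta> / w0))" by (rule continuous_on_Ln'[OF c3 nn])
      show ?thesis unfolding T_def by (intro continuous_on_add continuous_on_diff continuous_on_const continuous_on_id c4 c2)
    qed
    moreover have "T \<in> cball c0 (1/4) \<rightarrow> cball c0 (1/4)"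
    proof
      fix \<zeta> assume z: "\<zeta> \<in> cball c0 (1/4)"
      note b = B[OF z]
      define r where "r = Re \<zeta>"
      have pos: "0 < xa - L" "0 < r" "0 < xa" using YY(1,5) T1 b(1) by (simp_all add: r_def)
      have "ln r - ln xa \<le> (r - xa) / xa" by (rule ln_diff_le) (use pos in auto)
      also have "\<dots> \<le> L / xa" using b(2) pos by (intro divide_right_mono) (auto simp: r_def)
      also have "\<dots> \<le> L / (xa - L)" using L0 pos by (intro divide_left_mono) auto
      finally have l1: "ln r - ln xa \<le> L / (xa - L)" .
      have "ln xa - ln r \<le> (xa - r) / r" by (rule ln_diff_le) (use pos in auto)
      also have "\<dots> \<le> L / r" using b(1) pos by (intro divide_right_mono) (auto simp: r_def)
      also have "\<dots> \<le> L / (xa - L)" using L0 pos b(1) by (intro divide_left_mono) (auto simp: r_def)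
      finally have l2: "ln xa - ln r \<le> L / (xa - L)" .
      have l: "\<bar>ln xa - ln r\<bar> \<le> L / (xa - L)" using l1 l2 by linarith
      have e1: "cmod (of_real (of_int m * (ln xa - ln r)) :: complex) \<le> 1/16"
      proof -
        have "cmod (of_real (of_int m * (ln xa - ln r)) :: complex) = M * \<bar>ln xa - ln r\<bar>" by (simp only: norm_of_real real_norm_def abs_mult M_def)
        also have "\<dots> \<le> Mp * (L / (xa - L))" using l M0 by (intro mult_mono) (auto simp: Mp_def)
        finally show ?thesis using YY(2) by linarith
      qed
      have e2: "cmod (Ln (1 - \<psi> \<zeta> / w0)) \<le> 1/16"
      proof -
        have "cmod (1 - \<psi> \<zeta> / w0 - 1) \<le> 1/2 * (1/16)" using ps[OF z] by simp
        then show ?thesis using norm_Ln_le[of "1 - \<psi> \<zeta> / w0"] by linarith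
      qed
      have "Xr \<le> T0" by (simp add: T0_def)
      then have "Xr \<le> Re \<zeta>" using b(1) YY(1) by linarith
      from Xr(3)[OF this b(6)] have "cmod (sg \<zeta> - (\<zeta> + of_int m * of_real (ln r))) \<le> C / r" by (simp only: r_def)
      also have "\<dots> \<le> C' / r" using pos by (intro divide_right_mono) (auto simp: C'_def)
      also have "\<dots> \<le> C' / (xa - L)" using C' pos b(1) by (intro divide_left_mono) (auto simp: r_def)
      finally have e3: "cmod (sg \<zeta> - (\<zeta> + of_int m * of_real (ln r))) \<le> 1/16" using YY(3) by linarith
      have "T \<zeta> - c0 = of_real (of_int m * (ln xa - ln r)) + Ln (1 - \<psi> \<zeta> / w0) - (sg \<zeta> - (\<zeta> + of_int m * of_real (ln r)))"
        by (simp add: T_def c0_def algebra_simps)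
      then have "cmod (T \<zeta> - c0) \<le> cmod (of_real (of_int m * (ln xa - ln r)) :: complex) + cmod (Ln (1 - \<psi> \<zeta> / w0)) + cmod (sg \<zeta> - (\<zeta> + of_int m * of_real (ln r)))"
        by (metis norm_triangle_ineq norm_triangle_ineq4 add_right_mono order_trans)
      then have "cmod (T \<zeta> - c0) \<le> 1/4" using e1 e2 e3 by linarith
      then show "T \<zeta> \<in> cball c0 (1/4)" by (simp add: dist_norm norm_minus_commute)
    qed
    ultimately obtain \<zeta> where \<zeta>: "\<zeta> \<in> cball c0 (1/4)" "T \<zeta> = \<zeta>" using brouwer_ball[of "1/4" c0 T] by auto
    have w00: "w0 \<noteq> 0" using z0 by (auto simp: w0_def altsign_def)
    have "1 - \<psi> \<zeta> / w0 \<noteq> 0"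
    proof
      assume "1 - \<psi> \<zeta> / w0 = 0"
      then have "\<psi> \<zeta> / w0 = 1" by simp
      then show False using ps[OF \<zeta>(1)] by simp
    qed
    moreover have "sg \<zeta> = a + Ln (1 - \<psi> \<zeta> / w0)" using \<zeta>(2) by (simp add: T_def algebra_simps)
    ultimately have "exp (sg \<zeta>) = w0 * (1 - \<psi> \<zeta> / w0)" using exp_Ln[of "1 - \<psi> \<zeta> / w0"] by (simp only: exp_add ea) simp
    also have "\<dots> = w0 - \<psi> \<zeta>" using w00 by (simp add: right_diff_distrib)
    finally have "FC k \<zeta> = w0" by (simp add: \<psi>_def)
    then show "\<exists>\<zeta>\<in>petal k M1 \<inter> petal (k + 1) M2. hexp k (FC k \<zeta>) = t" using hw B(3,4)[OF \<zeta>(1)] by blast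
  qed simp
qed

text \<open>Germ number k acts on the intersection of petals k and k + 1. For k = - 2 j these are
  the attracting and the repelling petal of index j, for k = 1 - 2 j the repelling petal of index j
  and the attracting one of index j - 1. The signs of \<open>hexp\<close> then agree with the
  definition of horn maps, so all scaling factors can be taken as 1.\<close>

lemma realizes:
  assumes D: "\<And>k. \<exists>T. \<forall>M'\<ge>T. petal k M' \<subseteq> D"
    and HI: "\<And>j. H (- 2 * j) = hI j" and H0: "\<And>j. H (1 - 2 * j) = h0 j"
  shows "realizes_horn F D h0 hI"
proof -
  have "\<exists>M'. petal_ok k M' \<and> petal k M' \<subseteq> D" for k
  proof -
    obtain T where T: "\<forall>M'\<ge>T. petal_ok k M'" using petal_threshold by blast
    obtain T' where T': "\<forall>M'\<ge>T'. petal k M' \<subseteq> D" using D by blast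
    show ?thesis using T[rule_format, of "max T T'"] T'[rule_format, of "max T T'"] by auto
  qed
  then obtain Mk where Mk: "\<And>k. petal_ok k (Mk k)" "\<And>k. petal k (Mk k) \<subseteq> D" by metis
  define V where "V k = petal k (Mk k)" for k
  have good: "good_point k \<zeta>" if "\<zeta> \<in> V k" for k \<zeta> using Mk(1)[of k] that by (auto simp: petal_ok_def V_def)
  have fat: "fatou_coord F (V k) (FC k)" for k
    unfolding fatou_coord_def
  proof (intro conjI ballI impI)
    show "FC k holomorphic_on V k" by (rule FC_hol[OF _ good]) (simp_all add: V_def open_petal)
    show "inj_on (FC k) (V k)" using Mk(1)[of k] by (simp add: petal_ok_def V_def)
    show "FC k (F \<zeta>) = FC k \<zeta> + 1" if "\<zeta> \<in> V k" "F \<zeta> \<in> V k" for \<zeta> by (rule FC_step[OF good[OF that(1)] good[OF that(2)]])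
  qed
  have horn: "\<exists>\<epsilon>>0. \<forall>t. 0 < cmod t \<and> cmod t < \<epsilon> \<longrightarrow> (\<exists>\<zeta>. \<zeta> \<in> V k \<inter> V (k + 1) \<and> hexp k (FC k \<zeta>) = t) \<and>
      (\<forall>\<zeta>. \<zeta> \<in> V k \<inter> V (k + 1) \<and> hexp k (FC k \<zeta>) = t \<longrightarrow> H k t = hexp k (FC (k + 1) \<zeta>))" for k
  proof -
    have g: "good_point k \<zeta>" if "\<zeta> \<in> petal k (Mk k)" for \<zeta> using good[of \<zeta> k] that by (simp only: V_def)
    obtain \<epsilon> where e: "0 < \<epsilon>" "\<And>t. 0 < cmod t \<Longrightarrow> cmod t < \<epsilon> \<Longrightarrow> \<exists>\<zeta>\<in>petal k (Mk k) \<inter> petal (k + 1) (Mk (k + 1)). hexp k (FC k \<zeta>) = t"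
      by (rule horn_point[of k "Mk k" "Mk (k + 1)"]) (rule g, assumption, (rule that; assumption))
    show ?thesis
    proof (intro exI[of _ \<epsilon>] conjI allI impI e(1))
      fix t :: complex assume t: "0 < cmod t \<and> cmod t < \<epsilon>"
      show "\<exists>\<zeta>. \<zeta> \<in> V k \<inter> V (k + 1) \<and> hexp k (FC k \<zeta>) = t" using e(2)[of t] t unfolding V_def by blast
      fix \<zeta> assume z: "\<zeta> \<in> V k \<inter> V (k + 1) \<and> hexp k (FC k \<zeta>) = t"
      then have "H k (hexp k (FC k \<zeta>)) = hexp k (FC (k + 1) \<zeta>)" by (intro FC_horn good) auto
      then show "H k t = hexp k (FC (k + 1) \<zeta>)" using z by simp
    qed
  qed
  have hexp_odd: "hexp (1 - 2 * j) w = exp (- 2 * pi * \<i> * w)" and hexp_even: "hexp (- 2 * j) w = exp (2 * pi * \<i> * w)" for j w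
    by (simp_all add: hexp_def altsign_def)
  show ?thesis
    unfolding realizes_horn_def
  proof (rule exI[of _ "\<lambda>j. V (- 2 * j)"], rule exI[of _ "\<lambda>j. V (1 - 2 * j)"], rule exI[of _ "\<lambda>j. FC (- 2 * j)"],
      rule exI[of _ "\<lambda>j. FC (1 - 2 * j)"], intro exI[of _ "\<lambda>_. 1"] conjI allI ballI)
    fix j :: int
    have e: "even (- 2 * j)" and o: "odd (1 - 2 * j)" by simp_all
    have c: "2 * real_of_int j * pi = - of_int (- 2 * j) * pi" "(2 * real_of_int j - 1) * pi = - of_int (1 - 2 * j) * pi" by simp_all
    show "is_petal (2 * real_of_int j * pi) (2 * pi) (V (- 2 * j))" unfolding c V_def by (rule petal_is_petal)
    show "is_petal ((2 * real_of_int j - 1) * pi) (2 * pi) (V (1 - 2 * j))" unfolding c V_def by (rule petal_is_petal)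
    show "V (- 2 * j) \<subseteq> D" "V (1 - 2 * j) \<subseteq> D" unfolding V_def by (rule Mk(2))+
    show "F ` V (- 2 * j) \<subseteq> V (- 2 * j)" using Mk(1)[of "- 2 * j"] e unfolding petal_ok_def V_def by blast
    show "\<exists>\<zeta>\<in>V (1 - 2 * j). F \<zeta> = w" if "w \<in> V (1 - 2 * j)" for w using Mk(1)[of "1 - 2 * j"] o that unfolding petal_ok_def V_def by blast
    show "fatou_coord F (V (- 2 * j)) (FC (- 2 * j))" "fatou_coord F (V (1 - 2 * j)) (FC (1 - 2 * j))" by (rule fat)+
    have k1: "- 2 * (j - 1) = (1 - 2 * j) + 1" "1 - 2 * j = - 2 * j + 1" by simp_all
    obtain \<epsilon> where e0: "0 < \<epsilon>" "\<forall>t. 0 < cmod t \<and> cmod t < \<epsilon> \<longrightarrow> (\<exists>\<zeta>. \<zeta> \<in> V (1 - 2 * j) \<inter> V (1 - 2 * j + 1) \<and> hexp (1 - 2 * j) (FC (1 - 2 * j) \<zeta>) = t) \<and>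
      (\<forall>\<zeta>. \<zeta> \<in> V (1 - 2 * j) \<inter> V (1 - 2 * j + 1) \<and> hexp (1 - 2 * j) (FC (1 - 2 * j) \<zeta>) = t \<longrightarrow> h0 j t = hexp (1 - 2 * j) (FC (1 - 2 * j + 1) \<zeta>))"
      using horn[of "1 - 2 * j"] unfolding H0 by blast
    show "horn0_is (FC (- 2 * (j - 1))) (FC (1 - 2 * j)) (V (- 2 * (j - 1)) \<inter> V (1 - 2 * j)) (\<lambda>t. 1 * h0 j (1 * t))"
      unfolding horn0_is_def k1(1) mult_1_left by (rule exI[of _ \<epsilon>]) (use e0 in \<open>unfold hexp_odd, blast\<close>)
    obtain \<epsilon>' where e1: "0 < \<epsilon>'" "\<forall>t. 0 < cmod t \<and> cmod t < \<epsilon>' \<longrightarrow> (\<exists>\<zeta>. \<zeta> \<in> V (- 2 * j) \<inter> V (- 2 * j + 1) \<and> hexp (- 2 * j) (FC (- 2 * j) \<zeta>) = t) \<and>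
      (\<forall>\<zeta>. \<zeta> \<in> V (- 2 * j) \<inter> V (- 2 * j + 1) \<and> hexp (- 2 * j) (FC (- 2 * j) \<zeta>) = t \<longrightarrow> hI j t = hexp (- 2 * j) (FC (- 2 * j + 1) \<zeta>))"
      using horn[of "- 2 * j"] unfolding HI by blast
    show "hornI_is (FC (- 2 * j)) (FC (1 - 2 * j)) (V (1 - 2 * j) \<inter> V (- 2 * j)) (\<lambda>t. 1 * hI j (1 * t))"
      unfolding hornI_is_def k1(2) mult_1_left by (rule exI[of _ \<epsilon>']) (use e1 in \<open>unfold hexp_even, blast\<close>)
  qed simp_all
qed

end

section \<open>The realization theorem\<close>

text \<open>For s = csqrt (\<xi> + 1) with Re \<xi> > 0 one has |Im s| \<le> Re s and |\<xi> + 1|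
  \<le> 2 (Re s)^2, while Re \<zeta> \<ge> C Re s. Thus |Im \<xi>| \<le> (2/C^2) (Re \<zeta>)^2, and
  C^2 = 4/\<eta> turns this into half of the allowed bound. The other half absorbs C |Im s| \<le> Re
  \<zeta> as soon as Re \<zeta> > 2/\<eta>.\<close>

lemma quad_dom_narrow:
  assumes \<eta>: "0 < \<eta>"
  shows "\<exists>C R. 0 < C \<and> 0 < R \<and> quad_dom C R \<subseteq> narrow_dom \<eta> Y"
proof -
  define C where "C = 2 / sqrt \<eta>"
  have C: "0 < C" "C^2 = 4 / \<eta>" using \<eta> by (simp_all add: C_def power_divide)
  define Z where "Z = \<bar>Y\<bar> + 2 / \<eta> + 1"
  have "0 < 2 / \<eta>" using \<eta> by simp
  then have Z: "Y < Z" "2 / \<eta> < Z" "0 < Z" unfolding Z_def by linarith+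
  define R where "R = 2 * (Z / C)^2"
  have "quad_dom C R \<subseteq> narrow_dom \<eta> Y"
  proof
    fix \<zeta> assume "\<zeta> \<in> quad_dom C R"
    then obtain \<xi> where \<xi>: "0 < Re \<xi>" "R < cmod \<xi>" and z: "\<zeta> = \<xi> + of_real C * csqrt (\<xi> + 1)"
      by (auto simp: quad_dom_def quad_phi_def)
    define s where "s = csqrt (\<xi> + 1)"
    have s2: "s^2 = \<xi> + 1" by (simp add: s_def)
    have s0: "0 \<le> Re s" using csqrt_principal[of "\<xi> + 1"] by (auto simp: s_def)
    have "Re (s^2) = Re \<xi> + 1" by (simp add: s2)
    then have r: "(Re s)^2 - (Im s)^2 = Re \<xi> + 1" by (simp add: Re_power2)
    have N: "cmod (\<xi> + 1) = (Re s)^2 + (Im s)^2" using cmod_power2[of s] by (simp add: s2[symmetric] norm_power)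
    have le: "cmod \<xi> \<le> cmod (\<xi> + 1)" unfolding cmod_def using \<xi>(1) by (intro real_sqrt_le_mono) (simp add: power2_eq_square algebra_simps)
    have N2: "cmod (\<xi> + 1) \<le> 2 * (Re s)^2" using N r \<xi>(1) by linarith
    have "(Z / C)^2 < (Re s)^2" using N2 le \<xi>(2) unfolding R_def by linarith
    then have "Z / C < Re s" using s0 by (rule power_less_imp_less_base)
    then have Zs: "Z < C * Re s" using C by (simp add: pos_divide_less_eq mult.commute)
    have x: "Re \<zeta> = Re \<xi> + C * Re s" and y: "Im \<zeta> = Im \<xi> + C * Im s" by (simp_all add: z s_def[symmetric])
    have xC: "C * Re s \<le> Re \<zeta>" using x \<xi>(1) by simp
    have xZ: "Z < Re \<zeta>" using xC Zs by linarith
    have x0: "0 < Re \<zeta>" using xZ Z by linarith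
    have "(Im s)^2 \<le> (Re s)^2" using r \<xi>(1) by linarith
    then have "\<bar>Im s\<bar> \<le> Re s" using s0 by (metis abs_le_square_iff abs_of_nonneg)
    then have "C * \<bar>Im s\<bar> \<le> C * Re s" using C by (intro mult_left_mono) auto
    moreover have "\<bar>C * Im s\<bar> = C * \<bar>Im s\<bar>" using C(1) by (simp add: abs_mult)
    ultimately have 1: "\<bar>C * Im s\<bar> \<le> Re \<zeta>" using xC by linarith
    have "C^2 * (2 * (Re s)^2) = 2 * (C * Re s)^2" by (simp add: power_mult_distrib)
    also have "\<dots> \<le> 2 * (Re \<zeta>)^2" using xC C s0 by (intro mult_left_mono power_mono) auto
    finally have "4 / \<eta> * (2 * (Re s)^2) \<le> 2 * (Re \<zeta>)^2" by (simp only: C(2))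
    then have "\<eta> / 4 * (4 / \<eta> * (2 * (Re s)^2)) \<le> \<eta> / 4 * (2 * (Re \<zeta>)^2)" using \<eta> by (intro mult_left_mono) auto
    then have "2 * (Re s)^2 \<le> \<eta> / 2 * (Re \<zeta>)^2" using \<eta> by simp
    then have 2: "\<bar>Im \<xi>\<bar> \<le> \<eta> / 2 * (Re \<zeta>)^2" using N2 le abs_Im_le_cmod[of \<xi>] by linarith
    have "2 / \<eta> < Re \<zeta>" using xZ Z by linarith
    then have "1 < \<eta> / 2 * Re \<zeta>" using \<eta> by (simp add: divide_less_eq mult.commute)
    then have "1 * Re \<zeta> < \<eta> / 2 * Re \<zeta> * Re \<zeta>" using x0 by (rule mult_strict_right_mono)
    then have "Re \<zeta> < \<eta> / 2 * (Re \<zeta>)^2" by (simp add: power2_eq_square mult.assoc)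
    then have "\<bar>Im \<zeta>\<bar> < \<eta> * (Re \<zeta>)^2" using 1 2 abs_triangle_ineq[of "Im \<xi>" "C * Im s"] y by linarith
    then show "\<zeta> \<in> narrow_dom \<eta> Y" using xZ Z by (simp add: narrow_dom_def)
  qed
  moreover have "0 < R" using Z C by (simp add: R_def)
  ultimately show ?thesis using C(1) by blast
qed

text \<open>In s = csqrt (\<xi> + 1) the equation \<open>quad_phi C \<xi>\<close> = \<zeta> becomes
  the quadratic equation s^2 + C s = \<zeta> + 1. The square root u of its discriminant has a large
  real part and a bounded imaginary part on a petal, so the root s gives \<xi> = s^2 - 1 with Re
  \<xi> > R.\<close>

lemma petal_in_quad_dom:
  assumes C: "0 < C" and R: "0 < R"
  shows "\<exists>T. \<forall>M\<ge>T. petal k M \<subseteq> quad_dom C R"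
proof -
  define q where "q = (\<bar>real_of_int k\<bar> + 1) * pi"
  have q0: "0 \<le> q" by (simp add: q_def)
  define Z where "Z = C / 2 + R + q + 2"
  have Z1: "1 \<le> Z" using C R q0 by (simp add: Z_def)
  have "petal k M \<subseteq> quad_dom C R" if M: "Z^2 \<le> M" for M
  proof
    fix \<zeta> assume z: "\<zeta> \<in> petal k M"
    have "0 \<le> 8 / (pi - \<bar>Im \<zeta> - of_int k * pi\<bar>)^2" by simp
    moreover have "M + 8 / (pi - \<bar>Im \<zeta> - of_int k * pi\<bar>)^2 < Re \<zeta>" and Ip: "\<bar>Im \<zeta> - of_int k * pi\<bar> < pi" using z by (auto simp: petal_def)
    ultimately have x: "Z^2 \<le> Re \<zeta>" using M by linarith
    have "\<bar>of_int k * pi\<bar> = \<bar>of_int k\<bar> * pi" by (simp add: abs_mult)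
    then have Iq: "\<bar>Im \<zeta>\<bar> \<le> q" using Ip unfolding q_def distrib_right by linarith
    define u where "u = csqrt (of_real (C^2) + 4 * (\<zeta> + 1))"
    have u2: "u^2 = of_real (C^2) + 4 * (\<zeta> + 1)" by (simp add: u_def)
    have u0: "0 \<le> Re u" using csqrt_principal[of "of_real (C^2) + 4 * (\<zeta> + 1)"] by (auto simp: u_def)
    have "Re (u^2) = C^2 + 4 * (Re \<zeta> + 1)" "Im (u^2) = 4 * Im \<zeta>" by (simp_all add: u2)
    then have ru: "(Re u)^2 - (Im u)^2 = C^2 + 4 * (Re \<zeta> + 1)" and iu: "2 * Re u * Im u = 4 * Im \<zeta>" by (simp_all add: Re_power2 Im_power2)
    have C2: "0 \<le> C^2" and I2: "0 \<le> (Im u)^2" by simp_all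
    have "4 * Z^2 \<le> 4 * Re \<zeta>" using x by simp
    also have "\<dots> \<le> C^2 + (Im u)^2 + 4 * (Re \<zeta> + 1)" using C2 I2 by (simp add: distrib_left)
    also have "\<dots> = (Re u)^2" using ru by (simp add: diff_eq_eq)
    finally have "4 * Z^2 \<le> (Re u)^2" .
    then have "(2 * Z)^2 \<le> (Re u)^2" by (simp add: power_mult_distrib)
    then have uZ: "2 * Z \<le> Re u" using u0 by (rule power2_le_imp_le)
    have "2 * 1 * \<bar>Im u\<bar> \<le> 2 * Re u * \<bar>Im u\<bar>" using uZ Z1 by (intro mult_right_mono) auto
    also have "\<dots> = \<bar>2 * Re u * Im u\<bar>" using u0 by (simp add: abs_mult)
    also have "\<dots> \<le> 4 * q" using Iq by (simp only: iu abs_mult)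
    finally have Iu: "\<bar>Im u\<bar> \<le> 2 * q" by simp
    define s where "s = (u - of_real C) / 2"
    have Rs: "R + q + 2 \<le> Re s" using uZ by (simp add: s_def Z_def)
    have Is: "\<bar>Im s\<bar> \<le> q" using Iu by (simp add: s_def)
    have us: "u = 2 * s + of_real C" unfolding s_def by (simp add: field_simps)
    have "4 * (s^2 + of_real C * s) = 4 * (\<zeta> + 1)" using u2 unfolding us by (simp add: power2_eq_square algebra_simps)
    then have eq: "s^2 + of_real C * s = \<zeta> + 1" by (simp only: mult_cancel_left) simp
    define \<xi> where "\<xi> = s^2 - 1"
    have "0 < Re s" using Rs R q0 by linarith
    then have cs: "csqrt (\<xi> + 1) = s" by (simp add: \<xi>_def csqrt_square)
    have zx: "\<zeta> = quad_phi C \<xi>" unfolding quad_phi_def cs using eq by (simp add: \<xi>_def algebra_simps)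
    have "(R + q + 2)^2 \<le> (Re s)^2" using Rs R q0 by (intro power_mono) auto
    moreover have "(R + q + 2)^2 = R^2 + q^2 + 4 + 2 * (R * q) + 4 * R + 4 * q" by (simp add: power2_eq_square algebra_simps)
    moreover have "0 \<le> R * q" "0 \<le> R^2" using R q0 by simp_all
    moreover have "(Im s)^2 \<le> q^2" using Is q0 by (metis abs_le_square_iff abs_of_nonneg)
    moreover have "Re \<xi> = (Re s)^2 - (Im s)^2 - 1" by (simp add: \<xi>_def Re_power2)
    ultimately have Rx: "R < Re \<xi>" using R q0 by linarith
    then have "R < cmod \<xi>" using complex_Re_le_cmod[of \<xi>] by linarith
    then show "\<zeta> \<in> quad_dom C R" unfolding quad_dom_def zx using Rx R by (intro imageI) auto
  qed
  then show ?thesis by blast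
qed

text \<open>The symmetry hypothesis gives one of the two compositions only. Applying it at s = g
  (cnj t) and cancelling g by its local left inverse G gives the composition in the other order; the
  factor 1/4 in \<delta> keeps both applications in range.\<close>

lemma conj_inverse_swap:
  fixes f g G :: "complex \<Rightarrow> complex"
  assumes pos: "0 < \<epsilon>" "0 < e" "0 < r"
    and f: "\<And>u. cmod u < r \<Longrightarrow> cmod (f u) \<le> 2 * cmod u" and g: "\<And>u. cmod u < r \<Longrightarrow> cmod (g u) \<le> 2 * cmod u"
    and inv: "\<And>s. cmod s < \<epsilon> \<Longrightarrow> g (cnj (f (cnj s))) = s" and G: "\<And>u. cmod u < e \<Longrightarrow> G (g u) = u"
  shows "\<exists>\<delta>>0. \<forall>t. cmod t < \<delta> \<longrightarrow> f (cnj (g (cnj t))) = t"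
proof (intro exI conjI allI impI)
  show "0 < min (min \<epsilon> e) r / 4" using pos by simp
  fix t :: complex assume "cmod t < min (min \<epsilon> e) r / 4"
  then have t: "4 * cmod t < \<epsilon>" "4 * cmod t < e" "4 * cmod t < r" by auto
  have t0: "0 \<le> cmod t" by simp
  define w where "w = g (cnj t)"
  have w: "cmod w \<le> 2 * cmod t" using g[of "cnj t"] t t0 by (simp add: w_def)
  define v where "v = cnj (f (cnj w))"
  have v: "cmod v \<le> 4 * cmod t" using f[of "cnj w"] w t t0 by (simp add: v_def)
  have "cmod w < \<epsilon>" using w t t0 by linarith
  from inv[OF this] have "g v = w" by (simp only: v_def)
  then have eq: "G (g v) = G (g (cnj t))" by (simp only: w_def)
  have "cmod v < e" "cmod (cnj t) < e" using v t t0 unfolding complex_mod_cnj by linarith+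
  then have "v = cnj t" using eq G[of v] G[of "cnj t"] by simp
  moreover have "f (cnj w) = cnj v" by (simp only: v_def complex_cnj_cnj)
  ultimately have "f (cnj w) = t" by (simp only: complex_cnj_cnj)
  then show "f (cnj (g (cnj t))) = t" by (simp only: w_def)
qed

lemma near_identity_bound:
  assumes d: "0 < d" and f0: "f 0 = (0::complex)" and near: "\<And>t. 0 < cmod t \<Longrightarrow> cmod t < s \<Longrightarrow> cmod (f t - t) \<le> d * (cmod t)^2"
    and u: "cmod u < min s (1 / d)"
  shows "cmod (f u) \<le> 2 * cmod u"
proof (cases "u = 0")
  case False
  have "d * cmod u \<le> 1" using u d by (simp add: pos_less_divide_eq mult.commute)
  then have "d * cmod u * cmod u \<le> 1 * cmod u" by (intro mult_right_mono) auto
  moreover have "cmod (f u - u) \<le> d * (cmod u)^2" by (rule near) (use u False in auto)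
  moreover have "d * (cmod u)^2 = d * cmod u * cmod u" by (simp add: power2_eq_square)
  ultimately have "cmod (f u - u) \<le> cmod u" by linarith
  then show ?thesis using norm_triangle_ineq[of "f u - u" u] by simp
qed (simp add: f0)

theorem theoremA:
  fixes \<rho> :: real and m :: int
    and h0 hI :: "int \<Rightarrow> complex \<Rightarrow> complex" and \<sigma> :: "int \<Rightarrow> real"
  assumes germs: "\<And>j. \<sigma> j > 0 \<and>
      h0 j holomorphic_on ball 0 (\<sigma> j) \<and> hI j holomorphic_on ball 0 (\<sigma> j) \<and>
      h0 j 0 = 0 \<and> hI j 0 = 0 \<and> deriv (h0 j) 0 \<noteq> 0 \<and> deriv (hI j) 0 \<noteq> 0"
    and sym: "\<And>j. \<exists>\<epsilon>>0. \<forall>t. cmod t < \<epsilon> \<longrightarrow> h0 (1 - j) (cnj (hI j (cnj t))) = t"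
    and growth: "\<exists>C K K1. C > 0 \<and> K > 0 \<and> K1 > 0 \<and>
      (\<forall>j. \<sigma> j \<ge> K1 * exp (- K * exp (C * sqrt \<bar>real_of_int j\<bar>)))"
    and unif: "\<exists>d1 d2. d1 > 0 \<and> d2 > 0 \<and>
      (\<forall>j. \<forall>h\<in>{h0 j, hI j}. \<forall>t. 0 < cmod t \<and> cmod t < \<sigma> j \<longrightarrow>
          cmod (h t - t) \<le> d1 * (cmod t)\<^sup>2 \<and> cmod (deriv h t - 1) \<le> d2 * cmod t)"
  shows "\<exists>F :: complex \<Rightarrow> complex. \<exists>C' R c :: real. C' > 0 \<and> R > 0 \<and> c > 0 \<and>
      F holomorphic_on quad_dom C' R \<and>
      (\<forall>\<zeta>\<in>quad_dom C' R. Im \<zeta> = 0 \<longrightarrow> Im (F \<zeta>) = 0) \<and>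
      (\<forall>\<zeta>\<in>quad_dom C' R.
          cmod (exp (- F \<zeta>) - exp (- \<zeta>) + exp (- \<zeta>) ^ 2 * inverse \<zeta> powi m
                - of_real \<rho> * exp (- \<zeta>) ^ 3 * inverse \<zeta> powi (2 * m + 1))
          \<le> c * cmod (exp (- \<zeta>) ^ 3 * inverse \<zeta> powi (2 * m + 2))) \<and>
      realizes_horn F (quad_dom C' R) h0 hI"
proof -
  obtain C K K1 where gr: "C > 0" "K > 0" "K1 > 0" "\<And>j. \<sigma> j \<ge> K1 * exp (- K * exp (C * sqrt \<bar>real_of_int j\<bar>))"
    using growth by blast
  obtain d1 d2 where d12: "d1 > 0" "d2 > 0" and near12: "\<And>j h t. h \<in> {h0 j, hI j} \<Longrightarrow> 0 < cmod t \<Longrightarrow> cmod t < \<sigma> j \<Longrightarrow>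
          cmod (h t - t) \<le> d1 * (cmod t)\<^sup>2 \<and> cmod (deriv h t - 1) \<le> d2 * cmod t" using unif by metis
  define d where "d = d1 + d2"
  have d: "0 < d" using d12 by (simp add: d_def)
  \<comment> \<open>Inverse of the enumeration in which overlap - 2 j carries the germ at infinity
    of index j and overlap 1 - 2 j the germ at 0 of index j.\<close>
  define jx where "jx k = (if even k then - (k div 2) else (1 - k) div 2)" for k :: int
  define H where "H k = (if even k then hI (jx k) else h0 (jx k))" for k :: int
  define \<Sigma> where "\<Sigma> k = \<sigma> (jx k)" for k
  have jx: "jx (- 2 * j) = j" "jx (1 - 2 * j) = j" for j by (simp_all add: jx_def)
  have HI: "H (- 2 * j) = hI j" and H0: "H (1 - 2 * j) = h0 j" for j using jx[of j] by (simp_all add: H_def)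
  have S0: "0 < \<Sigma> k" for k using germs by (simp add: \<Sigma>_def)
  have H_hol: "H k holomorphic_on ball 0 (\<Sigma> k)" and Hz: "H k 0 = 0" for k using germs[of "jx k"] by (auto simp: H_def \<Sigma>_def)
  have H_near: "cmod (H k t - t) \<le> d * (cmod t)^2 \<and> cmod (deriv (H k) t - 1) \<le> d * cmod t" if t: "0 < cmod t" "cmod t < \<Sigma> k" for k t
  proof -
    have "H k \<in> {h0 (jx k), hI (jx k)}" by (simp add: H_def)
    note n = near12[OF this t[unfolded \<Sigma>_def]]
    have "d1 * (cmod t)^2 \<le> d * (cmod t)^2" "d2 * cmod t \<le> d * cmod t" using d12 by (auto simp: d_def intro!: mult_right_mono)
    then show ?thesis using n by linarith
  qed
  \<comment> \<open>Reindexing does not increase the absolute value of the index, so the lower bound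
    on the radii survives with the same constants.\<close>
  have gS: "\<Sigma> k \<ge> K1 * exp (- K * exp (C * sqrt \<bar>real_of_int k\<bar>))" for k
  proof -
    have "\<bar>jx k\<bar> \<le> \<bar>k\<bar>" unfolding jx_def by (auto elim!: evenE oddE)
    then have "\<bar>real_of_int (jx k)\<bar> \<le> \<bar>real_of_int k\<bar>" by linarith
    then have "C * sqrt \<bar>real_of_int (jx k)\<bar> \<le> C * sqrt \<bar>real_of_int k\<bar>" using gr by (intro mult_left_mono real_sqrt_le_mono) auto
    then have "K * exp (C * sqrt \<bar>real_of_int (jx k)\<bar>) \<le> K * exp (C * sqrt \<bar>real_of_int k\<bar>)" using gr by (intro mult_left_mono) auto
    then have "K1 * exp (- K * exp (C * sqrt \<bar>real_of_int k\<bar>)) \<le> K1 * exp (- K * exp (C * sqrt \<bar>real_of_int (jx k)\<bar>))" using gr by (intro mult_left_mono) auto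
    then show ?thesis using gr(4)[of "jx k"] by (simp only: \<Sigma>_def)
  qed
  have "\<exists>G \<epsilon>. 0 < \<epsilon> \<and> \<epsilon> \<le> \<Sigma> k \<and> G holomorphic_on ball 0 \<epsilon> \<and>
      (\<forall>t. cmod t < \<epsilon> \<longrightarrow> cmod (G t) < \<Sigma> k \<and> H k (G t) = t \<and> cmod (G t - t) \<le> 4 * d * (cmod t)^2 \<and> G (H k t) = t)" for k
    by (rule tangent_germ_inverse[OF H_hol S0 d Hz H_near], assumption, assumption) blast
  then obtain G eG where G: "\<And>k. 0 < eG k" "\<And>k. eG k \<le> \<Sigma> k" "\<And>k. G k holomorphic_on ball 0 (eG k)"
      "\<And>k t. cmod t < eG k \<Longrightarrow> cmod (G k t) < \<Sigma> k \<and> H k (G k t) = t \<and> cmod (G k t - t) \<le> 4 * d * (cmod t)^2 \<and> G k (H k t) = t"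
    by metis
  \<comment> \<open>The indices k and - k - 1 have opposite parity and carry two germs related by
    the symmetry. For odd k the claim is the hypothesis itself, for even k it is the composition in
    the opposite order.\<close>
  have H_neg: "\<exists>\<epsilon>>0. \<forall>t. cmod t < \<epsilon> \<longrightarrow> H k (cnj (H (- k - 1) (cnj t))) = t" for k
  proof (cases "even k")
    case False
    then obtain j where "k = 2 * j + 1" by (elim oddE)
    then have k: "k = 1 - 2 * (- j)" "- k - 1 = - 2 * (1 + j)" by simp_all
    show ?thesis using sym[of "1 + j"] unfolding k(2) HI unfolding k(1) H0 by simp
  next
    case True
    then obtain i where "k = 2 * i" by (elim evenE)
    then have k: "k = - 2 * (- i)" "- k - 1 = 1 - 2 * (1 - (- i))" by simp_all
    obtain \<epsilon> where e: "0 < \<epsilon>" "\<And>t. cmod t < \<epsilon> \<Longrightarrow> h0 (1 - (- i)) (cnj (hI (- i) (cnj t))) = t" using sym[of "- i"] by blast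
    have eqs: "H k = hI (- i)" "H (- k - 1) = h0 (1 - (- i))" unfolding k(2) H0 unfolding k(1) HI by (rule refl)+
    define r where "r = min (min (\<Sigma> k) (1 / d)) (min (\<Sigma> (- k - 1)) (1 / d))"
    have r: "0 < r" using S0 d by (simp add: r_def)
    have b: "cmod (H l u) \<le> 2 * cmod u" if "cmod u < min (\<Sigma> l) (1 / d)" for l u
      by (rule near_identity_bound[where f = "H l" and s = "\<Sigma> l" and u = u, OF d Hz _ that]) (use H_near[of _ l] in blast)
    show ?thesis
    proof (rule conj_inverse_swap[OF e(1) G(1)[of "- k - 1"] r, where G = "G (- k - 1)"])
      show "cmod (H k u) \<le> 2 * cmod u" "cmod (H (- k - 1) u) \<le> 2 * cmod u" if "cmod u < r" for u
        using b[of u k] b[of u "- k - 1"] that by (auto simp: r_def)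
      show "H (- k - 1) (cnj (H k (cnj s))) = s" if "cmod s < \<epsilon>" for s unfolding eqs by (rule e(2)[OF that])
      show "G (- k - 1) (H (- k - 1) u) = u" if "cmod u < eG (- k - 1)" for u using G(4)[OF that] by blast
    qed
  qed
  \<comment> \<open>Only the germs of the overlaps with k \<ge> 0 enter the gluing problem; for the
    reflected overlaps \<open>H_neg\<close> shows that the conjugated solution realises the
    prescribed germs.\<close>
  define h where "h n = H (int n)" for n
  have hh: "h n holomorphic_on ball 0 (\<Sigma> (int n))" "\<Sigma> (int n) \<ge> K1 * exp (- K * exp (C * sqrt (real n)))" for n
    using H_hol[of "int n"] gS[of "int n"] by (simp_all add: h_def)
  have hn: "cmod (h n t - t) \<le> d * (cmod t)^2" if "0 < cmod t" "cmod t < \<Sigma> (int n)" for n t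
    using H_near[OF that] by (simp add: h_def)
  obtain A B Rg where AB: "1 \<le> A" "1 \<le> B" and Rg:
    "\<And>k. Rg k holomorphic_on patch (\<lambda>k. A + B * sqrt (real k)) (3/4) k"
    "\<And>k s. s\<in>patch (\<lambda>k. A + B * sqrt (real k)) (3/4) k \<Longrightarrow> cmod (Rg k s) \<le> 1/4 \<and> cmod (deriv (Rg k) s) * (1 + cmod s)^2 \<le> 1/4"
    "\<And>s. s\<in>patch (\<lambda>k. A + B * sqrt (real k)) (3/4) 0 \<Longrightarrow> Rg 0 (cnj s) = cnj (Rg 0 s)"
    "\<And>k s. s\<in>overlap (\<lambda>k. A + B * sqrt (real k)) (3/4) k \<Longrightarrow>
        Rg (Suc k) s = Rg k s + hlog k (h k) (exp s + Rg k s) \<and> h k (hexp k (exp s + Rg k s)) \<noteq> 0"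
    using gluing_of_germs[where h = h and \<sigma> = "\<lambda>n. \<Sigma> (int n)", OF hh(1) d hn gr(1-3) hh(2)] by blast
  define \<kappa> where "\<kappa> = of_int m / 2 - \<rho>"
  obtain X Kc Psi sg where co: "1 \<le> X" "0 \<le> Kc" "8 * Kc \<le> X"
    "\<And>\<zeta>. \<zeta> \<in> parabolic_dom X \<Longrightarrow> (Psi has_field_derivative (expo m \<zeta> - 1 - of_real \<kappa> / \<zeta>)) (at \<zeta>)"
    "\<And>\<zeta>. \<zeta> \<in> parabolic_dom X \<Longrightarrow> exp (sg \<zeta>) = Psi \<zeta>"
    "\<And>\<zeta>. \<zeta> \<in> parabolic_dom X \<Longrightarrow> (sg has_field_derivative deriv sg \<zeta>) (at \<zeta>)"
    "\<And>\<zeta>. \<zeta> \<in> parabolic_dom X \<Longrightarrow> cmod (deriv sg \<zeta> - 1) \<le> Kc / Re \<zeta>"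
    "\<And>\<zeta>. \<zeta> \<in> parabolic_dom X \<Longrightarrow> cmod (sg \<zeta> - (\<zeta> + of_int m * Ln \<zeta>)) \<le> Kc / Re \<zeta>"
    "\<And>\<zeta>. \<zeta> \<in> parabolic_dom X \<Longrightarrow> sg (cnj \<zeta>) = cnj (sg \<zeta>)"
    by (rule log_coordinate[of m \<kappa>]) (rule that; assumption)
  interpret atlas m \<kappa> \<rho> X Kc A B Psi sg Rg h
  proof (unfold_locales, fact \<kappa>_def, fact co(1), fact co(2), fact co(3), fact AB(1), fact AB(2))
    show "cmod (Rg k s) \<le> 1/4" "cmod (deriv (Rg k) s) * (1 + cmod s)^2 \<le> 1/4" if "s \<in> patch (\<lambda>k. A + B * sqrt (real k)) (3/4) k" for k s
      using Rg(2)[OF that] by blast+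
    show "Rg (Suc k) s = Rg k s + hlog k (h k) (exp s + Rg k s)" "h k (hexp k (exp s + Rg k s)) \<noteq> 0"
      if "s \<in> overlap (\<lambda>k. A + B * sqrt (real k)) (3/4) k" for k s using Rg(4)[OF that] by blast+
  qed (fact co(4) co(5) co(6) co(7) co(8) co(9) Rg(1) Rg(3))+
  interpret atlas_horn m \<kappa> \<rho> X Kc A B Psi sg Rg h H G \<Sigma> eG d
  proof (unfold_locales, fact d, fact S0, fact H_hol)
    show "cmod (H k t - t) \<le> d * (cmod t)^2" if "0 < cmod t" "cmod t < \<Sigma> k" for k t using H_near[OF that] by blast
    show "H k = h (nat k)" if "0 \<le> k" for k using that by (simp add: h_def)
    show "\<exists>\<epsilon>>0. \<forall>t. cmod t < \<epsilon> \<longrightarrow> H k (cnj (h (nat (- k - 1)) (cnj t))) = t" if "k < 0" for k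
      using H_neg[of k] that by (simp add: h_def)
    show "0 < eG k" "eG k \<le> \<Sigma> k" "G k holomorphic_on ball 0 (eG k)" for k by (rule G)+
    show "cmod (G k t) < \<Sigma> k \<and> H k (G k t) = t \<and> cmod (G k t - t) \<le> 4 * d * (cmod t)^2" "G k (H k t) = t" if "cmod t < eG k" for k t
      using G(4)[OF that] by blast+
  qed
  have "0 < \<eta> / 4" using \<eta>_pos by simp
  then obtain C' R where CR: "0 < C'" "0 < R" "quad_dom C' R \<subseteq> D1" unfolding D1_def using quad_dom_narrow by blast
  obtain c where c: "0 < c" "\<And>\<zeta>. \<zeta> \<in> D1 \<Longrightarrow>
    cmod (exp (- F \<zeta>) - exp (- \<zeta>) + exp (- \<zeta>) ^ 2 * inverse \<zeta> powi m - of_real \<rho> * exp (- \<zeta>) ^ 3 * inverse \<zeta> powi (2 * m + 1))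
    \<le> c * cmod (exp (- \<zeta>) ^ 3 * inverse \<zeta> powi (2 * m + 2))" by (rule F_estimate) (rule that; assumption)
  have "F holomorphic_on quad_dom C' R" by (rule holomorphic_on_subset[OF F_hol CR(3)])
  moreover have "\<forall>\<zeta>\<in>quad_dom C' R. Im \<zeta> = 0 \<longrightarrow> Im (F \<zeta>) = 0" using F_real CR(3) by blast
  moreover have "realizes_horn F (quad_dom C' R) h0 hI" by (rule realizes[OF petal_in_quad_dom[OF CR(1,2)] HI H0])
  ultimately show ?thesis using CR c by (intro exI[of _ F] exI[of _ C'] exI[of _ R] exI[of _ c] conjI ballI) auto
qed

end
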